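(* Let $V=\mathbb{C}^4$ with ${\rm SL}_4$ acting by left multiplication, and for integers $n_1,n_2,n_3\ge 0$ let $$W=V^{n_1}\oplus\Big(\textstyle\bigwedge^2V\Big)^{n_2}\oplus\Big(\textstyle\bigwedge^3V\Big)^{n_3},$$ with elements written $(x_1,\dots,x_{n_1},y_1,\dots,y_{n_2},z_1,\dots,z_{n_3})$. Then the following polynomial invariants, taken for all index choices satisfying the stated constraints (with $1\le j,j_r\le n_1$, $1\le k,k_r\le n_2$, $1\le l,l_r\le n_3$), form a minimal (homogeneous) generating set of $\mathbb{C}[W]^{{\rm SL}_4}$ (summation over repeated indices $a,b,c,\dots\in\{1,2,3,4\}$): 1. $\det(x_{j_1},x_{j_2},x_{j_3},x_{j_4})$, $j_1<j_2<j_3<j_4$. 2. the determinant of the $4\times4$ matrix whose $r$-th column is $(z_{l_r,234},z_{l_r,134},z_{l_r,124},z_{l_r,123})^{T}$, $l_1<l_2<l_3<l_4$. 3. $\varepsilon_{abcd}\,y_k^{ab}y_k^{cd}$ (any $k$), and $\varepsilon_{abcd}\,y_{k_1}^{ab}y_{k_2}^{cd}$ with $k_1<k_2$. 4. the determinant of the $6\times 6$ matrix whose $r$-th column is $(y_{k_r,12},y_{k_r,13},y_{k_r,14},y_{k_r,23},y_{k_r,24},y_{k_r,34})^T$, $k_1<\dots<k_6$. 5. $\varepsilon_{abcd}\,x_j^a z_l^{bcd}$ (any $j,l$). 6. $\varepsilon_{abcd}\,x_{j_1}^a x_{j_2}^b y_k^{cd}$, $j_1<j_2$, any $k$. 7.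 $\varepsilon_{abcp}\varepsilon_{qdef}\,x_{j}^a y_{k_1}^{bc}y_{k_2}^{pq}x_{j'}^d y_{k_3}^{ef}$ with $k_1<k_2<k_3$ and either $j=j'$ or $j<j'$; and $\varepsilon_{abcp}\varepsilon_{qder}\varepsilon_{sfgt}\,x_{j_1}^a y_{k_1}^{bc}y_{k_2}^{pq}y_{k_3}^{de}y_{k_4}^{rt}x_{j_2}^s y_{k_5}^{fg}$ with $j_1<j_2$, $k_1<\dots<k_5$. 8. $\varepsilon_{abcp}\varepsilon_{qdef}\,z_{l_1}^{abc}y_k^{pq}z_{l_2}^{def}$ with $l_1<l_2$, any $k$; $\varepsilon_{abcp}\varepsilon_{qder}\varepsilon_{sfgh}\,z_{l}^{abc}y_{k_1}^{pq}y_{k_2}^{de}y_{k_3}^{rs}z_{l'}^{fgh}$ with $k_1<k_2<k_3$ and either $l=l'$ or $l<l'$; and $\varepsilon_{abcp}\varepsilon_{qder}\varepsilon_{sfgt}\varepsilon_{uhim}\,z_{l_1}^{abc}y_{k_1}^{pq}y_{k_2}^{de}y_{k_3}^{rs}y_{k_4}^{fg}y_{k_5}^{tu}z_{l_2}^{him}$ with $l_1<l_2$, $k_1<\dots<k_5$. 9. $\varepsilon_{abcp}\varepsilon_{qdef}\,x_j^a y_{k_1}^{bc}y_{k_2}^{pq}z_l^{def}$ with $k_1<k_2$, any $j,l$; and $\varepsilon_{abcp}\varepsilon_{qder}\varepsilon_{sfgh}\,x_j^a y_{k_1}^{bc}y_{k_2}^{pq}y_{k_3}^{de}y_{k_4}^{rs}z_l^{fgh}$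 with $k_1<\dots<k_4$, any $j,l$. (Each listed invariant is only relevant up to a nonzero scalar factor; families whose index constraints cannot be met for the given $n_1,n_2,n_3$ are empty.)
   Context: Coordinates: $x_j=(x_j^1,\dots,x_j^4)\in V$; for $y_k\in\bigwedge^2V$ write $y_k=\sum_{a<b}y_{k,ab}\,e_a\wedge e_b$ and set $y_k^{ab}=y_{k,ab}$ for $a<b$, $y_k^{ba}=-y_k^{ab}$, $y_k^{aa}=0$; for $z_l\in\bigwedge^3 V$ write $z_l=\sum_{a<b<c}z_{l,abc}\,e_a\wedge e_b\wedge e_c$ and let $z_l^{abc}$ be the totally antisymmetric extension of $z_{l,abc}$. $\varepsilon_{abcd}$ is the Levi-Civita symbol ($\varepsilon_{1234}=1$, totally antisymmetric). A minimal generating set of a graded algebra means a homogeneous generating set no proper subset of which generates. *)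

theory Defs
  imports Complex_Main "HOL-Combinatorics.Permutations"
begin

text \<open>Points of W = V^n1 + (wedge^2 V)^n2 + (wedge^3 V)^n3, V = C^4, in coordinates.
  All indices are 1-based as in the paper: x_j^a is X w j a (1 <= j <= n1, 1 <= a <= 4);
  y_{k,ab} (a<b) is Y w k a b; z_{l,abc} (a<b<c) is Z w l a b c.
  Entries of the coordinate functions outside these ranges are irrelevant padding:
  polynomial functions only depend on the genuine coordinates.\<close>

type_synonym pt = "(nat \<Rightarrow> nat \<Rightarrow> complex) \<times> (nat \<Rightarrow> nat \<Rightarrow> nat \<Rightarrow> complex)
                    \<times> (nat \<Rightarrow> nat \<Rightarrow> nat \<Rightarrow> nat \<Rightarrow> complex)"

definition X :: "pt \<Rightarrow> nat \<Rightarrow> nat \<Rightarrow> complex" where "X w = fst w"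
definition Y :: "pt \<Rightarrow> nat \<Rightarrow> nat \<Rightarrow> nat \<Rightarrow> complex" where "Y w = fst (snd w)"
definition Z :: "pt \<Rightarrow> nat \<Rightarrow> nat \<Rightarrow> nat \<Rightarrow> nat \<Rightarrow> complex" where "Z w = snd (snd w)"

definition I4 :: "nat set" where "I4 = {1..4}"

definition eps :: "nat \<Rightarrow> nat \<Rightarrow> nat \<Rightarrow> nat \<Rightarrow> complex" where
  "eps a b c d = of_int (sgn ((int b - int a) * (int c - int a) * (int d - int a)
                              * (int c - int b) * (int d - int b) * (int d - int c)))"

text \<open>Antisymmetric extensions y_k^{ab} and z_l^{abc}.\<close>
definition yA :: "pt \<Rightarrow> nat \<Rightarrow> nat \<Rightarrow> nat \<Rightarrow> complex" where
  "yA w k a b = of_int (sgn (int b - int a)) * Y w k (min a b) (max a b)"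

definition zA :: "pt \<Rightarrow> nat \<Rightarrow> nat \<Rightarrow> nat \<Rightarrow> nat \<Rightarrow> complex" where
  "zA w l a b c =
     of_int (sgn ((int b - int a) * (int c - int a) * (int c - int b)))
     * Z w l (min a (min b c)) (a + b + c - min a (min b c) - max a (max b c)) (max a (max b c))"

definition detN :: "nat \<Rightarrow> (nat \<Rightarrow> nat \<Rightarrow> complex) \<Rightarrow> complex" where
  "detN n M = (\<Sum>\<sigma> | \<sigma> permutes {1..n}. of_int (sign \<sigma>) * (\<Prod>i\<in>{1..n}. M (\<sigma> i) i))"

definition act :: "(nat \<Rightarrow> nat \<Rightarrow> complex) \<Rightarrow> pt \<Rightarrow> pt" where
  "act g w =
    ((\<lambda>j a. \<Sum>b\<in>I4. g a b * X w j b),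
     (\<lambda>k a b. \<Sum>c\<in>I4. \<Sum>d\<in>I4. g a c * g b d * yA w k c d),
     (\<lambda>l a b c. \<Sum>d\<in>I4. \<Sum>e\<in>I4. \<Sum>f\<in>I4. g a d * g b e * g c f * zA w l d e f))"

definition scale :: "complex \<Rightarrow> pt \<Rightarrow> pt" where
  "scale t w = ((\<lambda>j a. t * X w j a), (\<lambda>k a b. t * Y w k a b), (\<lambda>l a b c. t * Z w l a b c))"

inductive_set polyW :: "nat \<Rightarrow> nat \<Rightarrow> nat \<Rightarrow> (pt \<Rightarrow> complex) set"
  for n1 n2 n3 :: nat where
  const: "(\<lambda>w. c) \<in> polyW n1 n2 n3"
| xcoord: "1 \<le> j \<Longrightarrow> j \<le> n1 \<Longrightarrow> a \<in> I4 \<Longrightarrow> (\<lambda>w. X w j a) \<in> polyW n1 n2 n3"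
| ycoord: "1 \<le> k \<Longrightarrow> k \<le> n2 \<Longrightarrow> 1 \<le> a \<Longrightarrow> a < b \<Longrightarrow> b \<le> 4
           \<Longrightarrow> (\<lambda>w. Y w k a b) \<in> polyW n1 n2 n3"
| zcoord: "1 \<le> l \<Longrightarrow> l \<le> n3 \<Longrightarrow> 1 \<le> a \<Longrightarrow> a < b \<Longrightarrow> b < c \<Longrightarrow> c \<le> 4
           \<Longrightarrow> (\<lambda>w. Z w l a b c) \<in> polyW n1 n2 n3"
| add: "f \<in> polyW n1 n2 n3 \<Longrightarrow> h \<in> polyW n1 n2 n3 \<Longrightarrow> (\<lambda>w. f w + h w) \<in> polyW n1 n2 n3"
| mult: "f \<in> polyW n1 n2 n3 \<Longrightarrow> h \<in> polyW n1 n2 n3 \<Longrightarrow> (\<lambda>w. f w * h w) \<in> polyW n1 n2 n3"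

definition invW :: "nat \<Rightarrow> nat \<Rightarrow> nat \<Rightarrow> (pt \<Rightarrow> complex) set" where
  "invW n1 n2 n3 = {f \<in> polyW n1 n2 n3.
      \<forall>g w. detN 4 g = 1 \<longrightarrow> f (act g w) = f w}"

inductive_set alg_gen :: "(pt \<Rightarrow> complex) set \<Rightarrow> (pt \<Rightarrow> complex) set"
  for S where
  const: "(\<lambda>w. c) \<in> alg_gen S"
| gen: "f \<in> S \<Longrightarrow> f \<in> alg_gen S"
| add: "f \<in> alg_gen S \<Longrightarrow> h \<in> alg_gen S \<Longrightarrow> (\<lambda>w. f w + h w) \<in> alg_gen S"
| mult: "f \<in> alg_gen S \<Longrightarrow> h \<in> alg_gen S \<Longrightarrow> (\<lambda>w. f w * h w) \<in> alg_gen S"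

definition homogeneous :: "(pt \<Rightarrow> complex) \<Rightarrow> bool" where
  "homogeneous f \<longleftrightarrow> (\<exists>d::nat. \<forall>t w. f (scale t w) = t ^ d * f w)"

definition min_hom_gen_set :: "(pt \<Rightarrow> complex) set \<Rightarrow> (pt \<Rightarrow> complex) set \<Rightarrow> bool" where
  "min_hom_gen_set G R \<longleftrightarrow> G \<subseteq> R \<and> (\<forall>f\<in>G. homogeneous f) \<and> alg_gen G = R
      \<and> (\<forall>H. H \<subset> G \<longrightarrow> alg_gen H \<noteq> R)"

definition inv1 :: "nat \<Rightarrow> nat \<Rightarrow> nat \<Rightarrow> nat \<Rightarrow> pt \<Rightarrow> complex" where
  "inv1 j1 j2 j3 j4 w = detN 4 (\<lambda>a r. X w (if r = 1 then j1 else if r = 2 then j2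
                                             else if r = 3 then j3 else j4) a)"

definition zcol :: "pt \<Rightarrow> nat \<Rightarrow> nat \<Rightarrow> complex" where
  "zcol w l i = (if i = 1 then Z w l 2 3 4 else if i = 2 then Z w l 1 3 4
                 else if i = 3 then Z w l 1 2 4 else Z w l 1 2 3)"

definition inv2 :: "nat \<Rightarrow> nat \<Rightarrow> nat \<Rightarrow> nat \<Rightarrow> pt \<Rightarrow> complex" where
  "inv2 l1 l2 l3 l4 w = detN 4 (\<lambda>i r. zcol w (if r = 1 then l1 else if r = 2 then l2
                                             else if r = 3 then l3 else l4) i)"

definition inv3 :: "nat \<Rightarrow> nat \<Rightarrow> pt \<Rightarrow> complex" where
  "inv3 k1 k2 w = (\<Sum>a\<in>I4. \<Sum>b\<in>I4. \<Sum>c\<in>I4. \<Sum>d\<in>I4. eps a b c d * yA w k1 a b * yA w k2 c d)"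

definition ycol :: "pt \<Rightarrow> nat \<Rightarrow> nat \<Rightarrow> complex" where
  "ycol w k i = (if i = 1 then Y w k 1 2 else if i = 2 then Y w k 1 3
                 else if i = 3 then Y w k 1 4 else if i = 4 then Y w k 2 3
                 else if i = 5 then Y w k 2 4 else Y w k 3 4)"

definition inv4 :: "(nat \<Rightarrow> nat) \<Rightarrow> pt \<Rightarrow> complex" where
  "inv4 ks w = detN 6 (\<lambda>i r. ycol w (ks r) i)"

definition inv5 :: "nat \<Rightarrow> nat \<Rightarrow> pt \<Rightarrow> complex" where
  "inv5 j l w = (\<Sum>a\<in>I4. \<Sum>b\<in>I4. \<Sum>c\<in>I4. \<Sum>d\<in>I4. eps a b c d * X w j a * zA w l b c d)"

definition inv6 :: "nat \<Rightarrow> nat \<Rightarrow> nat \<Rightarrow> pt \<Rightarrow> complex" where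
  "inv6 j1 j2 k w = (\<Sum>a\<in>I4. \<Sum>b\<in>I4. \<Sum>c\<in>I4. \<Sum>d\<in>I4.
                       eps a b c d * X w j1 a * X w j2 b * yA w k c d)"

definition inv7a :: "nat \<Rightarrow> nat \<Rightarrow> nat \<Rightarrow> nat \<Rightarrow> nat \<Rightarrow> pt \<Rightarrow> complex" where
  "inv7a j j' k1 k2 k3 w =
    (\<Sum>a\<in>I4. \<Sum>b\<in>I4. \<Sum>c\<in>I4. \<Sum>p\<in>I4. \<Sum>q\<in>I4. \<Sum>d\<in>I4. \<Sum>e\<in>I4. \<Sum>f\<in>I4.
       eps a b c p * eps q d e f * X w j a * yA w k1 b c * yA w k2 p q
       * X w j' d * yA w k3 e f)"

definition inv7b :: "nat \<Rightarrow> nat \<Rightarrow> nat \<Rightarrow> nat \<Rightarrow> nat \<Rightarrow> nat \<Rightarrow> nat \<Rightarrow> pt \<Rightarrow> complex" where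
  "inv7b j1 j2 k1 k2 k3 k4 k5 w =
    (\<Sum>a\<in>I4. \<Sum>b\<in>I4. \<Sum>c\<in>I4. \<Sum>p\<in>I4. \<Sum>q\<in>I4. \<Sum>d\<in>I4. \<Sum>e\<in>I4. \<Sum>r\<in>I4.
     \<Sum>s\<in>I4. \<Sum>f\<in>I4. \<Sum>g\<in>I4. \<Sum>t\<in>I4.
       eps a b c p * eps q d e r * eps s f g t * X w j1 a * yA w k1 b c * yA w k2 p q
       * yA w k3 d e * yA w k4 r t * X w j2 s * yA w k5 f g)"

definition inv8a :: "nat \<Rightarrow> nat \<Rightarrow> nat \<Rightarrow> pt \<Rightarrow> complex" where
  "inv8a l1 l2 k w =
    (\<Sum>a\<in>I4. \<Sum>b\<in>I4. \<Sum>c\<in>I4. \<Sum>p\<in>I4. \<Sum>q\<in>I4. \<Sum>d\<in>I4. \<Sum>e\<in>I4. \<Sum>f\<in>I4.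
       eps a b c p * eps q d e f * zA w l1 a b c * yA w k p q * zA w l2 d e f)"

definition inv8b :: "nat \<Rightarrow> nat \<Rightarrow> nat \<Rightarrow> nat \<Rightarrow> nat \<Rightarrow> pt \<Rightarrow> complex" where
  "inv8b l l' k1 k2 k3 w =
    (\<Sum>a\<in>I4. \<Sum>b\<in>I4. \<Sum>c\<in>I4. \<Sum>p\<in>I4. \<Sum>q\<in>I4. \<Sum>d\<in>I4. \<Sum>e\<in>I4. \<Sum>r\<in>I4.
     \<Sum>s\<in>I4. \<Sum>f\<in>I4. \<Sum>g\<in>I4. \<Sum>h\<in>I4.
       eps a b c p * eps q d e r * eps s f g h * zA w l a b c * yA w k1 p q
       * yA w k2 d e * yA w k3 r s * zA w l' f g h)"

definition inv8c :: "nat \<Rightarrow> nat \<Rightarrow> nat \<Rightarrow> nat \<Rightarrow> nat \<Rightarrow> nat \<Rightarrow> nat \<Rightarrow> pt \<Rightarrow> complex" where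
  "inv8c l1 l2 k1 k2 k3 k4 k5 w =
    (\<Sum>a\<in>I4. \<Sum>b\<in>I4. \<Sum>c\<in>I4. \<Sum>p\<in>I4. \<Sum>q\<in>I4. \<Sum>d\<in>I4. \<Sum>e\<in>I4. \<Sum>r\<in>I4.
     \<Sum>s\<in>I4. \<Sum>f\<in>I4. \<Sum>g\<in>I4. \<Sum>t\<in>I4. \<Sum>u\<in>I4. \<Sum>h\<in>I4. \<Sum>i\<in>I4. \<Sum>m\<in>I4.
       eps a b c p * eps q d e r * eps s f g t * eps u h i m * zA w l1 a b c
       * yA w k1 p q * yA w k2 d e * yA w k3 r s * yA w k4 f g * yA w k5 t u
       * zA w l2 h i m)"

definition inv9a :: "nat \<Rightarrow> nat \<Rightarrow> nat \<Rightarrow> nat \<Rightarrow> pt \<Rightarrow> complex" where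
  "inv9a j k1 k2 l w =
    (\<Sum>a\<in>I4. \<Sum>b\<in>I4. \<Sum>c\<in>I4. \<Sum>p\<in>I4. \<Sum>q\<in>I4. \<Sum>d\<in>I4. \<Sum>e\<in>I4. \<Sum>f\<in>I4.
       eps a b c p * eps q d e f * X w j a * yA w k1 b c * yA w k2 p q * zA w l d e f)"

definition inv9b :: "nat \<Rightarrow> nat \<Rightarrow> nat \<Rightarrow> nat \<Rightarrow> nat \<Rightarrow> nat \<Rightarrow> pt \<Rightarrow> complex" where
  "inv9b j k1 k2 k3 k4 l w =
    (\<Sum>a\<in>I4. \<Sum>b\<in>I4. \<Sum>c\<in>I4. \<Sum>p\<in>I4. \<Sum>q\<in>I4. \<Sum>d\<in>I4. \<Sum>e\<in>I4. \<Sum>r\<in>I4.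
     \<Sum>s\<in>I4. \<Sum>f\<in>I4. \<Sum>g\<in>I4. \<Sum>h\<in>I4.
       eps a b c p * eps q d e r * eps s f g h * X w j a * yA w k1 b c * yA w k2 p q
       * yA w k3 d e * yA w k4 r s * zA w l f g h)"

definition listed :: "nat \<Rightarrow> nat \<Rightarrow> nat \<Rightarrow> (pt \<Rightarrow> complex) set" where
  "listed n1 n2 n3 =
     {inv1 j1 j2 j3 j4 | j1 j2 j3 j4. 1 \<le> j1 \<and> j1 < j2 \<and> j2 < j3 \<and> j3 < j4 \<and> j4 \<le> n1}
   \<union> {inv2 l1 l2 l3 l4 | l1 l2 l3 l4. 1 \<le> l1 \<and> l1 < l2 \<and> l2 < l3 \<and> l3 < l4 \<and> l4 \<le> n3}
   \<union> {inv3 k1 k2 | k1 k2. 1 \<le> k1 \<and> k1 \<le> k2 \<and> k2 \<le> n2}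
   \<union> {inv4 ks | ks. 1 \<le> ks 1 \<and> (\<forall>r\<in>{1..<6}. ks r < ks (Suc r)) \<and> ks 6 \<le> n2}
   \<union> {inv5 j l | j l. 1 \<le> j \<and> j \<le> n1 \<and> 1 \<le> l \<and> l \<le> n3}
   \<union> {inv6 j1 j2 k | j1 j2 k. 1 \<le> j1 \<and> j1 < j2 \<and> j2 \<le> n1 \<and> 1 \<le> k \<and> k \<le> n2}
   \<union> {inv7a j j' k1 k2 k3 | j j' k1 k2 k3. 1 \<le> j \<and> j \<le> j' \<and> j' \<le> n1
        \<and> 1 \<le> k1 \<and> k1 < k2 \<and> k2 < k3 \<and> k3 \<le> n2}
   \<union> {inv7b j1 j2 k1 k2 k3 k4 k5 | j1 j2 k1 k2 k3 k4 k5. 1 \<le> j1 \<and> j1 < j2 \<and> j2 \<le> n1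
        \<and> 1 \<le> k1 \<and> k1 < k2 \<and> k2 < k3 \<and> k3 < k4 \<and> k4 < k5 \<and> k5 \<le> n2}
   \<union> {inv8a l1 l2 k | l1 l2 k. 1 \<le> l1 \<and> l1 < l2 \<and> l2 \<le> n3 \<and> 1 \<le> k \<and> k \<le> n2}
   \<union> {inv8b l l' k1 k2 k3 | l l' k1 k2 k3. 1 \<le> l \<and> l \<le> l' \<and> l' \<le> n3
        \<and> 1 \<le> k1 \<and> k1 < k2 \<and> k2 < k3 \<and> k3 \<le> n2}
   \<union> {inv8c l1 l2 k1 k2 k3 k4 k5 | l1 l2 k1 k2 k3 k4 k5. 1 \<le> l1 \<and> l1 < l2 \<and> l2 \<le> n3
        \<and> 1 \<le> k1 \<and> k1 < k2 \<and> k2 < k3 \<and> k3 < k4 \<and> k4 < k5 \<and> k5 \<le> n2}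
   \<union> {inv9a j k1 k2 l | j k1 k2 l. 1 \<le> j \<and> j \<le> n1 \<and> 1 \<le> l \<and> l \<le> n3
        \<and> 1 \<le> k1 \<and> k1 < k2 \<and> k2 \<le> n2}
   \<union> {inv9b j k1 k2 k3 k4 l | j k1 k2 k3 k4 l. 1 \<le> j \<and> j \<le> n1 \<and> 1 \<le> l \<and> l \<le> n3
        \<and> 1 \<le> k1 \<and> k1 < k2 \<and> k2 < k3 \<and> k3 < k4 \<and> k4 \<le> n2}"

end

theory Submission
  imports Defs "HOL-Library.FuncSet" "HOL-Library.Multiset" "HOL-Library.Infinite_Set"
    "HOL-Computational_Algebra.Polynomial" "HOL-Computational_Algebra.Primes"
begin

text \<open>Applying an invariant to a generic matrix and pairing with a power of the determinant
  (Cayley's Omega process) writes it as a combination of complete contractions of the tensors x, y, z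
  with Levi-Civita symbols. The bivectors and trivectors are contracted one at a time: since
  antisymmetrising over five indices gives zero, each contraction removes a Levi-Civita symbol or joins
  two chains. What remains are determinants of four vectors or four covectors and words, that is
  products of bivectors and dual bivectors in alternation, either traced or placed between vectors
  and covectors. Words satisfy the Clifford relation: y y' + y' y is the scalar
  (y, y'). Hence, up to products with shorter words, a word is alternating in its letters, the alternating
  word in six letters is a multiple of the 6 x 6 determinant, and transposition decides which words
  of at most five letters are symmetric or antisymmetric in their ends.

  For minimality, the generators are multihomogeneous with pairwise distinct multidegrees. For each
  generator there is a point with pairwise orthogonal bivectors at which it does not vanish, whereas
  every product of other generators of the same multidegree contains a factor (y, y') and
  vanishes there.\<close>

text \<open>The Omega process needs an identity for all 4 x 4 matrices, while invariance concerns
  determinant one only. Weights, scalar matrices and a polynomial argument on a line through the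
  identity give F(gw) = det(g)^p F(w) for every g. The functional applied to both sides must not
  kill det^p; this holds because a positive multiple of its value is a sum of squares of real
  numbers, not all zero. Trivectors are contracted before bivectors: as long as no words exist, a
  trivector meets only determinants and covectors, and the class of forms stays closed. The factor
  between the alternating word in six letters and the determinant is read off at a point with
  orthogonal bivectors, where the letters anticommute exactly, instead of being summed over 720
  permutations. In the minimality argument a factor (y, y') is forced because the vectors and
  covectors of a word cannot be shared between two factors, and the other factors, with at most five
  bivectors at their disposal, can only be pairings.\<close>

lemma I4_eq: "I4 = {1,2,3,4}"
  by (auto simp: I4_def)

lemma sum_I4: "(\<Sum>a\<in>I4. f a) = f 1 + f 2 + f 3 + (f 4 :: 'a::comm_monoid_add)"
  by (simp add: I4_eq add.assoc)

lemma finite_I4 [simp]: "finite I4"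
  by (simp add: I4_def)

text \<open>Serves both as the standard basis, \<open>ev a\<close> being the a-th vector, and as the
  identity matrix in \<open>act ev\<close> and in the empty word.\<close>

definition ev :: "nat \<Rightarrow> nat \<Rightarrow> complex" where
  "ev a b = (if b = a then 1 else 0)"

text \<open>A sum over all indices rather than over permutations, so that it reads as a contraction
  of the Levi-Civita symbol and is visibly linear in each slot.\<close>

definition det4 :: "(nat \<Rightarrow> complex) \<Rightarrow> (nat \<Rightarrow> complex) \<Rightarrow> (nat \<Rightarrow> complex) \<Rightarrow> (nat \<Rightarrow> complex) \<Rightarrow> complex" where
  "det4 p q r s = (\<Sum>a\<in>I4. \<Sum>b\<in>I4. \<Sum>c\<in>I4. \<Sum>d\<in>I4. eps a b c d * p a * q b * r c * s d)"

lemma det4_explicit: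
  "det4 p q r s =
     p 1 * (q 2 * (r 3 * s 4 - r 4 * s 3) - q 3 * (r 2 * s 4 - r 4 * s 2) + q 4 * (r 2 * s 3 - r 3 * s 2))
   - p 2 * (q 1 * (r 3 * s 4 - r 4 * s 3) - q 3 * (r 1 * s 4 - r 4 * s 1) + q 4 * (r 1 * s 3 - r 3 * s 1))
   + p 3 * (q 1 * (r 2 * s 4 - r 4 * s 2) - q 2 * (r 1 * s 4 - r 4 * s 1) + q 4 * (r 1 * s 2 - r 2 * s 1))
   - p 4 * (q 1 * (r 2 * s 3 - r 3 * s 2) - q 2 * (r 1 * s 3 - r 3 * s 1) + q 3 * (r 1 * s 2 - r 2 * s 1))"
  by (simp add: det4_def sum_I4 eps_def algebra_simps)

lemma det4_swap12: "det4 q p r s = - det4 p q r s"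
  and det4_swap23: "det4 p r q s = - det4 p q r s"
  and det4_swap34: "det4 p q s r = - det4 p q r s"
  by (simp_all add: det4_explicit algebra_simps)

lemma detN4: "detN 4 M = det4 (\<lambda>a. M a 1) (\<lambda>a. M a 2) (\<lambda>a. M a 3) (\<lambda>a. M a 4)"
proof -
  have *: "{1..4::nat} = insert 1 (insert 2 (insert 3 (insert 4 {})))" by auto
  show ?thesis
    unfolding detN_def *
    by (simp add: sum_over_permutations_insert sign_compose permutation_swap_id sign_swap_id
       det4_explicit permutation_compose transpose_def algebra_simps)
qed

lemma det4_transpose:
  "det4 (\<lambda>a. M a 1) (\<lambda>a. M a 2) (\<lambda>a. M a 3) (\<lambda>a. M a 4) = det4 (M 1) (M 2) (M 3) (M 4)"
  by (simp add: det4_explicit algebra_simps)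

subsection \<open>Dual tensors\<close>

text \<open>Hodge dual without the usual factor 1/2; \<open>dualz\<close> likewise lacks 1/6. The
  constants 2, 3 and 6 in the contraction formulas come from this normalisation.\<close>

definition dualy :: "(nat \<Rightarrow> nat \<Rightarrow> complex) \<Rightarrow> nat \<Rightarrow> nat \<Rightarrow> complex" where
  "dualy y a b = (\<Sum>c\<in>I4. \<Sum>d\<in>I4. eps a b c d * y c d)"

definition dualz :: "(nat \<Rightarrow> nat \<Rightarrow> nat \<Rightarrow> complex) \<Rightarrow> nat \<Rightarrow> complex" where
  "dualz z a = (\<Sum>b\<in>I4. \<Sum>c\<in>I4. \<Sum>d\<in>I4. eps a b c d * z b c d)"

definition bil :: "(nat \<Rightarrow> complex) \<Rightarrow> (nat \<Rightarrow> nat \<Rightarrow> complex) \<Rightarrow> (nat \<Rightarrow> complex) \<Rightarrow> complex" where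
  "bil p M q = (\<Sum>a\<in>I4. \<Sum>b\<in>I4. p a * M a b * q b)"

definition dot :: "(nat \<Rightarrow> complex) \<Rightarrow> (nat \<Rightarrow> complex) \<Rightarrow> complex" where
  "dot p q = (\<Sum>a\<in>I4. p a * q a)"

definition alt2 :: "(nat \<Rightarrow> nat \<Rightarrow> complex) \<Rightarrow> bool" where
  "alt2 y \<longleftrightarrow> (\<forall>a b. y b a = - y a b)"

definition alt3 :: "(nat \<Rightarrow> nat \<Rightarrow> nat \<Rightarrow> complex) \<Rightarrow> bool" where
  "alt3 z \<longleftrightarrow> (\<forall>a b c. z b a c = - z a b c \<and> z a c b = - z a b c)"

lemma eq_neg_self: "x = - (x::complex) \<Longrightarrow> x = 0"
  by simp

lemma alt2_diag: "alt2 y \<Longrightarrow> y a a = 0"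
  unfolding alt2_def by (rule eq_neg_self) blast

lemma alt3_diag: assumes "alt3 z" shows "z a a c = 0" "z a c c = 0" "z a c a = 0"
proof -
  show 1: "z a a c = 0" for a c
    by (rule eq_neg_self) (use assms in \<open>unfold alt3_def, blast\<close>)
  show "z a c c = 0"
    by (rule eq_neg_self) (use assms in \<open>unfold alt3_def, blast\<close>)
  have "z a c a = - z a a c" using assms unfolding alt3_def by blast
  then show "z a c a = 0" using 1 by simp
qed

lemma alt2_norm:
  assumes "alt2 y"
  shows "y 2 1 = - y 1 2" "y 3 1 = - y 1 3" "y 4 1 = - y 1 4" "y 3 2 = - y 2 3" "y 4 2 = - y 2 4" "y 4 3 = - y 3 4"
    "y 1 1 = 0" "y 2 2 = 0" "y 3 3 = 0" "y 4 4 = 0"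
    "y (Suc 0) (Suc 0) = 0" "y 2 (Suc 0) = - y (Suc 0) 2" "y 3 (Suc 0) = - y (Suc 0) 3" "y 4 (Suc 0) = - y (Suc 0) 4"
proof -
  have 1: "y b a = - y a b" for a b using assms unfolding alt2_def by blast
  show "y 2 1 = - y 1 2" "y 3 1 = - y 1 3" "y 4 1 = - y 1 4" "y 3 2 = - y 2 3" "y 4 2 = - y 2 4" "y 4 3 = - y 3 4"
    "y 2 (Suc 0) = - y (Suc 0) 2" "y 3 (Suc 0) = - y (Suc 0) 3" "y 4 (Suc 0) = - y (Suc 0) 4"
    by (rule 1)+
qed (rule alt2_diag[OF assms])+

lemma alt3_norm:
  assumes "alt3 z" "a < b" "b < c"
  shows "z b a c = - z a b c" "z a c b = - z a b c" "z b c a = z a b c" "z c a b = z a b c" "z c b a = - z a b c"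
proof -
  have 1: "z y x w = - z x y w" and 2: "z x w y = - z x y w" for x y w
    using assms(1) unfolding alt3_def by blast+
  show "z b a c = - z a b c" "z a c b = - z a b c" using 1 2 by blast+
  show "z b c a = z a b c" using 2[of b c a] 1[of b a c] by simp
  show "z c a b = z a b c" using 1[of c a b] 2[of a c b] by simp
  show "z c b a = - z a b c" using 1[of c b a] 2[of b c a] 1[of b a c] by simp
qed

lemma alt3_norm4:
  assumes "alt3 z"
  shows "z 2 1 3 = - z 1 2 3" "z 1 3 2 = - z 1 2 3" "z 2 3 1 = z 1 2 3" "z 3 1 2 = z 1 2 3" "z 3 2 1 = - z 1 2 3"
    "z 2 1 4 = - z 1 2 4" "z 1 4 2 = - z 1 2 4" "z 2 4 1 = z 1 2 4" "z 4 1 2 = z 1 2 4" "z 4 2 1 = - z 1 2 4"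
    "z 3 1 4 = - z 1 3 4" "z 1 4 3 = - z 1 3 4" "z 3 4 1 = z 1 3 4" "z 4 1 3 = z 1 3 4" "z 4 3 1 = - z 1 3 4"
    "z 3 2 4 = - z 2 3 4" "z 2 4 3 = - z 2 3 4" "z 3 4 2 = z 2 3 4" "z 4 2 3 = z 2 3 4" "z 4 3 2 = - z 2 3 4"
  by (rule alt3_norm[OF assms]; simp)+

lemma dualy_explicit:
  assumes "alt2 y"
  shows "dualy y 1 2 = 2 * y 3 4" "dualy y 1 3 = - 2 * y 2 4" "dualy y 1 4 = 2 * y 2 3"
    "dualy y 2 3 = 2 * y 1 4" "dualy y 2 4 = - 2 * y 1 3" "dualy y 3 4 = 2 * y 1 2"
  by (simp_all add: dualy_def sum_I4 eps_def alt2_norm[OF assms])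

lemma of_int_sgn_neg: "x = - y \<Longrightarrow> complex_of_int (sgn x) = - of_int (sgn (y::int))"
  by (simp add: sgn_minus)

lemma eps_swap12: "eps b a c d = - eps a b c d"
proof -
  have *: "(- x) * u * v * p * q * t = - (x * p * q * u * v * t)" for x u v p q t :: int by (simp add: ac_simps)
  show ?thesis unfolding eps_def
    by (rule of_int_sgn_neg) (use *[of "int b - int a"] in simp)
qed

lemma eps_swap23: "eps a c b d = - eps a b c d"
proof -
  have *: "p * x * q * (- y) * t * v = - (x * p * q * y * v * t)" for x y v p q t :: int by (simp add: ac_simps)
  show ?thesis unfolding eps_def
    by (rule of_int_sgn_neg) (use *[of _ _ _ "int c - int b"] in simp)
qed

lemma eps_swap34: "eps a b d c = - eps a b c d"
proof -
  have *: "x * q * p * v * u * (- t) = - (x * p * q * u * v * t)" for x u v p q t :: int by (simp add: ac_simps)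
  show ?thesis unfolding eps_def
    by (rule of_int_sgn_neg) (use *[of _ _ _ _ _ "int d - int c"] in simp)
qed

lemma alt2_dualy: "alt2 (dualy y)"
  unfolding alt2_def
proof (intro allI)
  fix a b
  show "dualy y b a = - dualy y a b"
    unfolding dualy_def eps_swap12[of b a] by (simp add: sum_negf)
qed

lemma dualz_explicit:
  assumes "alt3 z"
  shows "dualz z 1 = 6 * z 2 3 4" "dualz z 2 = - 6 * z 1 3 4" "dualz z 3 = 6 * z 1 2 4" "dualz z 4 = - 6 * z 1 2 3"
  by (simp_all add: dualz_def sum_I4 eps_def alt3_norm4[OF assms, simplified] alt3_diag[OF assms])

section \<open>Contraction of determinants with bivectors and trivectors\<close>

lemma det4_ev1:
  "det4 (ev 1) q r s = q 2 * (r 3 * s 4 - r 4 * s 3) - q 3 * (r 2 * s 4 - r 4 * s 2) + q 4 * (r 2 * s 3 - r 3 * s 2)"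
  "det4 (ev 2) q r s = - (q 1 * (r 3 * s 4 - r 4 * s 3) - q 3 * (r 1 * s 4 - r 4 * s 1) + q 4 * (r 1 * s 3 - r 3 * s 1))"
  "det4 (ev 3) q r s = q 1 * (r 2 * s 4 - r 4 * s 2) - q 2 * (r 1 * s 4 - r 4 * s 1) + q 4 * (r 1 * s 2 - r 2 * s 1)"
  "det4 (ev 4) q r s = - (q 1 * (r 2 * s 3 - r 3 * s 2) - q 2 * (r 1 * s 3 - r 3 * s 1) + q 3 * (r 1 * s 2 - r 2 * s 1))"
  by (simp_all add: det4_explicit ev_def)

lemma bil_alt2:
  assumes "alt2 M"
  shows "bil p M q = M 1 2 * (p 1 * q 2 - p 2 * q 1) + M 1 3 * (p 1 * q 3 - p 3 * q 1) + M 1 4 * (p 1 * q 4 - p 4 * q 1)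
     + M 2 3 * (p 2 * q 3 - p 3 * q 2) + M 2 4 * (p 2 * q 4 - p 4 * q 2) + M 3 4 * (p 3 * q 4 - p 4 * q 3)"
  by (simp only: bil_def sum_I4 alt2_norm[OF assms]) algebra

text \<open>Antisymmetrising over five indices gives zero: this removes one Levi-Civita symbol
  whenever one of its slots meets a bivector.\<close>

lemma det4_bivector:
  assumes "alt2 y"
  shows "(\<Sum>a\<in>I4. \<Sum>e\<in>I4. y a e * det4 (ev a) p q r * \<phi> e)
    = (dot p \<phi> * bil q (dualy y) r - dot q \<phi> * bil p (dualy y) r + dot r \<phi> * bil p (dualy y) q) / 2"
  unfolding bil_alt2[OF alt2_dualy] dot_def
  by (simp only: sum_I4 det4_ev1 alt2_norm[OF assms] dualy_explicit[OF assms]) algebra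

lemma det4_trivector:
  assumes "alt3 z"
  shows "(\<Sum>i\<in>I4. \<Sum>j\<in>I4. \<Sum>k\<in>I4. z i j k * det4 (ev i) p q r * \<phi> j k)
    = - (dot p (dualz z) * (bil q \<phi> r - bil r \<phi> q) - dot q (dualz z) * (bil p \<phi> r - bil r \<phi> p)
         + dot r (dualz z) * (bil p \<phi> q - bil q \<phi> p)) / 6"
  unfolding bil_def dot_def
  by (simp only: sum_I4 det4_ev1 alt3_norm4[OF assms] alt3_diag[OF assms] dualz_explicit[OF assms]) algebra

lemma det4_trivector2:
  assumes "alt3 z"
  shows "(\<Sum>i\<in>I4. \<Sum>j\<in>I4. \<Sum>k\<in>I4. z i j k * det4 (ev i) (ev j) q r * \<phi> k)
    = (dot q (dualz z) * dot r \<phi> - dot r (dualz z) * dot q \<phi>) / 3"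
  unfolding bil_def dot_def
  by (simp only: sum_I4 det4_ev1 alt3_norm4[OF assms] alt3_diag[OF assms] dualz_explicit[OF assms],
      simp add: ev_def) algebra

lemma det4_trivector3:
  assumes "alt3 z"
  shows "(\<Sum>i\<in>I4. \<Sum>j\<in>I4. \<Sum>k\<in>I4. z i j k * det4 (ev i) (ev j) (ev k) r) = - dot r (dualz z)"
  unfolding dot_def
  by (simp only: sum_I4 det4_ev1 alt3_norm4[OF assms] alt3_diag[OF assms] dualz_explicit[OF assms])
    (simp add: ev_def)

lemma det4_biv2:
  assumes "alt2 y"
  shows "(\<Sum>a\<in>I4. \<Sum>c\<in>I4. y a c * det4 (ev a) (ev c) q r) = bil q (dualy y) r"
  unfolding bil_alt2[OF alt2_dualy] dualy_explicit[OF assms]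
  by (simp only: sum_I4 det4_ev1 alt2_norm[OF assms]) (simp add: ev_def algebra_simps)

lemma alt3_swap12: "alt3 z \<Longrightarrow> z j i k = - z i j k"
  and alt3_swap23: "alt3 z \<Longrightarrow> z i k j = - z i j k"
  unfolding alt3_def by blast+

lemma alt3_cyclic: "alt3 z \<Longrightarrow> z i j k = z j k i"
  using alt3_swap12[of z i j k] alt3_swap23[of z j i k] by simp

lemma alt2_contract_trivector:
  assumes "alt3 z"
  shows "alt2 (\<lambda>j k. \<Sum>i\<in>I4. z i j k * \<theta> i)"
  unfolding alt2_def
proof (intro allI)
  fix j k
  show "(\<Sum>i\<in>I4. z i k j * \<theta> i) = - (\<Sum>i\<in>I4. z i j k * \<theta> i)"
    unfolding sum_negf[symmetric] by (intro sum.cong refl) (simp add: alt3_swap23[OF assms, of _ k j])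
qed

text \<open>A trivector with one index filled by \<theta> is a bivector, and its dual is the
  decomposable form \<zeta> wedge \<theta> up to a factor, with \<zeta> the covector of z. This lets
  the contraction lemma for bivectors handle a trivector that has already met a covector.\<close>

lemma dualy_contract_trivector:
  assumes "alt3 z"
  shows "bil p (dualy (\<lambda>j k. \<Sum>i\<in>I4. z i j k * \<theta> i)) q = (dot p (dualz z) * dot q \<theta> - dot q (dualz z) * dot p \<theta>) / 3"
proof -
  have "bil p (dualy (\<lambda>j k. \<Sum>i\<in>I4. z i j k * \<theta> i)) q
      = (\<Sum>j\<in>I4. \<Sum>k\<in>I4. (\<Sum>i\<in>I4. z i j k * \<theta> i) * det4 (ev j) (ev k) p q)"
    by (rule det4_biv2[OF alt2_contract_trivector[OF assms], symmetric])
  also have "\<dots> = (\<Sum>j\<in>I4. \<Sum>k\<in>I4. \<Sum>i\<in>I4. z j k i * det4 (ev j) (ev k) p q * \<theta> i)"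
    unfolding sum_distrib_right
  proof (intro sum.cong refl)
    fix i j k
    show "z i j k * \<theta> i * det4 (ev j) (ev k) p q = z j k i * det4 (ev j) (ev k) p q * \<theta> i"
      using alt3_cyclic[OF assms, of i j k] by simp
  qed
  finally show ?thesis unfolding det4_trivector2[OF assms] .
qed

text \<open>Origin of the determinants of four covectors: they arise when all three indices of a
  trivector meet covectors.\<close>

lemma trivector_det4:
  assumes "alt3 z"
  shows "(\<Sum>i\<in>I4. \<Sum>j\<in>I4. \<Sum>k\<in>I4. z i j k * p i * q j * r k) = det4 (dualz z) p q r / 6"
  by (simp only: sum_I4 det4_explicit alt3_norm4[OF assms] alt3_diag[OF assms] dualz_explicit[OF assms]) algebra

text \<open>Polarisation of the Pfaffian identity: an alternating 4 x 4 matrix times its dual is a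
  scalar matrix. Traces give the factor -1/2: each of the two products has trace minus the pairing,
  and the identity has trace 4.\<close>

lemma clifford_lower:
  assumes "alt2 y" "alt2 y'" "a \<in> I4" "c \<in> I4"
  shows "(\<Sum>b\<in>I4. dualy y a b * y' b c + dualy y' a b * y b c)
     = - (\<Sum>a\<in>I4. \<Sum>b\<in>I4. \<Sum>c\<in>I4. \<Sum>d\<in>I4. eps a b c d * y a b * y' c d) / 2 * ev a c"
proof -
  have "a = 1 \<or> a = 2 \<or> a = 3 \<or> a = 4" "c = 1 \<or> c = 2 \<or> c = 3 \<or> c = 4"
    using assms unfolding I4_eq by auto
  then show ?thesis
    by (elim disjE; simp add: sum_I4 ev_def eps_def alt2_norm[OF assms(1), simplified] alt2_norm[OF assms(2), simplified]
       alt2_norm[OF alt2_dualy, simplified]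
      dualy_explicit[OF assms(1), simplified] dualy_explicit[OF assms(2), simplified])
qed

lemma clifford_upper:
  assumes "alt2 y" "alt2 y'" "a \<in> I4" "c \<in> I4"
  shows "(\<Sum>b\<in>I4. y a b * dualy y' b c + y' a b * dualy y b c)
     = - (\<Sum>a\<in>I4. \<Sum>b\<in>I4. \<Sum>c\<in>I4. \<Sum>d\<in>I4. eps a b c d * y a b * y' c d) / 2 * ev a c"
proof -
  have "a = 1 \<or> a = 2 \<or> a = 3 \<or> a = 4" "c = 1 \<or> c = 2 \<or> c = 3 \<or> c = 4"
    using assms unfolding I4_eq by auto
  then show ?thesis
    by (elim disjE; simp add: sum_I4 ev_def eps_def alt2_norm[OF assms(1), simplified] alt2_norm[OF assms(2), simplified]
       alt2_norm[OF alt2_dualy, simplified]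
      dualy_explicit[OF assms(1), simplified] dualy_explicit[OF assms(2), simplified])
qed

subsection \<open>Words in the bivectors\<close>

lemma alt2_yA: "alt2 (yA w k)"
  unfolding alt2_def yA_def
proof (intro allI)
  fix a b
  have "complex_of_int (sgn (int a - int b)) = - of_int (sgn (int b - int a))"
    by (rule of_int_sgn_neg) simp
  then show "complex_of_int (sgn (int a - int b)) * Y w k (min b a) (max b a) =
           - (complex_of_int (sgn (int b - int a)) * Y w k (min a b) (max a b))"
    by (simp add: min.commute max.commute)
qed

lemma alt3_zA: "alt3 (zA w l)"
  unfolding alt3_def zA_def
proof (intro allI conjI)
  fix a b c
  have "complex_of_int (sgn ((int a - int b) * (int c - int b) * (int c - int a)))
      = - of_int (sgn ((int b - int a) * (int c - int a) * (int c - int b)))"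
    by (rule of_int_sgn_neg) (simp add: algebra_simps)
  moreover have "min b (min a c) = min a (min b c)" "max b (max a c) = max a (max b c)" "b + a + c = a + b + c" by auto
  ultimately show "complex_of_int (sgn ((int a - int b) * (int c - int b) * (int c - int a))) *
       Z w l (min b (min a c)) (b + a + c - min b (min a c) - max b (max a c)) (max b (max a c)) =
       - (complex_of_int (sgn ((int b - int a) * (int c - int a) * (int c - int b))) *
          Z w l (min a (min b c)) (a + b + c - min a (min b c) - max a (max b c)) (max a (max b c)))"
    by (simp only: minus_mult_left)
next
  fix a b c
  have "complex_of_int (sgn ((int c - int a) * (int b - int a) * (int b - int c)))
      = - of_int (sgn ((int b - int a) * (int c - int a) * (int c - int b)))"
    by (rule of_int_sgn_neg) (simp add: algebra_simps)
  moreover have "min a (min c b) = min a (min b c)" "max a (max c b) = max a (max b c)" "a + c + b = a + b + c" by auto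
  ultimately show "complex_of_int (sgn ((int c - int a) * (int b - int a) * (int b - int c))) *
       Z w l (min a (min c b)) (a + c + b - min a (min c b) - max a (max c b)) (max a (max c b)) =
       - (complex_of_int (sgn ((int b - int a) * (int c - int a) * (int c - int b))) *
          Z w l (min a (min b c)) (a + b + c - min a (min b c) - max a (max b c)) (max a (max b c)))"
    by (simp only: minus_mult_left)
qed

text \<open>The covector of the l-th trivector under the isomorphism of the third exterior power
  with the dual of V, up to the factor 6. Words know trivectors only in this form.\<close>

definition zeta :: "pt \<Rightarrow> nat \<Rightarrow> nat \<Rightarrow> complex" where
  "zeta w l = dualz (zA w l)"

definition letter :: "bool \<Rightarrow> pt \<Rightarrow> nat \<Rightarrow> nat \<Rightarrow> nat \<Rightarrow> complex" where
  "letter t w k = (if t then dualy (yA w k) else yA w k)"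

text \<open>The flag records the index position of the rows: for \<open>True\<close> the word begins
  with a dual bivector, which has lower indices. The two kinds of letters alternate because every
  summation must pair an upper with a lower index.\<close>

fun wd :: "bool \<Rightarrow> nat list \<Rightarrow> pt \<Rightarrow> nat \<Rightarrow> nat \<Rightarrow> complex" where
  "wd t [] w a b = ev a b"
| "wd t (k # ks) w a b = (\<Sum>c\<in>I4. letter t w k a c * wd (\<not> t) ks w c b)"

lemma alt2_letter: "alt2 (letter t w k)"
  by (simp add: letter_def alt2_dualy alt2_yA)

lemma letter_swap: "letter t w k b a = - letter t w k a b"
  using alt2_letter unfolding alt2_def by blast

lemma sum_ev_left: "a \<in> I4 \<Longrightarrow> (\<Sum>c\<in>I4. ev a c * f c) = f a"
  by (simp add: ev_def if_distrib[of "\<lambda>x. x * _"] cong: if_cong)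

lemma sum_ev_right: "a \<in> I4 \<Longrightarrow> (\<Sum>c\<in>I4. f c * ev c a) = f a"
  by (simp add: ev_def if_distrib[of "\<lambda>x. _ * x"] cong: if_cong)

lemma ev_sym: "ev a b = ev b a"
  by (simp add: ev_def)

lemma wd_append:
  "a \<in> I4 \<Longrightarrow> wd t (xs @ ys) w a b = (\<Sum>c\<in>I4. wd t xs w a c * wd (if even (length xs) then t else \<not> t) ys w c b)"
proof (induction xs arbitrary: t a)
  case Nil
  then show ?case by (simp add: sum_ev_left)
next
  case (Cons k xs)
  have "wd t ((k # xs) @ ys) w a b
     = (\<Sum>d\<in>I4. letter t w k a d * (\<Sum>c\<in>I4. wd (\<not> t) xs w d c * wd (if even (length xs) then \<not> t else t) ys w c b))"
    using Cons.IH[of _ "\<not> t"] by simp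
  also have "\<dots> = (\<Sum>c\<in>I4. (\<Sum>d\<in>I4. letter t w k a d * wd (\<not> t) xs w d c) * wd (if even (length xs) then \<not> t else t) ys w c b)"
    by (subst sum_distrib_right, subst sum.swap) (simp add: sum_distrib_left mult.assoc)
  finally show ?case by simp
qed

text \<open>Each letter is alternating and contributes a sign. The reversed word begins with the
  kind of the former last letter, which is \<open>t\<close> exactly for odd length.\<close>

lemma wd_transpose:
  "a \<in> I4 \<Longrightarrow> b \<in> I4 \<Longrightarrow> wd t ks w a b = (-1) ^ length ks * wd (if odd (length ks) then t else \<not> t) (rev ks) w b a"
proof (induction ks arbitrary: t a)
  case Nil
  then show ?case by (simp add: ev_sym)
next
  case (Cons k ks)
  let ?s = "if odd (length ks) then \<not> t else t"
  have t': "(if even (length (rev ks)) then (if odd (length (k # ks)) then t else \<not> t) else \<not> (if odd (length (k # ks)) then t else \<not> t)) = t"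
    by simp
  have s': "(if odd (length (k # ks)) then t else \<not> t) = ?s" by simp
  have "wd ?s (rev ks @ [k]) w b a = (\<Sum>c\<in>I4. wd ?s (rev ks) w b c * wd t [k] w c a)"
    using wd_append[of b ?s "rev ks" "[k]" w a] Cons.prems by (cases "even (length ks)") simp_all
  also have "\<dots> = (\<Sum>c\<in>I4. wd ?s (rev ks) w b c * letter t w k c a)"
    using Cons.prems by (simp add: sum_ev_right)
  also have "\<dots> = (\<Sum>c\<in>I4. - (letter t w k a c * wd ?s (rev ks) w b c))"
    by (intro sum.cong refl) (simp add: letter_swap[of t w k _ a])
  finally have *: "wd ?s (rev ks @ [k]) w b a = - (\<Sum>c\<in>I4. letter t w k a c * wd ?s (rev ks) w b c)"
    by (simp add: sum_negf)
  have "wd t (k # ks) w a b = (\<Sum>c\<in>I4. letter t w k a c * ((-1) ^ length ks * wd ?s (rev ks) w b c))"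
    using Cons.IH[of _ "\<not> t"] Cons.prems(2) by (cases "odd (length ks)") simp_all
  also have "\<dots> = (-1) ^ length ks * (\<Sum>c\<in>I4. letter t w k a c * wd ?s (rev ks) w b c)"
    by (simp add: sum_distrib_left ac_simps)
  also have "\<dots> = (-1) ^ length (k # ks) * wd ?s (rev (k # ks)) w b a"
    using * by simp
  finally show ?case unfolding s' .
qed

lemma inv3_commute: "inv3 k k' w = inv3 k' k w"
proof -
  have "inv3 k k' w = (\<Sum>c\<in>I4. \<Sum>d\<in>I4. \<Sum>a\<in>I4. \<Sum>b\<in>I4. eps a b c d * yA w k a b * yA w k' c d)"
    unfolding inv3_def by (simp only: sum_I4 ac_simps)
  also have "\<dots> = inv3 k' k w"
    unfolding inv3_def
  proof (intro sum.cong refl)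
    fix a b c d
    have "eps a b c d = eps c d a b"
      by (metis eps_swap12 eps_swap23 eps_swap34 minus_minus)
    then show "eps a b c d * yA w k a b * yA w k' c d = eps c d a b * yA w k' c d * yA w k a b" by simp
  qed
  finally show ?thesis .
qed

lemma letter_clifford:
  assumes "a \<in> I4" "c \<in> I4"
  shows "(\<Sum>b\<in>I4. letter t w k a b * letter (\<not> t) w k' b c) + (\<Sum>b\<in>I4. letter t w k' a b * letter (\<not> t) w k b c)
     = - inv3 k k' w / 2 * ev a c"
  using clifford_lower[OF alt2_yA[of w k] alt2_yA[of w k'] assms] clifford_upper[OF alt2_yA[of w k] alt2_yA[of w k'] assms]
  unfolding inv3_def[symmetric] by (cases t) (simp_all add: letter_def sum.distrib)

lemma wd2: "c \<in> I4 \<Longrightarrow> wd t [k, k'] w a c = (\<Sum>b\<in>I4. letter t w k a b * letter (\<not> t) w k' b c)"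
  by (simp add: sum_ev_right)

text \<open>The Clifford relation replaces the pair by a scalar; the outer words still fit together
  because the removal of two letters preserves the alternation of kinds.\<close>

lemma wd_swap:
  assumes "a \<in> I4"
  shows "wd t (xs @ [k, k'] @ ys) w a b + wd t (xs @ [k', k] @ ys) w a b = - inv3 k k' w / 2 * wd t (xs @ ys) w a b"
proof -
  let ?t = "if even (length xs) then t else \<not> t"
  have e: "wd t (xs @ [p, q] @ ys) w a b = (\<Sum>c\<in>I4. wd t xs w a c * (\<Sum>d\<in>I4. wd ?t [p, q] w c d * wd ?t ys w d b))" for p q
    unfolding wd_append[OF assms, of t xs]
    by (intro sum.cong refl arg_cong2[of _ _ _ _ times]) (use wd_append[of _ ?t "[p, q]" ys w b] in simp)
  have "wd ?t [k, k'] w c d * wd ?t ys w d b + wd ?t [k', k] w c d * wd ?t ys w d b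
      = (- inv3 k k' w / 2 * ev c d) * wd ?t ys w d b" if "c \<in> I4" "d \<in> I4" for c d
    using letter_clifford[OF that, of ?t w k k'] unfolding wd2[OF that(2)] distrib_right[symmetric] by simp
  then have "wd t (xs @ [k, k'] @ ys) w a b + wd t (xs @ [k', k] @ ys) w a b
      = (\<Sum>c\<in>I4. wd t xs w a c * (\<Sum>d\<in>I4. (- inv3 k k' w / 2 * ev c d) * wd ?t ys w d b))"
    unfolding e by (simp add: sum.distrib[symmetric] distrib_left[symmetric])
  also have "\<dots> = (\<Sum>c\<in>I4. wd t xs w a c * (- inv3 k k' w / 2 * wd ?t ys w c b))"
  proof (intro sum.cong refl)
    fix c assume "c \<in> I4"
    have "(\<Sum>d\<in>I4. (- inv3 k k' w / 2 * ev c d) * wd ?t ys w d b) = - inv3 k k' w / 2 * (\<Sum>d\<in>I4. ev c d * wd ?t ys w d b)"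
      by (simp only: sum_distrib_left mult.assoc)
    then show "wd t xs w a c * (\<Sum>d\<in>I4. (- inv3 k k' w / 2 * ev c d) * wd ?t ys w d b)
       = wd t xs w a c * (- inv3 k k' w / 2 * wd ?t ys w c b)"
      using sum_ev_left[OF \<open>c \<in> I4\<close>] by simp
  qed
  also have "\<dots> = - inv3 k k' w / 2 * wd t (xs @ ys) w a b"
    unfolding wd_append[OF assms] sum_distrib_left by (intro sum.cong refl) (simp add: ac_simps)
  finally show ?thesis .
qed

lemma bil_transpose:
  "bil p (wd t ks w) q = (-1) ^ length ks * bil q (wd (if odd (length ks) then t else \<not> t) (rev ks) w) p"
proof -
  have "bil p (wd t ks w) q = (\<Sum>a\<in>I4. \<Sum>b\<in>I4. p a * ((-1) ^ length ks * wd (if odd (length ks) then t else \<not> t) (rev ks) w b a) * q b)"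
    unfolding bil_def by (intro sum.cong refl) (simp add: wd_transpose[of _ _ t ks])
  also have "\<dots> = (\<Sum>b\<in>I4. \<Sum>a\<in>I4. p a * ((-1) ^ length ks * wd (if odd (length ks) then t else \<not> t) (rev ks) w b a) * q b)"
    by (rule sum.swap)
  also have "\<dots> = (-1) ^ length ks * bil q (wd (if odd (length ks) then t else \<not> t) (rev ks) w) p"
    unfolding bil_def sum_distrib_left by (intro sum.cong refl) (simp only: ac_simps)
  finally show ?thesis .
qed

lemma bil_cong: "(\<And>a b. a \<in> I4 \<Longrightarrow> b \<in> I4 \<Longrightarrow> M a b = N a b) \<Longrightarrow> bil p M q = bil p N q"
  unfolding bil_def by (intro sum.cong refl) simp

lemma bil_wd_Nil: "bil p (wd t [] w) q = dot p q"
  unfolding bil_def dot_def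
  by (intro sum.cong refl) (simp add: mult.assoc sum_distrib_left[symmetric] sum_ev_left)

lemma bil_wd_single: "bil p (wd t [k] w) q = bil p (letter t w k) q"
  by (rule bil_cong) (simp add: sum_ev_right)

lemma dot_matrix: "dot p (\<lambda>a. \<Sum>b\<in>I4. M a b * q b) = bil p M q"
  unfolding dot_def bil_def by (simp add: sum_distrib_left mult.assoc)

lemma dot_commute: "dot p q = dot q p"
  unfolding dot_def by (simp add: mult.commute)

lemma bil_ev: "a \<in> I4 \<Longrightarrow> bil (ev a) M q = (\<Sum>b\<in>I4. M a b * q b)"
  using dot_matrix[of "ev a" M q] unfolding dot_def by (simp add: sum_ev_left)

text \<open>Both chains start at the contracted bivector. The first one has to be transposed, which
  puts its far end in front and produces the sign; the bivector becomes the letter in the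
  middle.\<close>

lemma chain_join:
  "bil (\<lambda>c. \<Sum>a\<in>I4. yA w k a c * (\<Sum>b\<in>I4. wd True ks w a b * q b)) (wd True ks' w) q'
   = (-1) ^ length ks * bil q (wd (odd (length ks)) (rev ks @ k # ks') w) q'"
proof -
  let ?T = "odd (length ks)"
  have F: "wd ?T (rev ks @ k # ks') w b d = (\<Sum>a\<in>I4. wd ?T (rev ks) w b a * (\<Sum>c\<in>I4. yA w k a c * wd True ks' w c d))"
    if "b \<in> I4" for b d
    using wd_append[OF that, of ?T "rev ks" "k # ks'" w d]
    by (cases "even (length ks)") (simp_all add: letter_def)
  have "bil (\<lambda>c. \<Sum>a\<in>I4. yA w k a c * (\<Sum>b\<in>I4. wd True ks w a b * q b)) (wd True ks' w) q'
      = (\<Sum>c\<in>I4. \<Sum>d\<in>I4. (\<Sum>a\<in>I4. yA w k a c * (\<Sum>b\<in>I4. ((-1) ^ length ks * wd ?T (rev ks) w b a) * q b)) * wd True ks' w c d * q' d)"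
    unfolding bil_def by (intro sum.cong refl) (simp add: wd_transpose[of _ _ True ks])
  also have "\<dots> = (\<Sum>c\<in>I4. \<Sum>d\<in>I4. \<Sum>a\<in>I4. \<Sum>b\<in>I4. (-1) ^ length ks * (q b * (wd ?T (rev ks) w b a * (yA w k a c * wd True ks' w c d)) * q' d))"
    by (simp only: sum_distrib_left sum_distrib_right ac_simps)
  also have "\<dots> = (\<Sum>b\<in>I4. \<Sum>d\<in>I4. \<Sum>a\<in>I4. \<Sum>c\<in>I4. (-1) ^ length ks * (q b * (wd ?T (rev ks) w b a * (yA w k a c * wd True ks' w c d)) * q' d))"
    by (simp only: sum_I4 ac_simps)
  also have "\<dots> = (-1) ^ length ks * bil q (wd ?T (rev ks @ k # ks') w) q'"
    unfolding bil_def by (simp add: F sum_distrib_left sum_distrib_right)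
  finally show ?thesis .
qed

lemma det4_lin: "det4 p q r s = (\<Sum>e\<in>I4. p e * det4 (ev e) q r s)"
  unfolding det4_explicit[of p q r s] sum_I4 det4_ev1 by algebra

lemma bil_lin: "bil p M q = (\<Sum>e\<in>I4. p e * bil (ev e) M q)"
proof -
  have "bil p M q = (\<Sum>e\<in>I4. p e * (\<Sum>b\<in>I4. M e b * q b))"
    by (simp add: bil_def sum_distrib_left mult.assoc)
  then show ?thesis by (simp add: bil_ev)
qed

text \<open>Reduces to \<open>det4_bivector\<close> by linearity; the sign comes from exchanging the
  two indices of y, since \<theta> enters through the first one.\<close>

lemma det4_yvec:
  assumes "alt2 y"
  shows "det4 (\<lambda>c. \<Sum>a\<in>I4. y a c * \<theta> a) p q r
    = - (dot p \<theta> * bil q (dualy y) r - dot q \<theta> * bil p (dualy y) r + dot r \<theta> * bil p (dualy y) q) / 2"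
proof -
  have "det4 (\<lambda>c. \<Sum>a\<in>I4. y a c * \<theta> a) p q r = (\<Sum>c\<in>I4. \<Sum>a\<in>I4. y a c * det4 (ev c) p q r * \<theta> a)"
    unfolding det4_lin[of "\<lambda>c. \<Sum>a\<in>I4. y a c * \<theta> a"] sum_distrib_right
    by (intro sum.cong refl) (simp only: ac_simps)
  also have "\<dots> = (\<Sum>c\<in>I4. \<Sum>a\<in>I4. - (y c a * det4 (ev c) p q r * \<theta> a))"
  proof (intro sum.cong refl)
    fix c a
    have "y a c = - y c a" using assms unfolding alt2_def by blast
    then show "y a c * det4 (ev c) p q r * \<theta> a = - (y c a * det4 (ev c) p q r * \<theta> a)" by simp
  qed
  also have "\<dots> = - (\<Sum>c\<in>I4. \<Sum>a\<in>I4. y c a * det4 (ev c) p q r * \<theta> a)"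
    by (simp only: sum_negf)
  finally show ?thesis unfolding det4_bivector[OF assms] by (simp only: minus_divide_left)
qed

subsection \<open>Determinants and chains\<close>

text \<open>A form takes vectors \<open>u i\<close> for labels i and a point of W. The labels are
  the index slots of Levi-Civita symbols that have not yet been contracted with a tensor.\<close>

type_synonym form = "(nat \<Rightarrow> nat \<Rightarrow> complex) \<Rightarrow> pt \<Rightarrow> complex"

datatype endp = Lab nat | Zt nat

fun rv :: "(nat \<Rightarrow> nat \<Rightarrow> complex) \<Rightarrow> pt \<Rightarrow> endp \<Rightarrow> nat \<Rightarrow> complex" where
  "rv u w (Lab j) = u j"
| "rv u w (Zt l) = zeta w l"

fun labs :: "endp \<Rightarrow> nat set" where
  "labs (Lab j) = {j}"
| "labs (Zt l) = {}"

text \<open>A chain starts at a label and ends at a label or at a covector. A word between two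
  covectors has no label left and counts as a scalar coefficient instead.\<close>

definition chain :: "nat list \<Rightarrow> nat \<Rightarrow> endp \<Rightarrow> form" where
  "chain ks i en u w = bil (u i) (wd True ks w) (rv u w en)"

text \<open>R is an abstract algebra containing all traces, all words between vectors and covectors
  and all determinants. The contraction argument takes place over such an R; that the listed
  invariants generate one is a separate matter, settled by the reduction of words. The parities make
  the index positions match at both ends of a word.\<close>

locale path_algebra =
  fixes R :: "(pt \<Rightarrow> complex) set" and n1 n2 n3 :: nat
  assumes R_const: "(\<lambda>w. c) \<in> R"
    and R_add: "f \<in> R \<Longrightarrow> h \<in> R \<Longrightarrow> (\<lambda>w. f w + h w) \<in> R"
    and R_mult: "f \<in> R \<Longrightarrow> h \<in> R \<Longrightarrow> (\<lambda>w. f w * h w) \<in> R"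
    and R_xx: "j \<in> {1..n1} \<Longrightarrow> j' \<in> {1..n1} \<Longrightarrow> set ks \<subseteq> {1..n2} \<Longrightarrow> odd (length ks) \<Longrightarrow> (\<lambda>w. bil (X w j) (wd True ks w) (X w j')) \<in> R"
    and R_xz: "j \<in> {1..n1} \<Longrightarrow> l \<in> {1..n3} \<Longrightarrow> set ks \<subseteq> {1..n2} \<Longrightarrow> even (length ks) \<Longrightarrow> (\<lambda>w. bil (X w j) (wd True ks w) (zeta w l)) \<in> R"
    and R_zz: "l \<in> {1..n3} \<Longrightarrow> l' \<in> {1..n3} \<Longrightarrow> set ks \<subseteq> {1..n2} \<Longrightarrow> odd (length ks) \<Longrightarrow> (\<lambda>w. bil (zeta w l) (wd False ks w) (zeta w l')) \<in> R"
    and R_tr: "set ks \<subseteq> {1..n2} \<Longrightarrow> even (length ks) \<Longrightarrow> (\<lambda>w. \<Sum>a\<in>I4. wd False ks w a a) \<in> R"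
    and R_dx: "{j1, j2, j3, j4} \<subseteq> {1..n1} \<Longrightarrow> (\<lambda>w. det4 (X w j1) (X w j2) (X w j3) (X w j4)) \<in> R"
    and R_dz: "{l1, l2, l3, l4} \<subseteq> {1..n3} \<Longrightarrow> (\<lambda>w. det4 (zeta w l1) (zeta w l2) (zeta w l3) (zeta w l4)) \<in> R"
begin

lemma R_smult: "f \<in> R \<Longrightarrow> (\<lambda>w. c * f w) \<in> R"
  by (rule R_mult[OF R_const])

text \<open>A word that begins with a dual letter ends in a lower index for odd length, fitting a
  vector, and in an upper index for even length, fitting a covector. Consequently no chain joins two
  labels while words are empty.\<close>

definition okc :: "bool \<Rightarrow> nat list \<Rightarrow> endp \<Rightarrow> bool" where
  "okc ph ks en \<longleftrightarrow> set ks \<subseteq> {1..n2} \<and> (\<not> ph \<longrightarrow> ks = [])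
     \<and> (case en of Lab j \<Rightarrow> odd (length ks) | Zt l \<Rightarrow> even (length ks) \<and> l \<in> {1..n3})"

text \<open>The flag is False while only trivectors have been contracted; words are then empty.\<close>

inductive atom :: "bool \<Rightarrow> nat set \<Rightarrow> form \<Rightarrow> bool" for ph where
  atom_det: "distinct [i, j, k, l] \<Longrightarrow> atom ph {i, j, k, l} (\<lambda>u w. det4 (u i) (u j) (u k) (u l))"
| atom_chain: "okc ph ks en \<Longrightarrow> i \<notin> labs en \<Longrightarrow> atom ph (insert i (labs en)) (chain ks i en)"

text \<open>Sums of products of atoms on disjoint label sets, with coefficients in R. Every label
  occurs exactly once in each product, which makes the forms multilinear.\<close>

inductive forms :: "bool \<Rightarrow> nat set \<Rightarrow> form \<Rightarrow> bool" for ph where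
  forms_scal: "r \<in> R \<Longrightarrow> forms ph {} (\<lambda>u w. r w)"
| forms_atom: "atom ph K A \<Longrightarrow> forms ph L \<Phi> \<Longrightarrow> K \<inter> L = {} \<Longrightarrow> forms ph (K \<union> L) (\<lambda>u w. A u w * \<Phi> u w)"
| forms_add: "forms ph L \<Phi> \<Longrightarrow> forms ph L \<Psi> \<Longrightarrow> forms ph L (\<lambda>u w. \<Phi> u w + \<Psi> u w)"

lemma forms_eq: "forms ph L \<Phi> \<Longrightarrow> L = L' \<Longrightarrow> (\<And>u w. \<Psi> u w = \<Phi> u w) \<Longrightarrow> forms ph L' \<Psi>"
proof -
  assume a: "forms ph L \<Phi>" "L = L'" "\<And>u w. \<Psi> u w = \<Phi> u w"
  then have "\<Psi> = \<Phi>" by (intro ext)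
  then show ?thesis using a by simp
qed

lemma forms_mult: "forms ph L \<Phi> \<Longrightarrow> forms ph L' \<Psi> \<Longrightarrow> L \<inter> L' = {} \<Longrightarrow> forms ph (L \<union> L') (\<lambda>u w. \<Phi> u w * \<Psi> u w)"
proof (induction L \<Phi> rule: forms.induct)
  case (forms_scal r)
  from \<open>forms ph L' \<Psi>\<close> \<open>r \<in> R\<close> have "forms ph L' (\<lambda>u w. r w * \<Psi> u w)"
  proof (induction L' \<Psi> rule: forms.induct)
    case (forms_scal s)
    then show ?case using forms.forms_scal[OF R_mult] by blast
  next
    case (forms_atom K A L \<Phi>)
    show ?case
      by (rule forms_eq[OF forms.forms_atom[OF forms_atom.hyps(1) forms_atom.IH[OF forms_atom.prems] forms_atom.hyps(3)] refl]) simp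
  next
    case (forms_add L \<Phi> \<Psi>)
    show ?case
      by (rule forms_eq[OF forms.forms_add[OF forms_add.IH(1)[OF forms_add.prems] forms_add.IH(2)[OF forms_add.prems]] refl])
        (simp add: distrib_left)
  qed
  then show ?case by simp
next
  case (forms_atom K A L \<Phi>)
  have "forms ph (L \<union> L') (\<lambda>u w. \<Phi> u w * \<Psi> u w)" using forms_atom by blast
  moreover have "K \<inter> (L \<union> L') = {}" using forms_atom by blast
  ultimately show ?case
    using forms_eq[OF forms.forms_atom[OF forms_atom.hyps(1)]] by (simp add: Un_assoc mult.assoc)
next
  case (forms_add L \<Phi>1 \<Phi>2)
  show ?case
    by (rule forms_eq[OF forms.forms_add[OF forms_add.IH(1) forms_add.IH(2)] refl]) (use forms_add.prems in \<open>simp_all add: distrib_right\<close>)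
qed

lemma forms_single:
  assumes "atom ph K A"
  shows "forms ph K A"
  by (rule forms_eq[OF forms_atom[OF assms forms_scal[OF R_const[of 1]]]]) simp_all

lemma forms_smult:
  assumes "forms ph L \<Phi>"
  shows "forms ph L (\<lambda>u w. c * \<Phi> u w)"
  by (rule forms_eq[OF forms_mult[OF forms_scal[OF R_const[of c]] assms]]) simp_all

lemma forms_diff:
  assumes "forms ph L \<Phi>" "forms ph L \<Psi>"
  shows "forms ph L (\<lambda>u w. \<Phi> u w - \<Psi> u w)"
  by (rule forms_eq[OF forms_add[OF assms(1) forms_smult[OF assms(2), of "-1"]]]) simp_all

lemma forms_det: "distinct [i, j, k, l] \<Longrightarrow> forms ph {i, j, k, l} (\<lambda>u w. det4 (u i) (u j) (u k) (u l))"
  by (rule forms_single[OF atom_det])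

lemma forms_chain: "okc ph ks en \<Longrightarrow> i \<notin> labs en \<Longrightarrow> forms ph (insert i (labs en)) (chain ks i en)"
  by (rule forms_single[OF atom_chain])

lemma rv_upd: "k \<notin> labs en \<Longrightarrow> rv (u(k := v)) w en = rv u w en"
  by (cases en) auto

lemma atom_local: "atom ph K A \<Longrightarrow> k \<notin> K \<Longrightarrow> A (u(k := v)) w = A u w"
  by (induction rule: atom.induct) (auto simp: chain_def rv_upd)

lemma forms_local: "forms ph L \<Phi> \<Longrightarrow> k \<notin> L \<Longrightarrow> \<Phi> (u(k := v)) w = \<Phi> u w"
  by (induction rule: forms.induct) (auto simp: atom_local)

lemma chain_flip:
  assumes "odd (length ks)"
  shows "chain ks i (Lab j) u w = - chain (rev ks) j (Lab i) u w"
  unfolding chain_def using bil_transpose[of "u i" True ks w "u j"] assms by simp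

text \<open>A determinant is alternating, and transposing a word of odd length costs a sign, so any
  chosen label can be moved to the front up to a scalar. The contractions below assume it
  there.\<close>

lemma atom_front:
  assumes "atom ph K A" "i \<in> K"
  shows "(\<exists>s j k l. distinct [i, j, k, l] \<and> K = {i, j, k, l} \<and> A = (\<lambda>u w. s * det4 (u i) (u j) (u k) (u l)))
     \<or> (\<exists>s ks en. okc ph ks en \<and> i \<notin> labs en \<and> K = insert i (labs en) \<and> A = (\<lambda>u w. s * chain ks i en u w))"
  using assms
proof (induction rule: atom.induct)
  case (atom_det p q r s)
  have *: "\<exists>s' j k l. distinct [i, j, k, l] \<and> {p, q, r, s} = {i, j, k, l} \<and> (\<lambda>u w. det4 (u p) (u q) (u r) (u s)) = (\<lambda>u w. s' * det4 (u i) (u j) (u k) (u l))"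
    if "distinct [i, a, b, c]" "{p, q, r, s} = {i, a, b, c}" "\<And>u. det4 (u p) (u q) (u r) (u s) = t * det4 (u i) (u a) (u b) (u c)"
    for a b c t
    by (intro exI[of _ t] exI[of _ a] exI[of _ b] exI[of _ c] conjI ext that)
  consider "i = p" | "i = q" | "i = r" | "i = s" using atom_det by blast
  then have "\<exists>s' j k l. distinct [i, j, k, l] \<and> {p, q, r, s} = {i, j, k, l} \<and> (\<lambda>u w. det4 (u p) (u q) (u r) (u s)) = (\<lambda>u w. s' * det4 (u i) (u j) (u k) (u l))"
  proof cases
    case 1
    show ?thesis by (rule *[of q r s 1]) (use atom_det 1 in auto)
  next
    case 2
    have "det4 (u p) (u q) (u r) (u s) = - det4 (u q) (u p) (u r) (u s)" for u
      by (rule det4_swap12)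
    then show ?thesis by (intro *[of p r s "-1"]) (use atom_det 2 in auto)
  next
    case 3
    have "det4 (u p) (u q) (u r) (u s) = det4 (u r) (u p) (u q) (u s)" for u
      using det4_swap12[of "u r" "u p" "u q" "u s"] det4_swap23[of "u p" "u q" "u r" "u s"] by simp
    then show ?thesis by (intro *[of p q s 1]) (use atom_det 3 in auto)
  next
    case 4
    have "det4 (u p) (u q) (u r) (u s) = - det4 (u s) (u p) (u q) (u r)" for u
      using det4_swap12[of "u s" "u p" "u q" "u r"] det4_swap23[of "u p" "u q" "u s" "u r"] det4_swap34[of "u p" "u q" "u r" "u s"] by simp
    then show ?thesis by (intro *[of p q r "-1"]) (use atom_det 4 in auto)
  qed
  then show ?case by blast
next
  case (atom_chain ks en j)
  show ?case
  proof (cases "i = j")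
    case True
    have "chain ks j en = (\<lambda>u w. 1 * chain ks j en u w)" by simp
    then show ?thesis using atom_chain True by blast
  next
    case False
    then have en: "en = Lab i" using atom_chain by (cases en) auto
    then have ok: "okc ph (rev ks) (Lab j)" and o: "odd (length ks)" using atom_chain by (auto simp: okc_def)
    have "chain ks j (Lab i) = (\<lambda>u w. (-1) * chain (rev ks) i (Lab j) u w)"
      by (intro ext) (simp add: chain_flip[OF o])
    then show ?thesis using ok en False by (intro disjI2 exI[of _ "-1"] exI[of _ "rev ks"] exI[of _ "Lab j"]) auto
  qed
qed

lemma atom_front2:
  assumes "atom ph K A" "i \<in> K" "k \<in> K" "i \<noteq> k"
  shows "(\<exists>s q r. distinct [i, k, q, r] \<and> K = {i, k, q, r} \<and> A = (\<lambda>u w. s * det4 (u i) (u k) (u q) (u r)))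
     \<or> (\<exists>s ks. okc ph ks (Lab k) \<and> K = {i, k} \<and> A = (\<lambda>u w. s * chain ks i (Lab k) u w))"
  using atom_front[OF assms(1,2)]
proof (elim disjE exE conjE)
  fix s a b c
  assume h: "distinct [i, a, b, c]" "K = {i, a, b, c}" "A = (\<lambda>u w. s * det4 (u i) (u a) (u b) (u c))"
  have *: "\<exists>s q r. distinct [i, k, q, r] \<and> K = {i, k, q, r} \<and> A = (\<lambda>u w. s * det4 (u i) (u k) (u q) (u r))"
    if "distinct [i, k, q, r]" "K = {i, k, q, r}" "\<And>u. s * det4 (u i) (u a) (u b) (u c) = s' * det4 (u i) (u k) (u q) (u r)" for s' q r
  proof -
    have "A = (\<lambda>u w. s' * det4 (u i) (u k) (u q) (u r))" unfolding h(3) using that(3) by (intro ext)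
    then show ?thesis using that(1,2) by (intro exI[of _ s'] exI[of _ q] exI[of _ r] conjI)
  qed
  consider "k = a" | "k = b" | "k = c" using assms(3,4) h(2) by blast
  then show ?thesis
  proof cases
    case 1
    show ?thesis by (intro disjI1 *[of b c s]) (use h 1 in auto)
  next
    case 2
    have "det4 (u i) (u a) (u b) (u c) = - det4 (u i) (u b) (u a) (u c)" for u
      by (rule det4_swap23)
    then show ?thesis by (intro disjI1 *[of a c "-s"]) (use h 2 in auto)
  next
    case 3
    have "det4 (u i) (u a) (u b) (u c) = det4 (u i) (u c) (u a) (u b)" for u
      using det4_swap34[of "u i" "u a" "u b" "u c"] det4_swap23[of "u i" "u a" "u c" "u b"] by simp
    then show ?thesis by (intro disjI1 *[of a b s]) (use h 3 in auto)
  qed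
next
  fix s ks en
  assume h: "okc ph ks en" "i \<notin> labs en" "K = insert i (labs en)" "A = (\<lambda>u w. s * chain ks i en u w)"
  then have "en = Lab k" using assms(3,4) by (cases en) auto
  then show ?thesis using h by auto
qed

lemma atom_lin:
  assumes "atom ph K A" "k \<in> K"
  shows "A (u(k := v)) w = (\<Sum>e\<in>I4. v e * A (u(k := ev e)) w)"
  using atom_front[OF assms]
proof (elim disjE exE conjE)
  fix s a b c
  assume h: "distinct [k, a, b, c]" "K = {k, a, b, c}" "A = (\<lambda>u w. s * det4 (u k) (u a) (u b) (u c))"
  then show ?thesis using det4_lin[of v "u a" "u b" "u c"] by (simp add: sum_distrib_left ac_simps)
next
  fix s ks en
  assume h: "okc ph ks en" "k \<notin> labs en" "K = insert k (labs en)" "A = (\<lambda>u w. s * chain ks k en u w)"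
  then show ?thesis using bil_lin[of v "wd True ks w" "rv u w en"] by (simp add: chain_def rv_upd sum_distrib_left ac_simps)
qed

lemma forms_lin: "forms ph L \<Phi> \<Longrightarrow> k \<in> L \<Longrightarrow> \<Phi> (u(k := v)) w = (\<Sum>e\<in>I4. v e * \<Phi> (u(k := ev e)) w)"
proof (induction rule: forms.induct)
  case (forms_scal r)
  then show ?case by simp
next
  case (forms_atom K A L \<Phi>)
  show ?case
  proof (cases "k \<in> K")
    case True
    then have "k \<notin> L" using forms_atom by blast
    then show ?thesis using atom_lin[OF forms_atom.hyps(1) True, of u v w] forms_local[OF forms_atom.hyps(2)]
      by (simp add: sum_distrib_right mult.assoc del: fun_upd_apply)
  next
    case False
    then have "k \<in> L" using forms_atom by blast
    then show ?thesis using forms_atom.IH atom_local[OF forms_atom.hyps(1) False]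
      by (simp add: sum_distrib_left ac_simps del: fun_upd_apply)
  qed
next
  case (forms_add L \<Phi> \<Psi>)
  then show ?case by (simp add: sum.distrib distrib_left del: fun_upd_apply)
qed

lemma forms_dot: "forms ph L \<Phi> \<Longrightarrow> k \<in> L \<Longrightarrow> dot v (\<lambda>e. \<Phi> (u(k := ev e)) w) = \<Phi> (u(k := v)) w"
  unfolding dot_def using forms_lin by simp

text \<open>Only the atom containing the label k is affected, so a substitution may be checked on
  single atoms. M collects the labels that the new vector brings along.\<close>

lemma forms_subst:
  assumes "forms ph L \<Phi>" "k \<in> L" "L \<inter> M = {}"
    and "\<And>K A. atom ph K A \<Longrightarrow> k \<in> K \<Longrightarrow> K \<inter> M = {} \<Longrightarrow> forms ph ((K - {k}) \<union> M) (\<lambda>u w. A (u(k := V u w)) w)"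
  shows "forms ph ((L - {k}) \<union> M) (\<lambda>u w. \<Phi> (u(k := V u w)) w)"
  using assms
proof (induction rule: forms.induct)
  case (forms_scal r)
  then show ?case by simp
next
  case (forms_atom K A L \<Phi>)
  show ?case
  proof (cases "k \<in> K")
    case True
    then have k: "k \<notin> L" using forms_atom by blast
    have 1: "forms ph ((K - {k}) \<union> M) (\<lambda>u w. A (u(k := V u w)) w)"
      using forms_atom True by blast
    show ?thesis
      by (rule forms_eq[OF forms_mult[OF 1 forms_atom.hyps(2)]])
        (use forms_atom.hyps forms_atom.prems k in \<open>auto simp: forms_local[OF forms_atom.hyps(2)] simp del: fun_upd_apply\<close>)
  next
    case False
    then have k: "k \<in> L" using forms_atom by blast
    have 1: "forms ph ((L - {k}) \<union> M) (\<lambda>u w. \<Phi> (u(k := V u w)) w)"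
      using forms_atom k by blast
    show ?thesis
      by (rule forms_eq[OF forms.forms_atom[OF forms_atom.hyps(1) 1]])
        (use forms_atom.hyps forms_atom.prems k False in \<open>auto simp: atom_local[OF forms_atom.hyps(1)] simp del: fun_upd_apply\<close>)
  qed
next
  case (forms_add L \<Phi> \<Psi>)
  then show ?case by (intro forms.forms_add) blast+
qed

text \<open>Dissolving a determinant hands one of its labels over to the slot in which the other
  index of the tensor sat.\<close>

lemma forms_relabel:
  assumes "forms ph L \<Phi>" "k \<in> L" "m \<notin> L"
  shows "forms ph (insert m (L - {k})) (\<lambda>u w. \<Phi> (u(k := u m)) w)"
proof -
  have "forms ph ((L - {k}) \<union> {m}) (\<lambda>u w. \<Phi> (u(k := u m)) w)"
  proof (rule forms_subst[OF assms(1,2)])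
    fix K A assume a: "atom ph K A" "k \<in> K" "K \<inter> {m} = {}"
    show "forms ph ((K - {k}) \<union> {m}) (\<lambda>u w. A (u(k := u m)) w)"
      using atom_front[OF a(1,2)]
    proof (elim disjE exE conjE)
      fix s x b c
      assume h: "distinct [k, x, b, c]" "K = {k, x, b, c}" "A = (\<lambda>u w. s * det4 (u k) (u x) (u b) (u c))"
      have "forms ph {m, x, b, c} (\<lambda>u w. s * det4 (u m) (u x) (u b) (u c))"
        by (rule forms_smult[OF forms_det]) (use h a in auto)
      then show ?thesis by (rule forms_eq) (use h in auto)
    next
      fix s ks en
      assume h: "okc ph ks en" "k \<notin> labs en" "K = insert k (labs en)" "A = (\<lambda>u w. s * chain ks k en u w)"
      have "forms ph (insert m (labs en)) (\<lambda>u w. s * chain ks m en u w)"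
        by (rule forms_smult[OF forms_chain]) (use h a in auto)
      then show ?thesis by (rule forms_eq) (use h in \<open>auto simp: chain_def rv_upd\<close>)
    qed
  qed (use assms in auto)
  then show ?thesis by simp
qed

end

subsection \<open>Contraction with bivectors and trivectors\<close>

lemma scale_neg: "s * (- T / m) = (- s / m) * (T::complex)"
  by simp

lemma scale_sixth: "s * (- (p * (a - b) - q * (c - d) + r * (e - f)) / 6)
   = (- s / 6) * ((p * a - p * b) - (q * c - q * d) + (r * e - r * (f::complex)))"
  unfolding right_diff_distrib[of p] right_diff_distrib[of q] right_diff_distrib[of r] by (rule scale_neg)

context path_algebra
begin

lemma forms_dual_pair:
  assumes "q \<noteq> r" "k \<in> {1..n2}"
  shows "forms True {q, r} (\<lambda>u w. bil (u q) (dualy (yA w k)) (u r))"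
proof -
  have "forms True (insert q (labs (Lab r))) (chain [k] q (Lab r))"
    by (rule forms_chain) (use assms in \<open>auto simp: okc_def\<close>)
  then show ?thesis
    by (rule forms_eq) (auto simp: chain_def bil_wd_single letter_def)
qed

lemma forms_zeta: "l \<in> {1..n3} \<Longrightarrow> forms ph {i} (\<lambda>u w. dot (u i) (zeta w l))"
  by (rule forms_eq[OF forms_chain[of ph "[]" "Zt l" i]]) (auto simp: okc_def chain_def bil_wd_Nil)

text \<open>A bivector y(w) is contracted with two labels of a form. The hypotheses say what happens
  to two labels of the same determinant, to a chain, and to the two ends of one chain.\<close>

lemma contract_bivector:
  fixes y :: "pt \<Rightarrow> nat \<Rightarrow> nat \<Rightarrow> complex"
  assumes alt: "\<And>w. alt2 (y w)"
    and H: "\<And>q r. q \<noteq> r \<Longrightarrow> forms ph {q, r} (\<lambda>u w. bil (u q) (dualy (y w)) (u r))"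
    and S: "\<And>ks en L \<Phi> k. okc ph ks en \<Longrightarrow> forms ph L \<Phi> \<Longrightarrow> k \<in> L \<Longrightarrow> L \<inter> labs en = {} \<Longrightarrow>
        forms ph ((L - {k}) \<union> labs en) (\<lambda>u w. \<Phi> (u(k := \<lambda>c. \<Sum>a\<in>I4. y w a c * (\<Sum>b\<in>I4. wd True ks w a b * rv u w en b))) w)"
    and T: "\<And>ks k. okc ph ks (Lab k) \<Longrightarrow> (\<lambda>w. \<Sum>a\<in>I4. \<Sum>c\<in>I4. y w a c * wd True ks w a c) \<in> R"
    and "forms ph L \<Phi>" "i \<in> L" "k \<in> L" "i \<noteq> k"
  shows "forms ph (L - {i, k}) (\<lambda>u w. \<Sum>a\<in>I4. \<Sum>c\<in>I4. y w a c * \<Phi> (u(i := ev a, k := ev c)) w)"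
proof -
  \<comment> \<open>The two indices of the bivector lie in different factors. A determinant at i
    dissolves into three products; a chain at i is prolonged through the bivector into the slot
    k.\<close>
  have split: "forms ph ((K \<union> L) - {i, k}) (\<lambda>u w. \<Sum>a\<in>I4. \<Sum>c\<in>I4. y w a c * (A (u(i := ev a)) w * \<Phi> (u(k := ev c)) w))"
    if A: "atom ph K A" and F: "forms ph L \<Phi>" and d: "K \<inter> L = {}" and ik: "i \<in> K" "k \<in> L" for K L A \<Phi> i k
    using atom_front[OF A ik(1)]
  proof (elim disjE exE conjE)
    fix s p q r
    assume h: "distinct [i, p, q, r]" "K = {i, p, q, r}" "A = (\<lambda>u w. s * det4 (u i) (u p) (u q) (u r))"
    have piece: "forms ph ((K \<union> L) - {i, k}) (\<lambda>u w. \<Phi> (u(k := u a)) w * bil (u b) (dualy (y w)) (u c))"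
      if "{i, p, q, r} = {i, a, b, c}" "distinct [i, a, b, c]" for a b c
      by (rule forms_eq[OF forms_mult[OF forms_relabel[OF F ik(2), of a] H[of b c]]])
        (use that d ik h(2) in auto)
    have 1: "forms ph ((K \<union> L) - {i, k}) (\<lambda>u w. (s / 2) *
        (\<Phi> (u(k := u p)) w * bil (u q) (dualy (y w)) (u r) - \<Phi> (u(k := u q)) w * bil (u p) (dualy (y w)) (u r)
         + \<Phi> (u(k := u r)) w * bil (u p) (dualy (y w)) (u q)))"
      by (intro forms_smult forms_add forms_diff piece) (use h(1) in auto)
    show ?thesis
    proof (rule forms_eq[OF 1 refl])
      fix u w
      have "(\<Sum>a\<in>I4. \<Sum>c\<in>I4. y w a c * (A (u(i := ev a)) w * \<Phi> (u(k := ev c)) w))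
        = s * (\<Sum>a\<in>I4. \<Sum>c\<in>I4. y w a c * det4 (ev a) (u p) (u q) (u r) * \<Phi> (u(k := ev c)) w)"
        using h(1) unfolding h(3) by (simp add: sum_distrib_left ac_simps)
      also have "\<dots> = (s / 2) *
        (\<Phi> (u(k := u p)) w * bil (u q) (dualy (y w)) (u r) - \<Phi> (u(k := u q)) w * bil (u p) (dualy (y w)) (u r)
         + \<Phi> (u(k := u r)) w * bil (u p) (dualy (y w)) (u q))"
        unfolding det4_bivector[OF alt] forms_dot[OF F ik(2)] by simp
      finally show "(\<Sum>a\<in>I4. \<Sum>c\<in>I4. y w a c * (A (u(i := ev a)) w * \<Phi> (u(k := ev c)) w)) = \<dots>" .
    qed
  next
    fix s ks en
    assume h: "okc ph ks en" "i \<notin> labs en" "K = insert i (labs en)" "A = (\<lambda>u w. s * chain ks i en u w)"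
    have d': "L \<inter> labs en = {}" using d h by auto
    show ?thesis
    proof (rule forms_eq[OF forms_smult[OF S[OF h(1) F ik(2) d'], of s]])
      show "L - {k} \<union> labs en = K \<union> L - {i, k}" using h d ik by auto
      fix u w
      have "\<Phi> (u(k := \<lambda>c. \<Sum>a\<in>I4. y w a c * (\<Sum>b\<in>I4. wd True ks w a b * rv u w en b))) w
         = (\<Sum>c\<in>I4. (\<Sum>a\<in>I4. y w a c * (\<Sum>b\<in>I4. wd True ks w a b * rv u w en b)) * \<Phi> (u(k := ev c)) w)"
        by (rule forms_lin[OF F ik(2)])
      also have "\<dots> = (\<Sum>a\<in>I4. \<Sum>c\<in>I4. y w a c * (\<Sum>b\<in>I4. wd True ks w a b * rv u w en b) * \<Phi> (u(k := ev c)) w)"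
        unfolding sum_distrib_right by (rule sum.swap)
      finally have E: "\<Phi> (u(k := \<lambda>c. \<Sum>a\<in>I4. y w a c * (\<Sum>b\<in>I4. wd True ks w a b * rv u w en b))) w = \<dots>" .
      have e1: "y w a c * (A (u(i := ev a)) w * \<Phi> (u(k := ev c)) w)
          = s * (y w a c * (\<Sum>b\<in>I4. wd True ks w a b * rv u w en b) * \<Phi> (u(k := ev c)) w)" if "a \<in> I4" for a c
        unfolding h(4) chain_def rv_upd[OF h(2)] fun_upd_same bil_ev[OF that] by (simp only: ac_simps)
      have "(\<Sum>a\<in>I4. \<Sum>c\<in>I4. y w a c * (A (u(i := ev a)) w * \<Phi> (u(k := ev c)) w))
         = (\<Sum>a\<in>I4. \<Sum>c\<in>I4. s * (y w a c * (\<Sum>b\<in>I4. wd True ks w a b * rv u w en b) * \<Phi> (u(k := ev c)) w))"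
        by (intro sum.cong refl e1)
      then show "(\<Sum>a\<in>I4. \<Sum>c\<in>I4. y w a c * (A (u(i := ev a)) w * \<Phi> (u(k := ev c)) w))
         = s * \<Phi> (u(k := \<lambda>c. \<Sum>a\<in>I4. y w a c * (\<Sum>b\<in>I4. wd True ks w a b * rv u w en b))) w"
        unfolding E by (simp only: sum_distrib_left[symmetric])
    qed
  qed
  \<comment> \<open>Both indices lie in the same atom. A determinant loses two slots and becomes a
    dual bivector between the other two labels; a chain closes up to a trace.\<close>
  have both: "forms ph ((K \<union> L) - {i, k}) (\<lambda>u w. \<Sum>a\<in>I4. \<Sum>c\<in>I4. y w a c * (A (u(i := ev a, k := ev c)) w * \<Phi> u w))"
    if A: "atom ph K A" and F: "forms ph L \<Phi>" and d: "K \<inter> L = {}" and ik: "i \<in> K" "k \<in> K" "i \<noteq> k" for K L A \<Phi> i k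
    using atom_front2[OF A ik]
  proof (elim disjE exE conjE)
    fix s q r
    assume h: "distinct [i, k, q, r]" "K = {i, k, q, r}" "A = (\<lambda>u w. s * det4 (u i) (u k) (u q) (u r))"
    have qr: "q \<noteq> r" using h by auto
    show ?thesis
    proof (rule forms_eq[OF forms_smult[OF forms_mult[OF H[OF qr] F], of s]])
      fix u w
      have "(\<Sum>a\<in>I4. \<Sum>c\<in>I4. y w a c * (A (u(i := ev a, k := ev c)) w * \<Phi> u w))
         = s * ((\<Sum>a\<in>I4. \<Sum>c\<in>I4. y w a c * det4 (ev a) (ev c) (u q) (u r)) * \<Phi> u w)"
        using h(1) unfolding h(3) by (simp add: sum_distrib_left sum_distrib_right ac_simps)
      then show "(\<Sum>a\<in>I4. \<Sum>c\<in>I4. y w a c * (A (u(i := ev a, k := ev c)) w * \<Phi> u w))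
         = s * (bil (u q) (dualy (y w)) (u r) * \<Phi> u w)"
        unfolding det4_biv2[OF alt] .
    qed (use h d in auto)
  next
    fix s ks
    assume h: "okc ph ks (Lab k)" "K = {i, k}" "A = (\<lambda>u w. s * chain ks i (Lab k) u w)"
    show ?thesis
    proof (rule forms_eq[OF forms_smult[OF forms_mult[OF forms_scal[OF T[OF h(1)]] F], of s]])
      fix u w
      have e: "A (u(i := ev a, k := ev c)) w = s * wd True ks w a c" if "a \<in> I4" "c \<in> I4" for a c
        unfolding h(3) chain_def using ik(3) that by (simp add: bil_ev ev_sym[of c] sum_ev_right)
      show "(\<Sum>a\<in>I4. \<Sum>c\<in>I4. y w a c * (A (u(i := ev a, k := ev c)) w * \<Phi> u w))
         = s * ((\<Sum>a\<in>I4. \<Sum>c\<in>I4. y w a c * wd True ks w a c) * \<Phi> u w)"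
        by (simp add: e sum_distrib_left sum_distrib_right ac_simps)
    qed (use h d in auto)
  qed
  show ?thesis
    using assms(5-8)
  proof (induction rule: forms.induct)
    case (forms_scal r)
    then show ?case by simp
  next
    case (forms_add L \<Phi> \<Psi>)
    then show ?case
      by (intro forms_eq[OF forms.forms_add[OF forms_add.IH(1) forms_add.IH(2)] refl])
        (auto simp: sum.distrib distrib_left simp del: fun_upd_apply)
  next
    case (forms_atom K A L \<Phi>)
    have upd_k: "A (u(i := p, k := q)) w = A (u(i := p)) w" if "k \<notin> K" for u p q w
      by (rule atom_local[OF forms_atom.hyps(1) that])
    have upd_i: "\<Phi> (u(i := p, k := q)) w = \<Phi> (u(k := q)) w" if "i \<notin> L" for u p q w
      unfolding fun_upd_twist[OF forms_atom.prems(3), of u p q] by (rule forms_local[OF forms_atom.hyps(2) that])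
    have upd_i': "A (u(i := p, k := q)) w = A (u(k := q)) w" if "i \<notin> K" for u p q w
      unfolding fun_upd_twist[OF forms_atom.prems(3), of u p q] by (rule atom_local[OF forms_atom.hyps(1) that])
    have upd_k': "\<Phi> (u(i := p, k := q)) w = \<Phi> (u(i := p)) w" if "k \<notin> L" for u p q w
      by (rule forms_local[OF forms_atom.hyps(2) that])
    consider (none) "i \<in> L" "k \<in> L" "i \<notin> K" "k \<notin> K" | (left) "i \<in> K" "k \<in> L" "k \<notin> K" "i \<notin> L"
      | (right) "k \<in> K" "i \<in> L" "i \<notin> K" "k \<notin> L" | (inner) "i \<in> K" "k \<in> K" "i \<notin> L" "k \<notin> L"
      using forms_atom by blast
    then show ?case
    proof cases
      case none
      show ?thesis
        by (rule forms_eq[OF forms.forms_atom[OF forms_atom.hyps(1) forms_atom.IH[OF none(1,2) forms_atom.prems(3)]]])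
          (use forms_atom.hyps none in \<open>auto simp: atom_local[OF forms_atom.hyps(1)] sum_distrib_left ac_simps simp del: fun_upd_apply\<close>)
    next
      case left
      show ?thesis
        by (rule forms_eq[OF split[OF forms_atom.hyps(1) forms_atom.hyps(2) forms_atom.hyps(3) left(1,2)] refl])
          (simp only: upd_k[OF left(3)] upd_i[OF left(4)])
    next
      \<comment> \<open>The roles of i and k are exchanged at the cost of the sign of the
        alternating bivector.\<close>
      case right
      have 1: "(\<Sum>a\<in>I4. \<Sum>c\<in>I4. y w a c * (A (u(k := ev c)) w * \<Phi> (u(i := ev a)) w))
          = - (\<Sum>a\<in>I4. \<Sum>c\<in>I4. y w a c * (A (u(k := ev a)) w * \<Phi> (u(i := ev c)) w))" for u w
      proof -
        have "(\<Sum>a\<in>I4. \<Sum>c\<in>I4. y w a c * (A (u(k := ev c)) w * \<Phi> (u(i := ev a)) w))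
           = (\<Sum>c\<in>I4. \<Sum>a\<in>I4. y w a c * (A (u(k := ev c)) w * \<Phi> (u(i := ev a)) w))" by (rule sum.swap)
        also have "\<dots> = (\<Sum>c\<in>I4. \<Sum>a\<in>I4. - (y w c a * (A (u(k := ev c)) w * \<Phi> (u(i := ev a)) w)))"
        proof (intro sum.cong refl)
          fix c a
          have "y w a c = - y w c a" using alt unfolding alt2_def by blast
          then show "y w a c * (A (u(k := ev c)) w * \<Phi> (u(i := ev a)) w) = - (y w c a * (A (u(k := ev c)) w * \<Phi> (u(i := ev a)) w))"
            by simp
        qed
        finally show ?thesis by (simp only: sum_negf)
      qed
      have 2: "forms ph (K \<union> L - {i, k}) (\<lambda>u w. (-1) * (\<Sum>a\<in>I4. \<Sum>c\<in>I4. y w a c * (A (u(k := ev a)) w * \<Phi> (u(i := ev c)) w)))"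
        using forms_smult[OF split[OF forms_atom.hyps(1) forms_atom.hyps(2) forms_atom.hyps(3) right(1,2)], of "-1"]
        by (simp only: insert_commute)
      show ?thesis
        by (rule forms_eq[OF 2 refl])
          (simp only: upd_i'[OF right(3)] upd_k'[OF right(4)] 1 mult_minus1)
    next
      case inner
      show ?thesis
        by (rule forms_eq[OF both[OF forms_atom.hyps(1) forms_atom.hyps(2) forms_atom.hyps(3) inner(1,2) forms_atom.prems(3)] refl])
          (use inner in \<open>simp add: forms_local[OF forms_atom.hyps(2)] del: fun_upd_apply\<close>)
    qed
  qed
qed

text \<open>Supplies the hypothesis on chains in \<open>contract_bivector\<close>: a chain end is
  sent through a bivector into an atom. If the atom is a determinant, the chain attaches to one of
  its other labels and the remaining two are joined by a dual letter; if it is a chain, the two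
  words merge.\<close>

lemma subst_y:
  assumes \<kappa>: "\<kappa> \<in> {1..n2}" and ok: "okc True ks en" and F: "forms True L \<Phi>" and k: "k \<in> L" and d: "L \<inter> labs en = {}"
  shows "forms True ((L - {k}) \<union> labs en) (\<lambda>u w. \<Phi> (u(k := \<lambda>c. \<Sum>a\<in>I4. yA w \<kappa> a c * (\<Sum>b\<in>I4. wd True ks w a b * rv u w en b))) w)"
proof (rule forms_subst[OF F k d])
  fix K A
  assume A: "atom True K A" "k \<in> K" "K \<inter> labs en = {}"
  let ?V = "\<lambda>u w c. \<Sum>a\<in>I4. yA w \<kappa> a c * (\<Sum>b\<in>I4. wd True ks w a b * rv u w en b)"
  show "forms True (K - {k} \<union> labs en) (\<lambda>u w. A (u(k := ?V u w)) w)"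
    using atom_front[OF A(1,2)]
  proof (elim disjE exE conjE)
    fix s p q r
    assume h: "distinct [k, p, q, r]" "K = {k, p, q, r}" "A = (\<lambda>u w. s * det4 (u k) (u p) (u q) (u r))"
    have piece: "forms True (K - {k} \<union> labs en) (\<lambda>u w. chain ks a en u w * bil (u b) (dualy (yA w \<kappa>)) (u c))"
      if "{k, p, q, r} = {k, a, b, c}" "distinct [k, a, b, c]" for a b c
      by (rule forms_eq[OF forms_mult[OF forms_chain[OF ok, of a] forms_dual_pair[of b c \<kappa>]]])
        (use that A h(2) \<kappa> in auto)
    have 1: "forms True (K - {k} \<union> labs en) (\<lambda>u w. (- s / 2) *
        (chain ks p en u w * bil (u q) (dualy (yA w \<kappa>)) (u r) - chain ks q en u w * bil (u p) (dualy (yA w \<kappa>)) (u r)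
         + chain ks r en u w * bil (u p) (dualy (yA w \<kappa>)) (u q)))"
      by (intro forms_smult forms_add forms_diff piece) (use h(1) in auto)
    show ?thesis
    proof (rule forms_eq[OF 1 refl])
      fix u w
      have e: "A (u(k := ?V u w)) w = s * det4 (?V u w) (u p) (u q) (u r)"
        using h(1) unfolding h(3) by simp
      show "A (u(k := ?V u w)) w = (- s / 2) *
        (chain ks p en u w * bil (u q) (dualy (yA w \<kappa>)) (u r) - chain ks q en u w * bil (u p) (dualy (yA w \<kappa>)) (u r)
         + chain ks r en u w * bil (u p) (dualy (yA w \<kappa>)) (u q))"
        unfolding e chain_def det4_yvec[OF alt2_yA] dot_matrix by (rule scale_neg)
    qed
  next
    fix s ks' en'
    assume h: "okc True ks' en'" "k \<notin> labs en'" "K = insert k (labs en')" "A = (\<lambda>u w. s * chain ks' k en' u w)"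
    let ?W = "rev ks @ \<kappa> # ks'"
    have e: "A (u(k := ?V u w)) w = s * ((-1) ^ length ks * bil (rv u w en) (wd (odd (length ks)) ?W w) (rv u w en'))" for u w
      unfolding h(4) chain_def rv_upd[OF h(2)] by (simp add: chain_join)
    have set: "set ?W \<subseteq> {1..n2}" using \<kappa> ok h(1) by (auto simp: okc_def)
    have "forms True (labs en' \<union> labs en) (\<lambda>u w. bil (rv u w en) (wd (odd (length ks)) ?W w) (rv u w en'))"
    proof (cases en)
      case (Lab j)
      then have o: "odd (length ks)" using ok by (simp add: okc_def)
      have "okc True ?W en'" using set h(1) o unfolding okc_def by (cases en') auto
      then show ?thesis
        by (intro forms_eq[OF forms_chain[of True ?W en' j]]) (use A h Lab o in \<open>auto simp: chain_def\<close>)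
    next
      case (Zt l)
      then have o: "even (length ks)" and l: "l \<in> {1..n3}" using ok by (simp_all add: okc_def)
      show ?thesis
      proof (cases en')
        \<comment> \<open>The merged word runs from the covector to the label m and is reversed,
          because chains start at labels.\<close>
        case (Lab m)
        then have ev: "even (length ?W)" using o h(1) by (simp add: okc_def)
        then have "okc True (rev ?W) (Zt l)" using set l by (auto simp: okc_def)
        then have "forms True {m} (chain (rev ?W) m (Zt l))" using forms_chain[of True "rev ?W" "Zt l" m] by simp
        then show ?thesis
          by (rule forms_eq) (use Lab Zt o ev bil_transpose[of _ False ?W] in \<open>simp_all add: chain_def\<close>)
      next
        \<comment> \<open>Both ends are covectors: the word is closed and joins the
          coefficients.\<close>
        case (Zt l')
        then have l': "l' \<in> {1..n3}" and od: "odd (length ?W)" using h(1) o by (simp_all add: okc_def)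
        show ?thesis
          by (rule forms_eq[OF forms_scal[OF R_zz[OF l l' set od]]]) (use Zt \<open>en = endp.Zt l\<close> o in simp_all)
      qed
    qed
    from forms_smult[OF forms_smult[OF this]]
    have "forms True (labs en' \<union> labs en) (\<lambda>u w. s * ((-1) ^ length ks * bil (rv u w en) (wd (odd (length ks)) ?W w) (rv u w en')))" .
    then show ?thesis by (rule forms_eq) (use h e in auto)
  qed
qed

lemma contract_y:
  assumes \<kappa>: "\<kappa> \<in> {1..n2}" and F: "forms True L \<Phi>" "i \<in> L" "k \<in> L" "i \<noteq> k"
  shows "forms True (L - {i, k}) (\<lambda>u w. \<Sum>a\<in>I4. \<Sum>c\<in>I4. yA w \<kappa> a c * \<Phi> (u(i := ev a, k := ev c)) w)"
proof (rule contract_bivector[OF alt2_yA forms_dual_pair[OF _ \<kappa>] subst_y[OF \<kappa>] _ F])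
  fix ks k assume ok: "okc True ks (Lab k)"
  \<comment> \<open>The closed chain is the trace of the word lengthened by \<kappa>; transposing
    the new letter gives the sign.\<close>
  have "(\<Sum>a\<in>I4. \<Sum>c\<in>I4. yA w \<kappa> a c * wd True ks w a c) = (-1) * (\<Sum>a\<in>I4. wd False (\<kappa> # ks) w a a)" for w
  proof -
    have "(\<Sum>a\<in>I4. \<Sum>c\<in>I4. yA w \<kappa> a c * wd True ks w a c) = (\<Sum>c\<in>I4. \<Sum>a\<in>I4. yA w \<kappa> a c * wd True ks w a c)"
      by (rule sum.swap)
    also have "\<dots> = (\<Sum>c\<in>I4. \<Sum>a\<in>I4. - (yA w \<kappa> c a * wd True ks w a c))"
    proof (intro sum.cong refl)
      fix c a
      have "yA w \<kappa> a c = - yA w \<kappa> c a" using alt2_yA unfolding alt2_def by blast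
      then show "yA w \<kappa> a c * wd True ks w a c = - (yA w \<kappa> c a * wd True ks w a c)" by simp
    qed
    finally show ?thesis by (simp add: sum_negf letter_def)
  qed
  moreover have "(\<lambda>w. (-1) * (\<Sum>a\<in>I4. wd False (\<kappa> # ks) w a a)) \<in> R"
    by (intro R_smult R_tr) (use ok \<kappa> in \<open>auto simp: okc_def\<close>)
  ultimately show "(\<lambda>w. \<Sum>a\<in>I4. \<Sum>c\<in>I4. yA w \<kappa> a c * wd True ks w a c) \<in> R" by simp
qed

section \<open>Contraction with trivectors\<close>

lemma det4_zvec:
  assumes "alt3 z"
  shows "det4 (\<lambda>c. \<Sum>a\<in>I4. (\<Sum>i\<in>I4. z i a c * \<theta> i) * \<eta> a) p q r
    = - (dot p (dualz z) * (dot q \<theta> * dot r \<eta> - dot r \<theta> * dot q \<eta>) - dot q (dualz z) * (dot p \<theta> * dot r \<eta> - dot r \<theta> * dot p \<eta>)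
         + dot r (dualz z) * (dot p \<theta> * dot q \<eta> - dot q \<theta> * dot p \<eta>)) / 6"
proof -
  have b: "bil p (\<lambda>i a. \<theta> i * \<eta> a) q = dot p \<theta> * dot q \<eta>" for p q
    unfolding bil_def dot_def sum_product by (intro sum.cong refl) simp
  have "det4 (\<lambda>c. \<Sum>a\<in>I4. (\<Sum>i\<in>I4. z i a c * \<theta> i) * \<eta> a) p q r
     = (\<Sum>c\<in>I4. (\<Sum>a\<in>I4. (\<Sum>i\<in>I4. z i a c * \<theta> i) * \<eta> a) * det4 (ev c) p q r)"
    by (rule det4_lin)
  also have "\<dots> = (\<Sum>c\<in>I4. \<Sum>i\<in>I4. \<Sum>a\<in>I4. z c i a * det4 (ev c) p q r * (\<theta> i * \<eta> a))"
  proof (intro sum.cong refl)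
    fix c
    have "(\<Sum>a\<in>I4. (\<Sum>i\<in>I4. z i a c * \<theta> i) * \<eta> a) * det4 (ev c) p q r
       = (\<Sum>a\<in>I4. \<Sum>i\<in>I4. z c i a * det4 (ev c) p q r * (\<theta> i * \<eta> a))"
      unfolding sum_distrib_right
    proof (intro sum.cong refl)
      fix a i
      show "z i a c * \<theta> i * \<eta> a * det4 (ev c) p q r = z c i a * det4 (ev c) p q r * (\<theta> i * \<eta> a)"
        using alt3_cyclic[OF assms, of c i a] by simp
    qed
    also have "\<dots> = (\<Sum>i\<in>I4. \<Sum>a\<in>I4. z c i a * det4 (ev c) p q r * (\<theta> i * \<eta> a))"
      by (rule sum.swap)
    finally show "(\<Sum>a\<in>I4. (\<Sum>i\<in>I4. z i a c * \<theta> i) * \<eta> a) * det4 (ev c) p q r = \<dots>" .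
  qed
  finally show ?thesis unfolding det4_trivector[OF assms] b .
qed

lemma dot_zvec:
  assumes "alt3 z"
  shows "dot (\<lambda>c. \<Sum>a\<in>I4. (\<Sum>i\<in>I4. z i a c * \<theta> i) * \<eta> a) \<phi> = det4 (dualz z) \<theta> \<eta> \<phi> / 6"
proof -
  have "dot (\<lambda>c. \<Sum>a\<in>I4. (\<Sum>i\<in>I4. z i a c * \<theta> i) * \<eta> a) \<phi>
      = (\<Sum>c\<in>I4. \<Sum>a\<in>I4. \<Sum>i\<in>I4. z i a c * \<theta> i * \<eta> a * \<phi> c)"
    unfolding dot_def sum_distrib_right ..
  also have "\<dots> = (\<Sum>i\<in>I4. \<Sum>a\<in>I4. \<Sum>c\<in>I4. z i a c * \<theta> i * \<eta> a * \<phi> c)"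
    by (simp only: sum_I4 ac_simps)
  finally show ?thesis unfolding trivector_det4[OF assms] .
qed

text \<open>Two indices of the trivector l have met covectors and the third feeds a vector into the
  form. With the flag \<open>False\<close> the atoms are determinants, which dissolve into pairings,
  and pairings with a covector, which complete a determinant of four covectors.\<close>

lemma subst_z:
  assumes l: "l \<in> {1..n3}" "l1 \<in> {1..n3}" "l2 \<in> {1..n3}" and F: "forms False L \<Phi>" "k \<in> L"
  shows "forms False (L - {k}) (\<lambda>u w. \<Phi> (u(k := \<lambda>c. \<Sum>a\<in>I4. (\<Sum>i\<in>I4. zA w l i a c * zeta w l1 i) * zeta w l2 a)) w)"
proof -
  let ?V = "\<lambda>w c. \<Sum>a\<in>I4. (\<Sum>i\<in>I4. zA w l i a c * zeta w l1 i) * zeta w l2 a"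
  have "forms False (L - {k} \<union> {}) (\<lambda>u w. \<Phi> (u(k := ?V w)) w)"
  proof (rule forms_subst[OF F])
    fix K A
    assume A: "atom False K A" "k \<in> K"
    show "forms False (K - {k} \<union> {}) (\<lambda>u w. A (u(k := ?V w)) w)"
      using atom_front[OF A]
    proof (elim disjE exE conjE)
      fix s p q r
      assume h: "distinct [k, p, q, r]" "K = {k, p, q, r}" "A = (\<lambda>u w. s * det4 (u k) (u p) (u q) (u r))"
      have piece: "forms False (K - {k} \<union> {}) (\<lambda>u w. dot (u a) (zeta w l) * (dot (u b) (zeta w l1) * dot (u c) (zeta w l2)))"
        if "{k, p, q, r} = {k, a, b, c}" "distinct [k, a, b, c]" for a b c
        by (rule forms_eq[OF forms_mult[OF forms_zeta[OF l(1), of _ a] forms_mult[OF forms_zeta[OF l(2), of _ b] forms_zeta[OF l(3), of _ c]]]])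
          (use that h(2) in auto)
      let ?d = "\<lambda>u w a b c. dot (u a) (zeta w l) * (dot (u b) (zeta w l1) * dot (u c) (zeta w l2))"
      have 1: "forms False (K - {k} \<union> {}) (\<lambda>u w. (- s / 6) * ((?d u w p q r - ?d u w p r q) - (?d u w q p r - ?d u w q r p) + (?d u w r p q - ?d u w r q p)))"
        by (intro forms_smult forms_add forms_diff piece) (use h(1) in auto)
      show ?thesis
      proof (rule forms_eq[OF 1 refl])
        fix u w
        have e: "A (u(k := ?V w)) w = s * det4 (?V w) (u p) (u q) (u r)"
          using h(1) unfolding h(3) by simp
        show "A (u(k := ?V w)) w = (- s / 6) * ((?d u w p q r - ?d u w p r q) - (?d u w q p r - ?d u w q r p) + (?d u w r p q - ?d u w r q p))"
          unfolding e det4_zvec[OF alt3_zA] zeta_def[of w l, symmetric] by (rule scale_sixth)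
      qed
    next
      fix s ks en
      assume h: "okc False ks en" "k \<notin> labs en" "K = insert k (labs en)" "A = (\<lambda>u w. s * chain ks k en u w)"
      then obtain l3 where l3: "ks = []" "en = Zt l3" "l3 \<in> {1..n3}" by (cases en) (auto simp: okc_def)
      have 1: "(\<lambda>w. (s / 6) * det4 (zeta w l) (zeta w l1) (zeta w l2) (zeta w l3)) \<in> R"
        by (intro R_smult R_dz) (use l l3 in auto)
      show ?thesis
        by (rule forms_eq[OF forms_scal[OF 1]])
          (use h l3 in \<open>simp_all add: chain_def bil_wd_Nil dot_zvec[OF alt3_zA] zeta_def[symmetric]\<close>)
    qed
  qed simp
  then show ?thesis by simp
qed

text \<open>After one index has met the covector of l1, the other two form an alternating bivector
  depending on the point, and \<open>contract_bivector\<close> applies to it with empty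
  words.\<close>

lemma contract_z2:
  assumes l: "l \<in> {1..n3}" "l1 \<in> {1..n3}" and F: "forms False L \<Phi>" "i \<in> L" "k \<in> L" "i \<noteq> k"
  shows "forms False (L - {i, k}) (\<lambda>u w. \<Sum>a\<in>I4. \<Sum>c\<in>I4. (\<Sum>i\<in>I4. zA w l i a c * zeta w l1 i) * \<Phi> (u(i := ev a, k := ev c)) w)"
proof (rule contract_bivector[OF alt2_contract_trivector[OF alt3_zA] _ _ _ F])
  fix q r :: nat assume "q \<noteq> r"
  have 1: "forms False {a, b} (\<lambda>u w. dot (u a) (zeta w l) * dot (u b) (zeta w l1))" if "a \<noteq> b" for a b
    by (rule forms_eq[OF forms_mult[OF forms_zeta[OF l(1), of _ a] forms_zeta[OF l(2), of _ b]]]) (use that in auto)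
  have 2: "forms False {q, r} (\<lambda>u w. dot (u r) (zeta w l) * dot (u q) (zeta w l1))"
    using 1[of r q] \<open>q \<noteq> r\<close> by (simp add: insert_commute)
  show "forms False {q, r} (\<lambda>u w. bil (u q) (dualy (\<lambda>j k. \<Sum>i\<in>I4. zA w l i j k * zeta w l1 i)) (u r))"
    by (rule forms_eq[OF forms_smult[OF forms_diff[OF 1[OF \<open>q \<noteq> r\<close>] 2], of "1/3"] refl])
      (simp add: dualy_contract_trivector[OF alt3_zA] zeta_def[symmetric])
next
  fix ks en L \<Phi> k
  assume h: "okc False ks en" "forms False L \<Phi>" "k \<in> L"
  then obtain l2 where l2: "ks = []" "en = Zt l2" "l2 \<in> {1..n3}" by (cases en) (auto simp: okc_def)
  show "forms False (L - {k} \<union> labs en)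
     (\<lambda>u w. \<Phi> (u(k := \<lambda>c. \<Sum>a\<in>I4. (\<Sum>i\<in>I4. zA w l i a c * zeta w l1 i) * (\<Sum>b\<in>I4. wd True ks w a b * rv u w en b))) w)"
    by (rule forms_eq[OF subst_z[OF l l2(3) h(2,3)]]) (simp_all add: l2 sum_ev_left)
next
  fix ks k assume "okc False ks (Lab k)"
  then show "(\<lambda>w. \<Sum>a\<in>I4. \<Sum>c\<in>I4. (\<Sum>i\<in>I4. zA w l i a c * zeta w l1 i) * wd True ks w a c) \<in> R"
    by (auto simp: okc_def)
qed

definition cz :: "nat \<Rightarrow> nat \<Rightarrow> nat \<Rightarrow> nat \<Rightarrow> form \<Rightarrow> form" where
  "cz l i j k \<Phi> u w = (\<Sum>a\<in>I4. \<Sum>b\<in>I4. \<Sum>c\<in>I4. zA w l a b c * \<Phi> (u(i := ev a, j := ev b, k := ev c)) w)"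

lemma cz_swap12:
  assumes "i \<noteq> j"
  shows "cz l j i k \<Phi> u w = - cz l i j k \<Phi> u w"
proof -
  have "cz l j i k \<Phi> u w = (\<Sum>b\<in>I4. \<Sum>a\<in>I4. \<Sum>c\<in>I4. zA w l a b c * \<Phi> (u(j := ev a, i := ev b, k := ev c)) w)"
    unfolding cz_def by (rule sum.swap)
  also have "\<dots> = (\<Sum>b\<in>I4. \<Sum>a\<in>I4. \<Sum>c\<in>I4. - (zA w l b a c * \<Phi> (u(i := ev b, j := ev a, k := ev c)) w))"
  proof (intro sum.cong refl)
    fix a b c
    have "zA w l a b c = - zA w l b a c" by (rule alt3_swap12[OF alt3_zA])
    moreover have "u(j := ev a, i := ev b, k := ev c) = u(i := ev b, j := ev a, k := ev c)" using assms by (simp add: fun_upd_twist)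
    ultimately show "zA w l a b c * \<Phi> (u(j := ev a, i := ev b, k := ev c)) w = - (zA w l b a c * \<Phi> (u(i := ev b, j := ev a, k := ev c)) w)"
      by simp
  qed
  finally show ?thesis unfolding cz_def by (simp only: sum_negf)
qed

lemma cz_swap23:
  assumes "j \<noteq> k"
  shows "cz l i k j \<Phi> u w = - cz l i j k \<Phi> u w"
proof -
  have "cz l i k j \<Phi> u w = (\<Sum>a\<in>I4. \<Sum>c\<in>I4. \<Sum>b\<in>I4. zA w l a b c * \<Phi> (u(i := ev a, k := ev b, j := ev c)) w)"
    unfolding cz_def by (intro sum.cong refl sum.swap)
  also have "\<dots> = (\<Sum>a\<in>I4. \<Sum>c\<in>I4. \<Sum>b\<in>I4. - (zA w l a c b * \<Phi> (u(i := ev a, j := ev c, k := ev b)) w))"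
  proof (intro sum.cong refl)
    fix a b c
    have "zA w l a b c = - zA w l a c b" by (rule alt3_swap23[OF alt3_zA])
    moreover have "u(i := ev a, k := ev b, j := ev c) = u(i := ev a, j := ev c, k := ev b)" using assms by (simp add: fun_upd_twist)
    ultimately show "zA w l a b c * \<Phi> (u(i := ev a, k := ev b, j := ev c)) w = - (zA w l a c b * \<Phi> (u(i := ev a, j := ev c, k := ev b)) w)"
      by simp
  qed
  finally show ?thesis unfolding cz_def by (simp only: sum_negf)
qed

text \<open>A chain has at most two labels, so three labels in one atom force a determinant.\<close>

lemma atom_front3:
  assumes "atom ph K A" "i \<in> K" "j \<in> K" "k \<in> K" "distinct [i, j, k]"
  shows "\<exists>s r. distinct [i, j, k, r] \<and> K = {i, j, k, r} \<and> A = (\<lambda>u w. s * det4 (u i) (u j) (u k) (u r))"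
proof -
  have "\<not> (\<exists>s ks. okc ph ks (Lab j) \<and> K = {i, j} \<and> A = (\<lambda>u w. s * chain ks i (Lab j) u w))"
    using assms by auto
  then obtain s q r where h: "distinct [i, j, q, r]" "K = {i, j, q, r}" "A = (\<lambda>u w. s * det4 (u i) (u j) (u q) (u r))"
    using atom_front2[OF assms(1,2,3)] assms(5) by auto
  show ?thesis
  proof (cases "k = q")
    case True
    then show ?thesis using h by blast
  next
    case False
    then have k: "k = r" using assms h by auto
    have "A = (\<lambda>u w. (- s) * det4 (u i) (u j) (u k) (u q))"
    proof (intro ext)
      fix u w
      show "A u w = (- s) * det4 (u i) (u j) (u k) (u q)"
        unfolding h(3) k using det4_swap34[of "u i" "u j" "u q" "u r"] by simp
    qed
    then show ?thesis using h k by (intro exI[of _ "- s"] exI[of _ q]) auto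
  qed
qed

lemma forms_bil:
  assumes F: "forms ph L \<Phi>" "j \<in> L" "k \<in> L" "j \<noteq> k"
  shows "bil p (\<lambda>b c. \<Phi> (u(j := ev b, k := ev c)) w) q = \<Phi> (u(j := p, k := q)) w"
proof -
  have "\<Phi> (u(j := p, k := q)) w = (\<Sum>b\<in>I4. p b * \<Phi> (u(k := q, j := ev b)) w)"
    using forms_lin[OF F(1,2), of "u(k := q)" p] fun_upd_twist[OF F(4), of u p q] by simp
  also have "\<dots> = (\<Sum>b\<in>I4. p b * (\<Sum>c\<in>I4. q c * \<Phi> (u(j := ev b, k := ev c)) w))"
  proof (intro sum.cong refl arg_cong2[of _ _ _ _ times])
    fix b
    show "\<Phi> (u(k := q, j := ev b)) w = (\<Sum>c\<in>I4. q c * \<Phi> (u(j := ev b, k := ev c)) w)"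
      unfolding fun_upd_twist[OF F(4), of u "ev b" q, symmetric] by (rule forms_lin[OF F(1,3)])
  qed
  finally show ?thesis unfolding bil_def by (simp add: sum_distrib_left ac_simps)
qed

lemma contract_z:
  assumes l: "l \<in> {1..n3}" and F: "forms False L \<Phi>" "i \<in> L" "j \<in> L" "k \<in> L" "distinct [i, j, k]"
  shows "forms False (L - {i, j, k}) (cz l i j k \<Phi>)"
proof -
  \<comment> \<open>The three auxiliary facts treat one, two or three indices of the trivector in
    the atom A and the others in the remaining product; alternation of the trivector reduces every
    distribution of i, j, k to one of them.\<close>
  have one: "forms False ((K \<union> L) - {i, j, k}) (cz l i j k (\<lambda>u w. A u w * \<Phi> u w))"
    if A: "atom False K A" and F: "forms False L \<Phi>" and d: "K \<inter> L = {}" and ik: "i \<in> K" "j \<in> L" "k \<in> L" "j \<noteq> k" for K L A \<Phi> i j k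
  proof -
    have n: "i \<notin> L" "j \<notin> K" "k \<notin> K" using d ik by auto
    have loc: "A (u(i := ev a, j := ev b, k := ev c)) w = A (u(i := ev a)) w"
      "\<Phi> (u(i := ev a, j := ev b, k := ev c)) w = \<Phi> (u(j := ev b, k := ev c)) w" for u w a b c
    proof -
      show "A (u(i := ev a, j := ev b, k := ev c)) w = A (u(i := ev a)) w"
        using atom_local[OF A] n by simp
      have "u(i := ev a, j := ev b, k := ev c) = u(j := ev b, k := ev c, i := ev a)"
        using n ik by (auto simp: fun_eq_iff)
      then show "\<Phi> (u(i := ev a, j := ev b, k := ev c)) w = \<Phi> (u(j := ev b, k := ev c)) w"
        using forms_local[OF F n(1)] by simp
    qed
    show ?thesis
      using atom_front[OF A ik(1)]
    proof (elim disjE exE conjE)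
      fix s p q r
      assume h: "distinct [i, p, q, r]" "K = {i, p, q, r}" "A = (\<lambda>u w. s * det4 (u i) (u p) (u q) (u r))"
      have piece: "forms False ((K \<union> L) - {i, j, k}) (\<lambda>u w. dot (u a) (zeta w l) * \<Phi> (u(j := u b, k := u c)) w)"
        if "{i, p, q, r} = {i, a, b, c}" "distinct [i, a, b, c]" for a b c
      proof -
        have m: "b \<notin> L" "c \<notin> L" "a \<notin> L" "b \<noteq> c" "a \<noteq> b" "a \<noteq> c" using that d h(2) by auto
        have 1: "forms False (insert c (L - {k})) (\<lambda>u w. \<Phi> (u(k := u c)) w)" by (rule forms_relabel[OF F ik(3) m(2)])
        have "forms False (insert b (insert c (L - {k}) - {j})) (\<lambda>u w. \<Phi> ((u(j := u b))(k := (u(j := u b)) c)) w)"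
          by (rule forms_relabel[OF 1]) (use ik m in auto)
        from forms_mult[OF forms_zeta[OF l, of _ a] this]
        show ?thesis by (rule forms_eq) (use m that h(2) ik n d in auto)
      qed
      let ?d = "\<lambda>u w a b c. dot (u a) (zeta w l) * \<Phi> (u(j := u b, k := u c)) w"
      have 1: "forms False ((K \<union> L) - {i, j, k}) (\<lambda>u w. (- s / 6) * ((?d u w p q r - ?d u w p r q) - (?d u w q p r - ?d u w q r p) + (?d u w r p q - ?d u w r q p)))"
        by (intro forms_smult forms_add forms_diff piece) (use h(1) in auto)
      show ?thesis
      proof (rule forms_eq[OF 1 refl])
        fix u w
        have e: "A (u(i := ev a)) w = s * det4 (ev a) (u p) (u q) (u r)" for a
          using h(1) unfolding h(3) by simp
        have "cz l i j k (\<lambda>u w. A u w * \<Phi> u w) u w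
          = s * (\<Sum>a\<in>I4. \<Sum>b\<in>I4. \<Sum>c\<in>I4. zA w l a b c * det4 (ev a) (u p) (u q) (u r) * \<Phi> (u(j := ev b, k := ev c)) w)"
          unfolding cz_def loc e by (simp add: sum_distrib_left ac_simps)
        then show "cz l i j k (\<lambda>u w. A u w * \<Phi> u w) u w = (- s / 6) * ((?d u w p q r - ?d u w p r q) - (?d u w q p r - ?d u w q r p) + (?d u w r p q - ?d u w r q p))"
          unfolding det4_trivector[OF alt3_zA] forms_bil[OF F ik(2,3,4)] zeta_def[symmetric] scale_sixth .
      qed
    next
      fix s ks en
      assume h: "okc False ks en" "i \<notin> labs en" "K = insert i (labs en)" "A = (\<lambda>u w. s * chain ks i en u w)"
      then obtain l1 where l1: "ks = []" "en = Zt l1" "l1 \<in> {1..n3}" by (cases en) (auto simp: okc_def)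
      show ?thesis
      proof (rule forms_eq[OF forms_smult[OF contract_z2[OF l l1(3) F ik(2,3,4)], of s]])
        fix u w
        have e: "A (u(i := ev a)) w = s * zeta w l1 a" if "a \<in> I4" for a
          unfolding h(4) chain_def l1 using that by (simp add: bil_wd_Nil dot_def sum_ev_left)
        have "cz l i j k (\<lambda>u w. A u w * \<Phi> u w) u w = (\<Sum>a\<in>I4. \<Sum>b\<in>I4. \<Sum>c\<in>I4. s * (zA w l a b c * zeta w l1 a * \<Phi> (u(j := ev b, k := ev c)) w))"
          unfolding cz_def loc by (intro sum.cong refl) (simp add: e)
        also have "\<dots> = s * (\<Sum>b\<in>I4. \<Sum>c\<in>I4. (\<Sum>a\<in>I4. zA w l a b c * zeta w l1 a) * \<Phi> (u(j := ev b, k := ev c)) w)"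
          unfolding sum_distrib_left sum_distrib_right by (simp only: sum_I4 ac_simps)
        finally show "cz l i j k (\<lambda>u w. A u w * \<Phi> u w) u w
          = s * (\<Sum>b\<in>I4. \<Sum>c\<in>I4. (\<Sum>a\<in>I4. zA w l a b c * zeta w l1 a) * \<Phi> (u(j := ev b, k := ev c)) w)" .
      qed (use h l1 n in auto)
    qed
  qed
  have two: "forms False ((K \<union> L) - {i, j, k}) (cz l i j k (\<lambda>u w. A u w * \<Phi> u w))"
    if A: "atom False K A" and F: "forms False L \<Phi>" and d: "K \<inter> L = {}" and ik: "i \<in> K" "j \<in> K" "i \<noteq> j" "k \<in> L" for K L A \<Phi> i j k
  proof -
    have n: "i \<notin> L" "j \<notin> L" "k \<notin> K" using d ik by auto
    \<comment> \<open>A chain between two labels would have an odd number of letters, but words are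
      still empty.\<close>
    have "\<not> (\<exists>s ks. okc False ks (Lab j) \<and> K = {i, j} \<and> A = (\<lambda>u w. s * chain ks i (Lab j) u w))"
      by (auto simp: okc_def)
    then obtain s q r where h: "distinct [i, j, q, r]" "K = {i, j, q, r}" "A = (\<lambda>u w. s * det4 (u i) (u j) (u q) (u r))"
      using atom_front2[OF A ik(1-3)] by auto
    have piece: "forms False ((K \<union> L) - {i, j, k}) (\<lambda>u w. dot (u a) (zeta w l) * \<Phi> (u(k := u b)) w)"
      if "{i, j, q, r} = {i, j, a, b}" "distinct [i, j, a, b]" for a b
      by (rule forms_eq[OF forms_mult[OF forms_zeta[OF l, of _ a] forms_relabel[OF F ik(4), of b]]])
        (use that h(2) ik n d in auto)
    have 1: "forms False ((K \<union> L) - {i, j, k}) (\<lambda>u w. (s / 3) * (dot (u q) (zeta w l) * \<Phi> (u(k := u r)) w - dot (u r) (zeta w l) * \<Phi> (u(k := u q)) w))"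
      by (intro forms_smult forms_diff piece) (use h(1) in auto)
    show ?thesis
    proof (rule forms_eq[OF 1 refl])
      fix u w
      have "k \<noteq> i" "k \<noteq> j" "k \<noteq> q" "k \<noteq> r" using n(3) h(2) by auto
      moreover have "q \<noteq> i" "r \<noteq> i" "q \<noteq> j" "r \<noteq> j" "i \<noteq> j" using h(1) by auto
      ultimately have e: "A (u(i := ev a, j := ev b, k := ev c)) w = s * det4 (ev a) (ev b) (u q) (u r)" for a b c
        unfolding h(3) by simp
      have f: "\<Phi> (u(i := ev a, j := ev b, k := ev c)) w = \<Phi> (u(k := ev c)) w" for a b c
      proof -
        have "u(i := ev a, j := ev b, k := ev c) = u(k := ev c, i := ev a, j := ev b)" using \<open>k \<noteq> i\<close> \<open>k \<noteq> j\<close> by (auto simp: fun_eq_iff)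
        then show ?thesis using forms_local[OF F n(1)] forms_local[OF F n(2)] by simp
      qed
      have "cz l i j k (\<lambda>u w. A u w * \<Phi> u w) u w
          = s * (\<Sum>a\<in>I4. \<Sum>b\<in>I4. \<Sum>c\<in>I4. zA w l a b c * det4 (ev a) (ev b) (u q) (u r) * \<Phi> (u(k := ev c)) w)"
        unfolding cz_def e f by (simp add: sum_distrib_left ac_simps)
      then show "cz l i j k (\<lambda>u w. A u w * \<Phi> u w) u w = (s / 3) * (dot (u q) (zeta w l) * \<Phi> (u(k := u r)) w - dot (u r) (zeta w l) * \<Phi> (u(k := u q)) w)"
        unfolding det4_trivector2[OF alt3_zA] forms_dot[OF F ik(4)] zeta_def[symmetric] by simp
    qed
  qed
  have three: "forms False ((K \<union> L) - {i, j, k}) (cz l i j k (\<lambda>u w. A u w * \<Phi> u w))"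
    if A: "atom False K A" and F: "forms False L \<Phi>" and d: "K \<inter> L = {}" and ik: "i \<in> K" "j \<in> K" "k \<in> K" "distinct [i, j, k]" for K L A \<Phi> i j k
  proof -
    have n: "i \<notin> L" "j \<notin> L" "k \<notin> L" using d ik by auto
    obtain s r where h: "distinct [i, j, k, r]" "K = {i, j, k, r}" "A = (\<lambda>u w. s * det4 (u i) (u j) (u k) (u r))"
      using atom_front3[OF A ik] by blast
    show ?thesis
    proof (rule forms_eq[OF forms_smult[OF forms_mult[OF forms_zeta[OF l, of _ r] F], of "- s"]])
      fix u w
      have e: "A (u(i := ev a, j := ev b, k := ev c)) w = s * det4 (ev a) (ev b) (ev c) (u r)" for a b c
        using h(1) unfolding h(3) by simp
      have f: "\<Phi> (u(i := ev a, j := ev b, k := ev c)) w = \<Phi> u w" for a b c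
        using forms_local[OF F] n by simp
      have "cz l i j k (\<lambda>u w. A u w * \<Phi> u w) u w
          = s * ((\<Sum>a\<in>I4. \<Sum>b\<in>I4. \<Sum>c\<in>I4. zA w l a b c * det4 (ev a) (ev b) (ev c) (u r)) * \<Phi> u w)"
        unfolding cz_def e f by (simp add: sum_distrib_left sum_distrib_right ac_simps)
      then show "cz l i j k (\<lambda>u w. A u w * \<Phi> u w) u w = - s * (dot (u r) (zeta w l) * \<Phi> u w)"
        unfolding det4_trivector3[OF alt3_zA] zeta_def[symmetric] by simp
    qed (use h d in auto)
  qed
  have sw12: "forms False M (cz l i j k \<Psi>)" if "forms False M (cz l j i k \<Psi>)" "i \<noteq> j" for M i j k \<Psi>
    by (rule forms_eq[OF forms_smult[OF that(1), of "-1"] refl]) (use cz_swap12[OF that(2)] in simp)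
  have sw23: "forms False M (cz l i j k \<Psi>)" if "forms False M (cz l i k j \<Psi>)" "j \<noteq> k" for M i j k \<Psi>
    by (rule forms_eq[OF forms_smult[OF that(1), of "-1"] refl]) (use cz_swap23[OF that(2)] in simp)
  show ?thesis
    using F
  proof (induction rule: forms.induct)
    case (forms_scal r)
    then show ?case by simp
  next
    case (forms_add L \<Phi> \<Psi>)
    then show ?case
      by (intro forms_eq[OF forms.forms_add[OF forms_add.IH(1) forms_add.IH(2)] refl])
        (auto simp: cz_def sum.distrib distrib_left simp del: fun_upd_apply)
  next
    case (forms_atom K A L \<Phi>)
    note A = forms_atom.hyps
    have d: "i \<noteq> j" "i \<noteq> k" "j \<noteq> k" using forms_atom.prems by auto
    have mem: "x \<notin> K \<Longrightarrow> x \<in> L" if "x \<in> K \<union> L" for x using that by blast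
    have s1: "{j, i, k} = {i, j, k}" "{i, k, j} = {i, j, k}" "{k, i, j} = {i, j, k}" "{j, k, i} = {i, j, k}" by auto
    consider "i \<notin> K" "j \<notin> K" "k \<notin> K" | "i \<in> K" "j \<notin> K" "k \<notin> K" | "i \<notin> K" "j \<in> K" "k \<notin> K" | "i \<notin> K" "j \<notin> K" "k \<in> K"
      | "i \<in> K" "j \<in> K" "k \<notin> K" | "i \<in> K" "j \<notin> K" "k \<in> K" | "i \<notin> K" "j \<in> K" "k \<in> K" | "i \<in> K" "j \<in> K" "k \<in> K" by blast
    then show ?case
    proof cases
      case 1
      then have m: "i \<in> L" "j \<in> L" "k \<in> L" using forms_atom.prems by auto
      show ?thesis
        by (rule forms_eq[OF forms.forms_atom[OF A(1) forms_atom.IH[OF m forms_atom.prems(4)]]])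
          (use A 1 in \<open>auto simp: cz_def atom_local[OF A(1)] sum_distrib_left ac_simps simp del: fun_upd_apply\<close>)
    next
      case 2
      then show ?thesis using one[OF A 2(1) _ _ d(3)] forms_atom.prems by auto
    next
      case 3
      have "forms False (K \<union> L - {j, i, k}) (cz l j i k (\<lambda>u w. A u w * \<Phi> u w))"
        by (rule one[OF A 3(2) _ _ d(2)]) (use 3 forms_atom.prems in auto)
      then show ?thesis unfolding s1 by (rule sw12[OF _ d(1)])
    next
      case 4
      have "forms False (K \<union> L - {k, i, j}) (cz l k i j (\<lambda>u w. A u w * \<Phi> u w))"
        by (rule one[OF A 4(3) _ _ d(1)]) (use 4 forms_atom.prems in auto)
      then show ?thesis unfolding s1 by (rule sw23[OF sw12[OF _ d(2)] d(3)])
    next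
      case 5
      show ?thesis by (rule two[OF A 5(1,2) d(1)]) (use 5 forms_atom.prems in auto)
    next
      case 6
      have "forms False (K \<union> L - {i, k, j}) (cz l i k j (\<lambda>u w. A u w * \<Phi> u w))"
        by (rule two[OF A 6(1,3) d(2)]) (use 6 forms_atom.prems in auto)
      then show ?thesis unfolding s1 by (rule sw23[OF _ d(3)])
    next
      case 7
      have "forms False (K \<union> L - {j, k, i}) (cz l j k i (\<lambda>u w. A u w * \<Phi> u w))"
        by (rule two[OF A 7(2,3) d(3)]) (use 7 forms_atom.prems in auto)
      then show ?thesis unfolding s1 by (rule sw12[OF sw23[OF _ d(2)] d(1)])
    next
      case 8
      show ?thesis by (rule three[OF A 8 forms_atom.prems(4)])
    qed
  qed
qed

end

section \<open>Complete contractions with a list of tensors\<close>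

datatype symb = SX nat | SY nat | SZ nat

fun arity :: "symb \<Rightarrow> nat" where
  "arity (SX j) = 1"
| "arity (SY k) = 2"
| "arity (SZ l) = 3"

text \<open>The last tensor of the list acts first.\<close>

fun con :: "symb list \<Rightarrow> nat \<Rightarrow> form \<Rightarrow> form" where
  "con [] n \<Phi> = \<Phi>"
| "con (SX j # K) n \<Phi> = (\<lambda>u w. con K (Suc n) \<Phi> (u(n := X w j)) w)"
| "con (SY k # K) n \<Phi> = (\<lambda>u w. \<Sum>a\<in>I4. \<Sum>b\<in>I4. yA w k a b * con K (Suc (Suc n)) \<Phi> (u(n := ev a, Suc n := ev b)) w)"
| "con (SZ l # K) n \<Phi> = (\<lambda>u w. \<Sum>a\<in>I4. \<Sum>b\<in>I4. \<Sum>c\<in>I4. zA w l a b c *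
      con K (Suc (Suc (Suc n))) \<Phi> (u(n := ev a, Suc n := ev b, Suc (Suc n) := ev c)) w)"

lemma con_append: "con (K @ K') n \<Phi> = con K n (con K' (n + sum_list (map arity K)) \<Phi>)"
proof (induction K arbitrary: n)
  case (Cons s K)
  then show ?case by (cases s) (simp_all add: numeral_3_eq_3)
qed simp

lemma con_X: "con (map SX js) n \<Phi> u w = \<Phi> (\<lambda>i. if n \<le> i \<and> i < n + length js then X w (js ! (i - n)) else u i) w"
proof (induction js arbitrary: n u)
  case (Cons j js)
  have "(\<lambda>i. if Suc n \<le> i \<and> i < Suc n + length js then X w (js ! (i - Suc n)) else (u(n := X w j)) i)
    = (\<lambda>i. if n \<le> i \<and> i < n + length (j # js) then X w ((j # js) ! (i - n)) else u i)"
    by (auto simp: fun_eq_iff nth_Cons' Suc_diff_Suc)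
  then show ?case using Cons by simp
next
  case Nil
  have "(\<lambda>i. if n \<le> i \<and> i < n + length [] then X w ([] ! (i - n)) else u i) = u" by (rule ext, rule if_not_P) simp
  then show ?case by simp
qed

text \<open>A product of p Levi-Civita symbols whose 4p slots are distributed over the labels by
  \<sigma>.\<close>

definition block_det :: "nat \<Rightarrow> (nat \<Rightarrow> nat) \<Rightarrow> form" where
  "block_det p \<sigma> u w = (\<Prod>i<p. det4 (u (\<sigma> (4 * i))) (u (\<sigma> (4 * i + 1))) (u (\<sigma> (4 * i + 2))) (u (\<sigma> (4 * i + 3))))"

context path_algebra
begin

lemma forms_mono: "forms False L \<Phi> \<Longrightarrow> forms True L \<Phi>"
proof (induction rule: forms.induct)
  case (forms_scal r)
  then show ?case by (rule forms.forms_scal)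
next
  case (forms_atom K A L \<Phi>)
  have "atom True K A" using forms_atom.hyps(1)
  proof (induction rule: atom.induct)
    case (atom_det i j k l)
    then show ?case by (rule atom.atom_det)
  next
    case (atom_chain ks en i)
    then show ?case by (intro atom.atom_chain) (auto simp: okc_def)
  qed
  then show ?case using forms_atom by (intro forms.forms_atom)
next
  case (forms_add L \<Phi> \<Psi>)
  then show ?case by (intro forms.forms_add)
qed

lemma forms_agree: "forms ph L \<Phi> \<Longrightarrow> (\<And>i. i \<in> L \<Longrightarrow> u i = u' i) \<Longrightarrow> \<Phi> u w = \<Phi> u' w"
proof (induction rule: forms.induct)
  case (forms_atom K A L \<Phi>)
  have "A u w = A u' w" using forms_atom.hyps(1) forms_atom.prems
  proof (induction rule: atom.induct)
    case (atom_chain ks en i)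
    then show ?case by (cases en) (auto simp: chain_def)
  qed auto
  then show ?case using forms_atom by auto
qed auto

lemma forms_vectors:
  assumes "forms ph L \<Phi>" "\<And>i. i \<in> L \<Longrightarrow> jf i \<in> {1..n1}"
  shows "(\<lambda>w. \<Phi> (\<lambda>i. X w (jf i)) w) \<in> R"
  using assms
proof (induction rule: forms.induct)
  case (forms_atom K A L \<Phi>)
  have "(\<lambda>w. A (\<lambda>i. X w (jf i)) w) \<in> R" using forms_atom.hyps(1) forms_atom.prems
  proof (induction rule: atom.induct)
    case (atom_det i j k l)
    then show ?case by (intro R_dx) auto
  next
    case (atom_chain ks en i)
    then show ?case
      by (cases en) (auto simp: chain_def okc_def intro!: R_xx R_xz)
  qed
  moreover have "(\<lambda>w. \<Phi> (\<lambda>i. X w (jf i)) w) \<in> R" using forms_atom by blast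
  ultimately show ?case by (rule R_mult)
next
  case (forms_add L \<Phi> \<Psi>)
  then show ?case by (intro R_add) auto
qed

text \<open>Every trivector consumes the three topmost labels, so the label set stays an initial
  segment throughout the induction.\<close>

lemma con_Z:
  "set ls \<subseteq> {1..n3} \<Longrightarrow> forms False {..<n + 3 * length ls} \<Phi> \<Longrightarrow> forms False {..<n} (con (map SZ ls) n \<Phi>)"
proof (induction ls arbitrary: n)
  case (Cons l ls)
  have "forms False {..<n + 3} (con (map SZ ls) (n + 3) \<Phi>)"
    by (rule Cons.IH) (use Cons.prems in \<open>simp_all add: ac_simps\<close>)
  then have "forms False ({..<n + 3} - {n, Suc n, Suc (Suc n)}) (cz l n (Suc n) (Suc (Suc n)) (con (map SZ ls) (n + 3) \<Phi>))"
    using Cons.prems by (intro contract_z) auto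
  then show ?case
    by (rule forms_eq) (auto simp: cz_def numeral_3_eq_3 simp del: fun_upd_apply)
qed simp

lemma con_Y:
  "set ks \<subseteq> {1..n2} \<Longrightarrow> forms True {..<n + 2 * length ks} \<Phi> \<Longrightarrow> forms True {..<n} (con (map SY ks) n \<Phi>)"
proof (induction ks arbitrary: n)
  case (Cons k ks)
  have "forms True {..<n + 2} (con (map SY ks) (n + 2) \<Phi>)"
    by (rule Cons.IH) (use Cons.prems in \<open>simp_all add: ac_simps\<close>)
  then have "forms True ({..<n + 2} - {n, Suc n}) (\<lambda>u w. \<Sum>a\<in>I4. \<Sum>c\<in>I4. yA w k a c * con (map SY ks) (n + 2) \<Phi> (u(n := ev a, Suc n := ev c)) w)"
    using Cons.prems by (intro contract_y) auto
  then show ?case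
    by (rule forms_eq) (auto simp del: fun_upd_apply)
qed simp

text \<open>The order of the list makes the trivectors act while words are still empty; bivectors
  create words afterwards, and vectors fill the labels that survive, turning every atom into an
  element of R. The case of a trivector meeting a nonempty word does not arise.\<close>

lemma con_in_R:
  assumes "set js \<subseteq> {1..n1}" "set ks \<subseteq> {1..n2}" "set ls \<subseteq> {1..n3}"
    and F: "forms False {..<length js + 2 * length ks + 3 * length ls} \<Phi>"
  shows "(\<lambda>w. con (map SX js @ map SY ks @ map SZ ls) 0 \<Phi> u w) \<in> R"
proof -
  have a: "sum_list (map arity (map SX js)) = length js" "sum_list (map arity (map SY ks)) = 2 * length ks"
    by (induction js; simp) (induction ks; simp)
  define \<Psi> where "\<Psi> = con (map SY ks) (length js) (con (map SZ ls) (length js + 2 * length ks) \<Phi>)"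
  have F2: "forms True {..<length js} \<Psi>"
    unfolding \<Psi>_def by (intro con_Y assms forms_mono con_Z F)
  have "con (map SX js @ map SY ks @ map SZ ls) 0 \<Phi> u w = \<Psi> (\<lambda>i. X w (js ! i)) w" for w
    unfolding con_append a con_X \<Psi>_def[symmetric] add_0
    by (rule forms_agree[OF F2]) simp
  moreover have "(\<lambda>w. \<Psi> (\<lambda>i. X w (js ! i)) w) \<in> R"
    by (rule forms_vectors[OF F2]) (use assms(1) nth_mem in fastforce)
  ultimately show ?thesis by simp
qed

lemma forms_block_det:
  "inj_on \<sigma> {..<4 * p} \<Longrightarrow> forms ph (\<sigma> ` {..<4 * p}) (block_det p \<sigma>)"
proof (induction p)
  case 0
  have "forms ph {} (\<lambda>u w. 1)" by (rule forms_scal[OF R_const])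
  then show ?case by (rule forms_eq) (auto simp: block_det_def)
next
  case (Suc p)
  have s: "{..<4 * Suc p} = {4 * p, 4 * p + 1, 4 * p + 2, 4 * p + 3} \<union> {..<4 * p}" by auto
  have d: "{4 * p, 4 * p + 1, 4 * p + 2, 4 * p + 3} \<inter> {..<4 * p} = {}" by auto
  have inj: "inj_on \<sigma> {..<4 * p}" using Suc.prems by (rule inj_on_subset) auto
  have dis: "\<sigma> ` {4 * p, 4 * p + 1, 4 * p + 2, 4 * p + 3} \<inter> \<sigma> ` {..<4 * p} = {}"
    using inj_on_image_Int[OF Suc.prems, of "{4 * p, 4 * p + 1, 4 * p + 2, 4 * p + 3}" "{..<4 * p}"] d by auto
  have "distinct [\<sigma> (4 * p), \<sigma> (4 * p + 1), \<sigma> (4 * p + 2), \<sigma> (4 * p + 3)]"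
    by (simp add: inj_on_eq_iff[OF Suc.prems])
  note D = forms_det[OF this, of ph]
  have "forms ph (\<sigma> ` {4 * p, 4 * p + 1, 4 * p + 2, 4 * p + 3} \<union> \<sigma> ` {..<4 * p})
     (\<lambda>u w. det4 (u (\<sigma> (4 * p))) (u (\<sigma> (4 * p + 1))) (u (\<sigma> (4 * p + 2))) (u (\<sigma> (4 * p + 3))) * block_det p \<sigma> u w)"
    by (rule forms_mult[OF _ Suc.IH[OF inj] dis]) (use D in simp)
  then show ?case unfolding s image_Un
    by (rule forms_eq[OF _ refl]) (simp add: block_det_def mult.commute)
qed

end

subsection \<open>Polarisation and the Omega process\<close>

lemma sum_ev_right2: "a \<in> I4 \<Longrightarrow> (\<Sum>c\<in>I4. f c * ev a c) = f a"
  using sum_ev_right[of a f] by (simp add: ev_def eq_commute)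

lemma con_sum:
  "finite D \<Longrightarrow> con S n (\<lambda>u w. \<Sum>t\<in>D. c t * \<Phi> t u w) u w = (\<Sum>t\<in>D. c t * con S n (\<Phi> t) u w)"
proof (induction S arbitrary: n u)
  case (Cons s S)
  show ?case
  proof (cases s)
    case (SX j)
    then show ?thesis using Cons by simp
  next
    case (SY k)
    have "con (s # S) n (\<lambda>u w. \<Sum>t\<in>D. c t * \<Phi> t u w) u w
       = (\<Sum>a\<in>I4. \<Sum>b\<in>I4. \<Sum>t\<in>D. c t * (yA w k a b * con S (Suc (Suc n)) (\<Phi> t) (u(n := ev a, Suc n := ev b)) w))"
      using Cons SY by (simp add: sum_distrib_left mult.left_commute del: fun_upd_apply)
    also have "\<dots> = (\<Sum>a\<in>I4. \<Sum>t\<in>D. \<Sum>b\<in>I4. c t * (yA w k a b * con S (Suc (Suc n)) (\<Phi> t) (u(n := ev a, Suc n := ev b)) w))"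
      by (intro sum.cong refl sum.swap)
    also have "\<dots> = (\<Sum>t\<in>D. \<Sum>a\<in>I4. \<Sum>b\<in>I4. c t * (yA w k a b * con S (Suc (Suc n)) (\<Phi> t) (u(n := ev a, Suc n := ev b)) w))"
      by (rule sum.swap)
    finally show ?thesis using SY by (simp add: sum_distrib_left del: fun_upd_apply)
  next
    case (SZ l)
    let ?t = "\<lambda>t a b d. c t * (zA w l a b d * con S (Suc (Suc (Suc n))) (\<Phi> t) (u(n := ev a, Suc n := ev b, Suc (Suc n) := ev d)) w)"
    have "con (s # S) n (\<lambda>u w. \<Sum>t\<in>D. c t * \<Phi> t u w) u w = (\<Sum>a\<in>I4. \<Sum>b\<in>I4. \<Sum>d\<in>I4. \<Sum>t\<in>D. ?t t a b d)"
      using Cons SZ by (simp add: sum_distrib_left mult.left_commute del: fun_upd_apply)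
    also have "\<dots> = (\<Sum>a\<in>I4. \<Sum>b\<in>I4. \<Sum>t\<in>D. \<Sum>d\<in>I4. ?t t a b d)"
      by (intro sum.cong refl sum.swap)
    also have "\<dots> = (\<Sum>a\<in>I4. \<Sum>t\<in>D. \<Sum>b\<in>I4. \<Sum>d\<in>I4. ?t t a b d)"
      by (intro sum.cong refl sum.swap)
    also have "\<dots> = (\<Sum>t\<in>D. \<Sum>a\<in>I4. \<Sum>b\<in>I4. \<Sum>d\<in>I4. ?t t a b d)"
      by (rule sum.swap)
    finally show ?thesis using SZ by (simp add: sum_distrib_left del: fun_upd_apply)
  qed
qed simp

datatype coord = CX nat nat | CY nat nat nat | CZ nat nat nat nat

fun cval :: "pt \<Rightarrow> coord \<Rightarrow> complex" where
  "cval w (CX j a) = X w j a"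
| "cval w (CY k a b) = Y w k a b"
| "cval w (CZ l a b c) = Z w l a b c"

fun sym_of :: "coord \<Rightarrow> symb" where
  "sym_of (CX j a) = SX j"
| "sym_of (CY k a b) = SY k"
| "sym_of (CZ l a b c) = SZ l"

fun inds :: "coord \<Rightarrow> nat list" where
  "inds (CX j a) = [a]"
| "inds (CY k a b) = [a, b]"
| "inds (CZ l a b c) = [a, b, c]"

fun okcoord :: "nat \<Rightarrow> nat \<Rightarrow> nat \<Rightarrow> coord \<Rightarrow> bool" where
  "okcoord n1 n2 n3 (CX j a) \<longleftrightarrow> j \<in> {1..n1} \<and> a \<in> I4"
| "okcoord n1 n2 n3 (CY k a b) \<longleftrightarrow> k \<in> {1..n2} \<and> 1 \<le> a \<and> a < b \<and> b \<le> 4"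
| "okcoord n1 n2 n3 (CZ l a b c) \<longleftrightarrow> l \<in> {1..n3} \<and> 1 \<le> a \<and> a < b \<and> b < c \<and> c \<le> 4"

definition idx :: "coord list \<Rightarrow> nat list" where
  "idx K = concat (map inds K)"

definition mon :: "coord list \<Rightarrow> pt \<Rightarrow> complex" where
  "mon K w = prod_list (map (cval w) K)"

text \<open>Each tensor transforms by one row of g per index, so a monomial evaluated at
  \<open>act g w\<close> is a contraction of a product of row functionals with the tensors of w. The
  functionals below n are carried along for the induction.\<close>

lemma mon_act_con:
  assumes "\<And>i v. i < length (idx K) \<Longrightarrow> lf (n + i) v = (\<Sum>b\<in>I4. g (idx K ! i) b * v b)"
  shows "con (map sym_of K) n (\<lambda>u w. \<Prod>r<n + length (idx K). lf r (u r)) u w = (\<Prod>r<n. lf r (u r)) * mon K (act g w)"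
  using assms
proof (induction K arbitrary: n u)
  case Nil
  then show ?case by (simp add: idx_def mon_def)
next
  case (Cons v K)
  have pr: "(\<Prod>r<n. lf r ((u(n := p)) r)) = (\<Prod>r<n. lf r (u r))"
     "(\<Prod>r<n. lf r ((u(n := p, Suc n := q)) r)) = (\<Prod>r<n. lf r (u r))"
     "(\<Prod>r<n. lf r ((u(n := p, Suc n := q, Suc (Suc n) := s)) r)) = (\<Prod>r<n. lf r (u r))" for p q s u
    by (auto intro!: prod.cong)
  show ?case
  proof (cases v)
    case (CX j a)
    then have ix: "idx (v # K) = a # idx K" by (simp add: idx_def)
    have IH: "con (map sym_of K) (Suc n) (\<lambda>u w. \<Prod>r<Suc n + length (idx K). lf r (u r)) u w = (\<Prod>r<Suc n. lf r (u r)) * mon K (act g w)" for u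
    proof (rule Cons.IH)
      fix i x assume "i < length (idx K)"
      then show "lf (Suc n + i) x = (\<Sum>b\<in>I4. g (idx K ! i) b * x b)"
        using Cons.prems[of "Suc i" x] ix by simp
    qed
    have l: "lf n (X w j) = X (act g w) j a" using Cons.prems[of 0 "X w j"] ix by (simp add: act_def X_def)
    have "con (map sym_of (v # K)) n (\<lambda>u w. \<Prod>r<n + length (idx (v # K)). lf r (u r)) u w
       = (\<Prod>r<Suc n. lf r ((u(n := X w j)) r)) * mon K (act g w)"
      using IH CX ix by (simp del: fun_upd_apply)
    also have "\<dots> = (\<Prod>r<n. lf r (u r)) * (X (act g w) j a * mon K (act g w))"
      unfolding prod.lessThan_Suc pr using l by simp
    finally show ?thesis using CX by (simp add: mon_def)
  next
    case (CY k a b)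
    then have ix: "idx (v # K) = a # b # idx K" by (simp add: idx_def)
    have IH: "con (map sym_of K) (Suc (Suc n)) (\<lambda>u w. \<Prod>r<Suc (Suc n) + length (idx K). lf r (u r)) u w = (\<Prod>r<Suc (Suc n). lf r (u r)) * mon K (act g w)" for u
    proof (rule Cons.IH)
      fix i x assume "i < length (idx K)"
      then show "lf (Suc (Suc n) + i) x = (\<Sum>b\<in>I4. g (idx K ! i) b * x b)"
        using Cons.prems[of "Suc (Suc i)" x] ix by simp
    qed
    have l: "lf n (ev c) = g a c" "lf (Suc n) (ev c) = g b c" if "c \<in> I4" for c
      using Cons.prems[of 0 "ev c"] Cons.prems[of 1 "ev c"] ix that by (simp_all add: sum_ev_right2)
    have "con (map sym_of (v # K)) n (\<lambda>u w. \<Prod>r<n + length (idx (v # K)). lf r (u r)) u w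
       = (\<Sum>c\<in>I4. \<Sum>d\<in>I4. yA w k c d * ((\<Prod>r<Suc (Suc n). lf r ((u(n := ev c, Suc n := ev d)) r)) * mon K (act g w)))"
      using IH CY ix by (simp del: fun_upd_apply prod.lessThan_Suc)
    also have "\<dots> = (\<Sum>c\<in>I4. \<Sum>d\<in>I4. yA w k c d * ((\<Prod>r<n. lf r (u r)) * g a c * g b d * mon K (act g w)))"
      unfolding prod.lessThan_Suc pr by (intro sum.cong refl) (simp add: l)
    also have "\<dots> = (\<Prod>r<n. lf r (u r)) * (Y (act g w) k a b * mon K (act g w))"
      by (simp add: act_def Y_def sum_distrib_left sum_distrib_right ac_simps)
    finally show ?thesis using CY by (simp add: mon_def)
  next
    case (CZ k a b e)
    then have ix: "idx (v # K) = a # b # e # idx K" by (simp add: idx_def)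
    have IH: "con (map sym_of K) (Suc (Suc (Suc n))) (\<lambda>u w. \<Prod>r<Suc (Suc (Suc n)) + length (idx K). lf r (u r)) u w = (\<Prod>r<Suc (Suc (Suc n)). lf r (u r)) * mon K (act g w)" for u
    proof (rule Cons.IH)
      fix i x assume "i < length (idx K)"
      then show "lf (Suc (Suc (Suc n)) + i) x = (\<Sum>b\<in>I4. g (idx K ! i) b * x b)"
        using Cons.prems[of "Suc (Suc (Suc i))" x] ix by simp
    qed
    have l: "lf n (ev c) = g a c" "lf (Suc n) (ev c) = g b c" "lf (Suc (Suc n)) (ev c) = g e c" if "c \<in> I4" for c
      using Cons.prems[of 0 "ev c"] Cons.prems[of 1 "ev c"] Cons.prems[of "Suc (Suc 0)" "ev c"] ix that by (simp_all add: sum_ev_right2)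
    have "con (map sym_of (v # K)) n (\<lambda>u w. \<Prod>r<n + length (idx (v # K)). lf r (u r)) u w
       = (\<Sum>c\<in>I4. \<Sum>d\<in>I4. \<Sum>f\<in>I4. zA w k c d f * ((\<Prod>r<Suc (Suc (Suc n)). lf r ((u(n := ev c, Suc n := ev d, Suc (Suc n) := ev f)) r)) * mon K (act g w)))"
      using IH CZ ix by (simp del: fun_upd_apply prod.lessThan_Suc)
    also have "\<dots> = (\<Sum>c\<in>I4. \<Sum>d\<in>I4. \<Sum>f\<in>I4. zA w k c d f * ((\<Prod>r<n. lf r (u r)) * g a c * g b d * g e f * mon K (act g w)))"
      unfolding prod.lessThan_Suc pr by (intro sum.cong refl) (simp add: l)
    also have "\<dots> = (\<Prod>r<n. lf r (u r)) * (Z (act g w) k a b e * mon K (act g w))"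
      by (simp add: act_def Z_def sum_distrib_left sum_distrib_right ac_simps)
    finally show ?thesis using CZ by (simp add: mon_def)
  qed
qed

lemma mon_act:
  "mon K (act g w) = con (map sym_of K) 0 (\<lambda>u w. \<Prod>r<length (idx K). \<Sum>b\<in>I4. g (idx K ! r) b * u r b) u w"
  using mon_act_con[of K "\<lambda>r v. \<Sum>b\<in>I4. g (idx K ! r) b * v b" 0 g u w] by simp

text \<open>Ryser's inclusion-exclusion formula for the permanent. Expanding the product over maps
  \<phi> from N to N, the signed sum over the sets T containing the image of \<phi> vanishes unless
  \<phi> is onto.\<close>

lemma polarise:
  fixes v :: "nat \<Rightarrow> nat \<Rightarrow> complex" and m :: nat
  defines "N \<equiv> {..<m}"
  shows "(\<Sum>T\<in>Pow N. (-1) ^ (card N - card T) * (\<Prod>r\<in>N. \<Sum>i\<in>T. v r i)) = (\<Sum>\<tau> | \<tau> permutes N. \<Prod>r\<in>N. v r (\<tau> r))"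
proof -
  let ?F = "PiE N (\<lambda>_. N)"
  have fin: "finite N" by (simp add: N_def)
  have finF: "finite ?F" using fin by (intro finite_PiE) auto
  \<comment> \<open>The signed sum over T is the expansion of a product over x in N whose factor is
    1 for x in the image of \<phi> and 0 otherwise.\<close>
  have ie: "(\<Sum>T\<in>Pow N. (-1) ^ (card N - card T) * (if \<phi> ` N \<subseteq> T then 1 else 0)) = (if \<phi> ` N = N then 1 else (0::complex))"
    if "\<phi> \<in> ?F" for \<phi>
  proof -
    have sub: "\<phi> ` N \<subseteq> N" using that by auto
    have "(\<Prod>x\<in>N - T. if x \<in> \<phi> ` N then 0 else 1) = (if \<phi> ` N \<subseteq> T then 1 else (0::complex))" if "T \<in> Pow N" for T
    proof (cases "\<phi> ` N \<subseteq> T")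
      case True
      then show ?thesis by (auto intro!: prod.neutral)
    next
      case False
      then obtain x where "x \<in> \<phi> ` N" "x \<notin> T" by blast
      then have "x \<in> N - T" using sub by blast
      then show ?thesis using False \<open>x \<in> \<phi> ` N\<close> fin by (auto intro!: prod_zero bexI[of _ x])
    qed
    then have "(\<Sum>T\<in>Pow N. (-1) ^ (card N - card T) * (if \<phi> ` N \<subseteq> T then 1 else (0::complex)))
       = (\<Sum>T\<in>Pow N. (-1) ^ (card N - card T) * (\<Prod>x\<in>T. 1) * (\<Prod>x\<in>N - T. if x \<in> \<phi> ` N then 0 else 1))"
      by (intro sum.cong refl) simp
    also have "\<dots> = (\<Prod>x\<in>N. 1 - (if x \<in> \<phi> ` N then 0 else 1))"
      by (rule prod_diff_conv_sum'[OF fin, symmetric])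
    also have "\<dots> = (if \<phi> ` N = N then 1 else 0)"
    proof (cases "\<phi> ` N = N")
      case False
      then obtain x where "x \<in> N" "x \<notin> \<phi> ` N" using sub by blast
      then show ?thesis using False fin by (auto intro!: prod_zero bexI[of _ x])
    qed (auto intro!: prod.neutral)
    finally show ?thesis .
  qed
  have "(\<Prod>r\<in>N. \<Sum>i\<in>T. v r i) = (\<Sum>\<phi>\<in>?F. (if \<phi> ` N \<subseteq> T then 1 else 0) * (\<Prod>r\<in>N. v r (\<phi> r)))" if "T \<in> Pow N" for T
  proof -
    have fT: "finite T" using that fin finite_subset by auto
    have "(\<Prod>r\<in>N. \<Sum>i\<in>T. v r i) = (\<Sum>\<phi>\<in>PiE N (\<lambda>_. T). \<Prod>r\<in>N. v r (\<phi> r))"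
      by (rule prod_sum_PiE[OF fin fT])
    also have "\<dots> = (\<Sum>\<phi>\<in>{\<phi> \<in> ?F. \<phi> ` N \<subseteq> T}. \<Prod>r\<in>N. v r (\<phi> r))"
      by (intro sum.cong refl) (use that in \<open>auto simp: PiE_iff extensional_def\<close>)
    also have "\<dots> = (\<Sum>\<phi>\<in>?F. if \<phi> ` N \<subseteq> T then \<Prod>r\<in>N. v r (\<phi> r) else 0)"
      using finF by (rule sum.inter_filter)
    also have "\<dots> = (\<Sum>\<phi>\<in>?F. (if \<phi> ` N \<subseteq> T then 1 else 0) * (\<Prod>r\<in>N. v r (\<phi> r)))"
      by (intro sum.cong refl) simp
    finally show ?thesis .
  qed
  then have "(\<Sum>T\<in>Pow N. (-1) ^ (card N - card T) * (\<Prod>r\<in>N. \<Sum>i\<in>T. v r i))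
     = (\<Sum>T\<in>Pow N. \<Sum>\<phi>\<in>?F. (-1) ^ (card N - card T) * (if \<phi> ` N \<subseteq> T then 1 else 0) * (\<Prod>r\<in>N. v r (\<phi> r)))"
    by (simp add: sum_distrib_left mult.assoc)
  also have "\<dots> = (\<Sum>\<phi>\<in>?F. (\<Sum>T\<in>Pow N. (-1) ^ (card N - card T) * (if \<phi> ` N \<subseteq> T then 1 else 0)) * (\<Prod>r\<in>N. v r (\<phi> r)))"
    unfolding sum_distrib_right by (rule sum.swap)
  also have "\<dots> = (\<Sum>\<phi>\<in>?F. (if \<phi> ` N = N then 1 else 0) * (\<Prod>r\<in>N. v r (\<phi> r)))"
    using ie by (intro sum.cong refl) simp
  also have "\<dots> = (\<Sum>\<phi>\<in>?F. if \<phi> ` N = N then \<Prod>r\<in>N. v r (\<phi> r) else 0)"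
    by (intro sum.cong refl) simp
  also have "\<dots> = (\<Sum>\<phi>\<in>{\<phi> \<in> ?F. \<phi> ` N = N}. \<Prod>r\<in>N. v r (\<phi> r))"
    using finF by (rule sum.inter_filter[symmetric])
  also have "\<dots> = (\<Sum>\<tau> | \<tau> permutes N. \<Prod>r\<in>N. v r (\<tau> r))"
  proof (rule sum.reindex_bij_witness[where i = "\<lambda>\<tau>. restrict \<tau> N" and j = "\<lambda>\<phi> x. if x \<in> N then \<phi> x else x"])
    fix \<phi> assume a: "\<phi> \<in> {\<phi> \<in> ?F. \<phi> ` N = N}"
    then show "restrict (\<lambda>x. if x \<in> N then \<phi> x else x) N = \<phi>"
      by (auto simp: restrict_def PiE_iff extensional_def fun_eq_iff)
    have "bij_betw \<phi> N N" using a fin by (auto simp: bij_betw_def intro: eq_card_imp_inj_on)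
    then have "bij_betw (\<lambda>x. if x \<in> N then \<phi> x else x) N N"
      by (rule bij_betw_cong[THEN iffD1, rotated]) simp
    then show "(\<lambda>x. if x \<in> N then \<phi> x else x) \<in> {\<tau>. \<tau> permutes N}"
      by (auto intro: bij_imp_permutes)
  next
    fix \<tau> assume "\<tau> \<in> {\<tau>. \<tau> permutes N}"
    then have t: "\<tau> permutes N" by simp
    then show "(\<lambda>x. if x \<in> N then restrict \<tau> N x else x) = \<tau>"
      by (auto simp: fun_eq_iff permutes_not_in)
    show "restrict \<tau> N \<in> {\<phi> \<in> ?F. \<phi> ` N = N}"
      using permutes_image[OF t] permutes_in_image[OF t] by (auto simp: image_restrict_eq)
  qed auto
  finally show ?thesis .
qed

lemma sum_PiE_insert:
  assumes "x \<notin> S" "finite S" "\<And>i. finite (T i)"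
  shows "(\<Sum>c\<in>PiE (insert x S) T. F c) = (\<Sum>y\<in>T x. \<Sum>c\<in>PiE S T. F (c(x := y)))"
proof -
  have "(\<Sum>c\<in>PiE (insert x S) T. F c) = (\<Sum>(y, c)\<in>T x \<times> PiE S T. F (c(x := y)))"
    unfolding PiE_insert_eq using inj_combinator[OF assms(1), of T]
    by (subst sum.reindex) (auto simp: case_prod_unfold)
  then show ?thesis by (simp add: sum.cartesian_product)
qed

section \<open>Powers of the determinant and the Omega functional\<close>

definition epsb :: "nat \<Rightarrow> (nat \<Rightarrow> nat) \<Rightarrow> complex" where
  "epsb p c = (\<Prod>i<p. eps (c (4 * i)) (c (4 * i + 1)) (c (4 * i + 2)) (c (4 * i + 3)))"

lemma epsb_cong: "(\<And>r. r < 4 * p \<Longrightarrow> c r = c' r) \<Longrightarrow> epsb p c = epsb p c'"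
  unfolding epsb_def by (intro prod.cong refl) simp

lemma sum_epsb:
  "(\<Sum>c\<in>PiE {..<4 * p} (\<lambda>_. I4). epsb p c * (\<Prod>r<4 * p. h r (c r)))
   = (\<Prod>i<p. det4 (h (4 * i)) (h (4 * i + 1)) (h (4 * i + 2)) (h (4 * i + 3)))"
proof (induction p)
  case 0
  then show ?case by (simp add: epsb_def)
next
  case (Suc p)
  let ?n = "4 * p"
  have s: "{..<4 * Suc p} = insert (?n + 3) (insert (?n + 2) (insert (?n + 1) (insert ?n {..<?n})))" by auto
  let ?u = "\<lambda>c a b d e. c(?n := a, ?n + 1 := b, ?n + 2 := d, ?n + 3 := e)"
  have e: "epsb (Suc p) (?u c a b d e) = epsb p c * eps a b d e" for c a b d e
  proof -
    have "epsb p (?u c a b d e) = epsb p c" by (rule epsb_cong) auto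
    then show ?thesis by (simp add: epsb_def)
  qed
  have q: "(\<Prod>r<4 * Suc p. h r (?u c a b d e r)) = (\<Prod>r<?n. h r (c r)) * (h ?n a * h (?n + 1) b * h (?n + 2) d * h (?n + 3) e)" for c a b d e
  proof -
    have "(\<Prod>r<?n. h r (?u c a b d e r)) = (\<Prod>r<?n. h r (c r))" by (intro prod.cong refl) auto
    then show ?thesis unfolding s by (simp add: mult.commute mult.left_commute)
  qed
  have "(\<Sum>c\<in>PiE {..<4 * Suc p} (\<lambda>_. I4). epsb (Suc p) c * (\<Prod>r<4 * Suc p. h r (c r)))
     = (\<Sum>e\<in>I4. \<Sum>d\<in>I4. \<Sum>b\<in>I4. \<Sum>a\<in>I4. \<Sum>c\<in>PiE {..<?n} (\<lambda>_. I4). epsb (Suc p) (?u c a b d e) * (\<Prod>r<4 * Suc p. h r (?u c a b d e r)))"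
    unfolding s by (subst sum_PiE_insert; simp)+
  also have "\<dots> = (\<Sum>e\<in>I4. \<Sum>d\<in>I4. \<Sum>b\<in>I4. \<Sum>a\<in>I4. (\<Sum>c\<in>PiE {..<?n} (\<lambda>_. I4). epsb p c * (\<Prod>r<?n. h r (c r)))
        * (eps a b d e * h ?n a * h (?n + 1) b * h (?n + 2) d * h (?n + 3) e))"
    unfolding e q sum_distrib_right by (intro sum.cong refl) (simp only: ac_simps)
  also have "\<dots> = (\<Sum>c\<in>PiE {..<?n} (\<lambda>_. I4). epsb p c * (\<Prod>r<?n. h r (c r))) *
       (\<Sum>e\<in>I4. \<Sum>d\<in>I4. \<Sum>b\<in>I4. \<Sum>a\<in>I4. eps a b d e * h ?n a * h (?n + 1) b * h (?n + 2) d * h (?n + 3) e)"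
    by (simp only: sum_distrib_left)
  also have "(\<Sum>e\<in>I4. \<Sum>d\<in>I4. \<Sum>b\<in>I4. \<Sum>a\<in>I4. eps a b d e * h ?n a * h (?n + 1) b * h (?n + 2) d * h (?n + 3) e)
     = det4 (h ?n) (h (?n + 1)) (h (?n + 2)) (h (?n + 3))"
    unfolding det4_def by (simp only: sum_I4 ac_simps)
  finally show ?case using Suc by simp
qed

text \<open>The 4p positions are cut into p blocks of four, and each block runs through the rows 1
  to 4 of one determinant.\<close>

definition rowi :: "nat \<Rightarrow> nat" where
  "rowi r = r mod 4 + 1"

lemma rowi_block: "rowi (4 * i) = 1" "rowi (4 * i + 1) = 2" "rowi (4 * i + 2) = 3" "rowi (4 * i + 3) = 4"
  unfolding rowi_def by presburger+

lemma rowi_I4: "rowi r \<in> I4"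
  unfolding rowi_def I4_def by (simp add: Suc_leI)

definition emat :: "nat \<Rightarrow> nat \<Rightarrow> nat \<Rightarrow> nat \<Rightarrow> complex" where
  "emat i j a b = (if a = i \<and> b = j then 1 else 0)"

text \<open>A functional on functions of a 4 x 4 matrix. On polynomials of degree 4p it is the
  apolar pairing with the p-th power of the determinant.\<close>

definition Lam :: "nat \<Rightarrow> ((nat \<Rightarrow> nat \<Rightarrow> complex) \<Rightarrow> complex) \<Rightarrow> complex" where
  "Lam p P = (\<Sum>x\<in>PiE {..<4 * p} (\<lambda>_. I4) \<times> Pow {..<4 * p}.
      (epsb p (fst x) * (-1) ^ (4 * p - card (snd x))) * P (\<lambda>a b. \<Sum>r\<in>snd x. emat (rowi r) (fst x r) a b))"

lemma finite_Lam: "finite (PiE {..<4 * (p::nat)} (\<lambda>_. I4) \<times> Pow {..<4 * p})"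
  by (intro finite_cartesian_product finite_PiE) auto

lemma Lam_sum: "Lam p (\<lambda>g. \<Sum>t\<in>D. k t * P t g) = (\<Sum>t\<in>D. k t * Lam p (P t))"
  unfolding Lam_def sum_distrib_left by (subst sum.swap) (simp add: mult.left_commute)

lemma Lam_scale: "Lam p (\<lambda>g. k * P g) = k * Lam p P"
  unfolding Lam_def by (simp add: sum_distrib_left mult.left_commute)

lemma Lam_con: "Lam p (\<lambda>g. con S n (\<lambda>u w. \<Psi> g u) u w) = con S n (\<lambda>u w. Lam p (\<lambda>g. \<Psi> g u)) u w"
  unfolding Lam_def by (rule con_sum[OF finite_Lam, symmetric])

text \<open>Evaluation at sums of matrix units over subsets, followed by polarisation, replaces
  differentiation: on a product of 4p additive functionals the result is a permanent, that is, a sum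
  over all assignments \<tau> of functionals to matrix units.\<close>

lemma Lam_prod:
  assumes "\<And>r T c. r < 4 * p \<Longrightarrow> L r (\<lambda>a b. \<Sum>i\<in>T. emat (rowi i) (c i) a b) = (\<Sum>i\<in>T. L r (emat (rowi i) (c i)))"
  shows "Lam p (\<lambda>g. \<Prod>r<4 * p. L r g)
    = (\<Sum>c\<in>PiE {..<4 * p} (\<lambda>_. I4). epsb p c * (\<Sum>\<tau> | \<tau> permutes {..<4 * p}. \<Prod>r<4 * p. L r (emat (rowi (\<tau> r)) (c (\<tau> r)))))"
proof -
  have "Lam p (\<lambda>g. \<Prod>r<4 * p. L r g)
     = (\<Sum>c\<in>PiE {..<4 * p} (\<lambda>_. I4). \<Sum>T\<in>Pow {..<4 * p}.
          (epsb p c * (-1) ^ (4 * p - card T)) * (\<Prod>r<4 * p. \<Sum>i\<in>T. L r (emat (rowi i) (c i))))"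
    unfolding Lam_def sum.cartesian_product by (intro sum.cong refl) (simp add: assms case_prod_unfold)
  also have "\<dots> = (\<Sum>c\<in>PiE {..<4 * p} (\<lambda>_. I4). epsb p c *
       (\<Sum>T\<in>Pow {..<4 * p}. (-1) ^ (card {..<4 * p} - card T) * (\<Prod>r<4 * p. \<Sum>i\<in>T. L r (emat (rowi i) (c i)))))"
    by (simp add: sum_distrib_left mult.assoc)
  also have "\<dots> = (\<Sum>c\<in>PiE {..<4 * p} (\<lambda>_. I4). epsb p c * (\<Sum>\<tau> | \<tau> permutes {..<4 * p}. \<Prod>r<4 * p. L r (emat (rowi (\<tau> r)) (c (\<tau> r)))))"
    unfolding polarise ..
  finally show ?thesis .
qed

text \<open>The matrix units force the row \<alpha> r to match the row of position \<tau> r; the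
  free column indices are contracted by the symbols in \<open>epsb\<close> and yield determinants of
  the vectors. This is where the Levi-Civita contractions come from.\<close>

lemma Lam_vectors:
  "Lam p (\<lambda>g. \<Prod>r<4 * p. \<Sum>b\<in>I4. g (\<alpha> r) b * u r b)
   = (\<Sum>\<tau> | \<tau> permutes {..<4 * p}. (if \<forall>r<4 * p. \<alpha> r = rowi (\<tau> r) then 1 else 0) * block_det p (inv \<tau>) u w)"
proof -
  let ?N = "{..<4 * p}"
  let ?C = "PiE ?N (\<lambda>_. I4)"
  have "Lam p (\<lambda>g. \<Prod>r<4 * p. \<Sum>b\<in>I4. g (\<alpha> r) b * u r b)
    = (\<Sum>c\<in>?C. epsb p c * (\<Sum>\<tau> | \<tau> permutes ?N. \<Prod>r<4 * p. \<Sum>b\<in>I4. emat (rowi (\<tau> r)) (c (\<tau> r)) (\<alpha> r) b * u r b))"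
    by (rule Lam_prod) (simp add: sum_distrib_right sum.swap[of _ I4])
  also have "\<dots> = (\<Sum>\<tau> | \<tau> permutes ?N. \<Sum>c\<in>?C. epsb p c * (\<Prod>r<4 * p. \<Sum>b\<in>I4. emat (rowi (\<tau> r)) (c (\<tau> r)) (\<alpha> r) b * u r b))"
    unfolding sum_distrib_left by (rule sum.swap)
  also have "\<dots> = (\<Sum>\<tau> | \<tau> permutes ?N. (if \<forall>r<4 * p. \<alpha> r = rowi (\<tau> r) then 1 else 0) * block_det p (inv \<tau>) u w)"
  proof (intro sum.cong refl)
    fix \<tau> assume "\<tau> \<in> {\<tau>. \<tau> permutes ?N}"
    then have t: "\<tau> permutes ?N" by simp
    have e: "(\<Prod>r<4 * p. \<Sum>b\<in>I4. emat (rowi (\<tau> r)) (c (\<tau> r)) (\<alpha> r) b * u r b)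
       = (if \<forall>r<4 * p. \<alpha> r = rowi (\<tau> r) then 1 else 0) * (\<Prod>r<4 * p. u (inv \<tau> r) (c r))" if "c \<in> ?C" for c
    proof -
      have "(\<Sum>b\<in>I4. emat (rowi (\<tau> r)) (c (\<tau> r)) (\<alpha> r) b * u r b) = (if \<alpha> r = rowi (\<tau> r) then u r (c (\<tau> r)) else 0)"
        if "r < 4 * p" for r
      proof -
        have "c (\<tau> r) \<in> I4" using \<open>c \<in> ?C\<close> permutes_in_image[OF t, of r] that by auto
        then show ?thesis by (simp add: emat_def if_distrib[of "\<lambda>x. x * _"] cong: if_cong)
      qed
      then have "(\<Prod>r<4 * p. \<Sum>b\<in>I4. emat (rowi (\<tau> r)) (c (\<tau> r)) (\<alpha> r) b * u r b)
         = (\<Prod>r<4 * p. if \<alpha> r = rowi (\<tau> r) then u r (c (\<tau> r)) else 0)" by simp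
      also have "\<dots> = (if \<forall>r<4 * p. \<alpha> r = rowi (\<tau> r) then 1 else 0) * (\<Prod>r<4 * p. u r (c (\<tau> r)))"
      proof (cases "\<forall>r<4 * p. \<alpha> r = rowi (\<tau> r)")
        case False
        then obtain r where "r < 4 * p" "\<alpha> r \<noteq> rowi (\<tau> r)" by blast
        then have "(\<Prod>r<4 * p. if \<alpha> r = rowi (\<tau> r) then u r (c (\<tau> r)) else 0) = 0"
          by (intro prod_zero) auto
        then show ?thesis using False by simp
      qed simp
      also have "(\<Prod>r<4 * p. u r (c (\<tau> r))) = (\<Prod>r<4 * p. u (inv \<tau> (\<tau> r)) (c (\<tau> r)))"
        using permutes_inverses(2)[OF t] by simp
      also have "\<dots> = (\<Prod>r<4 * p. u (inv \<tau> r) (c r))"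
        by (rule prod.reindex_bij_betw[OF permutes_imp_bij[OF t]])
      finally show ?thesis .
    qed
    have "(\<Sum>c\<in>?C. epsb p c * (\<Prod>r<4 * p. \<Sum>b\<in>I4. emat (rowi (\<tau> r)) (c (\<tau> r)) (\<alpha> r) b * u r b))
       = (if \<forall>r<4 * p. \<alpha> r = rowi (\<tau> r) then 1 else 0) * (\<Sum>c\<in>?C. epsb p c * (\<Prod>r<4 * p. u (inv \<tau> r) (c r)))"
      unfolding sum_distrib_left by (intro sum.cong refl) (simp add: e)
    then show "(\<Sum>c\<in>?C. epsb p c * (\<Prod>r<4 * p. \<Sum>b\<in>I4. emat (rowi (\<tau> r)) (c (\<tau> r)) (\<alpha> r) b * u r b))
       = (if \<forall>r<4 * p. \<alpha> r = rowi (\<tau> r) then 1 else 0) * block_det p (inv \<tau>) u w"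
      unfolding sum_epsb[of p "\<lambda>r. u (inv \<tau> r)"] block_det_def .
  qed
  finally show ?thesis .
qed

lemma detN4_power: "detN 4 g ^ p = (\<Sum>c\<in>PiE {..<4 * p} (\<lambda>_. I4). epsb p c * (\<Prod>r<4 * p. g (rowi r) (c r)))"
proof -
  have "detN 4 g = det4 (g 1) (g 2) (g 3) (g 4)"
    unfolding detN4 by (rule det4_transpose)
  then show ?thesis unfolding sum_epsb[of p "\<lambda>r. g (rowi r)"] rowi_block by simp
qed

lemma bij_PiE_permute:
  assumes "\<sigma> permutes N"
  shows "bij_betw (\<lambda>c. restrict (c \<circ> \<sigma>) N) (PiE N (\<lambda>_. B)) (PiE N (\<lambda>_. B))"
proof (rule bij_betwI[where g = "\<lambda>c. restrict (c \<circ> inv \<sigma>) N"])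
  note i = permutes_inv[OF assms]
  show "(\<lambda>c. restrict (c \<circ> \<sigma>) N) \<in> PiE N (\<lambda>_. B) \<rightarrow> PiE N (\<lambda>_. B)"
    using permutes_in_image[OF assms] by (auto simp: PiE_iff)
  show "(\<lambda>c. restrict (c \<circ> inv \<sigma>) N) \<in> PiE N (\<lambda>_. B) \<rightarrow> PiE N (\<lambda>_. B)"
    using permutes_in_image[OF i] by (auto simp: PiE_iff)
  show "restrict (restrict (c \<circ> \<sigma>) N \<circ> inv \<sigma>) N = c" if "c \<in> PiE N (\<lambda>_. B)" for c
    using that permutes_in_image[OF i] permutes_inverses(1)[OF assms] by (auto simp: fun_eq_iff PiE_iff extensional_def)
  show "restrict (restrict (c \<circ> inv \<sigma>) N \<circ> \<sigma>) N = c" if "c \<in> PiE N (\<lambda>_. B)" for c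
    using that permutes_in_image[OF assms] permutes_inverses(2)[OF assms] by (auto simp: fun_eq_iff PiE_iff extensional_def)
qed

text \<open>Positivity of the apolar pairing. Symmetrising the coefficients \<open>epsb p\<close>
  over the group G of position permutations that preserve rows gives h, and the order of G times the
  value in question equals the sum of the squares of h. The values of h are real, and h is nonzero
  at the assignment of column a to row a.\<close>

lemma Lam_det_power_nonzero: "Lam p (\<lambda>g. detN 4 g ^ p) \<noteq> 0"
proof
  let ?N = "{..<4 * p}"
  let ?C = "PiE ?N (\<lambda>_. I4)"
  define G where "G = {\<tau>. \<tau> permutes ?N \<and> (\<forall>r<4 * p. rowi (\<tau> r) = rowi r)}"
  define h where "h c = (\<Sum>\<tau>\<in>G. epsb p (c \<circ> \<tau>))" for c
  have finG: "finite G" unfolding G_def by (rule finite_subset[OF _ finite_permutations[of ?N]]) auto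
  have finC: "finite ?C" by (intro finite_PiE) auto
  have Gp: "\<tau> permutes ?N" if "\<tau> \<in> G" for \<tau> using that by (simp add: G_def)
  have Gr: "rowi (\<tau> r) = rowi r" if "\<tau> \<in> G" "r < 4 * p" for \<tau> r using that by (simp add: G_def)
  have G_comp: "\<sigma> \<circ> \<tau> \<in> G" if "\<sigma> \<in> G" "\<tau> \<in> G" for \<sigma> \<tau>
    using that permutes_compose[OF Gp Gp] permutes_in_image[OF Gp[OF that(2)]] by (auto simp: G_def)
  have G_inv: "inv \<sigma> \<in> G" if "\<sigma> \<in> G" for \<sigma>
  proof -
    have "rowi (inv \<sigma> r) = rowi r" if "r < 4 * p" for r
    proof -
      have "inv \<sigma> r < 4 * p" using permutes_in_image[OF permutes_inv[OF Gp[OF \<open>\<sigma> \<in> G\<close>]], of r] that by simp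
      then have "rowi (\<sigma> (inv \<sigma> r)) = rowi (inv \<sigma> r)" using Gr[OF \<open>\<sigma> \<in> G\<close>] by blast
      then show ?thesis using permutes_inverses(1)[OF Gp[OF \<open>\<sigma> \<in> G\<close>]] by simp
    qed
    then show ?thesis using permutes_inv[OF Gp[OF that]] by (auto simp: G_def)
  qed
  have "Lam p (\<lambda>g. detN 4 g ^ p) = (\<Sum>c'\<in>?C. epsb p c' * Lam p (\<lambda>g. \<Prod>r<4 * p. g (rowi r) (c' r)))"
    unfolding detN4_power by (rule Lam_sum)
  also have "\<dots> = (\<Sum>c'\<in>?C. epsb p c' * (\<Sum>c\<in>?C. epsb p c * (\<Sum>\<tau> | \<tau> permutes ?N. \<Prod>r<4 * p. emat (rowi (\<tau> r)) (c (\<tau> r)) (rowi r) (c' r))))"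
    by (intro sum.cong refl arg_cong2[of _ _ _ _ times] Lam_prod)
  also have "\<dots> = (\<Sum>c\<in>?C. epsb p c * (\<Sum>\<tau> | \<tau> permutes ?N. \<Sum>c'\<in>?C. epsb p c' * (\<Prod>r<4 * p. emat (rowi (\<tau> r)) (c (\<tau> r)) (rowi r) (c' r))))"
    (is "?l = ?r")
  proof -
    have "?l = (\<Sum>c'\<in>?C. \<Sum>c\<in>?C. \<Sum>\<tau> | \<tau> permutes ?N. epsb p c * (epsb p c' * (\<Prod>r<4 * p. emat (rowi (\<tau> r)) (c (\<tau> r)) (rowi r) (c' r))))"
      by (simp add: sum_distrib_left mult.left_commute)
    also have "\<dots> = (\<Sum>c\<in>?C. \<Sum>c'\<in>?C. \<Sum>\<tau> | \<tau> permutes ?N. epsb p c * (epsb p c' * (\<Prod>r<4 * p. emat (rowi (\<tau> r)) (c (\<tau> r)) (rowi r) (c' r))))"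
      by (rule sum.swap)
    also have "\<dots> = (\<Sum>c\<in>?C. \<Sum>\<tau> | \<tau> permutes ?N. \<Sum>c'\<in>?C. epsb p c * (epsb p c' * (\<Prod>r<4 * p. emat (rowi (\<tau> r)) (c (\<tau> r)) (rowi r) (c' r))))"
      by (intro sum.cong refl sum.swap)
    finally show ?thesis by (simp add: sum_distrib_left)
  qed
  also have "\<dots> = (\<Sum>c\<in>?C. epsb p c * (\<Sum>\<tau> | \<tau> permutes ?N. if \<tau> \<in> G then epsb p (c \<circ> \<tau>) else 0))"
  proof (intro sum.cong refl arg_cong2[of _ _ _ _ times])
    fix c \<tau> assume c: "c \<in> ?C" and "\<tau> \<in> {\<tau>. \<tau> permutes ?N}"
    then have t: "\<tau> permutes ?N" by simp
    define c0 where "c0 = restrict (c \<circ> \<tau>) ?N"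
    have cc: "c0 \<in> ?C" unfolding c0_def using c permutes_in_image[OF t] by (auto simp: PiE_iff)
    have "(\<Prod>r<4 * p. emat (rowi (\<tau> r)) (c (\<tau> r)) (rowi r) (c' r)) = (if \<tau> \<in> G \<and> c' = c0 then 1 else 0)" if "c' \<in> ?C" for c'
    proof (cases "\<tau> \<in> G \<and> c' = c0")
      case True
      then show ?thesis by (auto simp: emat_def Gr c0_def intro!: prod.neutral)
    next
      case False
      have "\<exists>r<4 * p. \<not> (rowi r = rowi (\<tau> r) \<and> c' r = c (\<tau> r))"
      proof (rule ccontr)
        assume "\<not> ?thesis"
        then have "\<tau> \<in> G" "\<And>r. r < 4 * p \<Longrightarrow> c' r = c (\<tau> r)" using t by (auto simp: G_def)
        then have "c' = c0" using that by (auto simp: c0_def fun_eq_iff PiE_iff extensional_def)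
        then show False using False \<open>\<tau> \<in> G\<close> by blast
      qed
      then have "(\<Prod>r<4 * p. emat (rowi (\<tau> r)) (c (\<tau> r)) (rowi r) (c' r)) = 0"
        by (intro prod_zero) (auto simp: emat_def)
      then show ?thesis unfolding if_not_P[OF False] .
    qed
    then have "(\<Sum>c'\<in>?C. epsb p c' * (\<Prod>r<4 * p. emat (rowi (\<tau> r)) (c (\<tau> r)) (rowi r) (c' r)))
       = (\<Sum>c'\<in>?C. if c' = c0 then (if \<tau> \<in> G then epsb p c' else 0) else 0)"
      by (intro sum.cong refl) simp
    also have "\<dots> = (if \<tau> \<in> G then epsb p (c0) else 0)"
      using cc finC by simp
    also have "epsb p (c0) = epsb p (c \<circ> \<tau>)" by (rule epsb_cong) (simp add: c0_def)
    finally show "(\<Sum>c'\<in>?C. epsb p c' * (\<Prod>r<4 * p. emat (rowi (\<tau> r)) (c (\<tau> r)) (rowi r) (c' r))) = (if \<tau> \<in> G then epsb p (c \<circ> \<tau>) else 0)" .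
  qed
  also have "\<dots> = (\<Sum>c\<in>?C. epsb p c * h c)"
  proof (intro sum.cong refl arg_cong2[of _ _ _ _ times])
    fix c
    have "(\<Sum>\<tau> | \<tau> permutes ?N. if \<tau> \<in> G then epsb p (c \<circ> \<tau>) else 0) = (\<Sum>\<tau>\<in>{\<tau> \<in> {\<tau>. \<tau> permutes ?N}. \<tau> \<in> G}. epsb p (c \<circ> \<tau>))"
      by (rule sum.inter_filter[symmetric]) (simp add: finite_permutations)
    also have "{\<tau> \<in> {\<tau>. \<tau> permutes ?N}. \<tau> \<in> G} = G" using Gp by auto
    finally show "(\<Sum>\<tau> | \<tau> permutes ?N. if \<tau> \<in> G then epsb p (c \<circ> \<tau>) else 0) = h c" unfolding h_def .
  qed
  finally have L: "Lam p (\<lambda>g. detN 4 g ^ p) = (\<Sum>c\<in>?C. epsb p c * h c)" .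
  have h_inv: "h (restrict (c \<circ> \<sigma>) ?N) = h c" if "\<sigma> \<in> G" for c \<sigma>
  proof -
    have "h (restrict (c \<circ> \<sigma>) ?N) = (\<Sum>\<tau>\<in>G. epsb p (c \<circ> (\<sigma> \<circ> \<tau>)))"
      unfolding h_def
    proof (intro sum.cong refl epsb_cong)
      fix \<tau> r assume "\<tau> \<in> G" "r < 4 * p"
      then show "(restrict (c \<circ> \<sigma>) ?N \<circ> \<tau>) r = (c \<circ> (\<sigma> \<circ> \<tau>)) r" using permutes_in_image[OF Gp[OF \<open>\<tau> \<in> G\<close>], of r] by simp
    qed
    also have "\<dots> = h c" unfolding h_def
      by (rule sum.reindex_bij_witness[where j = "\<lambda>\<tau>. \<sigma> \<circ> \<tau>" and i = "\<lambda>\<tau>. inv \<sigma> \<circ> \<tau>"])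
        (auto simp: fun_eq_iff permutes_inverses[OF Gp[OF that]] G_comp G_inv that)
    finally show ?thesis .
  qed
  \<comment> \<open>Invariance of h under G allows one of the two symmetrisations to be absorbed by
    a change of summation variable.\<close>
  have "(\<Sum>c\<in>?C. h c * h c) = (\<Sum>\<sigma>\<in>G. \<Sum>c\<in>?C. epsb p (c \<circ> \<sigma>) * h c)"
    by (subst sum.swap) (simp add: h_def sum_distrib_right)
  also have "\<dots> = (\<Sum>\<sigma>\<in>G. \<Sum>c\<in>?C. epsb p c * h c)"
  proof (rule sum.cong[OF refl])
    fix \<sigma> assume s: "\<sigma> \<in> G"
    have "(\<Sum>c\<in>?C. epsb p (c \<circ> \<sigma>) * h c) = (\<Sum>c\<in>?C. epsb p (restrict (c \<circ> \<sigma>) ?N) * h (restrict (c \<circ> \<sigma>) ?N))"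
      unfolding h_inv[OF s] by (intro sum.cong refl arg_cong2[of _ _ _ _ times] epsb_cong) simp
    also have "\<dots> = (\<Sum>c\<in>?C. epsb p c * h c)"
      by (rule sum.reindex_bij_betw[OF bij_PiE_permute[OF Gp[OF s]], of "\<lambda>c. epsb p c * h c"])
    finally show "(\<Sum>c\<in>?C. epsb p (c \<circ> \<sigma>) * h c) = \<dots>" .
  qed
  also have "\<dots> = of_nat (card G) * Lam p (\<lambda>g. detN 4 g ^ p)" unfolding L by simp
  finally have sq: "(\<Sum>c\<in>?C. h c * h c) = of_nat (card G) * Lam p (\<lambda>g. detN 4 g ^ p)" .
  assume "Lam p (\<lambda>g. detN 4 g ^ p) = 0"
  with sq have z: "(\<Sum>c\<in>?C. h c * h c) = 0" by simp
  have "epsb p c \<in> \<real>" for c unfolding epsb_def eps_def by (intro prod_in_Reals) auto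
  then have hr: "h c \<in> \<real>" for c unfolding h_def by (intro sum_in_Reals) auto
  then have hR: "h c = of_real (Re (h c))" for c by simp
  have "(\<Sum>c\<in>?C. h c * h c) = of_real (\<Sum>c\<in>?C. Re (h c) * Re (h c))"
    unfolding of_real_sum of_real_mult using hR by simp
  with z have "(\<Sum>c\<in>?C. Re (h c) * Re (h c)) = 0" by (simp only: of_real_eq_0_iff)
  then have "\<forall>c\<in>?C. Re (h c) * Re (h c) = 0"
    by (subst (asm) sum_nonneg_eq_0_iff[OF finC]) auto
  moreover have rC: "restrict rowi ?N \<in> ?C" using rowi_I4 by auto
  ultimately have "Re (h (restrict rowi ?N)) = 0" by (meson mult_eq_0_iff)
  then have "h (restrict rowi ?N) = 0" using hR[of "restrict rowi ?N"] by simp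
  \<comment> \<open>Permutations in G leave every block equal to 1, 2, 3, 4, so each term of the
    symmetrisation is 1.\<close>
  moreover have "h (restrict rowi ?N) = of_nat (card G)"
  proof -
    have "epsb p (restrict rowi ?N \<circ> \<tau>) = 1" if "\<tau> \<in> G" for \<tau>
    proof -
      have "epsb p (restrict rowi ?N \<circ> \<tau>) = epsb p rowi"
        by (rule epsb_cong) (use that Gr permutes_in_image[OF Gp[OF that]] in auto)
      also have "\<dots> = 1" unfolding epsb_def rowi_block by (simp add: eps_def)
      finally show ?thesis .
    qed
    then show ?thesis unfolding h_def by simp
  qed
  moreover have "id \<in> G" by (auto simp: G_def permutes_id)
  then have "card G \<noteq> 0" using finG by auto
  ultimately show False by simp
qed

subsection \<open>Reduction of invariants to contractions\<close>

lemma mon_Nil [simp]: "mon [] w = 1" by (simp add: mon_def)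
lemma mon_append: "mon (K @ L) w = mon K w * mon L w" by (simp add: mon_def)
lemma mon_Cons: "mon (v # K) w = cval w v * mon K w" by (simp add: mon_def)

definition lincomb :: "(complex \<times> coord list) list \<Rightarrow> pt \<Rightarrow> complex" where
  "lincomb cs w = (\<Sum>(c, K)\<leftarrow>cs. c * mon K w)"

lemma lincomb_Cons: "lincomb ((c, K) # cs) w = c * mon K w + lincomb cs w"
  by (simp add: lincomb_def)

lemma lincomb_append: "lincomb (cs @ ds) w = lincomb cs w + lincomb ds w"
  by (simp add: lincomb_def)

lemma lincomb_scale: "lincomb (map (\<lambda>(d, L). (c * d, K @ L)) ds) w = c * mon K w * lincomb ds w"
  by (induction ds) (auto simp: lincomb_def mon_append algebra_simps)

lemma lincomb_product:
  "lincomb (concat (map (\<lambda>(c, K). map (\<lambda>(d, L). (c * d, K @ L)) ds) cs)) w = lincomb cs w * lincomb ds w"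
  by (induction cs) (auto simp: lincomb_append lincomb_Cons lincomb_scale distrib_right, auto simp: lincomb_def)

lemma polyW_lincomb:
  "f \<in> polyW n1 n2 n3 \<Longrightarrow> \<exists>cs. (\<forall>(c, K)\<in>set cs. \<forall>v\<in>set K. okcoord n1 n2 n3 v) \<and> (\<forall>w. f w = lincomb cs w)"
proof (induction rule: polyW.induct)
  case (const c)
  show ?case by (rule exI[of _ "[(c, [])]"]) (simp add: lincomb_def)
next
  case (xcoord j a)
  then show ?case by (intro exI[of _ "[(1, [CX j a])]"]) (simp add: lincomb_def mon_def)
next
  case (ycoord k a b)
  then show ?case by (intro exI[of _ "[(1, [CY k a b])]"]) (simp add: lincomb_def mon_def)
next
  case (zcoord l a b c)
  then show ?case by (intro exI[of _ "[(1, [CZ l a b c])]"]) (simp add: lincomb_def mon_def)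
next
  case (add f h)
  then obtain cs ds where "\<forall>(c, K)\<in>set cs. \<forall>v\<in>set K. okcoord n1 n2 n3 v" "\<forall>w. f w = lincomb cs w"
    "\<forall>(c, K)\<in>set ds. \<forall>v\<in>set K. okcoord n1 n2 n3 v" "\<forall>w. h w = lincomb ds w" by blast
  then show ?case by (intro exI[of _ "cs @ ds"]) (auto simp: lincomb_append)
next
  case (mult f h)
  then obtain cs ds where h: "\<forall>(c, K)\<in>set cs. \<forall>v\<in>set K. okcoord n1 n2 n3 v" "\<forall>w. f w = lincomb cs w"
    "\<forall>(c, K)\<in>set ds. \<forall>v\<in>set K. okcoord n1 n2 n3 v" "\<forall>w. h w = lincomb ds w" by blast
  let ?es = "concat (map (\<lambda>(c, K). map (\<lambda>(d, L). (c * d, K @ L)) ds) cs)"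
  have "\<forall>(c, K)\<in>set ?es. \<forall>v\<in>set K. okcoord n1 n2 n3 v" using h(1,3) by fastforce
  then show ?case using h(2,4) by (intro exI[of _ ?es]) (simp add: lincomb_product)
qed

fun isX :: "coord \<Rightarrow> bool" where "isX (CX j a) = True" | "isX _ = False"
fun isY :: "coord \<Rightarrow> bool" where "isY (CY k a b) = True" | "isY _ = False"
fun isZ :: "coord \<Rightarrow> bool" where "isZ (CZ l a b c) = True" | "isZ _ = False"

text \<open>Only the kinds are separated, giving the order vectors, bivectors, trivectors in which
  \<open>con_in_R\<close> contracts.\<close>

definition msort :: "coord list \<Rightarrow> coord list" where
  "msort K = filter isX K @ filter isY K @ filter isZ K"

lemma mon_msort: "mon (msort K) w = mon K w"
proof (induction K)
  case (Cons v K)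
  then show ?case by (cases v) (simp_all add: msort_def mon_append mon_Cons)
qed (simp add: msort_def)

lemma set_msort: "set (msort K) = set K"
proof -
  have "isX v \<or> isY v \<or> isZ v" for v by (cases v) auto
  then show ?thesis by (auto simp: msort_def)
qed

lemma sym_msort:
  assumes "\<forall>v\<in>set K. okcoord n1 n2 n3 v"
  shows "\<exists>js ks ls. set js \<subseteq> {1..n1} \<and> set ks \<subseteq> {1..n2} \<and> set ls \<subseteq> {1..n3} \<and> map sym_of (msort K) = map SX js @ map SY ks @ map SZ ls
     \<and> length (idx (msort K)) = length js + 2 * length ks + 3 * length ls"
proof -
  have "\<exists>js. set js \<subseteq> {1..n1} \<and> map sym_of (filter isX K) = map SX js \<and> length (idx (filter isX K)) = length js"
    using assms
  proof (induction K)
    case (Cons v K)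
    then obtain js where js: "set js \<subseteq> {1..n1}" "map sym_of (filter isX K) = map SX js" "length (idx (filter isX K)) = length js" by auto
    show ?case
    proof (cases v)
      case (CX j a)
      then show ?thesis using js Cons.prems by (intro exI[of _ "j # js"]) (auto simp: idx_def)
    qed (use js in \<open>auto simp: idx_def\<close>)
  qed (simp add: idx_def)
  moreover have "\<exists>ks. set ks \<subseteq> {1..n2} \<and> map sym_of (filter isY K) = map SY ks \<and> length (idx (filter isY K)) = 2 * length ks"
    using assms
  proof (induction K)
    case (Cons v K)
    then obtain ks where ks: "set ks \<subseteq> {1..n2}" "map sym_of (filter isY K) = map SY ks" "length (idx (filter isY K)) = 2 * length ks" by auto
    show ?case
    proof (cases v)
      case (CY k a b)
      then show ?thesis using ks Cons.prems by (intro exI[of _ "k # ks"]) (auto simp: idx_def)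
    qed (use ks in \<open>auto simp: idx_def\<close>)
  qed (simp add: idx_def)
  moreover have "\<exists>ls. set ls \<subseteq> {1..n3} \<and> map sym_of (filter isZ K) = map SZ ls \<and> length (idx (filter isZ K)) = 3 * length ls"
    using assms
  proof (induction K)
    case (Cons v K)
    then obtain ls where ls: "set ls \<subseteq> {1..n3}" "map sym_of (filter isZ K) = map SZ ls" "length (idx (filter isZ K)) = 3 * length ls" by auto
    show ?case
    proof (cases v)
      case (CZ l a b c)
      then show ?thesis using ls Cons.prems by (intro exI[of _ "l # ls"]) (auto simp: idx_def)
    qed (use ls in \<open>auto simp: idx_def\<close>)
  qed (simp add: idx_def)
  ultimately obtain js ks ls where h: "set js \<subseteq> {1..n1}" "map sym_of (filter isX K) = map SX js" "length (idx (filter isX K)) = length js"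
    "set ks \<subseteq> {1..n2}" "map sym_of (filter isY K) = map SY ks" "length (idx (filter isY K)) = 2 * length ks"
    "set ls \<subseteq> {1..n3}" "map sym_of (filter isZ K) = map SZ ls" "length (idx (filter isZ K)) = 3 * length ls" by blast
  have i: "idx (A @ B) = idx A @ idx B" for A B by (simp add: idx_def)
  show ?thesis
    by (intro exI[of _ js] exI[of _ ks] exI[of _ ls]) (use h in \<open>simp add: msort_def i\<close>)
qed

lemma polyW_repr:
  assumes "f \<in> polyW n1 n2 n3"
  obtains N :: nat and c K where "\<And>t v. t < N \<Longrightarrow> v \<in> set (K t) \<Longrightarrow> okcoord n1 n2 n3 v" "\<And>w. f w = (\<Sum>t<N. c t * mon (msort (K t)) w)"
proof -
  obtain cs where cs: "\<forall>(c, K)\<in>set cs. \<forall>v\<in>set K. okcoord n1 n2 n3 v" "\<forall>w. f w = lincomb cs w"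
    using polyW_lincomb[OF assms] by blast
  show ?thesis
  proof (rule that[of "length cs" "\<lambda>t. snd (cs ! t)" "\<lambda>t. fst (cs ! t)"])
    fix t v assume "t < length cs" "v \<in> set (snd (cs ! t))"
    then show "okcoord n1 n2 n3 v" using cs(1) nth_mem[of t cs] by fastforce
  next
    fix w
    show "f w = (\<Sum>t<length cs. fst (cs ! t) * mon (msort (snd (cs ! t))) w)"
      unfolding mon_msort using cs(2)[rule_format, of w] by (simp add: lincomb_def sum_list_sum_nth case_prod_unfold atLeast0LessThan)
  qed
qed

section \<open>Weights and scalar matrices\<close>

definition wsc :: "complex \<Rightarrow> pt \<Rightarrow> pt" where
  "wsc s w = ((\<lambda>j a. s * X w j a), (\<lambda>k a b. s ^ 2 * Y w k a b), (\<lambda>l a b c. s ^ 3 * Z w l a b c))"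

lemma wsc_coords [simp]:
  "X (wsc s w) j a = s * X w j a" "Y (wsc s w) k a b = s ^ 2 * Y w k a b" "Z (wsc s w) l a b c = s ^ 3 * Z w l a b c"
  by (simp_all add: wsc_def X_def Y_def Z_def)

lemma act_coords:
  "X (act g w) j a = (\<Sum>b\<in>I4. g a b * X w j b)"
  "Y (act g w) k a b = (\<Sum>c\<in>I4. \<Sum>d\<in>I4. g a c * g b d * yA w k c d)"
  "Z (act g w) l a b c = (\<Sum>d\<in>I4. \<Sum>e\<in>I4. \<Sum>f\<in>I4. g a d * g b e * g c f * zA w l d e f)"
  by (simp_all add: act_def X_def Y_def Z_def)

lemma yA_wsc: "yA (wsc s w) k a b = s ^ 2 * yA w k a b"
  and zA_wsc: "zA (wsc s w) l a b c = s ^ 3 * zA w l a b c"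
  by (simp_all add: yA_def zA_def)

lemma mon_wsc: "mon K (wsc s w) = s ^ length (idx K) * mon K w"
proof (induction K)
  case (Cons v K)
  then show ?case by (cases v) (simp_all add: mon_Cons idx_def power2_eq_square power3_eq_cube)
qed (simp add: idx_def)

lemma pt_eqI:
  assumes "\<And>j a. X w j a = X w' j a" "\<And>k a b. Y w k a b = Y w' k a b" "\<And>l a b c. Z w l a b c = Z w' l a b c"
  shows "w = w'"
  using assms unfolding X_def Y_def Z_def by (intro prod_eqI ext) auto

lemma act_wsc: "act g (wsc s w) = wsc s (act g w)"
  by (rule pt_eqI) (simp_all add: act_coords yA_wsc zA_wsc sum_distrib_left mult.left_commute)

text \<open>A tensor with m indices picks up the m-th power of s, so scalar matrices act through the
  weights 1, 2 and 3.\<close>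

lemma act_smult: "act (\<lambda>a b. s * g a b) w = wsc s (act g w)"
  by (rule pt_eqI) (simp_all add: act_coords sum_distrib_left power2_eq_square power3_eq_cube ac_simps)

text \<open>\<open>act ev w\<close> may differ from w in the padding entries, for instance at
  unsorted indices; on genuine coordinates the identity matrix acts trivially.\<close>

lemma cval_act_id: "okcoord n1 n2 n3 v \<Longrightarrow> cval (act ev w) v = cval w v"
proof (cases v)
  case (CX j a)
  assume "okcoord n1 n2 n3 v"
  then show ?thesis using CX by (simp add: act_coords sum_ev_left)
next
  case (CY k a b)
  assume "okcoord n1 n2 n3 v"
  then have h: "a \<in> I4" "b \<in> I4" "a < b" using CY by (auto simp: I4_def)
  have "Y (act ev w) k a b = (\<Sum>c\<in>I4. ev a c * (\<Sum>d\<in>I4. ev b d * yA w k c d))"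
    by (simp add: act_coords sum_distrib_left mult.assoc)
  also have "\<dots> = yA w k a b" using h by (simp add: sum_ev_left)
  also have "\<dots> = Y w k a b" using h by (simp add: yA_def min_def max_def)
  finally show ?thesis using CY by simp
next
  case (CZ l a b c)
  assume "okcoord n1 n2 n3 v"
  then have h: "a \<in> I4" "b \<in> I4" "c \<in> I4" "a < b" "b < c" using CZ by (auto simp: I4_def)
  have "Z (act ev w) l a b c = (\<Sum>d\<in>I4. ev a d * (\<Sum>e\<in>I4. ev b e * (\<Sum>f\<in>I4. ev c f * zA w l d e f)))"
    by (simp add: act_coords sum_distrib_left mult.assoc)
  also have "\<dots> = zA w l a b c" using h by (simp add: sum_ev_left)
  also have "\<dots> = Z w l a b c" using h by (simp add: zA_def min_def max_def)
  finally show ?thesis using CZ by simp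
qed

lemma mon_act_id: "(\<And>v. v \<in> set K \<Longrightarrow> okcoord n1 n2 n3 v) \<Longrightarrow> mon K (act ev w) = mon K w"
  unfolding mon_def by (intro arg_cong[of _ _ prod_list] map_cong refl cval_act_id)

lemma detN4_smult: "detN 4 (\<lambda>a b. s * g a b) = s ^ 4 * detN 4 g"
  unfolding detN4 det4_explicit by algebra

lemma detN4_ev: "detN 4 ev = 1"
  unfolding detN4 det4_explicit by (simp add: ev_def)

lemma quartic_root: "\<exists>s::complex. s ^ 4 = d"
proof
  have "x ^ 4 = (x\<^sup>2)\<^sup>2" for x :: complex by (simp flip: power_mult)
  then show "csqrt (csqrt d) ^ 4 = d" by (simp only: power2_csqrt)
qed

text \<open>Serves to extend an identity along a line of matrices from the invertible ones to
  all.\<close>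

definition polyfn :: "(complex \<Rightarrow> complex) \<Rightarrow> bool" where
  "polyfn F \<longleftrightarrow> (\<exists>q. \<forall>t. F t = poly q t)"

lemma polyfn_const: "polyfn (\<lambda>t. c)"
  unfolding polyfn_def by (intro exI[of _ "[:c:]"]) simp

lemma polyfn_id: "polyfn (\<lambda>t. t)"
  unfolding polyfn_def by (intro exI[of _ "[:0, 1:]"]) simp

lemma polyfn_add: "polyfn F \<Longrightarrow> polyfn G \<Longrightarrow> polyfn (\<lambda>t. F t + G t)"
  unfolding polyfn_def by (metis poly_add)

lemma polyfn_mult: "polyfn F \<Longrightarrow> polyfn G \<Longrightarrow> polyfn (\<lambda>t. F t * G t)"
  unfolding polyfn_def by (metis poly_mult)

lemma polyfn_diff: "polyfn F \<Longrightarrow> polyfn G \<Longrightarrow> polyfn (\<lambda>t. F t - G t)"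
  unfolding polyfn_def by (metis poly_diff)

lemma polyfn_power: "polyfn F \<Longrightarrow> polyfn (\<lambda>t. F t ^ n)"
  unfolding polyfn_def by (metis poly_power)

lemma polyfn_sum: "(\<And>x. x \<in> A \<Longrightarrow> polyfn (\<lambda>t. F x t)) \<Longrightarrow> polyfn (\<lambda>t. \<Sum>x\<in>A. F x t)"
  by (induction A rule: infinite_finite_induct) (simp_all add: polyfn_const polyfn_add)

lemma polyfn_prod: "(\<And>x. x \<in> A \<Longrightarrow> polyfn (\<lambda>t. F x t)) \<Longrightarrow> polyfn (\<lambda>t. \<Prod>x\<in>A. F x t)"
  by (induction A rule: infinite_finite_induct) (simp_all add: polyfn_const polyfn_mult)

lemmas polyfn_intros = polyfn_const polyfn_id polyfn_add polyfn_mult polyfn_diff polyfn_power polyfn_sum polyfn_prod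

lemma polyfn_mon:
  assumes "\<And>a b. polyfn (\<lambda>t. g t a b)"
  shows "polyfn (\<lambda>t. mon K (act (g t) w))"
proof (induction K)
  case (Cons v K)
  have "polyfn (\<lambda>t. cval (act (g t) w) v)"
    by (cases v) (simp_all add: act_coords polyfn_intros assms)
  then show ?case using Cons by (simp add: mon_Cons polyfn_mult)
qed (simp add: polyfn_const)

lemma polyfn_detN: "(\<And>a b. polyfn (\<lambda>t. g t a b)) \<Longrightarrow> polyfn (\<lambda>t. detN n (g t))"
  unfolding detN_def by (intro polyfn_intros)

context path_algebra
begin

lemma R_sum: "(\<And>t. t \<in> D \<Longrightarrow> f t \<in> R) \<Longrightarrow> (\<lambda>w. \<Sum>t\<in>D. f t w) \<in> R"
  by (induction D rule: infinite_finite_induct) (simp_all add: R_const R_add)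

theorem invariants_in_R:
  assumes "f \<in> invW n1 n2 n3"
  shows "f \<in> R"
proof -
  have inv: "f (act g w) = f w" if "detN 4 g = 1" for g w using assms that unfolding invW_def by blast
  have fp: "f \<in> polyW n1 n2 n3" using assms unfolding invW_def by blast
  obtain N :: nat and c K0 where K0: "\<And>t v. t < N \<Longrightarrow> v \<in> set (K0 t) \<Longrightarrow> okcoord n1 n2 n3 v"
    and f0: "\<And>w. f w = (\<Sum>t<N. c t * mon (msort (K0 t)) w)"
    by (rule polyW_repr[OF fp]) blast
  define K where "K t = msort (K0 t)" for t
  have f: "f w = (\<Sum>t<N. c t * mon (K t) w)" for w using f0 by (simp add: K_def)
  have okK: "okcoord n1 n2 n3 v" if "t < N" "v \<in> set (K t)" for t v
    using that K0 by (simp add: K_def set_msort)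
  \<comment> \<open>Decomposition by weight: \<open>F m\<close> is the part of f of weight
    m.\<close>
  define D where "D m = {t \<in> {..<N}. length (idx (K t)) = m}" for m
  define F where "F m w = (\<Sum>t\<in>D m. c t * mon (K t) w)" for m w
  define M where "M = (\<Sum>t<N. length (idx (K t)))"
  have finD: "finite (D m)" for m by (simp add: D_def)
  have lenM: "(\<lambda>t. length (idx (K t))) ` {..<N} \<subseteq> {..M}"
    unfolding M_def by (auto intro: member_le_sum[of _ "{..<N}" "\<lambda>t. length (idx (K t))"])
  have grade: "f (wsc s w) = (\<Sum>m\<le>M. F m w * s ^ m)" for s w
  proof -
    have "f (wsc s w) = (\<Sum>t<N. c t * mon (K t) w * s ^ length (idx (K t)))"
      unfolding f mon_wsc by (intro sum.cong refl) simp
    also have "\<dots> = (\<Sum>m\<le>M. \<Sum>t\<in>D m. c t * mon (K t) w * s ^ length (idx (K t)))"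
      unfolding D_def by (rule sum.group[symmetric]) (use lenM in auto)
    also have "\<dots> = (\<Sum>m\<le>M. \<Sum>t\<in>D m. c t * mon (K t) w * s ^ m)"
      by (intro sum.cong refl) (simp add: D_def)
    finally show ?thesis by (simp add: F_def sum_distrib_right)
  qed
  \<comment> \<open>Both sides are coefficients of polynomials in s that agree for all s, so the
    invariance of f passes to every weight component.\<close>
  have Finv: "F m (act g w) = F m w" if "m \<le> M" "detN 4 g = 1" for m g w
  proof -
    have "\<forall>s. (\<Sum>m\<le>M. F m (act g w) * s ^ m) = (\<Sum>m\<le>M. F m w * s ^ m)"
      using inv[OF that(2)] unfolding grade[symmetric] act_wsc[symmetric] by simp
    then show ?thesis using that(1) by (subst (asm) polyfun_eq_coeffs) simp
  qed
  have Fwsc: "F m (wsc s w) = s ^ m * F m w" for m s w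
    unfolding F_def mon_wsc sum_distrib_left by (intro sum.cong refl) (simp add: D_def)
  have Fid: "F m (act ev w) = F m w" for m w
    unfolding F_def by (intro sum.cong refl arg_cong2[of _ _ _ _ times] mon_act_id[of _ n1 n2 n3]) (auto simp: D_def okK)
  have comp: "F m \<in> R" if m: "m \<le> M" for m
  proof (cases "4 dvd m")
    case False
    \<comment> \<open>The scalar matrix \<i> has determinant one and multiplies weight m by the m-th
      power of \<i>, so components of weight not divisible by 4 vanish.\<close>
    have "\<i> ^ m \<noteq> 1"
    proof -
      have "m mod 4 = 1 \<or> m mod 4 = 2 \<or> m mod 4 = 3" using False by presburger
      moreover have "\<i> ^ m = \<i> ^ (m mod 4)"
      proof -
        have "\<i> ^ m = \<i> ^ (4 * (m div 4) + m mod 4)" by simp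
        then show ?thesis unfolding power_add power_mult by simp
      qed
      ultimately show ?thesis by (auto simp: power3_eq_cube complex_eq_iff)
    qed
    moreover have "F m w = \<i> ^ m * F m w" for w
    proof -
      have "detN 4 (\<lambda>a b. \<i> * ev a b) = 1" unfolding detN4_smult detN4_ev by simp
      then have "F m w = F m (act (\<lambda>a b. \<i> * ev a b) w)" using Finv[OF m] by simp
      then show ?thesis unfolding act_smult Fwsc Fid .
    qed
    ultimately have "F m w = 0" for w
      by (metis mult_cancel_right1)
    then have "F m = (\<lambda>w. 0)" by (intro ext)
    then show ?thesis by (simp add: R_const)
  next
    case True
    then obtain p where p: "m = 4 * p" by blast
    \<comment> \<open>A fourth root of the determinant splits off a scalar matrix and leaves a
      matrix of determinant one.\<close>
    have regular: "F m (act g w) = detN 4 g ^ p * F m w" if "detN 4 g \<noteq> 0" for g w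
    proof -
      obtain s where s: "s ^ 4 = detN 4 g" using quartic_root by blast
      then have s0: "s \<noteq> 0" using that by auto
      define h where "h = (\<lambda>a b. inverse s * g a b)"
      have "detN 4 h = 1" unfolding h_def detN4_smult using s that by (simp add: power_inverse)
      moreover have "g = (\<lambda>a b. s * h a b)" unfolding h_def using s0 by (intro ext) simp
      then have "act g w = wsc s (act h w)" using act_smult[of s h w] by simp
      ultimately have "F m (act g w) = s ^ m * F m w" using Finv[OF m] by (simp add: Fwsc)
      then show ?thesis unfolding p power_mult s .
    qed
    \<comment> \<open>On the line from the identity to g, the difference of the two sides times the
      determinant vanishes identically. The determinant is 1 at t = 0, so the difference is the zero
      polynomial, and t = 1 gives the claim.\<close>
    have all: "F m (act g w) = detN 4 g ^ p * F m w" for g w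
    proof -
      define h where "h t a b = (1 - t) * ev a b + t * g a b" for t a b
      have h: "polyfn (\<lambda>t. h t a b)" for a b unfolding h_def by (intro polyfn_intros)
      have "polyfn (\<lambda>t. F m (act (h t) w) - detN 4 (h t) ^ p * F m w)"
        unfolding F_def by (intro polyfn_intros polyfn_mon polyfn_detN h)
      then obtain q1 where q1: "\<And>t. F m (act (h t) w) - detN 4 (h t) ^ p * F m w = poly q1 t" unfolding polyfn_def by blast
      obtain q2 where q2: "\<And>t. detN 4 (h t) = poly q2 t" using polyfn_detN[of h 4] h unfolding polyfn_def by blast
      have "poly (q1 * q2) t = 0" for t
        using regular[of "h t" w] by (cases "detN 4 (h t) = 0") (simp_all flip: q1 q2)
      then have "q1 * q2 = 0" using poly_all_0_iff_0[of "q1 * q2"] by blast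
      moreover have "h 0 = ev" unfolding h_def by (intro ext) simp
      then have "poly q2 0 = 1" using q2[of 0] detN4_ev by simp
      then have "q2 \<noteq> 0" by auto
      ultimately have "q1 = 0" by simp
      moreover have "h 1 = g" unfolding h_def by (intro ext) simp
      ultimately show ?thesis using q1[of 1] by simp
    qed
    define C where "C = Lam p (\<lambda>g. detN 4 g ^ p)"
    have C: "C \<noteq> 0" unfolding C_def by (rule Lam_det_power_nonzero)
    let ?P = "{\<tau>. \<tau> permutes {..<4 * p}}"
    let ?d = "\<lambda>t \<tau>. if \<forall>r<4 * p. idx (K t) ! r = rowi (\<tau> r) then 1 else (0::complex)"
    let ?G = "\<lambda>t \<tau> w. con (map sym_of (K t)) 0 (block_det p (inv \<tau>)) (\<lambda>i j. 0) w"
    have Lmon: "Lam p (\<lambda>g. mon (K t) (act g w)) = (\<Sum>\<tau>\<in>?P. ?d t \<tau> * ?G t \<tau> w)" if "t \<in> D m" for t w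
    proof -
      have len: "length (idx (K t)) = 4 * p" using that p by (simp add: D_def)
      have "Lam p (\<lambda>g. mon (K t) (act g w))
        = con (map sym_of (K t)) 0 (\<lambda>u w. Lam p (\<lambda>g. \<Prod>r<4 * p. \<Sum>b\<in>I4. g (idx (K t) ! r) b * u r b)) (\<lambda>i j. 0) w"
        unfolding mon_act[of _ _ _ "\<lambda>i j. 0"] len by (rule Lam_con)
      also have "\<dots> = con (map sym_of (K t)) 0 (\<lambda>u w. \<Sum>\<tau>\<in>?P. ?d t \<tau> * block_det p (inv \<tau>) u w) (\<lambda>i j. 0) w"
        by (intro arg_cong[where f = "\<lambda>\<Phi>. con (map sym_of (K t)) 0 \<Phi> (\<lambda>i j. 0) w"] ext Lam_vectors)
      also have "\<dots> = (\<Sum>\<tau>\<in>?P. ?d t \<tau> * ?G t \<tau> w)"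
        by (rule con_sum) (simp add: finite_permutations)
      finally show ?thesis .
    qed
    \<comment> \<open>The functional, applied in the variable g to
      \<open>F m (act g w) = detN 4 g ^ p * F m w\<close>, produces C times \<open>F m\<close> on
      one side and complete contractions on the other.\<close>
    have key: "C * F m w = (\<Sum>t\<in>D m. c t * (\<Sum>\<tau>\<in>?P. ?d t \<tau> * ?G t \<tau> w))" for w
    proof -
      have "C * F m w = F m w * Lam p (\<lambda>g. detN 4 g ^ p)" by (simp add: C_def)
      also have "\<dots> = Lam p (\<lambda>g. F m w * detN 4 g ^ p)" by (rule Lam_scale[symmetric])
      also have "\<dots> = Lam p (\<lambda>g. F m (act g w))" unfolding all by (simp only: mult.commute)
      also have "\<dots> = (\<Sum>t\<in>D m. c t * Lam p (\<lambda>g. mon (K t) (act g w)))" unfolding F_def by (rule Lam_sum)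
      also have "\<dots> = (\<Sum>t\<in>D m. c t * (\<Sum>\<tau>\<in>?P. ?d t \<tau> * ?G t \<tau> w))"
        by (intro sum.cong refl arg_cong2[of _ _ _ _ times] Lmon)
      finally show ?thesis .
    qed
    have GR: "?G t \<tau> \<in> R" if t: "t \<in> D m" and tau: "\<tau> permutes {..<4 * p}" for t \<tau>
    proof -
      have tN: "t < N" and len: "length (idx (K t)) = 4 * p" using t p by (auto simp: D_def)
      have "\<forall>v\<in>set (K0 t). okcoord n1 n2 n3 v" using K0[OF tN] by blast
      from sym_msort[OF this] obtain js ks ls where h: "set js \<subseteq> {1..n1}" "set ks \<subseteq> {1..n2}" "set ls \<subseteq> {1..n3}"
        "map sym_of (K t) = map SX js @ map SY ks @ map SZ ls" "4 * p = length js + 2 * length ks + 3 * length ls"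
        using len unfolding K_def by auto
      have i: "inv \<tau> permutes {..<4 * p}" by (rule permutes_inv[OF tau])
      have "forms False (inv \<tau> ` {..<4 * p}) (block_det p (inv \<tau>))"
        by (rule forms_block_det[OF permutes_inj_on[OF i]])
      then have "forms False {..<length js + 2 * length ks + 3 * length ls} (block_det p (inv \<tau>))"
        unfolding permutes_image[OF i] unfolding h(5) .
      then show ?thesis unfolding h(4) by (rule con_in_R[OF h(1-3)])
    qed
    have "(\<lambda>w. (1 / C) * (\<Sum>t\<in>D m. c t * (\<Sum>\<tau>\<in>?P. ?d t \<tau> * ?G t \<tau> w))) \<in> R"
      by (intro R_smult R_sum) (use GR in auto)
    moreover have "F m = (\<lambda>w. (1 / C) * (\<Sum>t\<in>D m. c t * (\<Sum>\<tau>\<in>?P. ?d t \<tau> * ?G t \<tau> w)))"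
      unfolding key[symmetric] using C by (intro ext) simp
    ultimately show ?thesis by simp
  qed
  have "f w = (\<Sum>m\<le>M. F m w)" for w
  proof -
    have "wsc 1 w = w" by (rule pt_eqI) simp_all
    then show ?thesis using grade[of 1 w] by simp
  qed
  then have "f = (\<lambda>w. \<Sum>m\<le>M. F m w)" by (intro ext)
  then show ?thesis using R_sum[of "{..M}" F] comp by simp
qed

end

subsection \<open>The listed invariants as words\<close>

lemma eps_rotate: "eps a b c p = eps a p b c" "eps a b c p = - eps p a b c"
  using eps_swap34[of a b p c] eps_swap23[of a p b c] eps_swap12[of p a b c] by simp_all

lemma dualy_alt: "dualy y a p = (\<Sum>b\<in>I4. \<Sum>c\<in>I4. eps a b c p * y b c)"
  unfolding dualy_def
proof (intro sum.cong refl)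
  fix b c
  show "eps a p b c * y b c = eps a b c p * y b c" using eps_rotate(1)[of a b c p] by simp
qed

lemma contract_start_x:
  "(\<Sum>a\<in>I4. \<Sum>b\<in>I4. \<Sum>c\<in>I4. \<Sum>p\<in>I4. eps a b c p * x a * y b c * B p) = (\<Sum>a\<in>I4. x a * (\<Sum>p\<in>I4. dualy y a p * B p))"
proof (rule sum.cong[OF refl])
  fix a
  have "(\<Sum>b\<in>I4. \<Sum>c\<in>I4. \<Sum>p\<in>I4. eps a b c p * x a * y b c * B p) = (\<Sum>p\<in>I4. \<Sum>b\<in>I4. \<Sum>c\<in>I4. x a * (eps a b c p * y b c * B p))"
    by (simp only: sum_I4 ac_simps)
  then show "(\<Sum>b\<in>I4. \<Sum>c\<in>I4. \<Sum>p\<in>I4. eps a b c p * x a * y b c * B p) = x a * (\<Sum>p\<in>I4. dualy y a p * B p)"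
    unfolding dualy_alt by (simp only: sum_distrib_left sum_distrib_right)
qed

lemma contract_mid:
  "(\<Sum>d\<in>I4. \<Sum>e\<in>I4. \<Sum>r\<in>I4. eps q d e r * y d e * B r) = (\<Sum>r\<in>I4. dualy y q r * B r)"
proof -
  have "(\<Sum>d\<in>I4. \<Sum>e\<in>I4. \<Sum>r\<in>I4. eps q d e r * y d e * B r) = (\<Sum>r\<in>I4. \<Sum>d\<in>I4. \<Sum>e\<in>I4. eps q d e r * y d e * B r)"
    by (simp only: sum_I4 ac_simps)
  then show ?thesis unfolding dualy_alt by (simp only: sum_distrib_right)
qed

lemma contract_end_x:
  "(\<Sum>d\<in>I4. \<Sum>e\<in>I4. \<Sum>f\<in>I4. eps q d e f * x d * y e f) = (\<Sum>d\<in>I4. dualy y q d * x d)"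
  unfolding dualy_def sum_distrib_right by (simp only: ac_simps)

lemma contract_start_z:
  "(\<Sum>a\<in>I4. \<Sum>b\<in>I4. \<Sum>c\<in>I4. \<Sum>p\<in>I4. eps a b c p * z a b c * B p) = - (\<Sum>p\<in>I4. dualz z p * B p)"
proof -
  have "(\<Sum>a\<in>I4. \<Sum>b\<in>I4. \<Sum>c\<in>I4. \<Sum>p\<in>I4. eps a b c p * z a b c * B p)
      = (\<Sum>a\<in>I4. \<Sum>b\<in>I4. \<Sum>p\<in>I4. \<Sum>c\<in>I4. eps a b c p * z a b c * B p)"
    by (intro sum.cong refl sum.swap)
  also have "\<dots> = (\<Sum>a\<in>I4. \<Sum>p\<in>I4. \<Sum>b\<in>I4. \<Sum>c\<in>I4. eps a b c p * z a b c * B p)"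
    by (intro sum.cong refl sum.swap)
  also have "\<dots> = (\<Sum>p\<in>I4. \<Sum>a\<in>I4. \<Sum>b\<in>I4. \<Sum>c\<in>I4. eps a b c p * z a b c * B p)"
    by (rule sum.swap)
  also have "\<dots> = (\<Sum>p\<in>I4. \<Sum>a\<in>I4. \<Sum>b\<in>I4. \<Sum>c\<in>I4. - (eps p a b c * z a b c * B p))"
  proof (intro sum.cong refl)
    fix p a b c
    show "eps a b c p * z a b c * B p = - (eps p a b c * z a b c * B p)" using eps_rotate(2)[of a b c p] by simp
  qed
  finally show ?thesis unfolding dualz_def by (simp only: sum_negf sum_distrib_right)
qed

lemma contract_end_x':
  "(\<Sum>s\<in>I4. \<Sum>f\<in>I4. \<Sum>g\<in>I4. \<Sum>t\<in>I4. eps s f g t * x s * y f g * B t) = - (\<Sum>t\<in>I4. B t * (\<Sum>s\<in>I4. dualy y t s * x s))"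
proof -
  have d: "dualy y s t = - dualy y t s" for s t using alt2_dualy unfolding alt2_def by blast
  have "(\<Sum>s\<in>I4. x s * (\<Sum>t\<in>I4. dualy y s t * B t)) = (\<Sum>t\<in>I4. \<Sum>s\<in>I4. x s * (dualy y s t * B t))"
    unfolding sum_distrib_left by (rule sum.swap)
  also have "\<dots> = (\<Sum>t\<in>I4. \<Sum>s\<in>I4. - (B t * (dualy y t s * x s)))"
  proof (intro sum.cong refl)
    fix t s
    show "x s * (dualy y s t * B t) = - (B t * (dualy y t s * x s))" using d[of s t] by simp
  qed
  finally show ?thesis unfolding contract_start_x by (simp only: sum_negf sum_distrib_left)
qed

text \<open>A word applied to a column vector; with it the listed contractions collapse from the
  right, one tensor at a time.\<close>

definition wv :: "bool \<Rightarrow> nat list \<Rightarrow> pt \<Rightarrow> (nat \<Rightarrow> complex) \<Rightarrow> nat \<Rightarrow> complex" where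
  "wv t ks w q a = (\<Sum>b\<in>I4. wd t ks w a b * q b)"

lemma bil_wv: "bil p (wd t ks w) q = (\<Sum>a\<in>I4. p a * wv t ks w q a)"
  unfolding wv_def bil_def by (simp only: sum_distrib_left mult.assoc)

lemma wv_Nil: "a \<in> I4 \<Longrightarrow> wv t [] w q a = q a"
  by (simp add: wv_def sum_ev_left)

lemma wv_Cons: "wv t (k # ks) w q a = (\<Sum>c\<in>I4. letter t w k a c * wv (\<not> t) ks w q c)"
proof -
  have "wv t (k # ks) w q a = (\<Sum>b\<in>I4. \<Sum>c\<in>I4. letter t w k a c * (wd (\<not> t) ks w c b * q b))"
    unfolding wv_def wd.simps sum_distrib_right by (simp only: mult.assoc)
  also have "\<dots> = (\<Sum>c\<in>I4. \<Sum>b\<in>I4. letter t w k a c * (wd (\<not> t) ks w c b * q b))" by (rule sum.swap)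
  finally show ?thesis unfolding wv_def by (simp only: sum_distrib_left)
qed

lemma wv_single: "wv t [k] w q a = (\<Sum>c\<in>I4. letter t w k a c * q c)"
  unfolding wv_Cons by (intro sum.cong refl) (simp add: wv_Nil)

lemma letterT: "letter True w k = dualy (yA w k)" and letterF: "letter False w k = yA w k"
  by (simp_all add: letter_def)

lemmas wv_unfold = wv_Cons[of _ _ "_ # _"] wv_single letterT letterF not_True_eq_False not_False_eq_True

lemma inv5_word: "inv5 j l w = bil (X w j) (wd True [] w) (zeta w l)"
  unfolding inv5_def bil_wd_Nil dot_def zeta_def dualz_def by (simp add: sum_distrib_left ac_simps)

lemma inv6_word: "inv6 j1 j2 k w = bil (X w j1) (wd True [k] w) (X w j2)"
  unfolding bil_wd_single letterT unfolding inv6_def bil_def dualy_def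
  by (simp only: sum_distrib_left sum_distrib_right ac_simps)

lemma inv3_word: "inv3 k1 k2 w = - (\<Sum>a\<in>I4. wd False [k1, k2] w a a)"
proof -
  have "(\<Sum>a\<in>I4. wd False [k1, k2] w a a) = (\<Sum>a\<in>I4. \<Sum>b\<in>I4. letter False w k1 a b * letter True w k2 b a)"
    by (intro sum.cong refl) (use wd2[of _ False] in simp)
  also have "\<dots> = (\<Sum>a\<in>I4. \<Sum>b\<in>I4. - (yA w k1 a b * dualy (yA w k2) a b))"
  proof (intro sum.cong refl)
    fix a b
    have "dualy (yA w k2) b a = - dualy (yA w k2) a b" using alt2_dualy unfolding alt2_def by blast
    then show "letter False w k1 a b * letter True w k2 b a = - (yA w k1 a b * dualy (yA w k2) a b)"
      by (simp add: letter_def)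
  qed
  finally show ?thesis unfolding dualy_def inv3_def by (simp add: sum_negf sum_distrib_left ac_simps)
qed

lemma inv7a_word: "inv7a j j' k1 k2 k3 w = bil (X w j) (wd True [k1, k2, k3] w) (X w j')"
proof -
  have "inv7a j j' k1 k2 k3 w = (\<Sum>a\<in>I4. \<Sum>b\<in>I4. \<Sum>c\<in>I4. \<Sum>p\<in>I4. eps a b c p * X w j a * yA w k1 b c *
     (\<Sum>q\<in>I4. yA w k2 p q * (\<Sum>d\<in>I4. \<Sum>e\<in>I4. \<Sum>f\<in>I4. eps q d e f * X w j' d * yA w k3 e f)))"
    unfolding inv7a_def by (simp only: sum_distrib_left ac_simps)
  also have "\<dots> = bil (X w j) (wd True [k1, k2, k3] w) (X w j')"
    unfolding contract_end_x contract_start_x bil_wv wv_unfold ..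
  finally show ?thesis .
qed

text \<open>The last symbol is entered through its final index t instead of its first one; turning
  the alternating dual letter around gives the minus sign.\<close>

lemma inv7b_word: "inv7b j1 j2 k1 k2 k3 k4 k5 w = - bil (X w j1) (wd True [k1, k2, k3, k4, k5] w) (X w j2)"
proof -
  have "inv7b j1 j2 k1 k2 k3 k4 k5 w = (\<Sum>a\<in>I4. \<Sum>b\<in>I4. \<Sum>c\<in>I4. \<Sum>p\<in>I4. eps a b c p * X w j1 a * yA w k1 b c *
     (\<Sum>q\<in>I4. yA w k2 p q * (\<Sum>d\<in>I4. \<Sum>e\<in>I4. \<Sum>r\<in>I4. eps q d e r * yA w k3 d e *
       (\<Sum>s\<in>I4. \<Sum>f\<in>I4. \<Sum>g\<in>I4. \<Sum>t\<in>I4. eps s f g t * X w j2 s * yA w k5 f g * yA w k4 r t))))"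
    unfolding inv7b_def by (simp only: sum_distrib_left ac_simps)
  also have "\<dots> = - bil (X w j1) (wd True [k1, k2, k3, k4, k5] w) (X w j2)"
    unfolding contract_end_x'[of "X w j2" "yA w k5"] unfolding contract_mid unfolding contract_start_x bil_wv wv_unfold
    by (simp only: mult_minus_right sum_negf)
  finally show ?thesis .
qed

text \<open>The sign comes from the first symbol: moving p in front of a, b, c is an odd
  permutation. The same sign occurs in the two longer families with covectors at both ends.\<close>

lemma inv8a_word: "inv8a l1 l2 k w = - bil (zeta w l1) (wd False [k] w) (zeta w l2)"
proof -
  have "inv8a l1 l2 k w = (\<Sum>a\<in>I4. \<Sum>b\<in>I4. \<Sum>c\<in>I4. \<Sum>p\<in>I4. eps a b c p * zA w l1 a b c *
     (\<Sum>q\<in>I4. yA w k p q * (\<Sum>d\<in>I4. \<Sum>e\<in>I4. \<Sum>f\<in>I4. eps q d e f * zA w l2 d e f)))"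
    unfolding inv8a_def by (simp only: sum_distrib_left ac_simps)
  also have "\<dots> = - bil (zeta w l1) (wd False [k] w) (zeta w l2)"
    unfolding contract_start_z dualz_def[symmetric] zeta_def[symmetric] bil_wv wv_unfold ..
  finally show ?thesis .
qed

lemma inv8b_word: "inv8b l l' k1 k2 k3 w = - bil (zeta w l) (wd False [k1, k2, k3] w) (zeta w l')"
proof -
  have "inv8b l l' k1 k2 k3 w = (\<Sum>a\<in>I4. \<Sum>b\<in>I4. \<Sum>c\<in>I4. \<Sum>p\<in>I4. eps a b c p * zA w l a b c *
     (\<Sum>q\<in>I4. yA w k1 p q * (\<Sum>d\<in>I4. \<Sum>e\<in>I4. \<Sum>r\<in>I4. eps q d e r * yA w k2 d e *
       (\<Sum>s\<in>I4. yA w k3 r s * (\<Sum>f\<in>I4. \<Sum>g\<in>I4. \<Sum>h\<in>I4. eps s f g h * zA w l' f g h)))))"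
    unfolding inv8b_def by (simp only: sum_distrib_left ac_simps)
  also have "\<dots> = - bil (zeta w l) (wd False [k1, k2, k3] w) (zeta w l')"
    unfolding contract_start_z unfolding contract_mid dualz_def[symmetric] zeta_def[symmetric] bil_wv wv_unfold ..
  finally show ?thesis .
qed

lemma inv8c_word: "inv8c l1 l2 k1 k2 k3 k4 k5 w = - bil (zeta w l1) (wd False [k1, k2, k3, k4, k5] w) (zeta w l2)"
proof -
  have "inv8c l1 l2 k1 k2 k3 k4 k5 w = (\<Sum>a\<in>I4. \<Sum>b\<in>I4. \<Sum>c\<in>I4. \<Sum>p\<in>I4. eps a b c p * zA w l1 a b c *
     (\<Sum>q\<in>I4. yA w k1 p q * (\<Sum>d\<in>I4. \<Sum>e\<in>I4. \<Sum>r\<in>I4. eps q d e r * yA w k2 d e *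
       (\<Sum>s\<in>I4. yA w k3 r s * (\<Sum>f\<in>I4. \<Sum>g\<in>I4. \<Sum>t\<in>I4. eps s f g t * yA w k4 f g *
         (\<Sum>u\<in>I4. yA w k5 t u * (\<Sum>h\<in>I4. \<Sum>i\<in>I4. \<Sum>m\<in>I4. eps u h i m * zA w l2 h i m)))))))"
    unfolding inv8c_def by (simp only: sum_distrib_left ac_simps)
  also have "\<dots> = - bil (zeta w l1) (wd False [k1, k2, k3, k4, k5] w) (zeta w l2)"
    unfolding contract_start_z unfolding contract_mid dualz_def[symmetric] zeta_def[symmetric] bil_wv wv_unfold ..
  finally show ?thesis .
qed

lemma inv9a_word: "inv9a j k1 k2 l w = bil (X w j) (wd True [k1, k2] w) (zeta w l)"
proof -
  have "inv9a j k1 k2 l w = (\<Sum>a\<in>I4. \<Sum>b\<in>I4. \<Sum>c\<in>I4. \<Sum>p\<in>I4. eps a b c p * X w j a * yA w k1 b c *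
     (\<Sum>q\<in>I4. yA w k2 p q * (\<Sum>d\<in>I4. \<Sum>e\<in>I4. \<Sum>f\<in>I4. eps q d e f * zA w l d e f)))"
    unfolding inv9a_def by (simp only: sum_distrib_left ac_simps)
  also have "\<dots> = bil (X w j) (wd True [k1, k2] w) (zeta w l)"
    unfolding contract_start_x dualz_def[symmetric] zeta_def[symmetric] bil_wv wv_unfold ..
  finally show ?thesis .
qed

lemma inv9b_word: "inv9b j k1 k2 k3 k4 l w = bil (X w j) (wd True [k1, k2, k3, k4] w) (zeta w l)"
proof -
  have "inv9b j k1 k2 k3 k4 l w = (\<Sum>a\<in>I4. \<Sum>b\<in>I4. \<Sum>c\<in>I4. \<Sum>p\<in>I4. eps a b c p * X w j a * yA w k1 b c *
     (\<Sum>q\<in>I4. yA w k2 p q * (\<Sum>d\<in>I4. \<Sum>e\<in>I4. \<Sum>r\<in>I4. eps q d e r * yA w k3 d e *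
       (\<Sum>s\<in>I4. yA w k4 r s * (\<Sum>f\<in>I4. \<Sum>g\<in>I4. \<Sum>h\<in>I4. eps s f g h * zA w l f g h)))))"
    unfolding inv9b_def by (simp only: sum_distrib_left ac_simps)
  also have "\<dots> = bil (X w j) (wd True [k1, k2, k3, k4] w) (zeta w l)"
    unfolding contract_mid contract_start_x dualz_def[symmetric] zeta_def[symmetric] bil_wv wv_unfold ..
  finally show ?thesis .
qed

lemma inv1_det4: "inv1 j1 j2 j3 j4 w = det4 (X w j1) (X w j2) (X w j3) (X w j4)"
  unfolding inv1_def detN4 by simp

lemma zeta_explicit:
  "zeta w l 1 = 6 * Z w l 2 3 4" "zeta w l 2 = - 6 * Z w l 1 3 4" "zeta w l 3 = 6 * Z w l 1 2 4" "zeta w l 4 = - 6 * Z w l 1 2 3"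
  unfolding zeta_def dualz_explicit[OF alt3_zA] by (simp_all add: zA_def)

text \<open>The covectors arise from the columns by multiplying the rows by 6, -6, 6, -6, and the
  product of these factors is 1296.\<close>

lemma inv2_det4: "det4 (zeta w l1) (zeta w l2) (zeta w l3) (zeta w l4) = 1296 * inv2 l1 l2 l3 l4 w"
proof -
  have c: "zcol w l 1 = Z w l 2 3 4" "zcol w l 2 = Z w l 1 3 4" "zcol w l 3 = Z w l 1 2 4" "zcol w l 4 = Z w l 1 2 3" for l
    by (simp_all add: zcol_def)
  have "inv2 l1 l2 l3 l4 w = det4 (zcol w l1) (zcol w l2) (zcol w l3) (zcol w l4)"
    unfolding inv2_def detN4 by simp
  then show ?thesis unfolding det4_explicit c zeta_explicit by algebra
qed

subsection \<open>Words with sign-commuting letters\<close>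

text \<open>Words whose adjacent letters anticommute modulo R. The relation is assumed only for
  words with letter multiset M, since in an induction on the length only shorter words are known to
  lie in R. With R consisting of zero alone it expresses exact anticommutation, and with index lists
  as words it covers determinants.\<close>

locale sign_words =
  fixes R :: "(pt \<Rightarrow> complex) set" and \<phi> :: "nat list \<Rightarrow> pt \<Rightarrow> complex" and M :: "nat multiset"
  assumes R_zero: "(\<lambda>w. 0) \<in> R"
    and R_plus: "f \<in> R \<Longrightarrow> h \<in> R \<Longrightarrow> (\<lambda>w. f w + h w) \<in> R"
    and R_scale: "f \<in> R \<Longrightarrow> (\<lambda>w. c * f w) \<in> R"
    and sw: "mset (A @ [k, k'] @ B) = M \<Longrightarrow> (\<lambda>w. \<phi> (A @ [k, k'] @ B) w + \<phi> (A @ [k', k] @ B) w) \<in> R"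
begin

definition eqv :: "complex \<Rightarrow> nat list \<Rightarrow> nat list \<Rightarrow> bool" where
  "eqv s L L' \<longleftrightarrow> (\<lambda>w. \<phi> L w - s * \<phi> L' w) \<in> R"

lemma eqv_refl: "eqv 1 L L"
  by (simp add: eqv_def R_zero)

lemma eqv_trans:
  assumes "eqv s L L'" "eqv s' L' L''"
  shows "eqv (s * s') L L''"
proof -
  have "(\<lambda>w. (\<phi> L w - s * \<phi> L' w) + s * (\<phi> L' w - s' * \<phi> L'' w)) \<in> R"
    using assms unfolding eqv_def by (intro R_plus R_scale)
  then show ?thesis unfolding eqv_def by (simp add: algebra_simps)
qed

lemma sign_square: "((-1::complex) ^ n) * (-1) ^ n = 1"
  by (simp flip: power_mult_distrib)

lemma eqv_sym: "eqv s L L' \<Longrightarrow> s * s = 1 \<Longrightarrow> eqv s L' L"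
  unfolding eqv_def using R_scale[of "\<lambda>w. \<phi> L w - s * \<phi> L' w" "- s"]
  by (simp add: algebra_simps mult.assoc[symmetric])

lemma eqv_mem: "eqv s L L' \<Longrightarrow> \<phi> L' \<in> R \<Longrightarrow> \<phi> L \<in> R"
  unfolding eqv_def using R_plus[of "\<lambda>w. \<phi> L w - s * \<phi> L' w" "\<lambda>w. s * \<phi> L' w"] R_scale[of "\<phi> L'" s] by simp

lemma eqv_swap: "mset (A @ [k, k'] @ B) = M \<Longrightarrow> eqv (-1) (A @ [k, k'] @ B) (A @ [k', k] @ B)"
  unfolding eqv_def using sw by simp

lemma eqv_move: "mset (A @ [k] @ B @ C) = M \<Longrightarrow> eqv ((-1) ^ length B) (A @ [k] @ B @ C) (A @ B @ [k] @ C)"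
proof (induction B arbitrary: A)
  case Nil
  then show ?case by (simp add: eqv_refl)
next
  case (Cons b B)
  have 1: "eqv (-1) (A @ [k, b] @ (B @ C)) (A @ [b, k] @ (B @ C))"
    by (rule eqv_swap) (use Cons.prems in simp)
  have 2: "eqv ((-1) ^ length B) ((A @ [b]) @ [k] @ B @ C) ((A @ [b]) @ B @ [k] @ C)"
    by (rule Cons.IH) (use Cons.prems in \<open>simp add: add_mset_commute\<close>)
  show ?case using eqv_trans[OF 1, of "(-1) ^ length B" "(A @ [b]) @ B @ [k] @ C"] 2 by simp
qed

text \<open>Moving x past B and y, and y back past B, takes an odd number of adjacent
  exchanges.\<close>

lemma eqv_exchange:
  assumes "mset (A @ [x] @ B @ [y] @ C) = M"
  shows "eqv (-1) (A @ [x] @ B @ [y] @ C) (A @ [y] @ B @ [x] @ C)"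
proof -
  have 1: "eqv ((-1) ^ length (B @ [y])) (A @ [x] @ (B @ [y]) @ C) (A @ (B @ [y]) @ [x] @ C)"
    by (rule eqv_move) (use assms in simp)
  have 2: "eqv ((-1) ^ length B) (A @ [y] @ B @ ([x] @ C)) (A @ B @ [y] @ ([x] @ C))"
    by (rule eqv_move) (use assms in \<open>simp add: add_mset_commute\<close>)
  have 3: "eqv ((-1) ^ length B) (A @ B @ [y] @ ([x] @ C)) (A @ [y] @ B @ ([x] @ C))"
    by (rule eqv_sym[OF 2]) (rule sign_square)
  have "eqv ((-1) ^ length (B @ [y]) * (-1) ^ length B) (A @ [x] @ B @ [y] @ C) (A @ [y] @ B @ [x] @ C)"
    using eqv_trans[OF 1, of "(-1) ^ length B" "A @ [y] @ B @ ([x] @ C)"] 3 by simp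
  moreover have "((-1::complex) ^ length (B @ [y])) * (-1) ^ length B = -1" using sign_square[of "length B"] by simp
  ultimately show ?thesis by metis
qed

lemma mem_cong_mset: "mset ks = mset ks' \<Longrightarrow> mset (A @ ks) = M \<Longrightarrow> \<phi> (A @ ks') \<in> R \<Longrightarrow> \<phi> (A @ ks) \<in> R"
proof (induction ks arbitrary: A ks')
  case Nil
  then show ?case by simp
next
  case (Cons k ks)
  then have "k \<in> set ks'" by (metis list.set_intros(1) set_mset_mset)
  then obtain B C where ks': "ks' = B @ k # C" by (meson split_list)
  have m: "mset ks = mset (B @ C)" using Cons.prems(1) ks' by simp
  have e: "eqv ((-1) ^ length B) (A @ [k] @ B @ C) (A @ B @ [k] @ C)"
    by (rule eqv_move) (use Cons.prems ks' in simp)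
  have "\<phi> (A @ [k] @ B @ C) \<in> R" by (rule eqv_mem[OF e]) (use Cons.prems ks' in simp)
  then have "\<phi> ((A @ [k]) @ ks) \<in> R" using Cons.IH[OF m, of "A @ [k]"] Cons.prems(2) by simp
  then show ?case by simp
qed

lemma mem_sort: "mset ks = M \<Longrightarrow> \<phi> (sort ks) \<in> R \<Longrightarrow> \<phi> ks \<in> R"
  using mem_cong_mset[of ks "sort ks" "[]"] by simp

text \<open>Two equal letters can be brought together, and exchanging them shows that twice the word
  lies in R.\<close>

lemma mem_repeated:
  assumes "mset ks = M" "\<not> distinct ks"
  shows "\<phi> ks \<in> R"
proof -
  obtain A y B C where ks: "ks = A @ [y] @ B @ [y] @ C" using not_distinct_decomp[OF assms(2)] by blast
  have "(\<lambda>w. \<phi> (A @ [y, y] @ (B @ C)) w + \<phi> (A @ [y, y] @ (B @ C)) w) \<in> R"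
    by (rule sw) (use assms(1) ks in simp)
  from R_scale[OF this, of "1/2"] have "\<phi> (A @ ([y, y] @ B @ C)) \<in> R" by simp
  then have "\<phi> (A @ ([y] @ B @ [y] @ C)) \<in> R"
    by (rule mem_cong_mset[rotated 2]) (use assms(1) ks in simp_all)
  then show ?thesis unfolding ks .
qed

lemma mset_map_permutes:
  assumes "distinct L" "p permutes set L"
  shows "mset (map (\<kappa> \<circ> p) L) = mset (map \<kappa> L)"
proof -
  have "image_mset p (mset L) = mset L"
    using permutes_image_mset[OF assms(2)] assms(1) by (simp add: mset_set_set)
  then have "image_mset \<kappa> (image_mset p (mset L)) = image_mset \<kappa> (mset L)" by simp
  then show ?thesis by (simp add: image_mset.compositionality comp_def)
qed

lemma eqv_transpose:
  assumes "distinct L" "a \<in> set L" "b \<in> set L" "a \<noteq> b" "mset (map \<kappa> L @ B) = M"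
  shows "eqv (-1) (map (\<kappa> \<circ> transpose a b) L @ B) (map \<kappa> L @ B)"
proof -
  have main: "eqv (-1) (map \<kappa> L @ B) (map (\<kappa> \<circ> transpose a b) L @ B)"
    if L: "L = A @ a # A' @ b # A''" for a b A A' A''
  proof -
    have d: "a \<noteq> b" "a \<notin> set A" "a \<notin> set A'" "a \<notin> set A''" "b \<notin> set A" "b \<notin> set A'" "b \<notin> set A''"
      using assms(1) unfolding L by auto
    have t: "map (\<kappa> \<circ> transpose a b) T = map \<kappa> T" if "a \<notin> set T" "b \<notin> set T" for T
      using that by (auto simp: transpose_def)
    have "map (\<kappa> \<circ> transpose a b) L @ B = map \<kappa> A @ [\<kappa> b] @ map \<kappa> A' @ [\<kappa> a] @ (map \<kappa> A'' @ B)"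
      unfolding L using t d by (simp add: transpose_def)
    moreover have "map \<kappa> L @ B = map \<kappa> A @ [\<kappa> a] @ map \<kappa> A' @ [\<kappa> b] @ (map \<kappa> A'' @ B)"
      unfolding L by simp
    ultimately show ?thesis
      using eqv_exchange[of "map \<kappa> A" "\<kappa> a" "map \<kappa> A'" "\<kappa> b" "map \<kappa> A'' @ B"] assms(5) by simp
  qed
  obtain A C where L: "L = A @ a # C" using assms(2) by (meson split_list)
  have "eqv (-1) (map \<kappa> L @ B) (map (\<kappa> \<circ> transpose a b) L @ B)"
  proof (cases "b \<in> set C")
    case True
    then obtain A' A'' where "C = A' @ b # A''" by (meson split_list)
    then show ?thesis using main[of A a A' b A''] L by simp
  next
    case False
    then have "b \<in> set A" using assms(3,4) L by auto
    then obtain A' A'' where "A = A' @ b # A''" by (meson split_list)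
    then show ?thesis using main[of A' b A'' a C] L by (simp add: transpose_commute)
  qed
  then show ?thesis by (rule eqv_sym) simp
qed

lemma eqv_permute:
  assumes L: "distinct L" and p: "p permutes set L" and M: "mset (map \<kappa> L @ B) = M"
  shows "eqv (of_int (sign p)) (map (\<kappa> \<circ> p) L @ B) (map \<kappa> L @ B)"
  using finite_set[of L] p
proof (induction rule: permutes_rev_induct)
  case id
  then show ?case by (simp add: eqv_refl)
next
  case (swap a b p)
  have m: "mset (map (\<kappa> \<circ> p) L @ B) = M" using mset_map_permutes[OF L swap.hyps(4), of \<kappa>] M by simp
  have "eqv (-1) (map ((\<kappa> \<circ> p) \<circ> transpose a b) L @ B) (map (\<kappa> \<circ> p) L @ B)"
    by (rule eqv_transpose[OF L swap.hyps(1,2,3) m])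
  from eqv_trans[OF this swap.IH]
  have "eqv (- 1 * of_int (sign p)) (map (\<kappa> \<circ> (p \<circ> transpose a b)) L @ B) (map \<kappa> L @ B)"
    unfolding comp_assoc .
  moreover have pp: "permutation p" using swap.hyps(4) permutation_permutes finite_set by blast
  have "sign (p \<circ> transpose a b) = - sign p"
    using sign_compose[OF pp permutation_swap_id[of a b]] swap.hyps(3) by (simp add: sign_swap_id)
  ultimately show ?case by (simp only: of_int_minus mult_minus1)
qed

text \<open>All signed terms are congruent to the word itself, so antisymmetrising amounts to
  multiplication by a factorial. This replaces a single word by an alternating function of its
  letters.\<close>

lemma alternating_sum:
  fixes L :: "nat list"
  assumes L: "distinct L" and M: "mset (map \<kappa> L @ B) = M"
  shows "(\<lambda>w. (\<Sum>p | p permutes set L. of_int (sign p) * \<phi> (map (\<kappa> \<circ> p) L @ B) w) - fact (length L) * \<phi> (map \<kappa> L @ B) w) \<in> R"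
proof -
  let ?P = "{p. p permutes set L}"
  have "(\<lambda>w. \<Sum>p\<in>Q. of_int (sign p) * (\<phi> (map (\<kappa> \<circ> p) L @ B) w - of_int (sign p) * \<phi> (map \<kappa> L @ B) w)) \<in> R"
    if "Q \<subseteq> ?P" "finite Q" for Q
    using that(2,1)
  proof (induction Q rule: finite_induct)
    case empty
    then show ?case by (simp add: R_zero)
  next
    case (insert p Q)
    have "(\<lambda>w. of_int (sign p) * (\<phi> (map (\<kappa> \<circ> p) L @ B) w - of_int (sign p) * \<phi> (map \<kappa> L @ B) w)) \<in> R"
      by (rule R_scale) (use eqv_permute[OF L _ M, of p] insert.prems in \<open>auto simp: eqv_def\<close>)
    moreover have "Q \<subseteq> ?P" using insert.prems by simp
    ultimately show ?case unfolding sum.insert[OF insert.hyps] by (intro R_plus insert.IH)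
  qed
  from this[of ?P] have "(\<lambda>w. \<Sum>p\<in>?P. of_int (sign p) * (\<phi> (map (\<kappa> \<circ> p) L @ B) w - of_int (sign p) * \<phi> (map \<kappa> L @ B) w)) \<in> R"
    by (simp add: finite_permutations)
  moreover have "(\<Sum>p\<in>?P. of_int (sign p) * (\<phi> (map (\<kappa> \<circ> p) L @ B) w - of_int (sign p) * \<phi> (map \<kappa> L @ B) w))
     = (\<Sum>p\<in>?P. of_int (sign p) * \<phi> (map (\<kappa> \<circ> p) L @ B) w) - fact (length L) * \<phi> (map \<kappa> L @ B) w" for w
  proof -
    have s1: "of_int (sign p) * (of_int (sign p) * z) = z" for p :: "nat \<Rightarrow> nat" and z :: complex
      by (simp add: mult.assoc[symmetric] flip: of_int_mult)
    have "card ?P = fact (length L)" using card_permutations[of "set L" "length L"] L by (simp add: distinct_card)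
    then show ?thesis by (simp add: right_diff_distrib sum_subtractf s1)
  qed
  ultimately show ?thesis by simp
qed

end

subsection \<open>Six letters\<close>

text \<open>The six bivectors are the basis elements e_a wedge e_b in the order of
  \<open>ycol\<close>, so that \<open>ycol\<close> lists the coefficients of a bivector in this
  basis.\<close>

definition wB :: pt where
  "wB = ((\<lambda>j a. 0), (\<lambda>k a b. if (k, a, b) \<in> {(1,1,2), (2,1,3), (3,1,4), (4,2,3), (5,2,4), (6,3,4)} then 1 else 0), (\<lambda>l a b c. 0))"

lemma atLeastAtMost_6: "{1..6::nat} = {1, 2, 3, 4, 5, 6}"
  by auto

lemma yA_expand:
  assumes "a \<in> I4" "b \<in> I4"
  shows "yA w k a b = (\<Sum>i\<in>{1..6}. ycol w k i * yA wB i a b)"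
proof -
  have "a = 1 \<or> a = 2 \<or> a = 3 \<or> a = 4" "b = 1 \<or> b = 2 \<or> b = 3 \<or> b = 4"
    using assms unfolding I4_eq by auto
  then show ?thesis unfolding atLeastAtMost_6
    by (elim disjE) (simp_all add: yA_def wB_def Y_def ycol_def numeral_2_eq_2[symmetric])
qed

lemma letter_expand:
  assumes "a \<in> I4" "b \<in> I4"
  shows "letter t w k a b = (\<Sum>i\<in>{1..6}. ycol w k i * letter t wB i a b)"
proof (cases t)
  case True
  have "dualy (yA w k) a b = (\<Sum>c\<in>I4. \<Sum>d\<in>I4. \<Sum>i\<in>{1..6}. ycol w k i * (eps a b c d * yA wB i c d))"
    unfolding dualy_def by (intro sum.cong refl) (simp add: yA_expand[of _ _ w k] sum_distrib_left mult.left_commute)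
  also have "\<dots> = (\<Sum>c\<in>I4. \<Sum>i\<in>{1..6}. \<Sum>d\<in>I4. ycol w k i * (eps a b c d * yA wB i c d))"
    by (intro sum.cong refl sum.swap)
  also have "\<dots> = (\<Sum>i\<in>{1..6}. \<Sum>c\<in>I4. \<Sum>d\<in>I4. ycol w k i * (eps a b c d * yA wB i c d))"
    by (rule sum.swap)
  finally show ?thesis using True by (simp add: letter_def dualy_def sum_distrib_left)
next
  case False
  then show ?thesis using yA_expand[OF assms, of w k] by (simp add: letter_def)
qed

text \<open>Multilinearity in the letters. The list \<open>rs\<close> consists of positions, to
  which \<kappa> assigns letters, so that repeated letters are expanded independently.\<close>

lemma wd_expand:
  fixes rs :: "nat list"
  shows "distinct rs \<Longrightarrow> a \<in> I4 \<Longrightarrow> wd t (map \<kappa> rs) w a b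
     = (\<Sum>i\<in>PiE (set rs) (\<lambda>_. {1..6}). (\<Prod>r\<in>set rs. ycol w (\<kappa> r) (i r)) * wd t (map i rs) wB a b)"
proof (induction rs arbitrary: t a)
  case Nil
  then show ?case by simp
next
  case (Cons s rs)
  let ?P = "PiE (set rs) (\<lambda>_. {1..6::nat})"
  have "wd t (map \<kappa> (s # rs)) w a b
    = (\<Sum>c\<in>I4. (\<Sum>m\<in>{1..6}. ycol w (\<kappa> s) m * letter t wB m a c) * (\<Sum>i\<in>?P. (\<Prod>r\<in>set rs. ycol w (\<kappa> r) (i r)) * wd (\<not> t) (map i rs) wB c b))"
    using Cons by (simp add: letter_expand[of a _ t w "\<kappa> s"])
  also have "\<dots> = (\<Sum>c\<in>I4. \<Sum>m\<in>{1..6}. \<Sum>i\<in>?P. ycol w (\<kappa> s) m * (\<Prod>r\<in>set rs. ycol w (\<kappa> r) (i r)) * (letter t wB m a c * wd (\<not> t) (map i rs) wB c b))"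
    unfolding sum_product by (simp only: ac_simps)
  also have "\<dots> = (\<Sum>m\<in>{1..6}. \<Sum>c\<in>I4. \<Sum>i\<in>?P. ycol w (\<kappa> s) m * (\<Prod>r\<in>set rs. ycol w (\<kappa> r) (i r)) * (letter t wB m a c * wd (\<not> t) (map i rs) wB c b))"
    by (rule sum.swap)
  also have "\<dots> = (\<Sum>m\<in>{1..6}. \<Sum>i\<in>?P. \<Sum>c\<in>I4. ycol w (\<kappa> s) m * (\<Prod>r\<in>set rs. ycol w (\<kappa> r) (i r)) * (letter t wB m a c * wd (\<not> t) (map i rs) wB c b))"
    by (intro sum.cong refl sum.swap)
  also have "\<dots> = (\<Sum>m\<in>{1..6}. \<Sum>i\<in>?P. (\<Prod>r\<in>set (s # rs). ycol w (\<kappa> r) ((i(s := m)) r)) * wd t (map (i(s := m)) (s # rs)) wB a b)"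
  proof (intro sum.cong refl)
    fix m :: nat and i :: "nat \<Rightarrow> nat"
    have s: "s \<notin> set rs" using Cons.prems by simp
    have 1: "map (i(s := m)) rs = map i rs" using s by auto
    have 2: "(\<Prod>r\<in>set rs. ycol w (\<kappa> r) ((i(s := m)) r)) = (\<Prod>r\<in>set rs. ycol w (\<kappa> r) (i r))"
      using s by (intro prod.cong refl) auto
    show "(\<Sum>c\<in>I4. ycol w (\<kappa> s) m * (\<Prod>r\<in>set rs. ycol w (\<kappa> r) (i r)) * (letter t wB m a c * wd (\<not> t) (map i rs) wB c b))
       = (\<Prod>r\<in>set (s # rs). ycol w (\<kappa> r) ((i(s := m)) r)) * wd t (map (i(s := m)) (s # rs)) wB a b"
      using s 1 2 by (simp add: sum_distrib_left)
  qed
  also have "\<dots> = (\<Sum>i\<in>PiE (set (s # rs)) (\<lambda>_. {1..6}). (\<Prod>r\<in>set (s # rs). ycol w (\<kappa> r) (i r)) * wd t (map i (s # rs)) wB a b)"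
    unfolding list.set by (rule sum_PiE_insert[symmetric]) (use Cons.prems in auto)
  finally show ?case .
qed

lemma sum_bijections:
  assumes "finite N"
  shows "(\<Sum>\<phi>\<in>{\<phi> \<in> PiE N (\<lambda>_. N). \<phi> ` N = N}. F \<phi>) = (\<Sum>\<tau> | \<tau> permutes N. F (restrict \<tau> N))"
proof (rule sum.reindex_bij_witness[where i = "\<lambda>\<tau>. restrict \<tau> N" and j = "\<lambda>\<phi> x. if x \<in> N then \<phi> x else x"])
  fix \<phi> assume a: "\<phi> \<in> {\<phi> \<in> PiE N (\<lambda>_. N). \<phi> ` N = N}"
  then show e: "restrict (\<lambda>x. if x \<in> N then \<phi> x else x) N = \<phi>"
    by (auto simp: restrict_def PiE_iff extensional_def fun_eq_iff)
  have "bij_betw \<phi> N N" using a assms by (auto simp: bij_betw_def intro: eq_card_imp_inj_on)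
  then have "bij_betw (\<lambda>x. if x \<in> N then \<phi> x else x) N N"
    by (rule bij_betw_cong[THEN iffD1, rotated]) simp
  then show "(\<lambda>x. if x \<in> N then \<phi> x else x) \<in> {\<tau>. \<tau> permutes N}"
    by (auto intro: bij_imp_permutes)
  show "F (restrict (\<lambda>x. if x \<in> N then \<phi> x else x) N) = F \<phi>" using e by simp
next
  fix \<tau> assume "\<tau> \<in> {\<tau>. \<tau> permutes N}"
  then have t: "\<tau> permutes N" by simp
  then show "(\<lambda>x. if x \<in> N then restrict \<tau> N x else x) = \<tau>"
    by (auto simp: fun_eq_iff permutes_not_in)
  show "restrict \<tau> N \<in> {\<phi> \<in> PiE N (\<lambda>_. N). \<phi> ` N = N}"
    using permutes_image[OF t] permutes_in_image[OF t] by (auto simp: image_restrict_eq)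
qed

lemma det_rows_permuted:
  assumes "\<rho> permutes {1..n}"
  shows "(\<Sum>\<pi> | \<pi> permutes {1..n}. of_int (sign \<pi>) * (\<Prod>r\<in>{1..n}. M (\<rho> r) (\<pi> r))) = of_int (sign \<rho>) * detN n M"
proof -
  let ?N = "{1..n}"
  have pr: "permutation p" if "p permutes ?N" for p using that permutation_permutes finite_atLeastAtMost by blast
  have "(\<Sum>\<pi> | \<pi> permutes ?N. of_int (sign \<pi>) * (\<Prod>r\<in>?N. M (\<rho> r) (\<pi> r)))
     = (\<Sum>\<sigma> | \<sigma> permutes ?N. of_int (sign \<rho>) * (of_int (sign \<sigma>) * (\<Prod>i\<in>?N. M (\<sigma> i) i)))"
  proof (rule sum.reindex_bij_witness[where j = "\<lambda>\<pi>. \<rho> \<circ> inv \<pi>" and i = "\<lambda>\<sigma>. inv \<sigma> \<circ> \<rho>"])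
    fix \<pi> assume "\<pi> \<in> {\<pi>. \<pi> permutes ?N}"
    then have p: "\<pi> permutes ?N" by simp
    show "inv (\<rho> \<circ> inv \<pi>) \<circ> \<rho> = \<pi>"
      using permutes_bij[OF p] permutes_bij[OF assms] p assms
      by (simp add: o_inv_distrib bij_imp_bij_inv inv_inv_eq comp_assoc permutes_inv_o)
    show "\<rho> \<circ> inv \<pi> \<in> {\<sigma>. \<sigma> permutes ?N}" using permutes_compose[OF permutes_inv[OF p] assms] by simp
    have "(\<Prod>i\<in>?N. M ((\<rho> \<circ> inv \<pi>) i) i) = (\<Prod>r\<in>?N. M ((\<rho> \<circ> inv \<pi>) (\<pi> r)) (\<pi> r))"
      by (rule prod.reindex_bij_betw[OF permutes_imp_bij[OF p], symmetric])
    also have "\<dots> = (\<Prod>r\<in>?N. M (\<rho> r) (\<pi> r))" using permutes_inverses(2)[OF p] by simp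
    finally have e: "(\<Prod>i\<in>?N. M ((\<rho> \<circ> inv \<pi>) i) i) = (\<Prod>r\<in>?N. M (\<rho> r) (\<pi> r))" .
    have "sign (\<rho> \<circ> inv \<pi>) = sign \<rho> * sign \<pi>"
      using sign_compose[OF pr[OF assms] pr[OF permutes_inv[OF p]]] sign_inverse[OF pr[OF p]] by simp
    then have "sign \<rho> * sign (\<rho> \<circ> inv \<pi>) = sign \<pi>" by (simp add: mult.assoc[symmetric])
    then have s: "complex_of_int (sign \<rho>) * of_int (sign (\<rho> \<circ> inv \<pi>)) = of_int (sign \<pi>)" by (metis of_int_mult)
    show "of_int (sign \<rho>) * (of_int (sign (\<rho> \<circ> inv \<pi>)) * (\<Prod>i\<in>?N. M ((\<rho> \<circ> inv \<pi>) i) i)) = of_int (sign \<pi>) * (\<Prod>r\<in>?N. M (\<rho> r) (\<pi> r))"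
      unfolding e mult.assoc[symmetric] s ..
  next
    fix \<sigma> assume "\<sigma> \<in> {\<sigma>. \<sigma> permutes ?N}"
    then have p: "\<sigma> permutes ?N" by simp
    show "\<rho> \<circ> inv (inv \<sigma> \<circ> \<rho>) = \<sigma>"
      using permutes_bij[OF p] permutes_bij[OF assms] p assms
      by (simp add: o_inv_distrib bij_imp_bij_inv inv_inv_eq o_assoc permutes_inv_o)
    show "inv \<sigma> \<circ> \<rho> \<in> {\<pi>. \<pi> permutes ?N}" using permutes_compose[OF assms permutes_inv[OF p]] by simp
  qed
  then show ?thesis unfolding detN_def by (simp add: sum_distrib_left)
qed

lemma det_rows_repeated:
  fixes M :: "nat \<Rightarrow> nat \<Rightarrow> complex"
  assumes "a \<in> {1..n}" "b \<in> {1..n}" "a \<noteq> b" "i a = i b"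
  shows "(\<Sum>\<pi> | \<pi> permutes {1..n}. of_int (sign \<pi>) * (\<Prod>r\<in>{1..n}. M (i r) (\<pi> r))) = 0"
proof -
  let ?N = "{1..n}" and ?t = "transpose a b"
  let ?S = "\<Sum>\<pi> | \<pi> permutes ?N. of_int (sign \<pi>) * (\<Prod>r\<in>?N. M (i r) (\<pi> r))"
  have t: "?t permutes ?N" by (rule permutes_swap_id[OF assms(1,2)])
  have pr: "permutation p" if "p permutes ?N" for p using that permutation_permutes finite_atLeastAtMost by blast
  have "?S = (\<Sum>\<pi> | \<pi> permutes ?N. of_int (sign (\<pi> \<circ> ?t)) * (\<Prod>r\<in>?N. M (i r) ((\<pi> \<circ> ?t) r)))"
    by (rule sum.reindex_bij_witness[where j = "\<lambda>p. p \<circ> ?t" and i = "\<lambda>p. p \<circ> ?t"])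
      (auto simp: comp_assoc permutes_compose[OF t] simp del: One_nat_def)
  also have "\<dots> = (\<Sum>\<pi> | \<pi> permutes ?N. - (of_int (sign \<pi>) * (\<Prod>r\<in>?N. M (i r) (\<pi> r))))"
  proof (rule sum.cong[OF refl])
    fix \<pi> assume "\<pi> \<in> {\<pi>. \<pi> permutes ?N}"
    then have p: "\<pi> permutes ?N" by simp
    have "(\<Prod>r\<in>?N. M (i r) ((\<pi> \<circ> ?t) r)) = (\<Prod>r\<in>?N. M (i (?t r)) (\<pi> (?t r)))"
      using assms(4) by (intro prod.cong refl) (auto simp: transpose_def)
    also have "\<dots> = (\<Prod>r\<in>?N. M (i r) (\<pi> r))"
      by (rule prod.reindex_bij_betw[OF permutes_imp_bij[OF t]])
    finally show "of_int (sign (\<pi> \<circ> ?t)) * (\<Prod>r\<in>?N. M (i r) ((\<pi> \<circ> ?t) r)) = - (of_int (sign \<pi>) * (\<Prod>r\<in>?N. M (i r) (\<pi> r)))"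
      using sign_compose[OF pr[OF p] permutation_swap_id[of a b]] assms(3) by (simp add: sign_swap_id)
  qed
  finally have "?S = - ?S" by (simp only: sum_negf)
  then show ?thesis by (rule eq_neg_self)
qed

definition six :: "nat list" where "six = [1, 2, 3, 4, 5, 6]"

lemma set_six: "set six = {1..6}" "distinct six" "length six = 6"
  by (auto simp: six_def)

definition altB :: "bool \<Rightarrow> nat \<Rightarrow> nat \<Rightarrow> complex" where
  "altB t a b = (\<Sum>\<rho> | \<rho> permutes {1..6}. of_int (sign \<rho>) * wd t (map \<rho> six) wB a b)"

text \<open>The left side is an alternating function of six vectors in a six-dimensional space,
  hence the determinant times its value on a basis. Non-bijective choices of basis elements drop out
  as determinants with a repeated row.\<close>

lemma wd_alternating_six:
  assumes "a \<in> I4"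
  shows "(\<Sum>\<pi> | \<pi> permutes {1..6}. of_int (sign \<pi>) * wd t (map (\<kappa> \<circ> \<pi>) six) w a b) = inv4 \<kappa> w * altB t a b"
proof -
  let ?N = "{1..6::nat}"
  let ?F = "PiE ?N (\<lambda>_. ?N)"
  let ?M = "\<lambda>i r. ycol w (\<kappa> r) i"
  let ?D = "\<lambda>i. \<Sum>\<pi> | \<pi> permutes ?N. of_int (sign \<pi>) * (\<Prod>r\<in>?N. ?M (i r) (\<pi> r))"
  have finF: "finite ?F" by (intro finite_PiE) auto
  have "(\<Sum>\<pi> | \<pi> permutes ?N. of_int (sign \<pi>) * wd t (map (\<kappa> \<circ> \<pi>) six) w a b)
      = (\<Sum>\<pi> | \<pi> permutes ?N. \<Sum>i\<in>?F. of_int (sign \<pi>) * (\<Prod>r\<in>?N. ?M (i r) (\<pi> r)) * wd t (map i six) wB a b)"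
  proof (rule sum.cong[OF refl])
    fix \<pi>
    show "of_int (sign \<pi>) * wd t (map (\<kappa> \<circ> \<pi>) six) w a b
       = (\<Sum>i\<in>?F. of_int (sign \<pi>) * (\<Prod>r\<in>?N. ?M (i r) (\<pi> r)) * wd t (map i six) wB a b)"
      unfolding wd_expand[OF set_six(2) assms, of t "\<kappa> \<circ> \<pi>" w b] set_six(1) sum_distrib_left
      by (simp only: mult.assoc comp_def)
  qed
  also have "\<dots> = (\<Sum>i\<in>?F. ?D i * wd t (map i six) wB a b)"
    unfolding sum_distrib_right by (rule sum.swap)
  also have "\<dots> = (\<Sum>i\<in>?F. if i ` ?N = ?N then ?D i * wd t (map i six) wB a b else 0)"
  proof (intro sum.cong refl)
    fix i assume i: "i \<in> ?F"
    show "?D i * wd t (map i six) wB a b = (if i ` ?N = ?N then ?D i * wd t (map i six) wB a b else 0)"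
    proof (cases "i ` ?N = ?N")
      case False
      have "\<not> inj_on i ?N"
      proof
        assume "inj_on i ?N"
        then have "card (i ` ?N) = card ?N" by (rule card_image)
        moreover have "i ` ?N \<subseteq> ?N" using i by auto
        ultimately show False using False card_subset_eq[of ?N "i ` ?N"] by simp
      qed
      then obtain x y where "x \<in> ?N" "y \<in> ?N" "x \<noteq> y" "i x = i y" unfolding inj_on_def by blast
      then have "?D i = 0" by (rule det_rows_repeated)
      then show ?thesis using False by simp
    qed simp
  qed
  also have "\<dots> = (\<Sum>i\<in>{i \<in> ?F. i ` ?N = ?N}. ?D i * wd t (map i six) wB a b)"
    using finF by (rule sum.inter_filter[symmetric])
  also have "\<dots> = (\<Sum>\<rho> | \<rho> permutes ?N. ?D (restrict \<rho> ?N) * wd t (map (restrict \<rho> ?N) six) wB a b)"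
    by (rule sum_bijections) simp
  also have "\<dots> = (\<Sum>\<rho> | \<rho> permutes ?N. inv4 \<kappa> w * (of_int (sign \<rho>) * wd t (map \<rho> six) wB a b))"
  proof (rule sum.cong[OF refl])
    fix \<rho> assume "\<rho> \<in> {\<rho>. \<rho> permutes ?N}"
    then have p: "\<rho> permutes ?N" by simp
    have "?D (restrict \<rho> ?N) = ?D \<rho>"
      by (intro sum.cong refl arg_cong2[of _ _ _ _ times] prod.cong) simp_all
    also have "\<dots> = of_int (sign \<rho>) * inv4 \<kappa> w"
      unfolding inv4_def by (rule det_rows_permuted[OF p])
    finally have 1: "?D (restrict \<rho> ?N) = of_int (sign \<rho>) * inv4 \<kappa> w" .
    have 2: "map (restrict \<rho> ?N) six = map \<rho> six" by (simp add: six_def)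
    show "?D (restrict \<rho> ?N) * wd t (map (restrict \<rho> ?N) six) wB a b = inv4 \<kappa> w * (of_int (sign \<rho>) * wd t (map \<rho> six) wB a b)"
      unfolding 1 2 by simp
  qed
  finally show ?thesis by (simp add: altB_def sum_distrib_left)
qed

subsection \<open>An orthogonal basis of bivectors\<close>

text \<open>The bivectors e12 +- e34, e13 +- e24, e14 +- e23, with the plus signs for r = 1, 2, 3
  and the minus signs for r = 4, 5, 6. They are eigenvectors of the Hodge dual, with opposite
  eigenvalues for odd and even r.\<close>

definition Fm :: "nat \<Rightarrow> nat \<Rightarrow> nat \<Rightarrow> complex" where
  "Fm r a b =
    (if a = 1 \<and> b = 2 then (if r = 1 \<or> r = 4 then 1 else 0)
     else if a = 3 \<and> b = 4 then (if r = 1 then 1 else if r = 4 then -1 else 0)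
     else if a = 1 \<and> b = 3 then (if r = 2 \<or> r = 5 then 1 else 0)
     else if a = 2 \<and> b = 4 then (if r = 2 then 1 else if r = 5 then -1 else 0)
     else if a = 1 \<and> b = 4 then (if r = 3 \<or> r = 6 then 1 else 0)
     else if a = 2 \<and> b = 3 then (if r = 3 then 1 else if r = 6 then -1 else 0) else 0)"

text \<open>The matrices of these bivectors are signed permutation matrices (up to the factor 2 for the duals).\<close>

definition pm :: "nat \<Rightarrow> nat \<Rightarrow> nat" where
  "pm r a = (if r = 1 \<or> r = 4 then (if a = 1 then 2 else if a = 2 then 1 else if a = 3 then 4 else 3)
     else if r = 2 \<or> r = 5 then (if a = 1 then 3 else if a = 2 then 4 else if a = 3 then 1 else 2)
     else (if a = 1 then 4 else if a = 2 then 3 else if a = 3 then 2 else 1))"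

definition sg :: "bool \<Rightarrow> nat \<Rightarrow> nat \<Rightarrow> complex" where
  "sg t r a = (if t then (if odd r then 2 else -2) else 1) *
      (if r = 1 \<or> r = 6 then (if a = 1 \<or> a = 3 then 1 else -1)
       else if r = 2 \<or> r = 3 then (if a = 1 \<or> a = 2 then 1 else -1)
       else (if a = 1 \<or> a = 4 then 1 else -1))"

lemma sg_nonzero: "sg t r a \<noteq> 0"
  by (simp add: sg_def)

lemma yA_num:
  "yA w k 1 2 = Y w k 1 2" "yA w k 1 3 = Y w k 1 3" "yA w k 1 4 = Y w k 1 4"
  "yA w k 2 3 = Y w k 2 3" "yA w k 2 4 = Y w k 2 4" "yA w k 3 4 = Y w k 3 4"
  by (simp_all add: yA_def numeral_2_eq_2[symmetric])

lemma yA_F: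
  assumes Y: "Y w k = Fm r" and r: "r \<in> {1..6}" and a: "a \<in> I4" and c: "c \<in> I4"
  shows "yA w k a c = (if c = pm r a then sg False r a else 0)"
proof -
  have r6: "r = 1 \<or> r = 2 \<or> r = 3 \<or> r = 4 \<or> r = 5 \<or> r = 6" using r by auto
  have "a = 1 \<or> a = 2 \<or> a = 3 \<or> a = 4" "c = 1 \<or> c = 2 \<or> c = 3 \<or> c = 4"
    using a c unfolding I4_eq by auto
  then show ?thesis using r6
    by (elim disjE; hypsubst; unfold alt2_norm[OF alt2_yA] yA_num Y; simp add: Fm_def pm_def sg_def)
qed

lemma dualy_F:
  assumes Y: "Y w k = Fm r" and r: "r \<in> {1..6}" and a: "a \<in> I4" and c: "c \<in> I4"
  shows "dualy (yA w k) a c = (if odd r then 2 else -2) * yA w k a c"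
proof -
  have r6: "r = 1 \<or> r = 2 \<or> r = 3 \<or> r = 4 \<or> r = 5 \<or> r = 6" using r by auto
  have "a = 1 \<or> a = 2 \<or> a = 3 \<or> a = 4" "c = 1 \<or> c = 2 \<or> c = 3 \<or> c = 4"
    using a c unfolding I4_eq by auto
  then show ?thesis using r6
    by (elim disjE; hypsubst; unfold alt2_norm[OF alt2_dualy] alt2_norm[OF alt2_yA] dualy_explicit[OF alt2_yA] yA_num Y; simp add: Fm_def)
qed

lemma letter_F:
  assumes "Y w k = Fm r" "r \<in> {1..6}" "a \<in> I4" "c \<in> I4"
  shows "letter t w k a c = (if c = pm r a then sg t r a else 0)"
proof -
  have "sg True r a = (if odd r then 2 else -2) * sg False r a" unfolding sg_def by simp
  then show ?thesis
    by (cases t) (simp_all add: letter_def dualy_F[OF assms] yA_F[OF assms] del: mult_minus_left mult_numeral_1)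
qed

lemma wd_F:
  assumes "Y w k = Fm r" "r \<in> {1..6}" "a \<in> I4"
  shows "wd t (k # ks) w a b = sg t r a * wd (\<not> t) ks w (pm r a) b"
proof -
  have p: "pm r a \<in> I4" by (auto simp: pm_def I4_def)
  have "wd t (k # ks) w a b = (\<Sum>c\<in>I4. if c = pm r a then sg t r a * wd (\<not> t) ks w c b else 0)"
    unfolding wd.simps by (intro sum.cong refl) (simp add: letter_F[OF assms])
  also have "\<dots> = sg t r a * wd (\<not> t) ks w (pm r a) b" using p by simp
  finally show ?thesis .
qed

lemma inv3_explicit: "inv3 k k' w = 4 * (Y w k 1 2 * Y w k' 3 4 - Y w k 1 3 * Y w k' 2 4 + Y w k 1 4 * Y w k' 2 3
   + Y w k 2 3 * Y w k' 1 4 - Y w k 2 4 * Y w k' 1 3 + Y w k 3 4 * Y w k' 1 2)"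
proof -
  note al = alt2_yA[of w k]
  have "inv3 k k' w = (\<Sum>a\<in>I4. \<Sum>b\<in>I4. yA w k a b * dualy (yA w k') a b)"
    unfolding inv3_def dualy_def by (simp add: sum_distrib_left ac_simps)
  also have "\<dots> = 4 * (Y w k 1 2 * Y w k' 3 4 - Y w k 1 3 * Y w k' 2 4 + Y w k 1 4 * Y w k' 2 3
     + Y w k 2 3 * Y w k' 1 4 - Y w k 2 4 * Y w k' 1 3 + Y w k 3 4 * Y w k' 1 2)"
    unfolding sum_I4 alt2_norm[OF al] alt2_norm[OF alt2_dualy] dualy_explicit[OF alt2_yA] yA_num by algebra
  finally show ?thesis .
qed

lemma inv3_F:
  assumes "Y w k = Fm r" "Y w k' = Fm r'" "r \<in> {1..6}" "r' \<in> {1..6}" "r \<noteq> r'"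
  shows "inv3 k k' w = 0"
proof -
  have "r = 1 \<or> r = 2 \<or> r = 3 \<or> r = 4 \<or> r = 5 \<or> r = 6" "r' = 1 \<or> r' = 2 \<or> r' = 3 \<or> r' = 4 \<or> r' = 5 \<or> r' = 6"
    using assms by auto
  then show ?thesis unfolding inv3_explicit assms(1,2) using assms(5)
    by (elim disjE) (simp_all add: Fm_def)
qed

definition wF :: pt where
  "wF = ((\<lambda>j a. 0), Fm, (\<lambda>l a b c. 0))"

lemma Y_wF: "Y wF r = Fm r"
  by (simp add: wF_def Y_def)

text \<open>The six signed permutations compose to minus the identity. The three dual letters
  contribute a factor 2 each at odd places and -2 each at even places.\<close>

lemma wd_six_F:
  assumes "a \<in> I4" "b \<in> I4"
  shows "wd t six wF a b = (if t then -8 else 8) * ev a b"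
proof -
  have "a = 1 \<or> a = 2 \<or> a = 3 \<or> a = 4" using assms unfolding I4_eq by auto
  then show ?thesis unfolding six_def
    by (cases t; elim disjE; simp add: wd_F[OF Y_wF] I4_def pm_def sg_def del: wd.simps(2))
qed

text \<open>At an orthogonal point the letters anticommute exactly, so the alternating sum is 6!
  times one word. Comparison with \<open>wd_alternating_six\<close> ties \<open>altB\<close> to a
  single product.\<close>

lemma altB_F:
  assumes a: "a \<in> I4"
  shows "inv4 id wF * altB t a b = 720 * wd t six wF a b"
proof -
  interpret S: sign_words "{\<lambda>w. 0}" "\<lambda>l w. wd t l wF a b" "mset six"
  proof
    fix A B :: "nat list" and k k'
    assume m: "mset (A @ [k, k'] @ B) = mset six"
    then have "distinct (A @ [k, k'] @ B)" using set_six(2) mset_eq_imp_distinct_iff by blast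
    moreover have "set (A @ [k, k'] @ B) = {1..6}" using mset_eq_setD[OF m] set_six(1) by simp
    ultimately have "inv3 k k' wF = 0" by (intro inv3_F[OF Y_wF Y_wF]) auto
    then have "wd t (A @ [k, k'] @ B) wF a b + wd t (A @ [k', k] @ B) wF a b = 0"
      using wd_swap[OF a, of t A k k' B wF b] by simp
    then show "(\<lambda>w. wd t (A @ [k, k'] @ B) wF a b + wd t (A @ [k', k] @ B) wF a b) \<in> {\<lambda>w. 0}" by simp
  qed auto
  have "(\<lambda>w::pt. (\<Sum>p | p permutes set six. of_int (sign p) * wd t (map (id \<circ> p) six @ []) wF a b) - fact (length six) * wd t (map id six @ []) wF a b) \<in> {\<lambda>w. 0}"
    by (rule S.alternating_sum[OF set_six(2)]) simp
  then have "(\<Sum>p | p permutes {1..6}. of_int (sign p) * wd t (map (id \<circ> p) six) wF a b) = 720 * wd t six wF a b"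
    unfolding set_six by (simp add: fun_eq_iff fact_numeral)
  then show ?thesis unfolding wd_alternating_six[OF a] .
qed

text \<open>Argued through words: a zero determinant would force the word in the six orthogonal
  letters to vanish, but that is a nonzero scalar matrix.\<close>

lemma inv4_F_nonzero: "inv4 id wF \<noteq> 0"
proof
  assume "inv4 id wF = 0"
  then have "720 * wd True six wF 1 1 = 0" using altB_F[of 1 True 1] by (simp add: I4_def)
  then show False using wd_six_F[of 1 1 True] by (simp add: I4_def ev_def)
qed

text \<open>Proportionality factor between the alternating word in six letters and the determinant,
  solved from \<open>altB_F\<close>.\<close>

definition csix :: "bool \<Rightarrow> complex" where
  "csix t = 720 * (if t then -8 else 8) / inv4 id wF"

lemma csix_nonzero: "csix t \<noteq> 0"
  using inv4_F_nonzero by (simp add: csix_def)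

lemma altB_scalar:
  assumes "a \<in> I4" "b \<in> I4"
  shows "altB t a b = csix t * ev a b"
  using altB_F[OF assms(1), of t b] wd_six_F[OF assms, of t] inv4_F_nonzero
  by (simp add: csix_def field_simps)

lemma wd_six:
  assumes a: "a \<in> I4"
  shows "(\<Sum>\<pi> | \<pi> permutes {1..6}. of_int (sign \<pi>) * wd t (map (\<kappa> \<circ> \<pi>) six @ B) w a b) = csix t * inv4 \<kappa> w * wd t B w a b"
proof -
  have e: "wd t (map (\<kappa> \<circ> \<pi>) six @ B) w a b = (\<Sum>d\<in>I4. wd t (map (\<kappa> \<circ> \<pi>) six) w a d * wd t B w d b)" for \<pi>
    unfolding wd_append[OF a] by (simp add: set_six)
  have "(\<Sum>\<pi> | \<pi> permutes {1..6}. of_int (sign \<pi>) * wd t (map (\<kappa> \<circ> \<pi>) six @ B) w a b)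
     = (\<Sum>\<pi> | \<pi> permutes {1..6}. \<Sum>d\<in>I4. of_int (sign \<pi>) * wd t (map (\<kappa> \<circ> \<pi>) six) w a d * wd t B w d b)"
    unfolding e sum_distrib_left by (simp only: mult.assoc)
  also have "\<dots> = (\<Sum>d\<in>I4. (\<Sum>\<pi> | \<pi> permutes {1..6}. of_int (sign \<pi>) * wd t (map (\<kappa> \<circ> \<pi>) six) w a d) * wd t B w d b)"
    unfolding sum_distrib_right by (rule sum.swap)
  also have "\<dots> = (\<Sum>d\<in>I4. csix t * inv4 \<kappa> w * (ev a d * wd t B w d b))"
    unfolding wd_alternating_six[OF a] by (intro sum.cong refl) (simp add: altB_scalar[OF a])
  also have "\<dots> = csix t * inv4 \<kappa> w * wd t B w a b"
    unfolding sum_distrib_left[symmetric] sum_ev_left[OF a] ..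
  finally show ?thesis .
qed

subsection \<open>Reduction of words\<close>

text \<open>Common frame for words between two ends and for traces: \<phi> obeys the Clifford
  relation, and the alternating sum over six leading letters splits off a determinant.\<close>

locale word_reduction =
  fixes R :: "(pt \<Rightarrow> complex) set" and n2 :: nat and \<phi> :: "nat list \<Rightarrow> pt \<Rightarrow> complex" and c :: complex
  assumes Rc: "(\<lambda>w. d) \<in> R"
    and Ra: "f \<in> R \<Longrightarrow> h \<in> R \<Longrightarrow> (\<lambda>w. f w + h w) \<in> R"
    and Rm: "f \<in> R \<Longrightarrow> h \<in> R \<Longrightarrow> (\<lambda>w. f w * h w) \<in> R"
    and R3: "k \<in> {1..n2} \<Longrightarrow> k' \<in> {1..n2} \<Longrightarrow> inv3 k k' \<in> R"
    and R4: "1 \<le> \<kappa> 1 \<Longrightarrow> (\<forall>r\<in>{1..<6}. \<kappa> r < \<kappa> (Suc r)) \<Longrightarrow> \<kappa> 6 \<le> n2 \<Longrightarrow> inv4 \<kappa> \<in> R"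
    and swp: "\<phi> (A @ [k, k'] @ B) w + \<phi> (A @ [k', k] @ B) w = - inv3 k k' w / 2 * \<phi> (A @ B) w"
    and sx: "(\<Sum>\<pi> | \<pi> permutes {1..6}. of_int (sign \<pi>) * \<phi> (map (\<kappa> \<circ> \<pi>) six @ B) w) = c * inv4 \<kappa> w * \<phi> B w"
begin

definition shorter :: "nat list \<Rightarrow> bool" where
  "shorter ks \<longleftrightarrow> (\<forall>ks'. set ks' \<subseteq> {1..n2} \<longrightarrow> length ks' < length ks \<longrightarrow> even (length ks') = even (length ks) \<longrightarrow> \<phi> ks' \<in> R)"

lemma sign_words:
  assumes s: "shorter ks" and ks: "set ks \<subseteq> {1..n2}"
  shows "sign_words R \<phi> (mset ks)"
proof
  fix A B :: "nat list" and k k'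
  assume m: "mset (A @ [k, k'] @ B) = mset ks"
  have st: "set (A @ [k, k'] @ B) = set ks" using mset_eq_setD[OF m] .
  have ln: "length (A @ [k, k'] @ B) = length ks" using mset_eq_length[OF m] .
  have "set (A @ B) \<subseteq> {1..n2}" using st ks by auto
  moreover have l2: "length ks = length (A @ B) + 2" using ln by simp
  have "length (A @ B) < length ks" "even (length (A @ B)) = even (length ks)" unfolding l2 by simp_all
  ultimately have "\<phi> (A @ B) \<in> R" using s unfolding shorter_def by blast
  moreover have "inv3 k k' \<in> R" by (rule R3) (use st ks in auto)
  ultimately have "(\<lambda>w. (- 1 / 2 * inv3 k k' w) * \<phi> (A @ B) w) \<in> R" by (intro Rm Rc)
  then show "(\<lambda>w. \<phi> (A @ [k, k'] @ B) w + \<phi> (A @ [k', k] @ B) w) \<in> R" unfolding swp by simp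
qed (auto intro: Rc Ra Rm)

text \<open>Strong induction on the length. Modulo shorter words of the same parity, a word with a
  repeated letter lies in R and any other word may be sorted. From six letters on, antisymmetrising
  the first six splits off \<open>inv4\<close> and leaves a word six letters shorter. This leaves
  \<open>base\<close>: strictly increasing words of at most five letters.\<close>

lemma reduce:
  assumes base: "\<And>ks. sorted_wrt (<) ks \<Longrightarrow> set ks \<subseteq> {1..n2} \<Longrightarrow> length ks \<le> 5 \<Longrightarrow> even (length ks) = q \<Longrightarrow> shorter ks \<Longrightarrow> \<phi> ks \<in> R"
    and "set ks \<subseteq> {1..n2}" "even (length ks) = q"
  shows "\<phi> ks \<in> R"
  using assms(2,3)
proof (induction "length ks" arbitrary: ks rule: less_induct)
  case less
  have sh: "shorter ks" using less unfolding shorter_def by blast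
  interpret S: sign_words R \<phi> "mset ks" by (rule sign_words[OF sh less.prems(1)])
  show ?case
  proof (cases "distinct ks")
    case False
    then show ?thesis by (intro S.mem_repeated) simp
  next
    case True
    let ?s = "sort ks"
    have so: "sorted_wrt (<) ?s" using True by (simp add: strict_sorted_iff)
    have st: "set ?s \<subseteq> {1..n2}" using less.prems by simp
    have "\<phi> ?s \<in> R"
    proof (cases "length ks \<le> 5")
      case True
      have "shorter ?s" using sh by (simp add: shorter_def)
      then show ?thesis using base[OF so st] True less.prems by simp
    next
      case False
      \<comment> \<open>\<open>inv4\<close> numbers its columns from 1, whereas list positions start
        at 0.\<close>
      define \<kappa> where "\<kappa> r = ?s ! (r - 1)" for r
      define B where "B = drop 6 ?s"
      have len: "6 \<le> length ?s" using False by simp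
      have t6: "map \<kappa> six = take 6 ?s"
        using len by (intro nth_equalityI) (auto simp: six_def \<kappa>_def nth_Cons' numeral_eq_Suc less_Suc_eq)
      have sB: "map \<kappa> six @ B = ?s" unfolding t6 B_def by simp
      have BR: "\<phi> B \<in> R"
      proof (rule less.hyps)
        have lB: "length B = length ks - 6" by (simp add: B_def)
        show "length B < length ks" using lB len by simp
        show "set B \<subseteq> {1..n2}" using st set_drop_subset[of 6 ?s] unfolding B_def by blast
        show "even (length B) = q" using lB len less.prems(2) by simp
      qed
      have nth: "?s ! i < ?s ! j" if "i < j" "j < length ?s" for i j using so that by (rule sorted_wrt_nth_less)
      have mem: "?s ! i \<in> {1..n2}" if "i < length ?s" for i using st nth_mem[OF that] by blast
      have i4: "inv4 \<kappa> \<in> R"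
      proof (rule R4)
        have "?s ! 0 \<in> {1..n2}" by (rule mem) (use len in linarith)
        moreover have "?s ! 5 \<in> {1..n2}" by (rule mem) (use len in linarith)
        ultimately show "1 \<le> \<kappa> 1" "\<kappa> 6 \<le> n2" by (simp_all add: \<kappa>_def)
        show "\<forall>r\<in>{1..<6}. \<kappa> r < \<kappa> (Suc r)"
        proof
          fix r :: nat assume "r \<in> {1..<6}"
          then have "?s ! (r - 1) < ?s ! r" using len by (intro nth) auto
          then show "\<kappa> r < \<kappa> (Suc r)" by (simp add: \<kappa>_def)
        qed
      qed
      have "(\<lambda>w. (\<Sum>p | p permutes set six. of_int (sign p) * \<phi> (map (\<kappa> \<circ> p) six @ B) w) - fact (length six) * \<phi> (map \<kappa> six @ B) w) \<in> R"
        by (rule S.alternating_sum[OF set_six(2)]) (simp add: sB)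
      then have 1: "(\<lambda>w. c * inv4 \<kappa> w * \<phi> B w - 720 * \<phi> ?s w) \<in> R"
        unfolding sB set_six sx by (simp add: fact_numeral)
      have 2: "(\<lambda>w. c * inv4 \<kappa> w * \<phi> B w) \<in> R" by (intro Rm Rc i4 BR)
      have "(\<lambda>w. (-1 / 720) * (c * inv4 \<kappa> w * \<phi> B w - 720 * \<phi> ?s w) + (1 / 720) * (c * inv4 \<kappa> w * \<phi> B w)) \<in> R"
        by (rule Ra[OF Rm[OF Rc 1] Rm[OF Rc 2]])
      moreover have "(-1 / 720) * (x - 720 * y) + (1 / 720) * x = y" for x y :: complex
        by (simp add: field_simps)
      ultimately show ?thesis by (simp only:)
    qed
    then show ?thesis by (rule S.mem_sort[OF refl])
  qed
qed

end

subsection \<open>Generation\<close>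

lemma alg_gen_smult: "f \<in> alg_gen S \<Longrightarrow> (\<lambda>w. c * f w) \<in> alg_gen S"
  by (rule alg_gen.mult[OF alg_gen.const])

lemma alg_gen_uminus: "f \<in> alg_gen S \<Longrightarrow> (\<lambda>w. - f w) \<in> alg_gen S"
  using alg_gen_smult[of f S "-1"] by simp

lemma listed_inv1:
  "1 \<le> j1 \<Longrightarrow> j1 < j2 \<Longrightarrow> j2 < j3 \<Longrightarrow> j3 < j4 \<Longrightarrow> j4 \<le> n1 \<Longrightarrow> inv1 j1 j2 j3 j4 \<in> listed n1 n2 n3"
  unfolding listed_def
  by (rule UnI1, rule UnI1, rule UnI1, rule UnI1, rule UnI1, rule UnI1, rule UnI1, rule UnI1, rule UnI1, rule UnI1, rule UnI1, rule UnI1, rule CollectI, intro exI conjI, rule refl, assumption+)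

lemma listed_inv2:
  "1 \<le> l1 \<Longrightarrow> l1 < l2 \<Longrightarrow> l2 < l3 \<Longrightarrow> l3 < l4 \<Longrightarrow> l4 \<le> n3 \<Longrightarrow> inv2 l1 l2 l3 l4 \<in> listed n1 n2 n3"
  unfolding listed_def
  by (rule UnI1, rule UnI1, rule UnI1, rule UnI1, rule UnI1, rule UnI1, rule UnI1, rule UnI1, rule UnI1, rule UnI1, rule UnI1, rule UnI2, rule CollectI, intro exI conjI, rule refl, assumption+)

lemma listed_inv3:
  "1 \<le> k1 \<Longrightarrow> k1 \<le> k2 \<Longrightarrow> k2 \<le> n2 \<Longrightarrow> inv3 k1 k2 \<in> listed n1 n2 n3"
  unfolding listed_def
  by (rule UnI1, rule UnI1, rule UnI1, rule UnI1, rule UnI1, rule UnI1, rule UnI1, rule UnI1, rule UnI1, rule UnI1, rule UnI2, rule CollectI, intro exI conjI, rule refl, assumption+)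

lemma listed_inv4:
  "1 \<le> ks 1 \<Longrightarrow> \<forall>r\<in>{1..<6}. ks r < ks (Suc r) \<Longrightarrow> ks 6 \<le> n2 \<Longrightarrow> inv4 ks \<in> listed n1 n2 n3"
  unfolding listed_def
  by (rule UnI1, rule UnI1, rule UnI1, rule UnI1, rule UnI1, rule UnI1, rule UnI1, rule UnI1, rule UnI1, rule UnI2, rule CollectI, intro exI conjI, rule refl, assumption+)

lemma listed_inv5:
  "1 \<le> j \<Longrightarrow> j \<le> n1 \<Longrightarrow> 1 \<le> l \<Longrightarrow> l \<le> n3 \<Longrightarrow> inv5 j l \<in> listed n1 n2 n3"
  unfolding listed_def
  by (rule UnI1, rule UnI1, rule UnI1, rule UnI1, rule UnI1, rule UnI1, rule UnI1, rule UnI1, rule UnI2, rule CollectI, intro exI conjI, rule refl, assumption+)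

lemma listed_inv6:
  "1 \<le> j1 \<Longrightarrow> j1 < j2 \<Longrightarrow> j2 \<le> n1 \<Longrightarrow> 1 \<le> k \<Longrightarrow> k \<le> n2 \<Longrightarrow> inv6 j1 j2 k \<in> listed n1 n2 n3"
  unfolding listed_def
  by (rule UnI1, rule UnI1, rule UnI1, rule UnI1, rule UnI1, rule UnI1, rule UnI1, rule UnI2, rule CollectI, intro exI conjI, rule refl, assumption+)

lemma listed_inv7a:
  "1 \<le> j \<Longrightarrow> j \<le> j' \<Longrightarrow> j' \<le> n1 \<Longrightarrow> 1 \<le> k1 \<Longrightarrow> k1 < k2 \<Longrightarrow> k2 < k3 \<Longrightarrow> k3 \<le> n2 \<Longrightarrow> inv7a j j' k1 k2 k3 \<in> listed n1 n2 n3"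
  unfolding listed_def
  by (rule UnI1, rule UnI1, rule UnI1, rule UnI1, rule UnI1, rule UnI1, rule UnI2, rule CollectI, intro exI conjI, rule refl, assumption+)

lemma listed_inv7b:
  "1 \<le> j1 \<Longrightarrow> j1 < j2 \<Longrightarrow> j2 \<le> n1 \<Longrightarrow> 1 \<le> k1 \<Longrightarrow> k1 < k2 \<Longrightarrow> k2 < k3 \<Longrightarrow> k3 < k4 \<Longrightarrow> k4 < k5 \<Longrightarrow> k5 \<le> n2 \<Longrightarrow> inv7b j1 j2 k1 k2 k3 k4 k5 \<in> listed n1 n2 n3"
  unfolding listed_def
  by (rule UnI1, rule UnI1, rule UnI1, rule UnI1, rule UnI1, rule UnI2, rule CollectI, intro exI conjI, rule refl, assumption+)

lemma listed_inv8a: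
  "1 \<le> l1 \<Longrightarrow> l1 < l2 \<Longrightarrow> l2 \<le> n3 \<Longrightarrow> 1 \<le> k \<Longrightarrow> k \<le> n2 \<Longrightarrow> inv8a l1 l2 k \<in> listed n1 n2 n3"
  unfolding listed_def
  by (rule UnI1, rule UnI1, rule UnI1, rule UnI1, rule UnI2, rule CollectI, intro exI conjI, rule refl, assumption+)

lemma listed_inv8b:
  "1 \<le> l \<Longrightarrow> l \<le> l' \<Longrightarrow> l' \<le> n3 \<Longrightarrow> 1 \<le> k1 \<Longrightarrow> k1 < k2 \<Longrightarrow> k2 < k3 \<Longrightarrow> k3 \<le> n2 \<Longrightarrow> inv8b l l' k1 k2 k3 \<in> listed n1 n2 n3"
  unfolding listed_def
  by (rule UnI1, rule UnI1, rule UnI1, rule UnI2, rule CollectI, intro exI conjI, rule refl, assumption+)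

lemma listed_inv8c:
  "1 \<le> l1 \<Longrightarrow> l1 < l2 \<Longrightarrow> l2 \<le> n3 \<Longrightarrow> 1 \<le> k1 \<Longrightarrow> k1 < k2 \<Longrightarrow> k2 < k3 \<Longrightarrow> k3 < k4 \<Longrightarrow> k4 < k5 \<Longrightarrow> k5 \<le> n2 \<Longrightarrow> inv8c l1 l2 k1 k2 k3 k4 k5 \<in> listed n1 n2 n3"
  unfolding listed_def
  by (rule UnI1, rule UnI1, rule UnI2, rule CollectI, intro exI conjI, rule refl, assumption+)

lemma listed_inv9a:
  "1 \<le> j \<Longrightarrow> j \<le> n1 \<Longrightarrow> 1 \<le> l \<Longrightarrow> l \<le> n3 \<Longrightarrow> 1 \<le> k1 \<Longrightarrow> k1 < k2 \<Longrightarrow> k2 \<le> n2 \<Longrightarrow> inv9a j k1 k2 l \<in> listed n1 n2 n3"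
  unfolding listed_def
  by (rule UnI1, rule UnI2, rule CollectI, intro exI conjI, rule refl, assumption+)

lemma listed_inv9b:
  "1 \<le> j \<Longrightarrow> j \<le> n1 \<Longrightarrow> 1 \<le> l \<Longrightarrow> l \<le> n3 \<Longrightarrow> 1 \<le> k1 \<Longrightarrow> k1 < k2 \<Longrightarrow> k2 < k3 \<Longrightarrow> k3 < k4 \<Longrightarrow> k4 \<le> n2 \<Longrightarrow> inv9b j k1 k2 k3 k4 l \<in> listed n1 n2 n3"
  unfolding listed_def
  by (rule UnI2, rule CollectI, intro exI conjI, rule refl, assumption+)

locale generators =
  fixes n1 n2 n3 :: nat
begin

abbreviation "RR \<equiv> alg_gen (listed n1 n2 n3)"

lemma RR_inv3: "k \<in> {1..n2} \<Longrightarrow> k' \<in> {1..n2} \<Longrightarrow> inv3 k k' \<in> RR"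
proof (cases "k \<le> k'")
  case True
  assume "k \<in> {1..n2}" "k' \<in> {1..n2}"
  then show ?thesis using True by (intro alg_gen.gen listed_inv3) auto
next
  case False
  assume "k \<in> {1..n2}" "k' \<in> {1..n2}"
  then have "inv3 k' k \<in> RR" using False by (intro alg_gen.gen listed_inv3) auto
  then show ?thesis using inv3_commute[of k k'] by (metis ext)
qed

lemma RR_inv4: "1 \<le> \<kappa> 1 \<Longrightarrow> (\<forall>r\<in>{1..<6}. \<kappa> r < \<kappa> (Suc r)) \<Longrightarrow> \<kappa> 6 \<le> n2 \<Longrightarrow> inv4 \<kappa> \<in> RR"
  by (intro alg_gen.gen listed_inv4)

lemma bil_swap:
  "bil p (wd t (A @ [k, k'] @ B) w) q + bil p (wd t (A @ [k', k] @ B) w) q = - inv3 k k' w / 2 * bil p (wd t (A @ B) w) q"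
proof -
  have "bil p (wd t (A @ [k, k'] @ B) w) q + bil p (wd t (A @ [k', k] @ B) w) q
    = (\<Sum>a\<in>I4. \<Sum>b\<in>I4. p a * (wd t (A @ [k, k'] @ B) w a b + wd t (A @ [k', k] @ B) w a b) * q b)"
    unfolding bil_def by (simp only: sum.distrib[symmetric] distrib_left distrib_right)
  also have "\<dots> = (\<Sum>a\<in>I4. \<Sum>b\<in>I4. - inv3 k k' w / 2 * (p a * wd t (A @ B) w a b * q b))"
    by (intro sum.cong refl) (simp only: wd_swap, simp only: ac_simps)
  finally show ?thesis unfolding bil_def by (simp only: sum_distrib_left)
qed

lemma bil_six:
  "(\<Sum>\<pi> | \<pi> permutes {1..6}. of_int (sign \<pi>) * bil p (wd t (map (\<kappa> \<circ> \<pi>) six @ B) w) q) = csix t * inv4 \<kappa> w * bil p (wd t B w) q"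
proof -
  have "(\<Sum>\<pi> | \<pi> permutes {1..6}. of_int (sign \<pi>) * bil p (wd t (map (\<kappa> \<circ> \<pi>) six @ B) w) q)
    = (\<Sum>\<pi> | \<pi> permutes {1..6}. \<Sum>a\<in>I4. \<Sum>b\<in>I4. p a * (of_int (sign \<pi>) * wd t (map (\<kappa> \<circ> \<pi>) six @ B) w a b) * q b)"
    unfolding bil_def sum_distrib_left by (simp only: ac_simps)
  also have "\<dots> = (\<Sum>a\<in>I4. \<Sum>\<pi> | \<pi> permutes {1..6}. \<Sum>b\<in>I4. p a * (of_int (sign \<pi>) * wd t (map (\<kappa> \<circ> \<pi>) six @ B) w a b) * q b)"
    by (rule sum.swap)
  also have "\<dots> = (\<Sum>a\<in>I4. \<Sum>b\<in>I4. \<Sum>\<pi> | \<pi> permutes {1..6}. p a * (of_int (sign \<pi>) * wd t (map (\<kappa> \<circ> \<pi>) six @ B) w a b) * q b)"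
    by (intro sum.cong refl sum.swap)
  also have "\<dots> = (\<Sum>a\<in>I4. \<Sum>b\<in>I4. p a * (\<Sum>\<pi> | \<pi> permutes {1..6}. of_int (sign \<pi>) * wd t (map (\<kappa> \<circ> \<pi>) six @ B) w a b) * q b)"
    by (simp only: sum_distrib_left sum_distrib_right)
  also have "\<dots> = (\<Sum>a\<in>I4. \<Sum>b\<in>I4. csix t * inv4 \<kappa> w * (p a * wd t B w a b * q b))"
    by (intro sum.cong refl) (simp only: wd_six, simp only: ac_simps)
  finally show ?thesis unfolding bil_def by (simp only: sum_distrib_left)
qed

lemma word_reduction_bil: "word_reduction RR n2 (\<lambda>ks w. bil (p w) (wd t ks w) (q w)) (csix t)"
  by unfold_locales (rule alg_gen.const bil_swap bil_six | (rule alg_gen.add alg_gen.mult RR_inv3 RR_inv4; assumption))+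

lemma word_reduction_tr: "word_reduction RR n2 (\<lambda>ks w. \<Sum>a\<in>I4. wd False ks w a a) (csix False)"
proof
  fix A B k k' w
  show "(\<Sum>a\<in>I4. wd False (A @ [k, k'] @ B) w a a) + (\<Sum>a\<in>I4. wd False (A @ [k', k] @ B) w a a)
     = - inv3 k k' w / 2 * (\<Sum>a\<in>I4. wd False (A @ B) w a a)"
    unfolding sum.distrib[symmetric] sum_distrib_left by (intro sum.cong refl wd_swap)
next
  fix \<kappa> :: "nat \<Rightarrow> nat" and B w
  have "(\<Sum>\<pi> | \<pi> permutes {1..6}. of_int (sign \<pi>) * (\<Sum>a\<in>I4. wd False (map (\<kappa> \<circ> \<pi>) six @ B) w a a))
     = (\<Sum>a\<in>I4. \<Sum>\<pi> | \<pi> permutes {1..6}. of_int (sign \<pi>) * wd False (map (\<kappa> \<circ> \<pi>) six @ B) w a a)"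
    unfolding sum_distrib_left by (rule sum.swap)
  then show "(\<Sum>\<pi> | \<pi> permutes {1..6}. of_int (sign \<pi>) * (\<Sum>a\<in>I4. wd False (map (\<kappa> \<circ> \<pi>) six @ B) w a a))
     = csix False * inv4 \<kappa> w * (\<Sum>a\<in>I4. wd False B w a a)"
    unfolding sum_distrib_left[of "csix False * inv4 \<kappa> w"] by (simp only:) (intro sum.cong refl wd_six)
qed (rule alg_gen.const | (rule alg_gen.add alg_gen.mult RR_inv3 RR_inv4; assumption))+

lemma list_1_3_5:
  assumes "odd (length ks)" "length ks \<le> 5"
  obtains k1 where "ks = [k1]" | k1 k2 k3 where "ks = [k1, k2, k3]" | k1 k2 k3 k4 k5 where "ks = [k1, k2, k3, k4, k5]"
proof -
  have "length ks = 1 \<or> length ks = 3 \<or> length ks = 5" using assms by presburger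
  then show ?thesis using that by (auto simp: length_Suc_conv numeral_eq_Suc)
qed

lemma list_0_2_4:
  assumes "even (length ks)" "length ks \<le> 5"
  obtains "ks = []" | k1 k2 where "ks = [k1, k2]" | k1 k2 k3 k4 where "ks = [k1, k2, k3, k4]"
proof -
  have "length ks = 0 \<or> length ks = 2 \<or> length ks = 4" using assms by presburger
  then show ?thesis using that by (auto simp: length_Suc_conv numeral_eq_Suc)
qed

lemma list4: "length xs = 4 \<Longrightarrow> \<exists>a b c d. xs = [a, b, c, d]"
  by (auto simp: length_Suc_conv numeral_eq_Suc)

text \<open>Transposing a word of odd length between equal ends gives minus the reversed word.
  Reversal is an even permutation of one or five letters and an odd one of three, so for equal ends
  words of length 1 and 5 reduce while those of length 3 survive. This is the reason for the mixture
  of strict and weak inequalities between the end indices in the list.\<close>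

lemma same_ends:
  fixes pf :: "nat \<Rightarrow> pt \<Rightarrow> nat \<Rightarrow> complex"
  assumes one: "\<And>j j' k. 1 \<le> j \<Longrightarrow> j < j' \<Longrightarrow> j' \<le> n \<Longrightarrow> k \<in> {1..n2} \<Longrightarrow> (\<lambda>w. bil (pf j w) (wd t [k] w) (pf j' w)) \<in> RR"
    and three: "\<And>j j' k1 k2 k3. 1 \<le> j \<Longrightarrow> j \<le> j' \<Longrightarrow> j' \<le> n \<Longrightarrow> 1 \<le> k1 \<Longrightarrow> k1 < k2 \<Longrightarrow> k2 < k3 \<Longrightarrow> k3 \<le> n2
        \<Longrightarrow> (\<lambda>w. bil (pf j w) (wd t [k1, k2, k3] w) (pf j' w)) \<in> RR"
    and five: "\<And>j j' k1 k2 k3 k4 k5. 1 \<le> j \<Longrightarrow> j < j' \<Longrightarrow> j' \<le> n \<Longrightarrow> 1 \<le> k1 \<Longrightarrow> k1 < k2 \<Longrightarrow> k2 < k3 \<Longrightarrow> k3 < k4 \<Longrightarrow> k4 < k5 \<Longrightarrow> k5 \<le> n2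
        \<Longrightarrow> (\<lambda>w. bil (pf j w) (wd t [k1, k2, k3, k4, k5] w) (pf j' w)) \<in> RR"
    and j: "j \<in> {1..n}" "j' \<in> {1..n}" and ks: "set ks \<subseteq> {1..n2}" "odd (length ks)"
  shows "(\<lambda>w. bil (pf j w) (wd t ks w) (pf j' w)) \<in> RR"
proof -
  have le: "(\<lambda>w. bil (pf j w) (wd t ks w) (pf j' w)) \<in> RR"
    if j: "1 \<le> j" "j \<le> j'" "j' \<le> n" and ks: "set ks \<subseteq> {1..n2}" "odd (length ks)" for j j' ks
  proof -
    interpret W: word_reduction RR n2 "\<lambda>ks w. bil (pf j w) (wd t ks w) (pf j' w)" "csix t" by (rule word_reduction_bil)
    show ?thesis
    proof (rule W.reduce[where q = False])
      fix ks :: "nat list"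
      assume so: "sorted_wrt (<) ks" and st: "set ks \<subseteq> {1..n2}" and l5: "length ks \<le> 5" and q: "even (length ks) = False" and sh: "W.shorter ks"
      have od: "odd (length ks)" using q by simp
      \<comment> \<open>With s the sign of the reversal, transposition puts (1 + s) times the word
        into the algebra, which settles every case but s = -1.\<close>
      have diag: "(\<lambda>w. bil (pf j w) (wd t ks w) (pf j' w)) \<in> RR" if e: "j = j'" and eq: "\<exists>s f. f \<in> RR \<and> s \<noteq> -1 \<and> (\<forall>w. bil (pf j w) (wd t (rev ks) w) (pf j' w) = s * bil (pf j w) (wd t ks w) (pf j' w) + f w)"
      proof -
        obtain s f where sf: "f \<in> RR" "s \<noteq> -1" "\<And>w. bil (pf j w) (wd t (rev ks) w) (pf j' w) = s * bil (pf j w) (wd t ks w) (pf j' w) + f w"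
          using eq by blast
        have "bil (pf j w) (wd t ks w) (pf j' w) = (- 1 / (1 + s)) * f w" for w
        proof -
          have "bil (pf j w) (wd t ks w) (pf j' w) = - bil (pf j w) (wd t (rev ks) w) (pf j' w)"
            using bil_transpose[of "pf j w" t ks w "pf j' w"] od e by simp
          then have "(1 + s) * bil (pf j w) (wd t ks w) (pf j' w) = - f w" unfolding sf(3) by (simp add: algebra_simps)
          moreover have "1 + s \<noteq> 0" using sf(2) by (metis add.commute add_eq_0_iff)
          ultimately show ?thesis by (simp add: field_simps)
        qed
        then show ?thesis using alg_gen_smult[OF sf(1), of "- 1 / (1 + s)"] by simp
      qed
      show "(\<lambda>w. bil (pf j w) (wd t ks w) (pf j' w)) \<in> RR"
        using od l5
      proof (cases rule: list_1_3_5)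
        case (1 k1)
        show ?thesis
        proof (cases "j = j'")
          case True
          show ?thesis
            by (rule diag[OF True]) (intro exI[of _ 1] exI[of _ "\<lambda>w. 0"], simp add: 1 alg_gen.const)
        next
          case False
          then show ?thesis using one[of j j' k1] j st 1 by simp
        qed
      next
        case (2 k1 k2 k3)
        then show ?thesis using three[of j j' k1 k2 k3] j st so by simp
      next
        case (3 k1 k2 k3 k4 k5)
        show ?thesis
        proof (cases "j = j'")
          case False
          then show ?thesis using five[of j j' k1 k2 k3 k4 k5] j st so 3 by simp
        next
          case True
          interpret S: sign_words RR "\<lambda>ks w. bil (pf j w) (wd t ks w) (pf j' w)" "mset ks" by (rule W.sign_words[OF sh st])
          have 1: "S.eqv (-1) ([] @ [k5] @ [k4, k3, k2] @ [k1] @ []) ([] @ [k1] @ [k4, k3, k2] @ [k5] @ [])"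
            by (rule S.eqv_exchange) (simp add: 3)
          have 2: "S.eqv (-1) ([k1] @ [k4] @ [k3] @ [k2] @ [k5]) ([k1] @ [k2] @ [k3] @ [k4] @ [k5])"
            by (rule S.eqv_exchange) (simp add: 3)
          have "S.eqv (-1 * -1) (rev ks) ks" using S.eqv_trans[OF 1, of "-1" ks] 2 3 by simp
          then have f: "(\<lambda>w. bil (pf j w) (wd t (rev ks) w) (pf j' w) - 1 * bil (pf j w) (wd t ks w) (pf j' w)) \<in> RR"
            unfolding S.eqv_def by simp
          show ?thesis
            by (rule diag[OF True], intro exI[of _ 1] exI conjI, rule f) simp_all
        qed
      qed
    qed (use ks in auto)
  qed
  show ?thesis
  proof (cases "j \<le> j'")
    case True
    then show ?thesis using le j ks by simp
  next
    case False
    then have "(\<lambda>w. bil (pf j' w) (wd t (rev ks) w) (pf j w)) \<in> RR" using le[of j' j "rev ks"] j ks by simp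
    from alg_gen_uminus[OF this] show ?thesis
      using bil_transpose[of "pf j _" t ks _ "pf j' _"] ks by simp
  qed
qed

lemma RR_xx: "j \<in> {1..n1} \<Longrightarrow> j' \<in> {1..n1} \<Longrightarrow> set ks \<subseteq> {1..n2} \<Longrightarrow> odd (length ks) \<Longrightarrow> (\<lambda>w. bil (X w j) (wd True ks w) (X w j')) \<in> RR"
proof (rule same_ends[where pf = "\<lambda>j w. X w j" and n = n1])
  fix j j' k assume h: "1 \<le> j" "j < j'" "j' \<le> n1" "k \<in> {1..n2}"
  have "inv6 j j' k \<in> RR" by (rule alg_gen.gen[OF listed_inv6]) (use h in auto)
  then show "(\<lambda>w. bil (X w j) (wd True [k] w) (X w j')) \<in> RR" unfolding inv6_word[symmetric] .
next
  fix j j' k1 k2 k3 assume h: "1 \<le> j" "j \<le> j'" "j' \<le> n1" "1 \<le> k1" "k1 < k2" "k2 < k3" "k3 \<le> n2"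
  have "inv7a j j' k1 k2 k3 \<in> RR" by (rule alg_gen.gen[OF listed_inv7a]) (use h in auto)
  then show "(\<lambda>w. bil (X w j) (wd True [k1, k2, k3] w) (X w j')) \<in> RR" unfolding inv7a_word[symmetric] .
next
  fix j j' k1 k2 k3 k4 k5 assume h: "1 \<le> j" "j < j'" "j' \<le> n1" "1 \<le> k1" "k1 < k2" "k2 < k3" "k3 < k4" "k4 < k5" "k5 \<le> n2"
  have "inv7b j j' k1 k2 k3 k4 k5 \<in> RR" by (rule alg_gen.gen[OF listed_inv7b]) (use h in auto)
  from alg_gen_uminus[OF this] show "(\<lambda>w. bil (X w j) (wd True [k1, k2, k3, k4, k5] w) (X w j')) \<in> RR" unfolding inv7b_word minus_minus .
qed

lemma RR_zz: "l \<in> {1..n3} \<Longrightarrow> l' \<in> {1..n3} \<Longrightarrow> set ks \<subseteq> {1..n2} \<Longrightarrow> odd (length ks) \<Longrightarrow> (\<lambda>w. bil (zeta w l) (wd False ks w) (zeta w l')) \<in> RR"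
proof (rule same_ends[where pf = "\<lambda>l w. zeta w l" and n = n3])
  fix j j' k assume h: "1 \<le> j" "j < j'" "j' \<le> n3" "k \<in> {1..n2}"
  have "inv8a j j' k \<in> RR" by (rule alg_gen.gen[OF listed_inv8a]) (use h in auto)
  from alg_gen_uminus[OF this] show "(\<lambda>w. bil (zeta w j) (wd False [k] w) (zeta w j')) \<in> RR" unfolding inv8a_word minus_minus .
next
  fix j j' k1 k2 k3 assume h: "1 \<le> j" "j \<le> j'" "j' \<le> n3" "1 \<le> k1" "k1 < k2" "k2 < k3" "k3 \<le> n2"
  have "inv8b j j' k1 k2 k3 \<in> RR" by (rule alg_gen.gen[OF listed_inv8b]) (use h in auto)
  from alg_gen_uminus[OF this] show "(\<lambda>w. bil (zeta w j) (wd False [k1, k2, k3] w) (zeta w j')) \<in> RR" unfolding inv8b_word minus_minus .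
next
  fix j j' k1 k2 k3 k4 k5 assume h: "1 \<le> j" "j < j'" "j' \<le> n3" "1 \<le> k1" "k1 < k2" "k2 < k3" "k3 < k4" "k4 < k5" "k5 \<le> n2"
  have "inv8c j j' k1 k2 k3 k4 k5 \<in> RR" by (rule alg_gen.gen[OF listed_inv8c]) (use h in auto)
  from alg_gen_uminus[OF this] show "(\<lambda>w. bil (zeta w j) (wd False [k1, k2, k3, k4, k5] w) (zeta w j')) \<in> RR" unfolding inv8c_word minus_minus .
qed

lemma RR_xz:
  assumes h: "j \<in> {1..n1}" "l \<in> {1..n3}" and ks: "set ks \<subseteq> {1..n2}" "even (length ks)"
  shows "(\<lambda>w. bil (X w j) (wd True ks w) (zeta w l)) \<in> RR"
proof -
  interpret W: word_reduction RR n2 "\<lambda>ks w. bil (X w j) (wd True ks w) (zeta w l)" "csix True" by (rule word_reduction_bil)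
  show ?thesis
  proof (rule W.reduce[where q = True])
    fix ks :: "nat list"
    assume so: "sorted_wrt (<) ks" and st: "set ks \<subseteq> {1..n2}" and l5: "length ks \<le> 5" and q: "even (length ks) = True"
    have ev: "even (length ks)" using q by simp
    show "(\<lambda>w. bil (X w j) (wd True ks w) (zeta w l)) \<in> RR"
      using ev l5
    proof (cases rule: list_0_2_4)
      case 1
      have "inv5 j l \<in> RR" by (rule alg_gen.gen[OF listed_inv5]) (use h in auto)
      then show ?thesis unfolding 1 inv5_word[symmetric] .
    next
      case (2 k1 k2)
      have k: "1 \<le> k1" "k1 < k2" "k2 \<le> n2" "1 \<le> j" "j \<le> n1" "1 \<le> l" "l \<le> n3" using h st so 2 by auto
      have "inv9a j k1 k2 l \<in> RR" by (rule alg_gen.gen[OF listed_inv9a]) (use k in auto)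
      then show ?thesis unfolding 2 inv9a_word[symmetric] .
    next
      case (3 k1 k2 k3 k4)
      have k: "1 \<le> k1" "k1 < k2" "k2 < k3" "k3 < k4" "k4 \<le> n2" "1 \<le> j" "j \<le> n1" "1 \<le> l" "l \<le> n3" using h st so 3 by auto
      have "inv9b j k1 k2 k3 k4 l \<in> RR" by (rule alg_gen.gen[OF listed_inv9b]) (use k in auto)
      then show ?thesis unfolding 3 inv9b_word[symmetric] .
    qed
  qed (use ks in auto)
qed

text \<open>Cyclicity of the trace. The rotated word starts with the other kind of letter, and k
  keeps its own kind because an odd number of letters now precedes it.\<close>

lemma tr_rotate: "(\<Sum>a\<in>I4. wd True (k # ks) w a a) = (\<Sum>a\<in>I4. wd False (ks @ [k]) w a a)" if "odd (length ks)"
proof -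
  have "(\<Sum>a\<in>I4. wd False (ks @ [k]) w a a) = (\<Sum>a\<in>I4. \<Sum>c\<in>I4. wd False ks w a c * letter True w k c a)"
    by (intro sum.cong refl) (use that in \<open>simp add: wd_append sum_ev_right\<close>)
  also have "\<dots> = (\<Sum>c\<in>I4. \<Sum>a\<in>I4. wd False ks w a c * letter True w k c a)" by (rule sum.swap)
  finally show ?thesis by (simp add: mult.commute)
qed

text \<open>For four letters, exchanging the first and the third changes the sign modulo the
  algebra, while rotation and transposition show that the trace is unchanged; hence twice the trace
  lies in the algebra. Traces of two letters are the pairings.\<close>

lemma RR_tr:
  assumes ks: "set ks \<subseteq> {1..n2}" "even (length ks)"
  shows "(\<lambda>w. \<Sum>a\<in>I4. wd False ks w a a) \<in> RR"
proof -
  interpret W: word_reduction RR n2 "\<lambda>ks w. \<Sum>a\<in>I4. wd False ks w a a" "csix False" by (rule word_reduction_tr)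
  show ?thesis
  proof (rule W.reduce[where q = True])
    fix ks :: "nat list"
    assume so: "sorted_wrt (<) ks" and st: "set ks \<subseteq> {1..n2}" and l5: "length ks \<le> 5" and q: "even (length ks) = True" and sh: "W.shorter ks"
    have ev: "even (length ks)" using q by simp
    show "(\<lambda>w. \<Sum>a\<in>I4. wd False ks w a a) \<in> RR"
      using ev l5
    proof (cases rule: list_0_2_4)
      case 1
      then show ?thesis by (simp add: alg_gen.const)
    next
      case (2 k1 k2)
      have "inv3 k1 k2 \<in> RR" using 2 st by (intro RR_inv3) auto
      from alg_gen_uminus[OF this] show ?thesis unfolding 2 inv3_word minus_minus .
    next
      case (3 k1 k2 k3 k4)
      interpret S: sign_words RR "\<lambda>ks w. \<Sum>a\<in>I4. wd False ks w a a" "mset ks" by (rule W.sign_words[OF sh st])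
      have "S.eqv (-1) ([] @ [k1] @ [k2] @ [k3] @ [k4]) ([] @ [k3] @ [k2] @ [k1] @ [k4])"
        by (rule S.eqv_exchange) (simp add: 3)
      then have f: "(\<lambda>w. (\<Sum>a\<in>I4. wd False ks w a a) + (\<Sum>a\<in>I4. wd False [k3, k2, k1, k4] w a a)) \<in> RR"
        unfolding S.eqv_def 3 by simp
      have "(\<Sum>a\<in>I4. wd False [k3, k2, k1, k4] w a a) = (\<Sum>a\<in>I4. wd False ks w a a)" for w
      proof -
        have "(\<Sum>a\<in>I4. wd False [k3, k2, k1, k4] w a a) = (\<Sum>a\<in>I4. wd True (rev ks) w a a)"
          using tr_rotate[of "[k3, k2, k1]" k4 w] 3 by (simp del: wd.simps)
        also have "\<dots> = (\<Sum>a\<in>I4. wd False ks w a a)"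
        proof (intro sum.cong refl)
          fix a assume "a \<in> I4"
          then show "wd True (rev ks) w a a = wd False ks w a a"
            using wd_transpose[of a a False ks w] 3 by (simp del: wd.simps)
        qed
        finally show ?thesis .
      qed
      then have "(\<lambda>w. 2 * (\<Sum>a\<in>I4. wd False ks w a a)) \<in> RR" using f by simp
      from alg_gen_smult[OF this, of "1/2"] show ?thesis by simp
    qed
  qed (use ks in auto)
qed

text \<open>The indices of a determinant behave like anticommuting letters, so
  \<open>sign_words\<close> sorts them and disposes of repetitions.\<close>

lemma alternating_det_mem:
  fixes pf :: "nat \<Rightarrow> pt \<Rightarrow> nat \<Rightarrow> complex"
  assumes s: "\<And>j1 j2 j3 j4. 1 \<le> j1 \<Longrightarrow> j1 < j2 \<Longrightarrow> j2 < j3 \<Longrightarrow> j3 < j4 \<Longrightarrow> j4 \<le> n \<Longrightarrow> (\<lambda>w. det4 (pf j1 w) (pf j2 w) (pf j3 w) (pf j4 w)) \<in> RR"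
    and j: "{j1, j2, j3, j4} \<subseteq> {1..n}"
  shows "(\<lambda>w. det4 (pf j1 w) (pf j2 w) (pf j3 w) (pf j4 w)) \<in> RR"
proof -
  let ?\<phi> = "\<lambda>L w. det4 (pf (L ! 0) w) (pf (L ! 1) w) (pf (L ! 2) w) (pf (L ! 3) w)"
  let ?L = "[j1, j2, j3, j4]"
  interpret S: sign_words RR ?\<phi> "mset ?L"
  proof
    fix A B :: "nat list" and k k'
    assume "mset (A @ [k, k'] @ B) = mset ?L"
    from mset_eq_length[OF this] have "length A + length B = 2" by simp
    then consider b c where "A = []" "B = [b, c]" | b c where "A = [b]" "B = [c]" | b c where "A = [b, c]" "B = []"
      by (cases A; cases "tl A"; cases B; cases "tl B") auto
    then have "?\<phi> (A @ [k, k'] @ B) w + ?\<phi> (A @ [k', k] @ B) w = 0" for w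
    proof cases
      case (1 b c)
      then show ?thesis using det4_swap12[of "pf k w" "pf k' w" "pf b w" "pf c w"] by simp
    next
      case (2 b c)
      then show ?thesis using det4_swap23[of "pf b w" "pf k w" "pf k' w" "pf c w"] by (simp add: numeral_2_eq_2 numeral_3_eq_3)
    next
      case (3 b c)
      then show ?thesis using det4_swap34[of "pf b w" "pf c w" "pf k w" "pf k' w"] by (simp add: numeral_2_eq_2 numeral_3_eq_3)
    qed
    then show "(\<lambda>w. ?\<phi> (A @ [k, k'] @ B) w + ?\<phi> (A @ [k', k] @ B) w) \<in> RR" by (simp only: alg_gen.const)
  qed (auto intro: alg_gen.const alg_gen.add alg_gen_smult)
  have "?\<phi> ?L \<in> RR"
  proof (cases "distinct ?L")
    case False
    then show ?thesis by (intro S.mem_repeated) simp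
  next
    case True
    have so: "sorted_wrt (<) (sort ?L)" using True by (simp add: strict_sorted_iff del: sort_key_simps distinct.simps)
    have st: "set (sort ?L) \<subseteq> {1..n}" using j by (simp del: sort_key_simps)
    have "length (sort ?L) = 4" by (simp del: sort_key_simps)
    then obtain a b c d where L: "sort ?L = [a, b, c, d]" using list4 by blast
    have "(\<lambda>w. det4 (pf a w) (pf b w) (pf c w) (pf d w)) \<in> RR"
      by (rule s) (use so st in \<open>auto simp: L simp del: sort_key_simps\<close>)
    then have "?\<phi> (sort ?L) \<in> RR" unfolding L by (simp add: numeral_2_eq_2 numeral_3_eq_3)
    then show ?thesis by (rule S.mem_sort[OF refl])
  qed
  then show ?thesis by (simp add: numeral_2_eq_2 numeral_3_eq_3)
qed

sublocale path_algebra RR n1 n2 n3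
proof
  fix j1 j2 j3 j4 assume "{j1, j2, j3, j4} \<subseteq> {1..n1}"
  then show "(\<lambda>w. det4 (X w j1) (X w j2) (X w j3) (X w j4)) \<in> RR"
  proof (rule alternating_det_mem[rotated])
    fix j1 j2 j3 j4 assume h: "1 \<le> j1" "j1 < j2" "j2 < j3" "j3 < j4" "j4 \<le> n1"
    have "inv1 j1 j2 j3 j4 \<in> RR" by (rule alg_gen.gen[OF listed_inv1]) (use h in auto)
    then show "(\<lambda>w. det4 (X w j1) (X w j2) (X w j3) (X w j4)) \<in> RR" unfolding inv1_det4[symmetric] .
  qed
next
  fix l1 l2 l3 l4 assume "{l1, l2, l3, l4} \<subseteq> {1..n3}"
  then show "(\<lambda>w. det4 (zeta w l1) (zeta w l2) (zeta w l3) (zeta w l4)) \<in> RR"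
  proof (rule alternating_det_mem[rotated])
    fix j1 j2 j3 j4 assume h: "1 \<le> j1" "j1 < j2" "j2 < j3" "j3 < j4" "j4 \<le> n3"
    have "inv2 j1 j2 j3 j4 \<in> RR" by (rule alg_gen.gen[OF listed_inv2]) (use h in auto)
    then show "(\<lambda>w. det4 (zeta w j1) (zeta w j2) (zeta w j3) (zeta w j4)) \<in> RR" unfolding inv2_det4 by (rule alg_gen_smult)
  qed
qed (rule alg_gen.const | (rule alg_gen.add alg_gen.mult RR_xx RR_zz RR_xz RR_tr; assumption))+

lemma invW_subset: "invW n1 n2 n3 \<subseteq> RR"
  using invariants_in_R by blast

end

subsection \<open>Invariance\<close>

lemma antisym_sort2:
  assumes "alt2 U"
  shows "complex_of_int (sgn (int b - int a)) * U (min a b) (max a b) = U a b"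
proof (cases a b rule: linorder_cases)
  case less
  then show ?thesis by (simp add: min_def max_def)
next
  case equal
  then show ?thesis using alt2_diag[OF assms] by simp
next
  case greater
  have "U a b = - U b a" using assms unfolding alt2_def by blast
  then show ?thesis using greater by (simp add: min_def max_def)
qed

lemma antisym_sort3:
  assumes V: "alt3 V"
  shows "complex_of_int (sgn ((int b - int a) * (int c - int a) * (int c - int b)))
     * V (min a (min b c)) (a + b + c - min a (min b c) - max a (max b c)) (max a (max b c)) = V a b c"
proof -
  define L where "L a b c = complex_of_int (sgn ((int b - int a) * (int c - int a) * (int c - int b)))
     * V (min a (min b c)) (a + b + c - min a (min b c) - max a (max b c)) (max a (max b c))" for a b c
  have main: "L a b c = V a b c" if "a < b" "b < c" for a b c
    using that by (simp add: L_def sgn_mult min_def max_def)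
  have s12: "L b a c = - L a b c" for a b c
  proof -
    have "complex_of_int (sgn ((int a - int b) * (int c - int b) * (int c - int a))) = - of_int (sgn ((int b - int a) * (int c - int a) * (int c - int b)))"
      by (rule of_int_sgn_neg) (simp add: algebra_simps)
    moreover have "min b (min a c) = min a (min b c)" "max b (max a c) = max a (max b c)" "b + a + c = a + b + c" by auto
    ultimately show ?thesis unfolding L_def by (simp only: minus_mult_left)
  qed
  have s23: "L a c b = - L a b c" for a b c
  proof -
    have "complex_of_int (sgn ((int c - int a) * (int b - int a) * (int b - int c))) = - of_int (sgn ((int b - int a) * (int c - int a) * (int c - int b)))"
      by (rule of_int_sgn_neg) (simp add: algebra_simps)
    moreover have "min a (min c b) = min a (min b c)" "max a (max c b) = max a (max b c)" "a + c + b = a + b + c" by auto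
    ultimately show ?thesis unfolding L_def by (simp only: minus_mult_left)
  qed
  have t12: "V b a c = - V a b c" and t23: "V a c b = - V a b c" for a b c
    using V unfolding alt3_def by blast+
  have d: "L a a c = V a a c" "L a c c = V a c c" "L a c a = V a c a" for a c
    unfolding L_def using alt3_diag[OF V] by simp_all
  consider "a = b \<or> b = c \<or> a = c" | "a < b" "b < c" | "a < c" "c < b" | "b < a" "a < c" | "b < c" "c < a" | "c < a" "a < b" | "c < b" "b < a"
    by linarith
  then have "L a b c = V a b c"
  proof cases
    case 1
    then show ?thesis using d by auto
  next
    case 2
    then show ?thesis by (rule main)
  next
    case 3
    then show ?thesis using main[of a c b] s23[of a b c] t23[of a b c] by simp
  next
    case 4
    then show ?thesis using main[of b a c] s12[of a b c] t12[of a b c] by simp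
  next
    case 5
    then show ?thesis using main[of b c a] s23[of b a c] t23[of b a c] s12[of a b c] t12[of a b c] by simp
  next
    case 6
    then show ?thesis using main[of c a b] s12[of a c b] t12[of a c b] s23[of a b c] t23[of a b c] by simp
  next
    case 7
    then show ?thesis using main[of c b a] s12[of b c a] t12[of b c a] s23[of b a c] t23[of b a c] s12[of a b c] t12[of a b c] by simp
  qed
  then show ?thesis unfolding L_def .
qed

text \<open>\<open>yA\<close> reads only the sorted entries of the transformed tensor; as that
  tensor is again alternating, it is recovered at all indices.\<close>

lemma yA_act: "yA (act g w) k a b = (\<Sum>c\<in>I4. \<Sum>d\<in>I4. g a c * g b d * yA w k c d)"
proof -
  let ?U = "\<lambda>a b. \<Sum>c\<in>I4. \<Sum>d\<in>I4. g a c * g b d * yA w k c d"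
  have "alt2 ?U"
    unfolding alt2_def
  proof (intro allI)
    fix a b
    have "?U b a = (\<Sum>d\<in>I4. \<Sum>c\<in>I4. g b c * g a d * yA w k c d)" by (rule sum.swap)
    also have "\<dots> = (\<Sum>d\<in>I4. \<Sum>c\<in>I4. - (g a d * g b c * yA w k d c))"
    proof (intro sum.cong refl)
      fix d c
      have "yA w k c d = - yA w k d c" using alt2_yA unfolding alt2_def by blast
      then show "g b c * g a d * yA w k c d = - (g a d * g b c * yA w k d c)" by simp
    qed
    finally show "?U b a = - ?U a b" by (simp only: sum_negf)
  qed
  from antisym_sort2[OF this, of b a] show ?thesis unfolding yA_def[of "act g w"] act_coords(2) .
qed

lemma zA_act: "zA (act g w) l a b c = (\<Sum>d\<in>I4. \<Sum>e\<in>I4. \<Sum>f\<in>I4. g a d * g b e * g c f * zA w l d e f)"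
proof -
  let ?V = "\<lambda>a b c. \<Sum>d\<in>I4. \<Sum>e\<in>I4. \<Sum>f\<in>I4. g a d * g b e * g c f * zA w l d e f"
  have "alt3 ?V"
    unfolding alt3_def
  proof (intro allI conjI)
    fix a b c
    have "?V b a c = (\<Sum>e\<in>I4. \<Sum>d\<in>I4. \<Sum>f\<in>I4. g b d * g a e * g c f * zA w l d e f)" by (rule sum.swap)
    also have "\<dots> = (\<Sum>e\<in>I4. \<Sum>d\<in>I4. \<Sum>f\<in>I4. - (g a e * g b d * g c f * zA w l e d f))"
    proof (intro sum.cong refl)
      fix d e f
      show "g b d * g a e * g c f * zA w l d e f = - (g a e * g b d * g c f * zA w l e d f)"
        using alt3_swap12[OF alt3_zA, of w l d e f] by simp
    qed
    finally show "?V b a c = - ?V a b c" by (simp only: sum_negf)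
    have "?V a c b = (\<Sum>d\<in>I4. \<Sum>f\<in>I4. \<Sum>e\<in>I4. g a d * g c e * g b f * zA w l d e f)" by (intro sum.cong refl sum.swap)
    also have "\<dots> = (\<Sum>d\<in>I4. \<Sum>f\<in>I4. \<Sum>e\<in>I4. - (g a d * g b f * g c e * zA w l d f e))"
    proof (intro sum.cong refl)
      fix d e f
      show "g a d * g c e * g b f * zA w l d e f = - (g a d * g b f * g c e * zA w l d f e)"
        using alt3_swap23[OF alt3_zA, of w l d e f] by simp
    qed
    finally show "?V a c b = - ?V a b c" by (simp only: sum_negf)
  qed
  from antisym_sort3[OF this, of b a c] show ?thesis unfolding zA_def[of "act g w"] act_coords(3) .
qed

lemma det4_perms:
  shows "det4 p q s r = - det4 p q r s"
    "det4 p r q s = - det4 p q r s"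
    "det4 p r s q = det4 p q r s"
    "det4 p s q r = det4 p q r s"
    "det4 p s r q = - det4 p q r s"
    "det4 q p r s = - det4 p q r s"
    "det4 q p s r = det4 p q r s"
    "det4 q r p s = det4 p q r s"
    "det4 q r s p = - det4 p q r s"
    "det4 q s p r = - det4 p q r s"
    "det4 q s r p = det4 p q r s"
    "det4 r p q s = det4 p q r s"
    "det4 r p s q = - det4 p q r s"
    "det4 r q p s = - det4 p q r s"
    "det4 r q s p = det4 p q r s"
    "det4 r s p q = det4 p q r s"
    "det4 r s q p = - det4 p q r s"
    "det4 s p q r = - det4 p q r s"
    "det4 s p r q = det4 p q r s"
    "det4 s q p r = det4 p q r s"
    "det4 s q r p = - det4 p q r s"
    "det4 s r p q = - det4 p q r s"
    "det4 s r q p = det4 p q r s"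
  unfolding det4_explicit by algebra+

lemma det4_columns:
  assumes "a \<in> I4" "b \<in> I4" "c \<in> I4" "d \<in> I4"
  shows "det4 (C a) (C b) (C c) (C d) = eps a b c d * det4 (C 1) (C 2) (C 3) (C 4)"
proof -
  have z: "det4 p p q r = 0" "det4 q p p r = 0" "det4 q r p p = 0" "det4 p q p r = 0" "det4 p q r p = 0" "det4 q p r p = 0" for p q r
    unfolding det4_explicit by algebra+
  have "\<forall>a\<in>I4. \<forall>b\<in>I4. \<forall>c\<in>I4. \<forall>d\<in>I4. det4 (C a) (C b) (C c) (C d) = eps a b c d * det4 (C 1) (C 2) (C 3) (C 4)"
    unfolding I4_eq ball_simps
    by (intro conjI TrueI; simp add: eps_def z det4_perms[where p = "C (Suc 0)" and q = "C 2" and r = "C 3" and s = "C 4"])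
  then show ?thesis using assms by blast
qed

text \<open>Column b of g, the image of the b-th basis vector.\<close>

definition gcol :: "(nat \<Rightarrow> nat \<Rightarrow> complex) \<Rightarrow> nat \<Rightarrow> nat \<Rightarrow> complex" where
  "gcol g b a = g a b"

lemma detN4_gcol: "detN 4 g = det4 (gcol g 1) (gcol g 2) (gcol g 3) (gcol g 4)"
  unfolding detN4 gcol_def ..

lemma det4_combination:
  assumes "\<And>a. a \<in> I4 \<Longrightarrow> P a = (\<Sum>b\<in>I4. p b * Q b a)"
  shows "det4 P q r s = (\<Sum>b\<in>I4. p b * det4 (Q b) q r s)"
proof -
  have P: "P 1 = (\<Sum>b\<in>I4. p b * Q b 1)" "P 2 = (\<Sum>b\<in>I4. p b * Q b 2)" "P 3 = (\<Sum>b\<in>I4. p b * Q b 3)" "P 4 = (\<Sum>b\<in>I4. p b * Q b 4)"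
    by (rule assms, simp add: I4_def)+
  show ?thesis unfolding det4_explicit P sum_I4 by algebra
qed

lemma det4_combination2:
  assumes "\<And>a. a \<in> I4 \<Longrightarrow> P a = (\<Sum>b\<in>I4. p b * Q b a)"
  shows "det4 q P r s = (\<Sum>b\<in>I4. p b * det4 q (Q b) r s)"
proof -
  have "det4 q P r s = (\<Sum>b\<in>I4. - (p b * det4 (Q b) q r s))"
    using det4_swap12[of q P r s] det4_combination[of P p Q q r s, OF assms] by (simp add: sum_negf)
  also have "\<dots> = (\<Sum>b\<in>I4. p b * det4 q (Q b) r s)"
  proof (intro sum.cong refl)
    fix b
    show "- (p b * det4 (Q b) q r s) = p b * det4 q (Q b) r s" using det4_swap12[of q "Q b" r s] by simp
  qed
  finally show ?thesis .
qed

lemma det4_combination3: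
  assumes "\<And>a. a \<in> I4 \<Longrightarrow> P a = (\<Sum>b\<in>I4. p b * Q b a)"
  shows "det4 q r P s = (\<Sum>b\<in>I4. p b * det4 q r (Q b) s)"
proof -
  have "det4 q r P s = (\<Sum>b\<in>I4. - (p b * det4 q (Q b) r s))"
    using det4_swap23[of q r P s] det4_combination2[of P p Q q r s, OF assms] by (simp add: sum_negf)
  also have "\<dots> = (\<Sum>b\<in>I4. p b * det4 q r (Q b) s)"
  proof (intro sum.cong refl)
    fix b
    show "- (p b * det4 q (Q b) r s) = p b * det4 q r (Q b) s" using det4_swap23[of q r "Q b" s] by simp
  qed
  finally show ?thesis .
qed

lemma det4_combination4:
  assumes "\<And>a. a \<in> I4 \<Longrightarrow> P a = (\<Sum>b\<in>I4. p b * Q b a)"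
  shows "det4 q r s P = (\<Sum>b\<in>I4. p b * det4 q r s (Q b))"
proof -
  have "det4 q r s P = (\<Sum>b\<in>I4. - (p b * det4 q r (Q b) s))"
    using det4_swap34[of q r s P] det4_combination3[of P p Q q r s, OF assms] by (simp add: sum_negf)
  also have "\<dots> = (\<Sum>b\<in>I4. p b * det4 q r s (Q b))"
  proof (intro sum.cong refl)
    fix b
    show "- (p b * det4 q r (Q b) s) = p b * det4 q r s (Q b)" using det4_swap34[of q r s "Q b"] by simp
  qed
  finally show ?thesis .
qed

lemma det4_lin2: "det4 q P r s = (\<Sum>b\<in>I4. P b * det4 q (ev b) r s)"
  by (rule det4_combination2) (simp add: sum_ev_right)

lemma det4_lin3: "det4 q r P s = (\<Sum>b\<in>I4. P b * det4 q r (ev b) s)"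
  by (rule det4_combination3) (simp add: sum_ev_right)

lemma bil_dualy: "bil P (dualy y) Q = (\<Sum>c\<in>I4. \<Sum>d\<in>I4. y c d * det4 (ev c) (ev d) P Q)" if "alt2 y"
  using det4_biv2[OF that, of P Q] by simp

lemma dot_dualz: "dot P (dualz z) = - (\<Sum>i\<in>I4. \<Sum>j\<in>I4. \<Sum>k\<in>I4. z i j k * det4 (ev i) (ev j) (ev k) P)" if "alt3 z"
  using det4_trivector3[OF that, of P] by simp

section \<open>Invariance under a matrix of determinant one\<close>

context
  fixes g :: "nat \<Rightarrow> nat \<Rightarrow> complex"
  assumes det: "detN 4 g = 1"
begin

lemma gcol_det: "a \<in> I4 \<Longrightarrow> b \<in> I4 \<Longrightarrow> c \<in> I4 \<Longrightarrow> d \<in> I4 \<Longrightarrow> det4 (gcol g a) (gcol g b) (gcol g c) (gcol g d) = eps a b c d"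
  using det4_columns[of a b c d "gcol g"] det unfolding detN4_gcol by simp

text \<open>The Levi-Civita symbol is fixed by g since the determinant is 1, so lowered indices
  transform contragrediently. Stating this as a pull-back keeps inverse matrices out of the
  argument.\<close>

lemma dualy_act:
  assumes "a \<in> I4" "b \<in> I4"
  shows "bil (gcol g a) (dualy (yA (act g w) k)) (gcol g b) = dualy (yA w k) a b"
proof -
  let ?P = "gcol g a" and ?Q = "gcol g b"
  have "bil ?P (dualy (yA (act g w) k)) ?Q = (\<Sum>c\<in>I4. \<Sum>d\<in>I4. (\<Sum>c'\<in>I4. \<Sum>d'\<in>I4. g c c' * g d d' * yA w k c' d') * det4 (ev c) (ev d) ?P ?Q)"
    unfolding bil_dualy[OF alt2_yA] yA_act ..
  also have "\<dots> = (\<Sum>c'\<in>I4. \<Sum>d'\<in>I4. yA w k c' d' * (\<Sum>c\<in>I4. g c c' * (\<Sum>d\<in>I4. g d d' * det4 (ev c) (ev d) ?P ?Q)))"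
  proof -
    have "(\<Sum>c\<in>I4. \<Sum>d\<in>I4. (\<Sum>c'\<in>I4. \<Sum>d'\<in>I4. g c c' * g d d' * yA w k c' d') * det4 (ev c) (ev d) ?P ?Q)
      = (\<Sum>c\<in>I4. \<Sum>d\<in>I4. \<Sum>c'\<in>I4. \<Sum>d'\<in>I4. yA w k c' d' * (g c c' * (g d d' * det4 (ev c) (ev d) ?P ?Q)))"
      unfolding sum_distrib_right by (simp only: ac_simps)
    also have "\<dots> = (\<Sum>c\<in>I4. \<Sum>c'\<in>I4. \<Sum>d\<in>I4. \<Sum>d'\<in>I4. yA w k c' d' * (g c c' * (g d d' * det4 (ev c) (ev d) ?P ?Q)))"
      by (intro sum.cong refl sum.swap)
    also have "\<dots> = (\<Sum>c'\<in>I4. \<Sum>c\<in>I4. \<Sum>d\<in>I4. \<Sum>d'\<in>I4. yA w k c' d' * (g c c' * (g d d' * det4 (ev c) (ev d) ?P ?Q)))"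
      by (rule sum.swap)
    also have "\<dots> = (\<Sum>c'\<in>I4. \<Sum>c\<in>I4. \<Sum>d'\<in>I4. \<Sum>d\<in>I4. yA w k c' d' * (g c c' * (g d d' * det4 (ev c) (ev d) ?P ?Q)))"
      by (intro sum.cong refl sum.swap)
    also have "\<dots> = (\<Sum>c'\<in>I4. \<Sum>d'\<in>I4. \<Sum>c\<in>I4. \<Sum>d\<in>I4. yA w k c' d' * (g c c' * (g d d' * det4 (ev c) (ev d) ?P ?Q)))"
      by (intro sum.cong refl sum.swap)
    finally show ?thesis by (simp only: sum_distrib_left)
  qed
  also have "\<dots> = (\<Sum>c'\<in>I4. \<Sum>d'\<in>I4. yA w k c' d' * eps a b c' d')"
  proof (intro sum.cong refl arg_cong2[of _ _ _ _ times])
    fix c' d' assume i: "c' \<in> I4" "d' \<in> I4"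
    have "(\<Sum>d\<in>I4. g d d' * det4 (ev c) (ev d) ?P ?Q) = det4 (ev c) (gcol g d') ?P ?Q" for c
      using det4_lin2[of "ev c" "gcol g d'" ?P ?Q] by (simp add: gcol_def)
    then have "(\<Sum>c\<in>I4. g c c' * (\<Sum>d\<in>I4. g d d' * det4 (ev c) (ev d) ?P ?Q)) = det4 (gcol g c') (gcol g d') ?P ?Q"
      using det4_lin[of "gcol g c'" "gcol g d'" ?P ?Q] by (simp add: gcol_def)
    also have "\<dots> = eps c' d' a b" by (rule gcol_det[OF i assms])
    also have "\<dots> = eps a b c' d'"
      using eps_swap23[of c' a d' b] eps_swap12[of a c' d' b] eps_swap34[of a c' b d'] eps_swap23[of a b c' d'] by simp
    finally show "(\<Sum>c\<in>I4. g c c' * (\<Sum>d\<in>I4. g d d' * det4 (ev c) (ev d) ?P ?Q)) = eps a b c' d'" .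
  qed
  finally show ?thesis unfolding dualy_def by (simp only: mult.commute)
qed

lemma zeta_act:
  assumes "a \<in> I4"
  shows "dot (gcol g a) (zeta (act g w) l) = zeta w l a"
proof -
  let ?P = "gcol g a"
  have "dot ?P (zeta (act g w) l) = - (\<Sum>i\<in>I4. \<Sum>j\<in>I4. \<Sum>k\<in>I4. (\<Sum>d\<in>I4. \<Sum>e\<in>I4. \<Sum>f\<in>I4. g i d * g j e * g k f * zA w l d e f) * det4 (ev i) (ev j) (ev k) ?P)"
    unfolding zeta_def dot_dualz[OF alt3_zA] zA_act ..
  also have "(\<Sum>i\<in>I4. \<Sum>j\<in>I4. \<Sum>k\<in>I4. (\<Sum>d\<in>I4. \<Sum>e\<in>I4. \<Sum>f\<in>I4. g i d * g j e * g k f * zA w l d e f) * det4 (ev i) (ev j) (ev k) ?P)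
     = (\<Sum>d\<in>I4. \<Sum>e\<in>I4. \<Sum>f\<in>I4. zA w l d e f * (\<Sum>i\<in>I4. g i d * (\<Sum>j\<in>I4. g j e * (\<Sum>k\<in>I4. g k f * det4 (ev i) (ev j) (ev k) ?P))))"
    (is "?l = ?r")
  proof -
    let ?t = "\<lambda>i j k d e f. zA w l d e f * (g i d * (g j e * (g k f * det4 (ev i) (ev j) (ev k) ?P)))"
    have "?l = (\<Sum>i\<in>I4. \<Sum>j\<in>I4. \<Sum>k\<in>I4. \<Sum>d\<in>I4. \<Sum>e\<in>I4. \<Sum>f\<in>I4. ?t i j k d e f)"
      unfolding sum_distrib_right by (simp only: ac_simps)
    also have "\<dots> = (\<Sum>i\<in>I4. \<Sum>j\<in>I4. \<Sum>d\<in>I4. \<Sum>k\<in>I4. \<Sum>e\<in>I4. \<Sum>f\<in>I4. ?t i j k d e f)" by (intro sum.cong refl sum.swap)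
    also have "\<dots> = (\<Sum>i\<in>I4. \<Sum>d\<in>I4. \<Sum>j\<in>I4. \<Sum>k\<in>I4. \<Sum>e\<in>I4. \<Sum>f\<in>I4. ?t i j k d e f)" by (intro sum.cong refl sum.swap)
    also have "\<dots> = (\<Sum>d\<in>I4. \<Sum>i\<in>I4. \<Sum>j\<in>I4. \<Sum>k\<in>I4. \<Sum>e\<in>I4. \<Sum>f\<in>I4. ?t i j k d e f)" by (rule sum.swap)
    also have "\<dots> = (\<Sum>d\<in>I4. \<Sum>i\<in>I4. \<Sum>j\<in>I4. \<Sum>e\<in>I4. \<Sum>k\<in>I4. \<Sum>f\<in>I4. ?t i j k d e f)" by (intro sum.cong refl sum.swap)
    also have "\<dots> = (\<Sum>d\<in>I4. \<Sum>i\<in>I4. \<Sum>e\<in>I4. \<Sum>j\<in>I4. \<Sum>k\<in>I4. \<Sum>f\<in>I4. ?t i j k d e f)" by (intro sum.cong refl sum.swap)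
    also have "\<dots> = (\<Sum>d\<in>I4. \<Sum>e\<in>I4. \<Sum>i\<in>I4. \<Sum>j\<in>I4. \<Sum>k\<in>I4. \<Sum>f\<in>I4. ?t i j k d e f)" by (intro sum.cong refl sum.swap)
    also have "\<dots> = (\<Sum>d\<in>I4. \<Sum>e\<in>I4. \<Sum>i\<in>I4. \<Sum>j\<in>I4. \<Sum>f\<in>I4. \<Sum>k\<in>I4. ?t i j k d e f)" by (intro sum.cong refl sum.swap)
    also have "\<dots> = (\<Sum>d\<in>I4. \<Sum>e\<in>I4. \<Sum>i\<in>I4. \<Sum>f\<in>I4. \<Sum>j\<in>I4. \<Sum>k\<in>I4. ?t i j k d e f)" by (intro sum.cong refl sum.swap)
    also have "\<dots> = (\<Sum>d\<in>I4. \<Sum>e\<in>I4. \<Sum>f\<in>I4. \<Sum>i\<in>I4. \<Sum>j\<in>I4. \<Sum>k\<in>I4. ?t i j k d e f)" by (intro sum.cong refl sum.swap)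
    finally show ?thesis by (simp only: sum_distrib_left)
  qed
  also have "\<dots> = (\<Sum>d\<in>I4. \<Sum>e\<in>I4. \<Sum>f\<in>I4. zA w l d e f * eps d e f a)"
  proof (intro sum.cong refl arg_cong2[of _ _ _ _ times])
    fix d e f assume i: "d \<in> I4" "e \<in> I4" "f \<in> I4"
    have 1: "(\<Sum>k\<in>I4. g k f * det4 p q (ev k) ?P) = det4 p q (gcol g f) ?P" for p q
      using det4_lin3[of p q "gcol g f" ?P] by (simp add: gcol_def)
    have 2: "(\<Sum>j\<in>I4. g j e * det4 p (ev j) q ?P) = det4 p (gcol g e) q ?P" for p q
      using det4_lin2[of p "gcol g e" q ?P] by (simp add: gcol_def)
    have 3: "(\<Sum>i\<in>I4. g i d * det4 (ev i) p q ?P) = det4 (gcol g d) p q ?P" for p q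
      using det4_lin[of "gcol g d" p q ?P] by (simp add: gcol_def)
    show "(\<Sum>i\<in>I4. g i d * (\<Sum>j\<in>I4. g j e * (\<Sum>k\<in>I4. g k f * det4 (ev i) (ev j) (ev k) ?P))) = eps d e f a"
      unfolding 1 2 3 by (rule gcol_det[OF i assms])
  qed
  also have "- \<dots> = (\<Sum>d\<in>I4. \<Sum>e\<in>I4. \<Sum>f\<in>I4. eps a d e f * zA w l d e f)"
    unfolding sum_negf[symmetric]
  proof (intro sum.cong refl)
    fix d e f
    show "- (zA w l d e f * eps d e f a) = eps a d e f * zA w l d e f" using eps_rotate(2)[of d e f a] by simp
  qed
  finally show ?thesis unfolding zeta_def dualz_def .
qed

text \<open>For vectors, v' is the image of v under g. For covectors the relation says that v' pulls
  back to v, which amounts to the inverse transpose action.\<close>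

definition rel :: "bool \<Rightarrow> (nat \<Rightarrow> complex) \<Rightarrow> (nat \<Rightarrow> complex) \<Rightarrow> bool" where
  "rel up v v' \<longleftrightarrow> (if up then \<forall>a\<in>I4. v' a = (\<Sum>b\<in>I4. g a b * v b) else \<forall>a\<in>I4. (\<Sum>b\<in>I4. g b a * v' b) = v a)"

lemma rel_X: "rel True (X w j) (X (act g w) j)"
  by (simp add: rel_def act_coords)

lemma rel_zeta: "rel False (zeta w l) (zeta (act g w) l)"
  using zeta_act unfolding rel_def dot_def gcol_def by simp

lemma rel_dot:
  assumes "rel True p p'" "rel False q q'"
  shows "dot p' q' = dot p q"
proof -
  have "dot p' q' = (\<Sum>a\<in>I4. (\<Sum>b\<in>I4. g a b * p b) * q' a)"
    unfolding dot_def using assms(1) by (intro sum.cong refl) (simp add: rel_def)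
  also have "\<dots> = (\<Sum>a\<in>I4. \<Sum>b\<in>I4. p b * (g a b * q' a))"
    unfolding sum_distrib_right by (simp only: ac_simps)
  also have "\<dots> = (\<Sum>b\<in>I4. \<Sum>a\<in>I4. p b * (g a b * q' a))" by (rule sum.swap)
  also have "\<dots> = (\<Sum>b\<in>I4. p b * (\<Sum>a\<in>I4. g a b * q' a))" by (simp only: sum_distrib_left)
  also have "\<dots> = dot p q" unfolding dot_def using assms(2) by (intro sum.cong refl) (simp add: rel_def)
  finally show ?thesis .
qed

lemma rel_letter:
  assumes "rel t q q'"
  shows "rel (\<not> t) (\<lambda>a. \<Sum>c\<in>I4. letter t w k a c * q c) (\<lambda>a. \<Sum>c\<in>I4. letter t (act g w) k a c * q' c)"
proof (cases t)
  case True
  have q': "q' c = (\<Sum>e\<in>I4. g c e * q e)" if "c \<in> I4" for c using assms True that by (simp add: rel_def)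
  have "(\<Sum>b\<in>I4. g b a * (\<Sum>c\<in>I4. dualy (yA (act g w) k) b c * q' c)) = (\<Sum>c\<in>I4. dualy (yA w k) a c * q c)" if a: "a \<in> I4" for a
  proof -
    have "(\<Sum>b\<in>I4. g b a * (\<Sum>c\<in>I4. dualy (yA (act g w) k) b c * q' c))
       = (\<Sum>b\<in>I4. \<Sum>c\<in>I4. \<Sum>e\<in>I4. q e * (g b a * dualy (yA (act g w) k) b c * g c e))"
      unfolding sum_distrib_left by (intro sum.cong refl) (simp add: q' sum_distrib_left ac_simps)
    also have "\<dots> = (\<Sum>b\<in>I4. \<Sum>e\<in>I4. \<Sum>c\<in>I4. q e * (g b a * dualy (yA (act g w) k) b c * g c e))"
      by (intro sum.cong refl sum.swap)
    also have "\<dots> = (\<Sum>e\<in>I4. \<Sum>b\<in>I4. \<Sum>c\<in>I4. q e * (g b a * dualy (yA (act g w) k) b c * g c e))"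
      by (rule sum.swap)
    also have "\<dots> = (\<Sum>e\<in>I4. q e * bil (gcol g a) (dualy (yA (act g w) k)) (gcol g e))"
      unfolding bil_def gcol_def by (simp only: sum_distrib_left)
    also have "\<dots> = (\<Sum>e\<in>I4. dualy (yA w k) a e * q e)"
      by (intro sum.cong refl) (simp add: dualy_act[OF a])
    finally show ?thesis .
  qed
  then show ?thesis using True by (simp add: rel_def letter_def)
next
  case False
  have q': "(\<Sum>b\<in>I4. g b d * q' b) = q d" if "d \<in> I4" for d using assms False that by (simp add: rel_def)
  have "(\<Sum>c\<in>I4. yA (act g w) k a c * q' c) = (\<Sum>b\<in>I4. g a b * (\<Sum>c\<in>I4. yA w k b c * q c))" for a
  proof -
    have "(\<Sum>c\<in>I4. yA (act g w) k a c * q' c) = (\<Sum>c\<in>I4. \<Sum>b\<in>I4. \<Sum>d\<in>I4. g a b * (yA w k b d * (g c d * q' c)))"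
      unfolding yA_act sum_distrib_right by (simp only: ac_simps)
    also have "\<dots> = (\<Sum>b\<in>I4. \<Sum>c\<in>I4. \<Sum>d\<in>I4. g a b * (yA w k b d * (g c d * q' c)))" by (rule sum.swap)
    also have "\<dots> = (\<Sum>b\<in>I4. \<Sum>d\<in>I4. \<Sum>c\<in>I4. g a b * (yA w k b d * (g c d * q' c)))" by (intro sum.cong refl sum.swap)
    also have "\<dots> = (\<Sum>b\<in>I4. g a b * (\<Sum>d\<in>I4. yA w k b d * (\<Sum>c\<in>I4. g c d * q' c)))" by (simp only: sum_distrib_left)
    also have "\<dots> = (\<Sum>b\<in>I4. g a b * (\<Sum>d\<in>I4. yA w k b d * q d))" by (intro sum.cong refl arg_cong2[of _ _ _ _ times] q')
    finally show ?thesis .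
  qed
  then show ?thesis using False by (simp add: rel_def letter_def)
qed

lemma rel_wv: "rel (if even (length ks) then \<not> t else t) q q' \<Longrightarrow> rel (\<not> t) (wv t ks w q) (wv t ks (act g w) q')"
proof (induction ks arbitrary: t)
  case Nil
  then show ?case unfolding rel_def by (auto simp: wv_Nil)
next
  case (Cons k ks)
  have "rel (\<not> \<not> t) (wv (\<not> t) ks w q) (wv (\<not> t) ks (act g w) q')"
    by (rule Cons.IH) (use Cons.prems in \<open>cases "even (length ks)"; simp\<close>)
  then have "rel t (wv (\<not> t) ks w q) (wv (\<not> t) ks (act g w) q')" by simp
  from rel_letter[OF this, of w k] show ?case unfolding wv_Cons .
qed

lemma word_xx: "odd (length ks) \<Longrightarrow> bil (X (act g w) j) (wd True ks (act g w)) (X (act g w) j') = bil (X w j) (wd True ks w) (X w j')"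
  unfolding bil_wv dot_def[symmetric] by (rule rel_dot[OF rel_X]) (use rel_wv[of ks True] rel_X in simp)

lemma word_xz: "even (length ks) \<Longrightarrow> bil (X (act g w) j) (wd True ks (act g w)) (zeta (act g w) l) = bil (X w j) (wd True ks w) (zeta w l)"
  unfolding bil_wv dot_def[symmetric] by (rule rel_dot[OF rel_X]) (use rel_wv[of ks True] rel_zeta in simp)

lemma word_zz: "odd (length ks) \<Longrightarrow> bil (zeta (act g w) l) (wd False ks (act g w)) (zeta (act g w) l') = bil (zeta w l) (wd False ks w) (zeta w l')"
  unfolding bil_wv dot_def[symmetric] dot_commute[of "zeta _ _"]
  by (rule rel_dot[OF _ rel_zeta]) (use rel_wv[of ks False] rel_zeta in simp)

lemma inv3_act: "inv3 k k' (act g w) = inv3 k k' w"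
proof -
  have e: "inv3 k k' w = (\<Sum>a\<in>I4. \<Sum>b\<in>I4. yA w k a b * dualy (yA w k') a b)" for w
    unfolding inv3_def dualy_def by (simp add: sum_distrib_left ac_simps)
  have "inv3 k k' (act g w) = (\<Sum>a\<in>I4. \<Sum>b\<in>I4. \<Sum>c\<in>I4. \<Sum>d\<in>I4. yA w k c d * (g a c * dualy (yA (act g w) k') a b * g b d))"
    unfolding e yA_act[of _ _ k] sum_distrib_right by (simp only: ac_simps)
  also have "\<dots> = (\<Sum>a\<in>I4. \<Sum>c\<in>I4. \<Sum>b\<in>I4. \<Sum>d\<in>I4. yA w k c d * (g a c * dualy (yA (act g w) k') a b * g b d))" by (intro sum.cong refl sum.swap)
  also have "\<dots> = (\<Sum>c\<in>I4. \<Sum>a\<in>I4. \<Sum>b\<in>I4. \<Sum>d\<in>I4. yA w k c d * (g a c * dualy (yA (act g w) k') a b * g b d))" by (rule sum.swap)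
  also have "\<dots> = (\<Sum>c\<in>I4. \<Sum>a\<in>I4. \<Sum>d\<in>I4. \<Sum>b\<in>I4. yA w k c d * (g a c * dualy (yA (act g w) k') a b * g b d))" by (intro sum.cong refl sum.swap)
  also have "\<dots> = (\<Sum>c\<in>I4. \<Sum>d\<in>I4. \<Sum>a\<in>I4. \<Sum>b\<in>I4. yA w k c d * (g a c * dualy (yA (act g w) k') a b * g b d))" by (intro sum.cong refl sum.swap)
  also have "\<dots> = (\<Sum>c\<in>I4. \<Sum>d\<in>I4. yA w k c d * bil (gcol g c) (dualy (yA (act g w) k')) (gcol g d))"
    unfolding bil_def gcol_def by (simp only: sum_distrib_left)
  also have "\<dots> = inv3 k k' w" unfolding e by (intro sum.cong refl) (simp add: dualy_act)
  finally show ?thesis .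
qed

text \<open>The determinant is read off from words: by \<open>bil_six\<close> the alternating word
  in six letters is a multiple of \<open>inv4\<close> times the identity. Its invariance between a
  vector and a covector gives that of \<open>inv4\<close>, provided that the two pair to a nonzero
  number; here the pairing is a nonzero entry \<open>g a 1\<close>.\<close>

lemma inv4_act: "inv4 \<kappa> (act g w) = inv4 \<kappa> w"
proof -
  have "\<exists>a\<in>I4. g a 1 \<noteq> 0"
  proof (rule ccontr)
    assume "\<not> ?thesis"
    then have "gcol g 1 1 = 0" "gcol g 1 2 = 0" "gcol g 1 3 = 0" "gcol g 1 4 = 0" unfolding gcol_def by (auto simp: I4_def)
    then have "detN 4 g = 0" unfolding detN4_gcol det4_explicit by simp
    then show False using det by simp
  qed
  then obtain a where a: "a \<in> I4" "g a 1 \<noteq> 0" by blast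
  define p' where "p' = gcol g 1"
  define q where "q b = g a b" for b
  have 1: "1 \<in> I4" by (simp add: I4_def)
  have rp: "rel True (ev 1) p'" unfolding rel_def p'_def gcol_def by (simp add: sum_ev_right2[OF 1] del: One_nat_def)
  have rq: "rel False q (ev a)" unfolding rel_def q_def by (simp add: sum_ev_right2[OF a(1)])
  have w: "bil p' (wd True (map (\<kappa> \<circ> \<pi>) six @ []) (act g w)) (ev a) = bil (ev 1) (wd True (map (\<kappa> \<circ> \<pi>) six @ []) w) q" for \<pi>
    unfolding bil_wv dot_def[symmetric]
    by (rule rel_dot[OF rp]) (use rel_wv[of "map (\<kappa> \<circ> \<pi>) six @ []" True q "ev a" w] rq in \<open>simp add: set_six\<close>)
  have "csix True * inv4 \<kappa> (act g w) * bil p' (wd True [] (act g w)) (ev a) = csix True * inv4 \<kappa> w * bil (ev 1) (wd True [] w) q"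
    unfolding generators.bil_six[symmetric] w ..
  moreover have "dot p' (ev a) = g a 1" unfolding dot_def p'_def gcol_def by (rule sum_ev_right2[OF a(1)])
  moreover have "dot (ev 1) q = g a 1" unfolding dot_def q_def by (rule sum_ev_left[OF 1])
  ultimately show ?thesis using csix_nonzero[of True] a(2) by (simp add: bil_wd_Nil)
qed

lemma inv1_act: "inv1 j1 j2 j3 j4 (act g w) = inv1 j1 j2 j3 j4 w"
proof -
  have c: "X (act g w) j a = (\<Sum>b\<in>I4. X w j b * gcol g b a)" for j a
    by (simp add: act_coords gcol_def mult.commute)
  note s1 = det4_combination[of "X (act g w) _" "X w _" "gcol g", OF c]
  note s2 = det4_combination2[of "X (act g w) _" "X w _" "gcol g", OF c]
  note s3 = det4_combination3[of "X (act g w) _" "X w _" "gcol g", OF c]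
  note s = det4_combination4[of "X (act g w) _" "X w _" "gcol g", OF c]
  have "inv1 j1 j2 j3 j4 (act g w) = (\<Sum>a\<in>I4. X w j1 a * (\<Sum>b\<in>I4. X w j2 b * (\<Sum>c\<in>I4. X w j3 c * (\<Sum>d\<in>I4. X w j4 d *
     det4 (gcol g a) (gcol g b) (gcol g c) (gcol g d)))))"
    unfolding inv1_det4 unfolding s1 unfolding s2 unfolding s3 unfolding s ..
  also have "\<dots> = (\<Sum>a\<in>I4. X w j1 a * (\<Sum>b\<in>I4. X w j2 b * (\<Sum>c\<in>I4. X w j3 c * (\<Sum>d\<in>I4. X w j4 d * eps a b c d))))"
    by (intro sum.cong refl arg_cong2[of _ _ _ _ times] gcol_det)
  also have "\<dots> = inv1 j1 j2 j3 j4 w"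
    unfolding inv1_det4 det4_def sum_distrib_left by (simp only: ac_simps)
  finally show ?thesis .
qed

lemma inv2_act: "inv2 l1 l2 l3 l4 (act g w) = inv2 l1 l2 l3 l4 w"
proof -
  define c where "c p a = (\<Sum>b\<in>I4. g b a * p b)" for p :: "nat \<Rightarrow> complex" and a
  have z: "det4 (zeta w l1) (zeta w l2) (zeta w l3) (zeta w l4)
    = det4 (c (zeta (act g w) l1)) (c (zeta (act g w) l2)) (c (zeta (act g w) l3)) (c (zeta (act g w) l4))"
  proof -
    have "c (zeta (act g w) l) a = zeta w l a" if "a \<in> I4" for l a
      using zeta_act[OF that, of w l] unfolding c_def dot_def gcol_def .
    then have "c (zeta (act g w) l) 1 = zeta w l 1" "c (zeta (act g w) l) 2 = zeta w l 2" "c (zeta (act g w) l) 3 = zeta w l 3" "c (zeta (act g w) l) 4 = zeta w l 4" for l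
      by (simp_all add: I4_def)
    then show ?thesis unfolding det4_explicit by simp
  qed
  have r: "det4 (g 1) (g 2) (g 3) (g 4) = 1" using det unfolding detN4 det4_transpose .
  have cc: "c P a = (\<Sum>b\<in>I4. P b * g b a)" for P a by (simp add: c_def mult.commute)
  note s1 = det4_combination[of "c _" _ g, OF cc]
  note s2 = det4_combination2[of "c _" _ g, OF cc]
  note s3 = det4_combination3[of "c _" _ g, OF cc]
  note s4 = det4_combination4[of "c _" _ g, OF cc]
  have "det4 (c P) (c Q) (c U) (c V) = det4 P Q U V" for P Q U V
  proof -
    have "det4 (c P) (c Q) (c U) (c V) = (\<Sum>a\<in>I4. P a * (\<Sum>b\<in>I4. Q b * (\<Sum>d\<in>I4. U d * (\<Sum>e\<in>I4. V e * det4 (g a) (g b) (g d) (g e)))))"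
      unfolding s1 unfolding s2 unfolding s3 unfolding s4 ..
    also have "\<dots> = (\<Sum>a\<in>I4. P a * (\<Sum>b\<in>I4. Q b * (\<Sum>d\<in>I4. U d * (\<Sum>e\<in>I4. V e * eps a b d e))))"
      by (intro sum.cong refl arg_cong2[of _ _ _ _ times]) (use det4_columns[of _ _ _ _ g] r in simp)
    also have "\<dots> = det4 P Q U V" unfolding det4_def sum_distrib_left by (simp only: ac_simps)
    finally show ?thesis .
  qed
  then have "1296 * inv2 l1 l2 l3 l4 w = 1296 * inv2 l1 l2 l3 l4 (act g w)" using z by (simp only: inv2_det4)
  then show ?thesis by simp
qed

lemma listed_act:
  assumes "f \<in> listed n1 n2 n3"
  shows "f (act g w) = f w"
  using assms unfolding listed_def
  by (elim UnE CollectE exE conjE; hypsubst;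
      simp only: inv1_act inv2_act inv3_act inv4_act inv5_word inv6_word inv7a_word inv7b_word inv8a_word inv8b_word inv8c_word inv9a_word inv9b_word
        word_xx word_xz word_zz list.size even_Suc even_zero simp_thms odd_one even_add even_plus_one_iff add_0 add_0_right One_nat_def)

end

subsection \<open>Multidegrees of the generators\<close>

text \<open>The listed invariants with their multidegrees: the three lists hold the vector, bivector
  and trivector indices in increasing order. The index ranges are restored by
  \<open>listed_gen\<close>.\<close>

inductive gen :: "nat list \<Rightarrow> nat list \<Rightarrow> nat list \<Rightarrow> (pt \<Rightarrow> complex) \<Rightarrow> bool" where
  g1: "j1 < j2 \<Longrightarrow> j2 < j3 \<Longrightarrow> j3 < j4 \<Longrightarrow> gen [j1, j2, j3, j4] [] [] (inv1 j1 j2 j3 j4)"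
| g2: "l1 < l2 \<Longrightarrow> l2 < l3 \<Longrightarrow> l3 < l4 \<Longrightarrow> gen [] [] [l1, l2, l3, l4] (inv2 l1 l2 l3 l4)"
| g3: "k1 \<le> k2 \<Longrightarrow> gen [] [k1, k2] [] (inv3 k1 k2)"
| g4: "ks 1 < ks 2 \<Longrightarrow> ks 2 < ks 3 \<Longrightarrow> ks 3 < ks 4 \<Longrightarrow> ks 4 < ks 5 \<Longrightarrow> ks 5 < ks 6 \<Longrightarrow>
    gen [] [ks 1, ks 2, ks 3, ks 4, ks 5, ks 6] [] (inv4 ks)"
| g5: "gen [j] [] [l] (inv5 j l)"
| g6: "j1 < j2 \<Longrightarrow> gen [j1, j2] [k] [] (inv6 j1 j2 k)"
| g7a: "j \<le> j' \<Longrightarrow> k1 < k2 \<Longrightarrow> k2 < k3 \<Longrightarrow> gen [j, j'] [k1, k2, k3] [] (inv7a j j' k1 k2 k3)"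
| g7b: "j < j' \<Longrightarrow> k1 < k2 \<Longrightarrow> k2 < k3 \<Longrightarrow> k3 < k4 \<Longrightarrow> k4 < k5 \<Longrightarrow>
    gen [j, j'] [k1, k2, k3, k4, k5] [] (inv7b j j' k1 k2 k3 k4 k5)"
| g8a: "l < l' \<Longrightarrow> gen [] [k] [l, l'] (inv8a l l' k)"
| g8b: "l \<le> l' \<Longrightarrow> k1 < k2 \<Longrightarrow> k2 < k3 \<Longrightarrow> gen [] [k1, k2, k3] [l, l'] (inv8b l l' k1 k2 k3)"
| g8c: "l < l' \<Longrightarrow> k1 < k2 \<Longrightarrow> k2 < k3 \<Longrightarrow> k3 < k4 \<Longrightarrow> k4 < k5 \<Longrightarrow>
    gen [] [k1, k2, k3, k4, k5] [l, l'] (inv8c l l' k1 k2 k3 k4 k5)"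
| g9a: "k1 < k2 \<Longrightarrow> gen [j] [k1, k2] [l] (inv9a j k1 k2 l)"
| g9b: "k1 < k2 \<Longrightarrow> k2 < k3 \<Longrightarrow> k3 < k4 \<Longrightarrow> gen [j] [k1, k2, k3, k4] [l] (inv9b j k1 k2 k3 k4 l)"

lemma listed_gen:
  assumes "f \<in> listed n1 n2 n3"
  shows "\<exists>xs ys zs. gen xs ys zs f \<and> set xs \<subseteq> {1..n1} \<and> set ys \<subseteq> {1..n2} \<and> set zs \<subseteq> {1..n3}"
  using assms unfolding listed_def
proof (elim UnE CollectE exE conjE; hypsubst)
  fix ks :: "nat \<Rightarrow> nat" assume h: "1 \<le> ks 1" "\<forall>r\<in>{1..<6}. ks r < ks (Suc r)" "ks 6 \<le> n2"
  have "ks 1 < ks 2" "ks 2 < ks 3" "ks 3 < ks 4" "ks 4 < ks 5" "ks 5 < ks 6"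
    using h(2)[rule_format, of 1] h(2)[rule_format, of 2] h(2)[rule_format, of 3] h(2)[rule_format, of 4] h(2)[rule_format, of 5]
    by (simp_all add: eval_nat_numeral)
  then show "\<exists>xs ys zs. gen xs ys zs (inv4 ks) \<and> set xs \<subseteq> {1..n1} \<and> set ys \<subseteq> {1..n2} \<and> set zs \<subseteq> {1..n3}"
    using h(1,3) by - (intro exI conjI, rule g4, auto simp del: One_nat_def)
qed (intro exI conjI, rule gen.intros; auto)+

text \<open>\<open>inv4\<close> takes an index function on all natural numbers; this makes the
  invariant depend on six values only, as uniqueness for a given multidegree demands.\<close>

lemma inv4_cong: "(\<And>r. r \<in> {1..6} \<Longrightarrow> ks r = ks' r) \<Longrightarrow> inv4 ks = inv4 ks'"
  unfolding inv4_def detN_def by (intro ext sum.cong refl arg_cong2[of _ _ _ _ times] prod.cong) simp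

text \<open>The lengths of the lists determine the family and their entries the indices; F recovers
  the invariant from these data.\<close>

lemma gen_unique:
  assumes "gen xs ys zs f" "gen xs ys zs f'"
  shows "f = f'"
proof -
  define F where "F = (if length xs = 4 then inv1 (xs ! 0) (xs ! 1) (xs ! 2) (xs ! 3)
    else if length zs = 4 then inv2 (zs ! 0) (zs ! 1) (zs ! 2) (zs ! 3)
    else if length xs = 2 then
      (if length ys = 1 then inv6 (xs ! 0) (xs ! 1) (ys ! 0)
       else if length ys = 3 then inv7a (xs ! 0) (xs ! 1) (ys ! 0) (ys ! 1) (ys ! 2)
       else inv7b (xs ! 0) (xs ! 1) (ys ! 0) (ys ! 1) (ys ! 2) (ys ! 3) (ys ! 4))
    else if length zs = 2 then
      (if length ys = 1 then inv8a (zs ! 0) (zs ! 1) (ys ! 0)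
       else if length ys = 3 then inv8b (zs ! 0) (zs ! 1) (ys ! 0) (ys ! 1) (ys ! 2)
       else inv8c (zs ! 0) (zs ! 1) (ys ! 0) (ys ! 1) (ys ! 2) (ys ! 3) (ys ! 4))
    else if length xs = 1 then
      (if length ys = 0 then inv5 (xs ! 0) (zs ! 0)
       else if length ys = 2 then inv9a (xs ! 0) (ys ! 0) (ys ! 1) (zs ! 0)
       else inv9b (xs ! 0) (ys ! 0) (ys ! 1) (ys ! 2) (ys ! 3) (zs ! 0))
    else if length ys = 2 then inv3 (ys ! 0) (ys ! 1)
    else inv4 (\<lambda>r. ys ! (r - 1)))"
  have "f = F" if "gen xs ys zs f" for f
    using that
  proof cases
    case (g4 ks)
    have "r = 1 \<or> r = 2 \<or> r = 3 \<or> r = 4 \<or> r = 5 \<or> r = 6" if "r \<in> {1..6::nat}" for r using that by auto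
    note m = this
    have "inv4 ks = inv4 (\<lambda>r. ys ! (r - 1))"
      by (rule inv4_cong, drule m) (use g4 in \<open>auto simp: nth_Cons'\<close>)
    then show ?thesis using g4 by (simp add: F_def)
  qed (simp_all add: F_def)
  then show ?thesis using assms by blast
qed

lemma gen_sorted: "gen xs ys zs f \<Longrightarrow> sorted xs \<and> sorted ys \<and> sorted zs"
  by (erule gen.cases; simp)

definition gen_types :: "(nat \<times> nat \<times> nat) set" where
  "gen_types = {(4,0,0), (0,0,4), (0,2,0), (0,6,0), (1,0,1), (2,1,0),
     (2,3,0), (2,5,0), (0,1,2), (0,3,2), (0,5,2), (1,2,1), (1,4,1)}"

lemma gen_lengths: "gen xs ys zs f \<Longrightarrow> (length xs, length ys, length zs) \<in> gen_types"
  unfolding gen_types_def by (erule gen.cases; simp)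

lemma gen_distinct: "gen xs ys zs f \<Longrightarrow> distinct ys \<or> xs = [] \<and> zs = [] \<and> length ys = 2"
  by (erule gen.cases; simp)

subsection \<open>The generators are polynomials\<close>

lemma polyW_sum:
  assumes "finite A" "\<And>i. i \<in> A \<Longrightarrow> f i \<in> polyW n1 n2 n3"
  shows "(\<lambda>w. \<Sum>i\<in>A. f i w) \<in> polyW n1 n2 n3"
  using assms
proof (induction A rule: finite_induct)
  case empty
  then show ?case using polyW.const[of 0] by simp
next
  case (insert x F)
  then show ?case using polyW.add[of "f x" n1 n2 n3 "\<lambda>w. \<Sum>i\<in>F. f i w"] by simp
qed

lemma polyW_prod:
  assumes "finite A" "\<And>i. i \<in> A \<Longrightarrow> f i \<in> polyW n1 n2 n3"
  shows "(\<lambda>w. \<Prod>i\<in>A. f i w) \<in> polyW n1 n2 n3"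
  using assms
proof (induction A rule: finite_induct)
  case empty
  then show ?case using polyW.const[of 1] by simp
next
  case (insert x F)
  then show ?case using polyW.mult[of "f x" n1 n2 n3 "\<lambda>w. \<Prod>i\<in>F. f i w"] by simp
qed

lemma polyW_smult: "f \<in> polyW n1 n2 n3 \<Longrightarrow> (\<lambda>w. c * f w) \<in> polyW n1 n2 n3"
  by (rule polyW.mult[OF polyW.const])

lemma polyW_X: "j \<in> {1..n1} \<Longrightarrow> a \<in> I4 \<Longrightarrow> (\<lambda>w. X w j a) \<in> polyW n1 n2 n3"
  by (rule polyW.xcoord) auto

lemma polyW_yA:
  assumes "k \<in> {1..n2}" "a \<in> I4" "b \<in> I4"
  shows "(\<lambda>w. yA w k a b) \<in> polyW n1 n2 n3"
proof (cases "a = b")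
  case True
  then show ?thesis using polyW.const[of 0] by (simp add: yA_def)
next
  case False
  show ?thesis unfolding yA_def
    by (rule polyW_smult, rule polyW.ycoord) (use assms False in \<open>auto simp: I4_def min_def max_def\<close>)
qed

lemma polyW_zeta:
  assumes "l \<in> {1..n3}" "a \<in> I4"
  shows "(\<lambda>w. zeta w l a) \<in> polyW n1 n2 n3"
proof -
  have "(\<lambda>w. Z w l 2 3 4) \<in> polyW n1 n2 n3" "(\<lambda>w. Z w l 1 3 4) \<in> polyW n1 n2 n3"
    "(\<lambda>w. Z w l 1 2 4) \<in> polyW n1 n2 n3" "(\<lambda>w. Z w l 1 2 3) \<in> polyW n1 n2 n3"
    by (rule polyW.zcoord; use assms in simp)+
  note p = this[THEN polyW_smult]
  from assms(2) show ?thesis unfolding I4_eq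
    by (elim insertE; simp only: zeta_explicit p empty_iff)
qed

lemma polyW_wd:
  assumes "set ks \<subseteq> {1..n2}" "a \<in> I4"
  shows "(\<lambda>w. wd t ks w a b) \<in> polyW n1 n2 n3"
  using assms
proof (induction ks arbitrary: t a)
  case Nil
  then show ?case by (simp add: polyW.const)
next
  case (Cons k ks)
  have "(\<lambda>w. letter t w k a c) \<in> polyW n1 n2 n3" if "c \<in> I4" for c
  proof (cases t)
    case True
    then show ?thesis unfolding letter_def dualy_def
      using Cons.prems that by (auto intro!: polyW_sum finite_I4 polyW_smult polyW_yA)
  next
    case False
    then show ?thesis unfolding letter_def using Cons.prems that by (auto intro!: polyW_yA)
  qed
  then show ?case unfolding wd.simps
    using Cons by (auto intro!: polyW_sum finite_I4 polyW.mult)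
qed

lemma polyW_bil:
  assumes "\<And>a. a \<in> I4 \<Longrightarrow> (\<lambda>w. p w a) \<in> polyW n1 n2 n3" "\<And>a. a \<in> I4 \<Longrightarrow> (\<lambda>w. q w a) \<in> polyW n1 n2 n3" "set ks \<subseteq> {1..n2}"
  shows "(\<lambda>w. bil (p w) (wd t ks w) (q w)) \<in> polyW n1 n2 n3"
  unfolding bil_def using assms by (auto intro!: polyW_sum finite_I4 polyW.mult polyW_wd)

lemma polyW_det4:
  assumes "\<And>a i. a \<in> I4 \<Longrightarrow> (\<lambda>w. p w a) \<in> polyW n1 n2 n3" "\<And>a i. a \<in> I4 \<Longrightarrow> (\<lambda>w. q w a) \<in> polyW n1 n2 n3"
    "\<And>a i. a \<in> I4 \<Longrightarrow> (\<lambda>w. r w a) \<in> polyW n1 n2 n3" "\<And>a i. a \<in> I4 \<Longrightarrow> (\<lambda>w. s w a) \<in> polyW n1 n2 n3"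
  shows "(\<lambda>w. det4 (p w) (q w) (r w) (s w)) \<in> polyW n1 n2 n3"
  unfolding det4_def using assms by (auto intro!: polyW_sum finite_I4 polyW.mult polyW.const)

lemma gen_polyW:
  assumes "gen xs ys zs f" and s: "set xs \<subseteq> {1..n1}" "set ys \<subseteq> {1..n2}" "set zs \<subseteq> {1..n3}"
  shows "f \<in> polyW n1 n2 n3"
proof -
  have xx: "(\<lambda>w. bil (X w j) (wd t ks w) (X w j')) \<in> polyW n1 n2 n3" if "j \<in> {1..n1}" "j' \<in> {1..n1}" "set ks \<subseteq> {1..n2}" for t j j' ks
    by (rule polyW_bil) (use that polyW_X in auto)
  have xz: "(\<lambda>w. bil (X w j) (wd t ks w) (zeta w l)) \<in> polyW n1 n2 n3" if "j \<in> {1..n1}" "l \<in> {1..n3}" "set ks \<subseteq> {1..n2}" for t j l ks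
    by (rule polyW_bil) (use that polyW_X polyW_zeta in auto)
  have zz: "(\<lambda>w. bil (zeta w l) (wd t ks w) (zeta w l')) \<in> polyW n1 n2 n3" if "l \<in> {1..n3}" "l' \<in> {1..n3}" "set ks \<subseteq> {1..n2}" for t l l' ks
    by (rule polyW_bil) (use that polyW_zeta in auto)
  have neg: "(\<lambda>w. - f w) \<in> polyW n1 n2 n3" if "f \<in> polyW n1 n2 n3" for f
    using polyW_smult[OF that, of "-1"] by simp
  from assms(1) show ?thesis
  proof cases
    case (g1 j1 j2 j3 j4)
    have "(\<lambda>w. det4 (X w j1) (X w j2) (X w j3) (X w j4)) \<in> polyW n1 n2 n3"
      by (rule polyW_det4; rule polyW_X) (use s g1 in auto)
    then show ?thesis unfolding g1 inv1_det4[symmetric] .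
  next
    case (g2 l1 l2 l3 l4)
    have "(\<lambda>w. (1 / 1296) * det4 (zeta w l1) (zeta w l2) (zeta w l3) (zeta w l4)) \<in> polyW n1 n2 n3"
      by (rule polyW_smult, rule polyW_det4; rule polyW_zeta) (use s g2 in auto)
    then show ?thesis unfolding g2 inv2_det4 by simp
  next
    case (g3 k1 k2)
    have "(\<lambda>w. inv3 k1 k2 w) \<in> polyW n1 n2 n3"
      unfolding inv3_def using s g3 by (auto intro!: polyW_sum finite_I4 polyW.mult polyW_yA polyW.const)
    then show ?thesis using g3 by simp
  next
    case (g4 ks)
    have k: "ks r \<in> {1..n2}" if "r \<in> {1..6}" for r
    proof -
      have "r = 1 \<or> r = 2 \<or> r = 3 \<or> r = 4 \<or> r = 5 \<or> r = 6" using that by auto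
      then show ?thesis using s(2) g4 by (auto simp del: One_nat_def)
    qed
    have y: "(\<lambda>w. ycol w k i) \<in> polyW n1 n2 n3" if "k \<in> {1..n2}" for k i
      unfolding ycol_def by (cases "i = 1"; cases "i = 2"; cases "i = 3"; cases "i = 4"; cases "i = 5"; use that in \<open>simp add: polyW.ycoord\<close>)
    have "(\<lambda>w. inv4 ks w) \<in> polyW n1 n2 n3"
      unfolding inv4_def detN_def
      by (intro polyW_sum polyW_smult polyW_prod y k) (simp_all add: finite_permutations)
    then show ?thesis using g4 by simp
  next
    case (g5 j l)
    show ?thesis unfolding g5 using xz[of j l "[]" True] s g5 by (simp only: inv5_word[symmetric]) auto
  next
    case (g6 j1 j2 k)
    show ?thesis unfolding g6 using xx[of j1 j2 "[k]" True] s g6 by (simp only: inv6_word[symmetric]) auto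
  next
    case (g7a j j' k1 k2 k3)
    show ?thesis unfolding g7a using xx[of j j' "[k1,k2,k3]" True] s g7a by (simp only: inv7a_word[symmetric]) auto
  next
    case (g7b j j' k1 k2 k3 k4 k5)
    show ?thesis unfolding g7b using xx[of j j' "[k1,k2,k3,k4,k5]" True, THEN neg] s g7b by (simp only: inv7b_word[symmetric]) auto
  next
    case (g8a l l' k)
    show ?thesis unfolding g8a using zz[of l l' "[k]" False, THEN neg] s g8a by (simp only: inv8a_word[symmetric]) auto
  next
    case (g8b l l' k1 k2 k3)
    show ?thesis unfolding g8b using zz[of l l' "[k1,k2,k3]" False, THEN neg] s g8b by (simp only: inv8b_word[symmetric]) auto
  next
    case (g8c l l' k1 k2 k3 k4 k5)
    show ?thesis unfolding g8c using zz[of l l' "[k1,k2,k3,k4,k5]" False, THEN neg] s g8c by (simp only: inv8c_word[symmetric]) auto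
  next
    case (g9a k1 k2 j l)
    show ?thesis unfolding g9a using xz[of j l "[k1,k2]" True] s g9a by (simp only: inv9a_word[symmetric]) auto
  next
    case (g9b k1 k2 k3 k4 j l)
    show ?thesis unfolding g9b using xz[of j l "[k1,k2,k3,k4]" True] s g9b by (simp only: inv9b_word[symmetric]) auto
  qed
qed

lemma listed_subset_invW: "listed n1 n2 n3 \<subseteq> invW n1 n2 n3"
proof
  fix f assume f: "f \<in> listed n1 n2 n3"
  then have "f \<in> polyW n1 n2 n3" using listed_gen gen_polyW by blast
  then show "f \<in> invW n1 n2 n3" unfolding invW_def using listed_act[OF _ f] by blast
qed

lemma alg_gen_listed: "alg_gen (listed n1 n2 n3) = invW n1 n2 n3"
proof
  show "alg_gen (listed n1 n2 n3) \<subseteq> invW n1 n2 n3"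
  proof
    fix f assume "f \<in> alg_gen (listed n1 n2 n3)"
    then show "f \<in> invW n1 n2 n3"
    proof induction
      case (gen f)
      then show ?case using listed_subset_invW by blast
    qed (auto simp: invW_def intro: polyW.intros)
  qed
qed (rule generators.invW_subset)

subsection \<open>Multihomogeneity\<close>

definition mdeg :: "nat list \<Rightarrow> nat list \<Rightarrow> nat list \<Rightarrow> symb multiset" where
  "mdeg xs ys zs = image_mset SX (mset xs) + image_mset SY (mset ys) + image_mset SZ (mset zs)"

text \<open>The torus that scales each tensor of the point by a factor of its own; its weights are
  the multidegrees.\<close>

definition sc :: "(symb \<Rightarrow> complex) \<Rightarrow> pt \<Rightarrow> pt" where
  "sc t w = ((\<lambda>j a. t (SX j) * X w j a), (\<lambda>k a b. t (SY k) * Y w k a b), (\<lambda>l a b c. t (SZ l) * Z w l a b c))"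

lemma sc_coords: "X (sc t w) j = (\<lambda>a. t (SX j) * X w j a)" "Y (sc t w) k a b = t (SY k) * Y w k a b"
  "Z (sc t w) l a b c = t (SZ l) * Z w l a b c"
  by (simp_all add: sc_def X_def Y_def Z_def)

lemma sc_zeta:
  assumes "a \<in> I4"
  shows "zeta (sc t w) l a = t (SZ l) * zeta w l a"
  using assms unfolding I4_eq by (elim insertE; simp only: zeta_explicit sc_coords empty_iff; simp)

lemma sc_wd: "wd p ks (sc t w) a b = prod_list (map (t \<circ> SY) ks) * wd p ks w a b"
proof (induction ks arbitrary: p a)
  case (Cons k ks)
  have y: "yA (sc t w) k a b = t (SY k) * yA w k a b" for a b by (simp add: yA_def sc_coords)
  have "letter p (sc t w) k a c = t (SY k) * letter p w k a c" for c
    by (simp add: letter_def dualy_def y sum_distrib_left ac_simps)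
  then show ?case by (simp add: Cons.IH sum_distrib_left ac_simps)
qed simp

lemma sc_bil:
  assumes "\<And>a. a \<in> I4 \<Longrightarrow> p' a = c * p a" "\<And>a. a \<in> I4 \<Longrightarrow> q' a = d * q a"
  shows "bil p' (wd t' ks (sc t w)) q' = c * d * prod_list (map (t \<circ> SY) ks) * bil p (wd t' ks w) q"
  unfolding bil_def sum_distrib_left by (intro sum.cong refl) (simp add: assms sc_wd)

lemma sc_xx: "bil (X (sc t w) j) (wd t' ks (sc t w)) (X (sc t w) j') = t (SX j) * t (SX j') * prod_list (map (t \<circ> SY) ks) * bil (X w j) (wd t' ks w) (X w j')"
  by (rule sc_bil) (simp_all add: sc_coords)

lemma sc_xz: "bil (X (sc t w) j) (wd t' ks (sc t w)) (zeta (sc t w) l) = t (SX j) * t (SZ l) * prod_list (map (t \<circ> SY) ks) * bil (X w j) (wd t' ks w) (zeta w l)"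
  by (rule sc_bil) (simp_all add: sc_coords sc_zeta)

lemma sc_zz: "bil (zeta (sc t w) l) (wd t' ks (sc t w)) (zeta (sc t w) l') = t (SZ l) * t (SZ l') * prod_list (map (t \<circ> SY) ks) * bil (zeta w l) (wd t' ks w) (zeta w l')"
  by (rule sc_bil) (simp_all add: sc_zeta)

lemma sc_det4:
  assumes "\<And>a. a \<in> I4 \<Longrightarrow> p' a = c1 * p a" "\<And>a. a \<in> I4 \<Longrightarrow> q' a = c2 * q a" "\<And>a. a \<in> I4 \<Longrightarrow> r' a = c3 * r a" "\<And>a. a \<in> I4 \<Longrightarrow> s' a = c4 * s a"
  shows "det4 p' q' r' s' = c1 * c2 * c3 * c4 * det4 p q r s"
  unfolding det4_def sum_distrib_left by (intro sum.cong refl) (simp add: assms)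

lemma gen_sc:
  assumes "gen xs ys zs f"
  shows "f (sc t w) = prod_mset (image_mset t (mdeg xs ys zs)) * f w"
  using assms
proof cases
  case (g1 j1 j2 j3 j4)
  have "det4 (X (sc t w) j1) (X (sc t w) j2) (X (sc t w) j3) (X (sc t w) j4)
    = t (SX j1) * t (SX j2) * t (SX j3) * t (SX j4) * det4 (X w j1) (X w j2) (X w j3) (X w j4)"
    by (rule sc_det4) (simp_all add: sc_coords)
  then show ?thesis using g1 by (simp add: inv1_det4 mdeg_def)
next
  case (g2 l1 l2 l3 l4)
  have "det4 (zeta (sc t w) l1) (zeta (sc t w) l2) (zeta (sc t w) l3) (zeta (sc t w) l4)
    = t (SZ l1) * t (SZ l2) * t (SZ l3) * t (SZ l4) * det4 (zeta w l1) (zeta w l2) (zeta w l3) (zeta w l4)"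
    by (rule sc_det4) (simp_all add: sc_zeta)
  then show ?thesis using g2 by (simp add: inv2_det4 mdeg_def)
next
  case (g3 k1 k2)
  have "inv3 k1 k2 (sc t w) = t (SY k1) * t (SY k2) * inv3 k1 k2 w"
    unfolding inv3_explicit sc_coords by algebra
  then show ?thesis using g3 by (simp add: mdeg_def)
next
  case (g4 ks)
  have y: "ycol (sc t w) k i = t (SY k) * ycol w k i" for k i by (simp add: ycol_def sc_coords)
  have s: "{1..6::nat} = {1,2,3,4,5,6}" by auto
  have "inv4 ks (sc t w) = (\<Prod>i\<in>{1..6}. t (SY (ks i))) * inv4 ks w"
    unfolding inv4_def detN_def y prod.distrib sum_distrib_left by (simp only: ac_simps)
  then show ?thesis using g4 unfolding s by (simp add: mdeg_def ac_simps)
qed (simp add: mdeg_def inv5_word inv6_word inv7a_word inv7b_word inv8a_word inv8b_word inv8c_word inv9a_word inv9b_word sc_xx sc_xz sc_zz del: wd.simps)+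

lemma gen_homogeneous:
  assumes "gen xs ys zs f"
  shows "homogeneous f"
  unfolding homogeneous_def
proof (intro exI allI)
  fix t w
  have "scale t w = sc (\<lambda>_. t) w" by (simp add: scale_def sc_def)
  then show "f (scale t w) = t ^ size (mdeg xs ys zs) * f w"
    using gen_sc[OF assms, of "\<lambda>_. t" w] by (simp add: image_mset_const_eq)
qed

subsection \<open>Linear independence of monomials\<close>

definition mono_expansion :: "(complex \<times> 'v multiset) list \<Rightarrow> ('v \<Rightarrow> complex) \<Rightarrow> complex" where
  "mono_expansion cs t = (\<Sum>(c, D)\<leftarrow>cs. c * prod_mset (image_mset t D))"

lemma mono_expansion_mult:
  "mono_expansion (concat (map (\<lambda>(c, D). map (\<lambda>(c', D'). (c * c', D + D')) cs') cs)) t = mono_expansion cs t * mono_expansion cs' t"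
proof (induction cs)
  case Nil
  then show ?case by (simp add: mono_expansion_def)
next
  case (Cons x cs)
  obtain c D where x: "x = (c, D)" by (cases x)
  have "mono_expansion (map (\<lambda>(c', D'). (c * c', D + D')) cs') t = c * prod_mset (image_mset t D) * mono_expansion cs' t"
    by (induction cs') (auto simp: mono_expansion_def algebra_simps)
  then show ?case using Cons by (simp add: x mono_expansion_def algebra_simps)
qed

lemma symb_prime_coding: "\<exists>pr :: symb \<Rightarrow> nat. inj pr \<and> (\<forall>v. prime (pr v))"
proof -
  define cd where "cd v = (case v of SX j \<Rightarrow> 3 * j | SY k \<Rightarrow> 3 * k + 1 | SZ l \<Rightarrow> 3 * l + 2)" for v
  have "inj cd"
  proof
    fix u v assume "cd u = cd v"
    then show "u = v" by (cases u; cases v; simp add: cd_def; presburger)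
  qed
  moreover have i: "infinite {p::nat. prime p}" by (rule primes_infinite)
  ultimately have "inj (enumerate {p::nat. prime p} \<circ> cd)" by (intro inj_compose inj_enumerate)
  moreover have "prime ((enumerate {p::nat. prime p} \<circ> cd) v)" for v using enumerate_in_set[OF i, of "cd v"] by simp
  ultimately show ?thesis by blast
qed

text \<open>Substituting the s-th power of the v-th prime for the variable v turns a monomial into the
  geometric sequence of an integer that determines the monomial.\<close>

lemma mono_independent:
  fixes \<delta> :: "symb multiset"
  assumes D: "\<And>c D. (c, D) \<in> set cs \<Longrightarrow> D \<noteq> \<delta>"
    and e: "\<And>t. b * prod_mset (image_mset t \<delta>) = mono_expansion cs t"
  shows "b = 0"
proof -
  obtain pr :: "symb \<Rightarrow> nat" where pr: "inj pr" "\<And>v. prime (pr v)" using symb_prime_coding by blast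
  define N where "N D = prod_mset (image_mset pr D)" for D
  have inj: "D = D'" if "N D = N D'" for D D'
  proof -
    have "prime_factorization (N D) = image_mset pr D" for D
      unfolding N_def by (rule prime_factorization_prod_mset_primes) (auto simp: pr)
    then have "image_mset pr D = image_mset pr D'" using that by metis
    then show ?thesis using multiset.inj_map[OF pr(1)] by (auto dest: injD)
  qed
  have pw: "prod_mset (image_mset (\<lambda>v. of_nat (pr v) ^ s) D) = (of_nat (N D) ^ s :: complex)" for D s
    unfolding N_def by (induction D) (simp_all add: power_mult_distrib)
  define A :: "complex set" where "A = (\<lambda>(c, D). of_nat (N D)) ` set cs"
  \<comment> \<open>Q vanishes at the integers of all monomials in \<open>cs\<close> but not at that
    of \<delta>; combining the equations for the powers s with the coefficients of Q isolates
    b.\<close>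
  define Q where "Q = (\<Prod>x\<in>A. [:- x, 1:])"
  have fin: "finite A" by (simp add: A_def)
  have z: "poly Q (of_nat (N D)) = 0" if "(c, D) \<in> set cs" for c D
  proof -
    have "of_nat (N D) \<in> A" using that unfolding A_def by force
    then show ?thesis unfolding Q_def poly_prod using fin by auto
  qed
  have "of_nat (N \<delta>) \<notin> A" unfolding A_def using inj D by fastforce
  then have nz: "poly Q (of_nat (N \<delta>)) \<noteq> 0" unfolding Q_def poly_prod using fin by auto
  have "b * poly Q (of_nat (N \<delta>)) = (\<Sum>s\<le>degree Q. coeff Q s * (b * of_nat (N \<delta>) ^ s))"
    by (simp add: poly_altdef sum_distrib_left ac_simps)
  also have "\<dots> = (\<Sum>s\<le>degree Q. coeff Q s * (\<Sum>(c, D)\<leftarrow>cs. c * of_nat (N D) ^ s))"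
    using e[of "\<lambda>v. of_nat (pr v) ^ _"] by (simp add: pw mono_expansion_def)
  also have "\<dots> = (\<Sum>(c, D)\<leftarrow>cs. c * poly Q (of_nat (N D)))"
  proof (induction cs)
    case (Cons x cs)
    then show ?case by (cases x) (simp add: poly_altdef sum_distrib_left ac_simps sum.distrib distrib_left)
  qed simp
  also have "\<dots> = (\<Sum>x\<leftarrow>cs. 0)"
    by (intro arg_cong[of _ _ sum_list] map_cong refl) (auto simp: z)
  finally show ?thesis using nz by simp
qed

text \<open>Restriction to the scalings of a fixed point w turns elements of the algebra into
  polynomials in the scaling factors. A generator vanishing at w may be given any multidegree in S,
  so only those not vanishing at w constrain S.\<close>

lemma alg_gen_expansion:
  assumes "f \<in> alg_gen H"
    and gen: "\<And>h. h \<in> H \<Longrightarrow> \<exists>c D. D \<in> S \<and> (\<forall>t. h (sc t w) = c * prod_mset (image_mset t D))"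
    and S: "{#} \<in> S" "\<And>D D'. D \<in> S \<Longrightarrow> D' \<in> S \<Longrightarrow> D + D' \<in> S"
  shows "\<exists>cs. (\<forall>(c, D)\<in>set cs. D \<in> S) \<and> (\<forall>t. f (sc t w) = mono_expansion cs t)"
  using assms(1)
proof induction
  case (const c)
  show ?case by (rule exI[of _ "[(c, {#})]"]) (simp add: mono_expansion_def S)
next
  case (gen f)
  then obtain c D where "D \<in> S" "\<forall>t. f (sc t w) = c * prod_mset (image_mset t D)" using assms(2) by blast
  then show ?case by (intro exI[of _ "[(c, D)]"]) (simp add: mono_expansion_def)
next
  case (add f h)
  then obtain cs cs' where "\<forall>(c, D)\<in>set cs. D \<in> S" "\<forall>t. f (sc t w) = mono_expansion cs t"
    "\<forall>(c, D)\<in>set cs'. D \<in> S" "\<forall>t. h (sc t w) = mono_expansion cs' t" by blast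
  then show ?case by (intro exI[of _ "cs @ cs'"]) (auto simp: mono_expansion_def)
next
  case (mult f h)
  then obtain cs cs' where "\<forall>(c, D)\<in>set cs. D \<in> S" "\<forall>t. f (sc t w) = mono_expansion cs t"
    "\<forall>(c, D)\<in>set cs'. D \<in> S" "\<forall>t. h (sc t w) = mono_expansion cs' t" by blast
  then show ?case
    by (intro exI[of _ "concat (map (\<lambda>(c, D). map (\<lambda>(c', D'). (c * c', D + D')) cs') cs)"])
      (auto simp: mono_expansion_mult intro!: S)
qed

subsection \<open>Test points\<close>

text \<open>Since 1 + 2 + 3 + 4 = 10, this is the basis trivector omitting the index b; its covector
  is a multiple of \<open>ev b\<close>.\<close>

definition Zv :: "nat \<Rightarrow> nat \<Rightarrow> nat \<Rightarrow> nat \<Rightarrow> complex" where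
  "Zv b p q r = (if p + q + r + b = 10 then 1 else 0)"

definition tp :: "(nat \<Rightarrow> nat) \<Rightarrow> (nat \<Rightarrow> nat) \<Rightarrow> (nat \<Rightarrow> nat) \<Rightarrow> pt" where
  "tp \<alpha> \<beta> \<gamma> = ((\<lambda>j. ev (\<alpha> j)), (\<lambda>k. Fm (\<beta> k)), (\<lambda>l. Zv (\<gamma> l)))"

text \<open>Counted from 1, to match the numbering of \<open>Fm\<close>: the letter at place i of
  the list receives the i-th orthogonal bivector.\<close>

definition pos :: "nat list \<Rightarrow> nat \<Rightarrow> nat" where
  "pos ys k = Suc (length (takeWhile (\<lambda>x. x \<noteq> k) ys))"

lemma pos_nth: "distinct ys \<Longrightarrow> i < length ys \<Longrightarrow> pos ys (ys ! i) = Suc i"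
  unfolding pos_def
proof (induction ys arbitrary: i)
  case (Cons y ys)
  then show ?case by (cases i) auto
qed simp

lemma map_pos: "distinct ys \<Longrightarrow> map (pos ys) ys = [1..<Suc (length ys)]"
  by (rule nth_equalityI) (simp_all add: pos_nth del: upt_Suc)

lemma X_tp: "X (tp \<alpha> \<beta> \<gamma>) j = ev (\<alpha> j)" and Y_tp: "Y (tp \<alpha> \<beta> \<gamma>) k = Fm (\<beta> k)" and Z_tp: "Z (tp \<alpha> \<beta> \<gamma>) l = Zv (\<gamma> l)"
  by (simp_all add: tp_def X_def Y_def Z_def)

lemma zeta_tp:
  assumes "\<gamma> l \<in> I4" "a \<in> I4"
  shows "zeta (tp \<alpha> \<beta> \<gamma>) l a = (if odd (\<gamma> l) then 6 else -6) * ev (\<gamma> l) a"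
  using assms unfolding I4_eq
  by (elim insertE; simp only: zeta_explicit Z_tp empty_iff; simp add: Zv_def ev_def)

lemma wd_tp: "wd t ks (tp \<alpha> \<beta> \<gamma>) = wd t (map \<beta> ks) wF"
proof (induction ks arbitrary: t)
  case (Cons k ks)
  have "yA (tp \<alpha> \<beta> \<gamma>) k = yA wF (\<beta> k)" by (intro ext) (simp add: yA_def Y_tp Y_wF)
  then have "letter t (tp \<alpha> \<beta> \<gamma>) k = letter t wF (\<beta> k)" by (simp add: letter_def)
  then show ?case by (intro ext) (simp add: Cons.IH)
qed (simp add: fun_eq_iff)

lemma bil_ev_ev:
  assumes "a \<in> I4" "b \<in> I4"
  shows "bil (ev a) M (ev b) = M a b"
  using assms unfolding bil_def I4_eq by (elim insertE; simp add: ev_def)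

lemma bil_tp_xx:
  assumes "\<alpha> j \<in> I4" "\<alpha> j' \<in> I4"
  shows "bil (X (tp \<alpha> \<beta> \<gamma>) j) (wd t ks (tp \<alpha> \<beta> \<gamma>)) (X (tp \<alpha> \<beta> \<gamma>) j') = wd t (map \<beta> ks) wF (\<alpha> j) (\<alpha> j')"
  unfolding X_tp bil_ev_ev[OF assms] wd_tp ..

lemma bil_scaled:
  assumes "\<And>a. a \<in> I4 \<Longrightarrow> p' a = c * p a" "\<And>a. a \<in> I4 \<Longrightarrow> q' a = d * q a"
  shows "bil p' M q' = c * d * bil p M q"
  unfolding bil_def sum_distrib_left by (intro sum.cong refl) (simp add: assms)

lemma bil_tp_xz:
  assumes "\<alpha> j \<in> I4" "\<gamma> l \<in> I4"
  shows "bil (X (tp \<alpha> \<beta> \<gamma>) j) (wd t ks (tp \<alpha> \<beta> \<gamma>)) (zeta (tp \<alpha> \<beta> \<gamma>) l) = 1 * (if odd (\<gamma> l) then 6 else -6) * wd t (map \<beta> ks) wF (\<alpha> j) (\<gamma> l)"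
  unfolding wd_tp bil_ev_ev[OF assms, symmetric]
  by (rule bil_scaled) (simp_all add: X_tp zeta_tp[of \<gamma> l, OF assms(2)])

lemma bil_tp_zz:
  assumes "\<gamma> l \<in> I4" "\<gamma> l' \<in> I4"
  shows "bil (zeta (tp \<alpha> \<beta> \<gamma>) l) (wd t ks (tp \<alpha> \<beta> \<gamma>)) (zeta (tp \<alpha> \<beta> \<gamma>) l')
    = (if odd (\<gamma> l) then 6 else -6) * (if odd (\<gamma> l') then 6 else -6) * wd t (map \<beta> ks) wF (\<gamma> l) (\<gamma> l')"
  unfolding wd_tp bil_ev_ev[OF assms, symmetric]
  by (rule bil_scaled) (simp_all add: zeta_tp[of \<gamma> l, OF assms(1)] zeta_tp[of \<gamma> l', OF assms(2)])

lemma wd_wF: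
  assumes "r \<in> {1..6}" "a \<in> I4"
  shows "wd t (r # rs) wF a b = sg t r a * wd (\<not> t) rs wF (pm r a) b"
  by (rule wd_F[OF Y_wF assms])

text \<open>The words are signed permutation matrices up to scalars. The column index is the image
  of 1 under the permutation, namely 2, 4, 1, 2, 4 for one to five letters.\<close>

lemma wd_wF_nonzero:
  "wd t [1] wF 1 2 \<noteq> 0" "wd t [1, 2, 3] wF 1 1 \<noteq> 0" "wd t [1, 2, 3, 4, 5] wF 1 4 \<noteq> 0"
  "wd t [] wF 1 1 \<noteq> 0" "wd t [1, 2] wF 1 4 \<noteq> 0" "wd t [1, 2, 3, 4] wF 1 2 \<noteq> 0"
  by (simp_all add: wd_wF pm_def sg_nonzero I4_def ev_def del: wd.simps(2))

text \<open>Giving the bivectors of the generator distinct members of the orthogonal basis kills all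
  pairings of distinct letters, and basis vectors at the ends pick out a nonzero entry of the word.
  The pairings (y, y') themselves are tested where all bivectors coincide.\<close>

lemma gen_test_point:
  assumes "gen xs ys zs g"
  obtains w where "g w \<noteq> 0"
    "xs \<noteq> [] \<or> zs \<noteq> [] \<or> length ys \<noteq> 2 \<longrightarrow> (\<forall>k\<in>set ys. \<forall>k'\<in>set ys. k \<noteq> k' \<longrightarrow> inv3 k k' w = 0)"
proof (cases "xs = [] \<and> zs = [] \<and> length ys = 2")
  case True
  from assms True obtain k1 k2 where "g = inv3 k1 k2" by (cases rule: gen.cases) auto
  then have "g (tp (\<lambda>_. 1) (\<lambda>_. 1) (\<lambda>_. 1)) \<noteq> 0" by (simp add: inv3_explicit Y_tp Fm_def)
  then show ?thesis using that True by blast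
next
  case False
  then have d: "distinct ys" using gen_distinct[OF assms] by blast
  have l: "length ys \<le> 6" using gen_lengths[OF assms] by (auto simp: gen_types_def)
  have orth: "inv3 k k' (tp \<alpha> (pos ys) \<gamma>) = 0" if kk: "k \<in> set ys" "k' \<in> set ys" "k \<noteq> k'" for \<alpha> \<gamma> k k'
  proof -
    obtain i where i: "i < length ys" "ys ! i = k" using kk(1) unfolding in_set_conv_nth by blast
    obtain i' where i': "i' < length ys" "ys ! i' = k'" using kk(2) unfolding in_set_conv_nth by blast
    have p: "pos ys k = Suc i" "pos ys k' = Suc i'"
      using pos_nth[OF d i(1)] pos_nth[OF d i'(1)] unfolding i i' by simp_all
    have "i \<noteq> i'" using i i' kk(3) by blast
    then show ?thesis using i(1) i'(1) l p by (intro inv3_F[OF Y_tp Y_tp]) simp_all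
  qed
  have "\<exists>\<alpha> \<gamma>. g (tp \<alpha> (pos ys) \<gamma>) \<noteq> 0"
    using assms
  proof cases
    case (g1 j1 j2 j3 j4)
    then have d: "distinct xs" by auto
    have "pos xs j1 = 1" "pos xs j2 = 2" "pos xs j3 = 3" "pos xs j4 = 4"
      using pos_nth[OF d, of 0] pos_nth[OF d, of 1] pos_nth[OF d, of 2] pos_nth[OF d, of 3] g1 by simp_all
    then show ?thesis using g1 by (intro exI[of _ "pos xs"]) (simp add: inv1_det4 X_tp det4_explicit ev_def)
  next
    case (g2 l1 l2 l3 l4)
    then have d: "distinct zs" by auto
    have p: "pos zs l1 = 1" "pos zs l2 = 2" "pos zs l3 = 3" "pos zs l4 = 4"
      using pos_nth[OF d, of 0] pos_nth[OF d, of 1] pos_nth[OF d, of 2] pos_nth[OF d, of 3] g2 by simp_all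
    let ?w = "tp (\<lambda>_. 1) (pos ys) (pos zs)"
    have "det4 (zeta ?w l1) (zeta ?w l2) (zeta ?w l3) (zeta ?w l4) \<noteq> 0"
      unfolding det4_explicit zeta_explicit Z_tp p by (simp add: Zv_def)
    then have "inv2 l1 l2 l3 l4 ?w \<noteq> 0" unfolding inv2_det4 by simp
    then show ?thesis using g2 by blast
  next
    case (g3 k1 k2)
    then show ?thesis using False by simp
  next
    case (g4 ks)
    have p: "pos ys (ks r) = r" if "r \<in> {1..6}" for r
    proof -
      have "r = 1 \<or> r = 2 \<or> r = 3 \<or> r = 4 \<or> r = 5 \<or> r = 6" using that by auto
      then have "ks r = ys ! (r - 1)" using g4 by auto
      then show ?thesis using pos_nth[OF d, of "r - 1"] that g4 by auto
    qed
    have "inv4 ks (tp (\<lambda>_. 1) (pos ys) (\<lambda>_. 1)) = inv4 id wF"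
      unfolding inv4_def detN_def
      by (intro sum.cong refl arg_cong2[of _ _ _ _ times] prod.cong) (simp add: ycol_def Y_tp Y_wF p)
    then show ?thesis using inv4_F_nonzero g4 by metis
  next
    case (g5 j l)
    show ?thesis using g5
      by (intro exI[of _ "\<lambda>_. 1"]) (simp add: inv5_word bil_tp_xz I4_def wd_wF_nonzero ev_def)
  next
    case (g6 j1 j2 k)
    have "map (pos ys) [k] = [1]" using g6 map_pos[OF d] by (simp add: upt_rec)
    then show ?thesis using g6
      by (intro exI[of _ "\<lambda>j. if j = j1 then 1 else 2"]) (simp add: inv6_word bil_tp_xx I4_def wd_wF_nonzero del: wd.simps(2) One_nat_def)
  next
    case (g7a j j' k1 k2 k3)
    have "map (pos ys) [k1, k2, k3] = [1, 2, 3]" using g7a map_pos[OF d] by (simp add: upt_rec)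
    then show ?thesis using g7a
      by (intro exI[of _ "\<lambda>j. 1"]) (simp add: inv7a_word bil_tp_xx I4_def wd_wF_nonzero del: wd.simps(2) One_nat_def)
  next
    case (g7b j j' k1 k2 k3 k4 k5)
    have "map (pos ys) [k1, k2, k3, k4, k5] = [1, 2, 3, 4, 5]" using g7b map_pos[OF d] by (simp add: upt_rec)
    then show ?thesis using g7b
      by (intro exI[of _ "\<lambda>i. if i = j then 1 else 4"]) (simp add: inv7b_word bil_tp_xx I4_def wd_wF_nonzero del: wd.simps(2) One_nat_def)
  next
    case (g8a l l' k)
    have "map (pos ys) [k] = [1]" using g8a map_pos[OF d] by (simp add: upt_rec)
    then show ?thesis using g8a
      by (intro exI[of _ "\<lambda>i. 1"] exI[of _ "\<lambda>i. if i = l then 1 else 2"]) (simp add: inv8a_word bil_tp_zz I4_def wd_wF_nonzero del: wd.simps(2) One_nat_def)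
  next
    case (g8b l l' k1 k2 k3)
    have "map (pos ys) [k1, k2, k3] = [1, 2, 3]" using g8b map_pos[OF d] by (simp add: upt_rec)
    then show ?thesis using g8b
      by (intro exI[of _ "\<lambda>j. 1"]) (simp add: inv8b_word bil_tp_zz I4_def wd_wF_nonzero del: wd.simps(2) One_nat_def)
  next
    case (g8c l l' k1 k2 k3 k4 k5)
    have "map (pos ys) [k1, k2, k3, k4, k5] = [1, 2, 3, 4, 5]" using g8c map_pos[OF d] by (simp add: upt_rec)
    then show ?thesis using g8c
      by (intro exI[of _ "\<lambda>i. 1"] exI[of _ "\<lambda>i. if i = l then 1 else 4"]) (simp add: inv8c_word bil_tp_zz I4_def wd_wF_nonzero del: wd.simps(2) One_nat_def)
  next
    case (g9a k1 k2 j l)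
    have "map (pos ys) [k1, k2] = [1, 2]" using g9a map_pos[OF d] by (simp add: upt_rec)
    then show ?thesis using g9a
      by (intro exI[of _ "\<lambda>i. 1"] exI[of _ "\<lambda>i. 4"]) (simp add: inv9a_word bil_tp_xz I4_def wd_wF_nonzero del: wd.simps(2) One_nat_def)
  next
    case (g9b k1 k2 k3 k4 j l)
    have "map (pos ys) [k1, k2, k3, k4] = [1, 2, 3, 4]" using g9b map_pos[OF d] by (simp add: upt_rec)
    then show ?thesis using g9b
      by (intro exI[of _ "\<lambda>i. 1"] exI[of _ "\<lambda>i. 2"]) (simp add: inv9b_word bil_tp_xz I4_def wd_wF_nonzero del: wd.simps(2) One_nat_def)
  qed
  then show ?thesis using orth that by blast
qed

subsection \<open>Minimality\<close>

lemma count_mdeg: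
  "count (mdeg xs ys zs) (SX j) = count (mset xs) j" "count (mdeg xs ys zs) (SY j) = count (mset ys) j" "count (mdeg xs ys zs) (SZ j) = count (mset zs) j"
proof -
  have i: "count (image_mset f A) (f j) = count A j" if "inj f" for f :: "nat \<Rightarrow> symb" and A
    by (induction A) (use that in \<open>auto dest: injD\<close>)
  have n: "count (image_mset f A) v = 0" if "v \<notin> range f" for f :: "nat \<Rightarrow> symb" and A v
    using that by (auto simp: count_eq_zero_iff)
  have "inj SX" "inj SY" "inj SZ" by (auto intro: injI)
  then show "count (mdeg xs ys zs) (SX j) = count (mset xs) j" "count (mdeg xs ys zs) (SY j) = count (mset ys) j" "count (mdeg xs ys zs) (SZ j) = count (mset zs) j"
    unfolding mdeg_def count_union by (simp_all add: i n image_iff)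
qed

text \<open>The vector and trivector part of a multidegree. Viewing the second exterior power as a
  quadratic space, V and its dual are the half-spin representations.\<close>

definition spinor :: "symb multiset \<Rightarrow> symb multiset" where
  "spinor D = filter_mset (\<lambda>v. \<forall>k. v \<noteq> SY k) D"

lemma spinor_mdeg: "spinor (mdeg xs ys zs) = mdeg xs [] zs"
proof (rule multiset_eqI)
  fix v show "count (spinor (mdeg xs ys zs)) v = count (mdeg xs [] zs) v"
    by (cases v) (simp_all add: spinor_def count_mdeg)
qed

lemma mdeg_subset:
  assumes "mdeg xs ys zs \<subseteq># mdeg xs' ys' zs'"
  shows "mset xs \<subseteq># mset xs'" "mset ys \<subseteq># mset ys'" "mset zs \<subseteq># mset zs'"
  by (rule mset_subset_eqI, use mset_subset_eq_count[OF assms, of "SX _"] mset_subset_eq_count[OF assms, of "SY _"]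
    mset_subset_eq_count[OF assms, of "SZ _"] in \<open>simp add: count_mdeg\<close>)+

lemma mdeg_inj:
  assumes "mdeg xs ys zs = mdeg xs' ys' zs'"
  shows "mset xs = mset xs' \<and> mset ys = mset ys' \<and> mset zs = mset zs'"
  using mdeg_subset[of xs ys zs xs' ys' zs'] mdeg_subset[of xs' ys' zs' xs ys zs] assms by (simp add: subset_mset.antisym)

text \<open>Finite check behind minimality: a family whose degree properly divides that of another,
  without containing all its vectors and covectors when there are any, can only be the pairings (y,
  y').\<close>

lemma gen_types_arith:
  "\<forall>T\<in>gen_types. \<forall>T'\<in>gen_types. case T of (a, b, c) \<Rightarrow> case T' of (a', b', c') \<Rightarrow>
    a' \<le> a \<longrightarrow> b' \<le> b \<longrightarrow> c' \<le> c \<longrightarrow> \<not> (a' = a \<and> b' = b \<and> c' = c) \<longrightarrow> \<not> (a' = a \<and> c' = c \<and> (a \<noteq> 0 \<or> c \<noteq> 0)) \<longrightarrow>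
    a' = 0 \<and> c' = 0 \<and> b' = 2 \<and> (a \<noteq> 0 \<or> c \<noteq> 0 \<or> b \<noteq> 2)"
  unfolding gen_types_def by simp

text \<open>The degree table leaves only a pairing for h. Its two letters are distinct because g has
  no repeated bivectors, so it will vanish at the test point of g.\<close>

lemma gen_proper_divisor:
  assumes g: "gen xs ys zs g" and h: "gen xs' ys' zs' h" and ne: "h \<noteq> g"
    and sub: "mdeg xs' ys' zs' \<subseteq># mdeg xs ys zs"
    and sp: "mdeg xs' [] zs' = mdeg xs [] zs \<Longrightarrow> mdeg xs [] zs \<noteq> {#} \<Longrightarrow> mdeg xs' ys' zs' = mdeg xs ys zs"
  obtains k k' where "h = inv3 k k'" "k \<in> set ys" "k' \<in> set ys" "k \<noteq> k'" "xs \<noteq> [] \<or> zs \<noteq> [] \<or> length ys \<noteq> 2"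
proof -
  note m = mdeg_subset[OF sub]
  have le: "length xs' \<le> length xs" "length ys' \<le> length ys" "length zs' \<le> length zs"
    using m[THEN size_mset_mono] by simp_all
  have eq: "mset xs' = mset xs" if "length xs' = length xs" using m(1) that
    by (metis mset_subset_size size_mset subset_mset.le_imp_less_or_eq nat_neq_iff)
  have eqy: "mset ys' = mset ys" if "length ys' = length ys" using m(2) that
    by (metis mset_subset_size size_mset subset_mset.le_imp_less_or_eq nat_neq_iff)
  have eqz: "mset zs' = mset zs" if "length zs' = length zs" using m(3) that
    by (metis mset_subset_size size_mset subset_mset.le_imp_less_or_eq nat_neq_iff)
  have neq: "\<not> (length xs' = length xs \<and> length ys' = length ys \<and> length zs' = length zs)"
  proof
    assume "length xs' = length xs \<and> length ys' = length ys \<and> length zs' = length zs"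
    then have "mset xs' = mset xs" "mset ys' = mset ys" "mset zs' = mset zs" using eq eqy eqz by auto
    then have "xs' = xs" "ys' = ys" "zs' = zs"
      using gen_sorted[OF g] gen_sorted[OF h] by (metis properties_for_sort)+
    then show False using gen_unique[OF g] h ne by blast
  qed
  have spl: "\<not> (length xs' = length xs \<and> length zs' = length zs \<and> (xs \<noteq> [] \<or> zs \<noteq> []))"
  proof
    assume a: "length xs' = length xs \<and> length zs' = length zs \<and> (xs \<noteq> [] \<or> zs \<noteq> [])"
    then have "mset xs' = mset xs" "mset zs' = mset zs" using eq eqz by auto
    then have "mdeg xs' ys' zs' = mdeg xs ys zs" using sp a by (auto simp: mdeg_def)
    then have "mset ys' = mset ys" using mdeg_inj by blast
    then have "length ys' = length ys" by (rule mset_eq_length)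
    then show False using neq a by blast
  qed
  have *: "xs' = [] \<and> zs' = [] \<and> length ys' = 2 \<and> (xs \<noteq> [] \<or> zs \<noteq> [] \<or> length ys \<noteq> 2)"
    using gen_lengths[OF g] gen_lengths[OF h] le neq spl
    using gen_types_arith[rule_format, of "(length xs, length ys, length zs)" "(length xs', length ys', length zs')"]
    by simp
  from h * obtain k k' where k: "ys' = [k, k']" "h = inv3 k k'" by (cases rule: gen.cases) auto
  have "distinct ys" using gen_distinct[OF g] * by blast
  then have "k \<noteq> k'" using mset_subset_eq_count[OF m(2), of k'] k by (auto simp: distinct_count_atmost_1 split: if_splits)
  moreover have "k \<in> set ys" "k' \<in> set ys" using set_mset_mono[OF m(2)] k by auto
  ultimately show ?thesis using that k * by blast
qed

lemma listed_irredundant: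
  assumes g: "g \<in> listed n1 n2 n3"
  shows "g \<notin> alg_gen (listed n1 n2 n3 - {g})"
proof
  assume a: "g \<in> alg_gen (listed n1 n2 n3 - {g})"
  obtain xs ys zs where gg: "gen xs ys zs g" using listed_gen[OF g] by blast
  obtain w where w: "g w \<noteq> 0"
    "xs \<noteq> [] \<or> zs \<noteq> [] \<or> length ys \<noteq> 2 \<longrightarrow> (\<forall>k\<in>set ys. \<forall>k'\<in>set ys. k \<noteq> k' \<longrightarrow> inv3 k k' w = 0)"
    using gen_test_point[OF gg] by blast
  define \<delta> where "\<delta> = mdeg xs ys zs"
  \<comment> \<open>Multidegrees that products of the other generators can have at w: the trivial
    one, those not dividing \<delta>, and those different from \<delta> with the same nonempty
    vector and covector part. Two of the last kind exceed \<delta> in sum, so S is closed under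
    addition, while \<delta> itself is not in S.\<close>
  define S where "S = {D. D = {#} \<or> \<not> D \<subseteq># \<delta> \<or> (D \<noteq> \<delta> \<and> spinor D = spinor \<delta> \<and> spinor \<delta> \<noteq> {#})}"
  have "mdeg xs ys zs \<noteq> {#}" using gen_lengths[OF gg] by (auto simp: mdeg_def gen_types_def)
  then have \<delta>: "\<delta> \<notin> S" by (simp add: S_def \<delta>_def)
  have "D + D' \<in> S" if "D \<in> S" "D' \<in> S" for D D'
  proof (cases "D = {#} \<or> D' = {#} \<or> \<not> D \<subseteq># \<delta> \<or> \<not> D' \<subseteq># \<delta>")
    case True
    moreover have "\<not> D + D' \<subseteq># \<delta>" if "\<not> D \<subseteq># \<delta> \<or> \<not> D' \<subseteq># \<delta>"
      using that subset_mset.order_trans[OF mset_subset_eq_add_left, of D D' \<delta>]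
        subset_mset.order_trans[OF mset_subset_eq_add_right[of D' D], of \<delta>] by blast
    moreover have "D + D' \<in> S" if "\<not> D + D' \<subseteq># \<delta>" using that by (simp add: S_def)
    ultimately show ?thesis using \<open>D \<in> S\<close> \<open>D' \<in> S\<close> by (elim disjE) simp_all
  next
    case False
    then have s: "spinor D = spinor \<delta>" "spinor D' = spinor \<delta>" "spinor \<delta> \<noteq> {#}" using that by (auto simp: S_def)
    have "\<not> D + D' \<subseteq># \<delta>"
    proof
      assume "D + D' \<subseteq># \<delta>"
      then have "spinor (D + D') \<subseteq># spinor \<delta>" unfolding spinor_def by (rule multiset_filter_mono)
      then have "spinor \<delta> + spinor \<delta> \<subseteq># spinor \<delta>" using s by (simp add: spinor_def)
      then have "size (spinor \<delta> + spinor \<delta>) \<le> size (spinor \<delta>)" by (rule size_mset_mono)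
      then show False using s(3) by simp
    qed
    then show ?thesis by (simp add: S_def)
  qed
  moreover have "\<exists>c D. D \<in> S \<and> (\<forall>t. h (sc t w) = c * prod_mset (image_mset t D))" if h: "h \<in> listed n1 n2 n3 - {g}" for h
  proof -
    obtain xs' ys' zs' where hh: "gen xs' ys' zs' h" using listed_gen h by blast
    show ?thesis
    proof (cases "mdeg xs' ys' zs' \<in> S")
      case True
      then show ?thesis using gen_sc[OF hh] by (intro exI[of _ "h w"] exI[of _ "mdeg xs' ys' zs'"]) simp
    next
      case False
      then have n: "mdeg xs' ys' zs' \<subseteq># mdeg xs ys zs"
        "mdeg xs' [] zs' = mdeg xs [] zs \<Longrightarrow> mdeg xs [] zs \<noteq> {#} \<Longrightarrow> mdeg xs' ys' zs' = mdeg xs ys zs"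
        unfolding S_def \<delta>_def by (auto simp: spinor_mdeg)
      \<comment> \<open>A generator with multidegree outside S is a pairing of two distinct letters
        of g, which are orthogonal at w.\<close>
      have "h w = 0" by (rule gen_proper_divisor[OF gg hh _ n]) (use h w(2) in auto)
      then show ?thesis using gen_sc[OF hh] by (intro exI[of _ 0] exI[of _ "{#}"]) (simp add: S_def)
    qed
  qed
  moreover have "{#} \<in> S" by (simp add: S_def)
  ultimately obtain cs where cs: "\<forall>(c, D)\<in>set cs. D \<in> S" "\<forall>t. g (sc t w) = mono_expansion cs t"
    using alg_gen_expansion[OF a, of S w] by blast
  have "g w = 0"
    by (rule mono_independent[of cs \<delta>]) (use cs \<delta> gen_sc[OF gg] in \<open>auto simp: \<delta>_def mult.commute\<close>)
  then show False using w(1) by blast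
qed

lemma alg_gen_mono:
  assumes "H \<subseteq> H'"
  shows "alg_gen H \<subseteq> alg_gen H'"
proof
  fix f assume "f \<in> alg_gen H"
  then show "f \<in> alg_gen H'" by induction (use assms in \<open>auto intro: alg_gen.intros\<close>)
qed

theorem theorem1p1:
  fixes n1 n2 n3 :: nat
  shows "min_hom_gen_set (listed n1 n2 n3) (invW n1 n2 n3)"
  unfolding min_hom_gen_set_def
proof (intro conjI ballI allI impI)
  show "listed n1 n2 n3 \<subseteq> invW n1 n2 n3" by (rule listed_subset_invW)
  show "homogeneous f" if "f \<in> listed n1 n2 n3" for f
    using listed_gen[OF that] gen_homogeneous by blast
  show "alg_gen (listed n1 n2 n3) = invW n1 n2 n3" by (rule alg_gen_listed)
  show "alg_gen H \<noteq> invW n1 n2 n3" if H: "H \<subset> listed n1 n2 n3" for H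
  proof
    assume e: "alg_gen H = invW n1 n2 n3"
    obtain g where g: "g \<in> listed n1 n2 n3" "g \<notin> H" using H by blast
    then have "g \<in> alg_gen H" using listed_subset_invW e by blast
    then have "g \<in> alg_gen (listed n1 n2 n3 - {g})" using alg_gen_mono[of H "listed n1 n2 n3 - {g}"] H g by blast
    then show False using listed_irredundant[OF g(1)] by blast
  qed
qed

end
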